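(* Let $r\ge 1$ be an integer and let $\phi,(\psi^{(i)})_{1\le i<2^d}\in C^r_c(\mathbb{R}^d)$ be a compactly supported wavelet family of class $C^r$. Let $(f_m)_{m\in\mathbb{N}}$ be a family of random linear forms on $C^r_c(\mathbb{R}^d)$, let $1\le p<\infty$ and let $\beta\in\mathbb{R}$ be such that $|\beta|<r$. Assume that there exists a constant $C<\infty$ such that for every $m\in\mathbb{N}$ the following two statements hold: $$\sup_{x\in\mathbb{R}^d}\mathbb{E}\left[\left|\langle f_m,\phi(\,\cdot\,-x)\rangle\right|^p\right]^{1/p}\le C;$$ and, for every $i\in\{1,\ldots,2^d-1\}$ and $n\in\mathbb{N}$, $$\sup_{x\in\mathbb{R}^d}2^{dn}\,\mathbb{E}\left[\left|\langle f_m,\psi^{(i)}(2^n(\,\cdot\,-x))\rangle\right|^p\right]^{1/p}\le C\,2^{-n\beta}.$$ Then the family $(f_m)$ is tight in $\mathcal{C}^\alpha_{\mathrm{loc}}(\mathbb{R}^d)$ for every $\alpha<\beta-\frac dp$.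
   Context: $\mathbb{N}=\{0,1,2,\dots\}$. $C^r_c(\mathbb{R}^d)$ is the set of $r$ times continuously differentiable compactly supported functions on $\mathbb{R}^d$, and $\|\eta\|_{C^r}=\sum_{|k|\le r}\|\partial^k\eta\|_{L^\infty}$. A random linear form is a random element $f$ of the set of linear forms on $C^r_c(\mathbb{R}^d)$, each $\langle f,\eta\rangle$ being a random variable. Wavelet family of class $C^r$: functions $\phi,(\psi^{(i)})_{1\le i<2^d}\in C^r_c(\mathbb{R}^d)$ such that (i) $\phi$ is the scaling function of a multiresolution analysis $(V_n)_{n\in\mathbb{Z}}$ of $L^2(\mathbb{R}^d)$, i.e. $(V_n)$ is an increasing sequence of subspaces of $L^2(\mathbb{R}^d)$ with $\bigcup_n V_n$ dense and $\bigcap_n V_n=\{0\}$, $f\in V_n$ if and only if $f(2^{-n}\,\cdot\,)\in V_0$, and $(\phi(\cdot-k))_{k\in\mathbb{Z}^d}$ is an orthonormal basis of $V_0$; (ii) $(\psi^{(i)}(\cdot-k))_{i<2^d,k\in\mathbb{Z}^d}$ is an orthonormal basis of $W_0$, where $W_n$ is the orthogonal complement of $V_n$ in $V_{n+1}$. Such families exist for every positive integer $r$ (Daubechies). Local Hölder spaces. For $\alpha<0$, let $r_0=-\lfloor\alpha\rfloor$, let $\mathscr{B}^{r_0}$ be the set of $\eta\in C^{r_0}(\mathbb{R}^d)$ with $\|\eta\|_{C^{r_0}}\le1$ and support in the unit ball $B(0,1)$, and for $f\in C^\infty_c(\mathbb{R}^d)$ put $\|f\|_{\mathcal{C}^\alpha}=\sup_{\lambda\in(0,1]}\sup_{x\in\mathbb{R}^d}\sup_{\eta\in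 \mathscr{B}^{r_0}}\lambda^{-\alpha}\int f\,\lambda^{-d}\eta((\cdot-x)/\lambda)$. For $0\le\alpha<r$, put $\|f\|_{\mathcal{C}^\alpha}=\|\mathcal{V}_0f\|_{L^\infty}+\sup_{n\in\mathbb{N}}2^{\alpha n}\|\mathcal{W}_nf\|_{L^\infty}$, where $\mathcal{V}_n,\mathcal{W}_n$ are the orthogonal projections of $L^2(\mathbb{R}^d)$ onto $V_n,W_n$ (for $\alpha<0$ with $|\alpha|<r$ this formula gives a norm equivalent to the previous one). $\mathcal{C}^\alpha_{\mathrm{loc}}(\mathbb{R}^d)$ is the completion of $C^\infty_c(\mathbb{R}^d)$ (equivalently of $C^\infty(\mathbb{R}^d)$) with respect to the family of seminorms $f\mapsto\|\chi f\|_{\mathcal{C}^\alpha}$, $\chi\in C^\infty_c(\mathbb{R}^d)$. It is metrisable, and is viewed as a subset of the dual of $C^\infty_c(\mathbb{R}^d)$.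
   Formalization: Linear forms need not be continuous, and for discontinuous ones the literal claim fails; there the form is identified with the distributional limit of its projections onto V_n. For forms continuous on C^r_c the element of C^α_loc is the form itself restricted to C^∞_c. *)

theory Defs
  imports "HOL-Probability.Probability" "HOL-Library.Multiset"
begin

section \<open>Differentiable functions on \<open>real ^ 'n\<close>\<close>

definition partial :: "'n \<Rightarrow> (real ^ 'n \<Rightarrow> real) \<Rightarrow> real ^ 'n \<Rightarrow> real" where
  "partial i f = (\<lambda>x. frechet_derivative f (at x) (axis i 1))"

fun Cr :: "nat \<Rightarrow> (real ^ 'n \<Rightarrow> real) \<Rightarrow> bool" where
  "Cr 0 f \<longleftrightarrow> continuous_on UNIV f"
| "Cr (Suc r) f \<longleftrightarrow> (\<forall>x. f differentiable (at x)) \<and> (\<forall>i. Cr r (partial i f))"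

definition supp :: "('a::topological_space \<Rightarrow> real) \<Rightarrow> 'a set" where
  "supp f = closure {x. f x \<noteq> 0}"

definition Cr_c :: "nat \<Rightarrow> (real ^ 'n \<Rightarrow> real) set" where
  "Cr_c r = {f. Cr r f \<and> compact (supp f)}"

definition Cinf_c :: "(real ^ 'n \<Rightarrow> real) set" where
  "Cinf_c = (\<Inter>r. Cr_c r)"

text \<open>A multi-index is a finite multiset of coordinates, its order being the size of the multiset.
  Partial derivatives of order at most \<open>r\<close> of a \<open>C\<^sup>r\<close> function commute, so for such a function the
  order of differentiation selected by \<open>SOME\<close> is irrelevant.\<close>

lemma finite_multi_indices: "finite {k :: 'n::finite multiset. size k \<le> r}"
proof (rule finite_subset)
  show "{k :: 'n multiset. size k \<le> r} \<subseteq> mset ` {xs. set xs \<subseteq> UNIV \<and> length xs \<le> r}"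
  proof
    fix k :: "'n multiset" assume "k \<in> {k. size k \<le> r}"
    then show "k \<in> mset ` {xs. set xs \<subseteq> UNIV \<and> length xs \<le> r}"
      using ex_mset[of k] by auto
  qed
qed (intro finite_imageI finite_lists_length_le finite)

definition mpartial :: "'n multiset \<Rightarrow> (real ^ 'n \<Rightarrow> real) \<Rightarrow> real ^ 'n \<Rightarrow> real" where
  "mpartial k f = foldr partial (SOME xs. mset xs = k) f"

definition Linf_norm :: "('a::euclidean_space \<Rightarrow> real) \<Rightarrow> ennreal" where
  "Linf_norm f = esssup lborel (\<lambda>x. ennreal \<bar>f x\<bar>)"

definition Cr_norm :: "nat \<Rightarrow> (real ^ 'n \<Rightarrow> real) \<Rightarrow> ennreal" where
  "Cr_norm r f = (\<Sum>k | size k \<le> r. Linf_norm (mpartial k f))"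

section \<open>Square-integrable functions\<close>

text \<open>Elements of \<open>L\<^sup>2\<close> are represented by functions, not by classes of functions; closed subspaces
  in the sense below are automatically saturated under almost everywhere equality.\<close>

definition L2 :: "(real ^ 'n \<Rightarrow> real) set" where
  "L2 = {f \<in> borel_measurable lborel. integrable lborel (\<lambda>x. (f x)\<^sup>2)}"

definition L2_inner :: "(real ^ 'n \<Rightarrow> real) \<Rightarrow> (real ^ 'n \<Rightarrow> real) \<Rightarrow> real" where
  "L2_inner f g = (LINT x|lborel. f x * g x)"

definition L2_dist :: "(real ^ 'n \<Rightarrow> real) \<Rightarrow> (real ^ 'n \<Rightarrow> real) \<Rightarrow> real" where
  "L2_dist f g = sqrt (LINT x|lborel. (f x - g x)\<^sup>2)"

definition closed_subspace_L2 :: "(real ^ 'n \<Rightarrow> real) set \<Rightarrow> bool" where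
  "closed_subspace_L2 S \<longleftrightarrow>
     S \<subseteq> L2 \<and> (\<lambda>x. 0) \<in> S \<and>
     (\<forall>f\<in>S. \<forall>g\<in>S. (\<lambda>x. f x + g x) \<in> S) \<and>
     (\<forall>f\<in>S. \<forall>c. (\<lambda>x. c * f x) \<in> S) \<and>
     (\<forall>f\<in>L2. (\<forall>e>0. \<exists>g\<in>S. L2_dist f g < e) \<longrightarrow> f \<in> S)"

definition orthonormal_basis_of ::
  "(real ^ 'n \<Rightarrow> real) set \<Rightarrow> 'i set \<Rightarrow> ('i \<Rightarrow> real ^ 'n \<Rightarrow> real) \<Rightarrow> bool" where
  "orthonormal_basis_of S I e \<longleftrightarrow>
     (\<forall>i\<in>I. e i \<in> S) \<and>
     (\<forall>i\<in>I. \<forall>j\<in>I. L2_inner (e i) (e j) = (if i = j then 1 else 0)) \<and>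
     (\<forall>f\<in>S. \<forall>\<epsilon>>0. \<exists>J c. finite J \<and> J \<subseteq> I \<and> L2_dist f (\<lambda>x. \<Sum>j\<in>J. c j * e j x) < \<epsilon>)"

definition L2_proj :: "(real ^ 'n \<Rightarrow> real) set \<Rightarrow> (real ^ 'n \<Rightarrow> real) \<Rightarrow> real ^ 'n \<Rightarrow> real" where
  "L2_proj S f = (SOME g. g \<in> S \<and> (\<forall>h\<in>S. L2_inner (\<lambda>x. f x - g x) h = 0))"

section \<open>Wavelets\<close>

definition int_lattice :: "(real ^ 'n) set" where
  "int_lattice = {k. \<forall>i. k $ i \<in> \<int>}"

definition multiresolution_analysis ::
  "(int \<Rightarrow> (real ^ 'n \<Rightarrow> real) set) \<Rightarrow> (real ^ 'n \<Rightarrow> real) \<Rightarrow> bool" where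
  "multiresolution_analysis V \<phi> \<longleftrightarrow>
     (\<forall>n. closed_subspace_L2 (V n)) \<and>
     (\<forall>n. V n \<subseteq> V (n + 1)) \<and>
     (\<forall>f\<in>L2. \<forall>\<epsilon>>0. \<exists>n. \<exists>g\<in>V n. L2_dist f g < \<epsilon>) \<and>
     (\<Inter>n. V n) = {f\<in>L2. AE x in lborel. f x = 0} \<and>
     (\<forall>n f. f \<in> V n \<longleftrightarrow> (\<lambda>x. f (2 powi (- n) *\<^sub>R x)) \<in> V 0) \<and>
     orthonormal_basis_of (V 0) int_lattice (\<lambda>k x. \<phi> (x - k))"

definition wavelet_space ::
  "(int \<Rightarrow> (real ^ 'n \<Rightarrow> real) set) \<Rightarrow> int \<Rightarrow> (real ^ 'n \<Rightarrow> real) set" where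
  "wavelet_space V n = {f \<in> V (n + 1). \<forall>g\<in>V n. L2_inner f g = 0}"

definition wavelet_family ::
  "nat \<Rightarrow> (int \<Rightarrow> (real ^ 'n \<Rightarrow> real) set) \<Rightarrow> (real ^ 'n \<Rightarrow> real) \<Rightarrow> (nat \<Rightarrow> real ^ 'n \<Rightarrow> real) \<Rightarrow> bool"
  where
  "wavelet_family r V \<phi> \<psi> \<longleftrightarrow>
     \<phi> \<in> Cr_c r \<and> (\<forall>i\<in>{1..<2 ^ CARD('n)}. \<psi> i \<in> Cr_c r) \<and>
     multiresolution_analysis V \<phi> \<and>
     orthonormal_basis_of (wavelet_space V 0) ({1..<2 ^ CARD('n)} \<times> int_lattice)
       (\<lambda>(i, k) x. \<psi> i (x - k))"

section \<open>Local Hoelder spaces\<close>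

definition test_ball :: "nat \<Rightarrow> (real ^ 'n \<Rightarrow> real) set" where
  "test_ball r = {\<eta>. Cr r \<eta> \<and> Cr_norm r \<eta> \<le> 1 \<and> supp \<eta> \<subseteq> cball 0 1}"

definition holder_norm ::
  "(int \<Rightarrow> (real ^ 'n \<Rightarrow> real) set) \<Rightarrow> real \<Rightarrow> (real ^ 'n \<Rightarrow> real) \<Rightarrow> ennreal" where
  "holder_norm V \<alpha> f =
     (if \<alpha> < 0 then
        (SUP l\<in>{0<..1}. SUP x. SUP \<eta>\<in>test_ball (nat (- \<lfloor>\<alpha>\<rfloor>)).
           ennreal (l powr (- \<alpha>) *
             (LINT y|lborel. f y * (l powr (- real CARD('n)) * \<eta> ((1 / l) *\<^sub>R (y - x))))))
      else
        Linf_norm (L2_proj (V 0) f) +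
        (SUP n::nat. ennreal (2 powr (\<alpha> * real n)) * Linf_norm (L2_proj (wavelet_space V (int n)) f)))"

text \<open>The completion of \<open>C\<^sub>c\<^sup>\<infinity>\<close> is realised inside the dual of \<open>C\<^sub>c\<^sup>\<infinity>\<close>: its elements are the
  distributional limits of sequences that are Cauchy for every seminorm (sequences suffice since
  the space is metrisable). A distribution is a functional extensional on \<open>C\<^sub>c\<^sup>\<infinity>\<close>.\<close>

definition approximates ::
  "(int \<Rightarrow> (real ^ 'n \<Rightarrow> real) set) \<Rightarrow> real \<Rightarrow> (nat \<Rightarrow> real ^ 'n \<Rightarrow> real) \<Rightarrow>
   ((real ^ 'n \<Rightarrow> real) \<Rightarrow> real) \<Rightarrow> bool" where
  "approximates V \<alpha> g u \<longleftrightarrow>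
     (\<forall>j. g j \<in> Cinf_c) \<and>
     (\<forall>\<rho>\<in>Cinf_c. \<forall>\<epsilon>>0. \<exists>N. \<forall>i\<ge>N. \<forall>j\<ge>N. holder_norm V \<alpha> (\<lambda>x. \<rho> x * (g i x - g j x)) < \<epsilon>) \<and>
     (\<forall>\<eta>\<in>Cinf_c. (\<lambda>j. LINT x|lborel. g j x * \<eta> x) \<longlonglongrightarrow> u \<eta>)"

definition holder_loc ::
  "(int \<Rightarrow> (real ^ 'n \<Rightarrow> real) set) \<Rightarrow> real \<Rightarrow> ((real ^ 'n \<Rightarrow> real) \<Rightarrow> real) set" where
  "holder_loc V \<alpha> = {u \<in> extensional Cinf_c. \<exists>g. approximates V \<alpha> g u}"

text \<open>The extension of the seminorm with cut-off \<open>\<rho>\<close> to the completion. The limit does not depend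
  on the approximating sequence, so the infimum is taken over a set of equal values.\<close>

definition holder_loc_seminorm ::
  "(int \<Rightarrow> (real ^ 'n \<Rightarrow> real) set) \<Rightarrow> real \<Rightarrow> (real ^ 'n \<Rightarrow> real) \<Rightarrow>
   ((real ^ 'n \<Rightarrow> real) \<Rightarrow> real) \<Rightarrow> ennreal" where
  "holder_loc_seminorm V \<alpha> \<rho> u =
     (INF g\<in>{g. approximates V \<alpha> g u}. lim (\<lambda>j. holder_norm V \<alpha> (\<lambda>x. \<rho> x * g j x)))"

definition holder_loc_topology ::
  "(int \<Rightarrow> (real ^ 'n \<Rightarrow> real) set) \<Rightarrow> real \<Rightarrow> ((real ^ 'n \<Rightarrow> real) \<Rightarrow> real) topology" where
  "holder_loc_topology V \<alpha> = topology_generated_by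
     {{v \<in> holder_loc V \<alpha>. holder_loc_seminorm V \<alpha> \<rho> (\<lambda>\<eta>\<in>Cinf_c. v \<eta> - u \<eta>) < \<epsilon>} | u \<rho> \<epsilon>.
        u \<in> holder_loc V \<alpha> \<and> \<rho> \<in> Cinf_c \<and> 0 < \<epsilon>}"

section \<open>Random linear forms and tightness\<close>

definition linear_form :: "nat \<Rightarrow> ((real ^ 'n \<Rightarrow> real) \<Rightarrow> real) \<Rightarrow> bool" where
  "linear_form r f \<longleftrightarrow>
     (\<forall>\<eta>\<in>Cr_c r. \<forall>\<theta>\<in>Cr_c r. f (\<lambda>x. \<eta> x + \<theta> x) = f \<eta> + f \<theta>) \<and>
     (\<forall>\<eta>\<in>Cr_c r. \<forall>c. f (\<lambda>x. c * \<eta> x) = c * f \<eta>)"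

definition random_linear_form ::
  "nat \<Rightarrow> 'w measure \<Rightarrow> ('w \<Rightarrow> (real ^ 'n \<Rightarrow> real) \<Rightarrow> real) \<Rightarrow> bool" where
  "random_linear_form r M f \<longleftrightarrow>
     (\<forall>\<omega>\<in>space M. linear_form r (f \<omega>)) \<and>
     (\<forall>\<eta>\<in>Cr_c r. (\<lambda>\<omega>. f \<omega> \<eta>) \<in> borel_measurable M)"

text \<open>Continuity for the inductive limit topology of \<open>C\<^sub>c\<^sup>r\<close>.\<close>

definition continuous_form :: "nat \<Rightarrow> ((real ^ 'n \<Rightarrow> real) \<Rightarrow> real) \<Rightarrow> bool" where
  "continuous_form r f \<longleftrightarrow>
     (\<forall>K. compact K \<longrightarrow> (\<exists>B. \<forall>\<eta>\<in>Cr_c r. supp \<eta> \<subseteq> K \<longrightarrow>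
        ennreal \<bar>f \<eta>\<bar> \<le> ennreal B * Cr_norm r \<eta>))"

definition scaled :: "(real ^ 'n \<Rightarrow> real) \<Rightarrow> nat \<Rightarrow> real ^ 'n \<Rightarrow> real ^ 'n \<Rightarrow> real" where
  "scaled \<phi> n k = (\<lambda>x. 2 powr (real (CARD('n) * n) / 2) * \<phi> (2 ^ n *\<^sub>R x - k))"

text \<open>The projection onto \<open>V n\<close> of a linear form; the sum is locally finite for compactly
  supported \<open>\<phi>\<close>.\<close>

definition form_proj ::
  "(real ^ 'n \<Rightarrow> real) \<Rightarrow> nat \<Rightarrow> ((real ^ 'n \<Rightarrow> real) \<Rightarrow> real) \<Rightarrow> real ^ 'n \<Rightarrow> real" where
  "form_proj \<phi> n f =
     (\<lambda>x. \<Sum>k | k \<in> int_lattice \<and> scaled \<phi> n k x \<noteq> 0. f (scaled \<phi> n k) * scaled \<phi> n k x)"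

text \<open>When a linear form \<open>f\<close> on \<open>C\<^sub>c\<^sup>r\<close> is viewed as the distribution \<open>u\<close>. If \<open>f\<close> is continuous,
  \<open>u\<close> must be the restriction of \<open>f\<close> to \<open>C\<^sub>c\<^sup>\<infinity>\<close>. Moments of \<open>f\<close> against wavelets say nothing about a
  discontinuous \<open>f\<close> outside of the algebraic span of the wavelets (extend \<open>0\<close> from that span along
  a Hamel basis), so \<open>f\<close> is in general identified with \<open>u\<close> through its multiresolution expansion.\<close>

definition form_is_distribution ::
  "nat \<Rightarrow> (real ^ 'n \<Rightarrow> real) \<Rightarrow> ((real ^ 'n \<Rightarrow> real) \<Rightarrow> real) \<Rightarrow> ((real ^ 'n \<Rightarrow> real) \<Rightarrow> real) \<Rightarrow> bool"
  where
  "form_is_distribution r \<phi> f u \<longleftrightarrow>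
     (continuous_form r f \<longrightarrow> (\<forall>\<eta>\<in>Cinf_c. u \<eta> = f \<eta>)) \<and>
     (\<forall>\<eta>\<in>Cinf_c. (\<lambda>n. LINT x|lborel. form_proj \<phi> n f x * \<eta> x) \<longlonglongrightarrow> u \<eta>)"

text \<open>The event \<open>A\<close> spares a measurability statement: the inner probability of belonging to the
  compact set is at least \<open>1 - \<epsilon>\<close>. Tightness only involves the laws, so each form may live on a
  probability space of its own.\<close>

definition tight_in_holder_loc ::
  "nat \<Rightarrow> (int \<Rightarrow> (real ^ 'n \<Rightarrow> real) set) \<Rightarrow> (real ^ 'n \<Rightarrow> real) \<Rightarrow> real \<Rightarrow>
   (nat \<Rightarrow> 'w measure) \<Rightarrow> (nat \<Rightarrow> 'w \<Rightarrow> (real ^ 'n \<Rightarrow> real) \<Rightarrow> real) \<Rightarrow> bool" where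
  "tight_in_holder_loc r V \<phi> \<alpha> M f \<longleftrightarrow>
     (\<forall>\<epsilon>>0. \<exists>K. compactin (holder_loc_topology V \<alpha>) K \<and>
        (\<forall>m. \<exists>A\<in>sets (M m). measure (M m) A \<ge> 1 - \<epsilon> \<and>
           (\<forall>\<omega>\<in>A. \<exists>u\<in>K. form_is_distribution r \<phi> (f m \<omega>) u)))"

definition Lp_norm :: "'w measure \<Rightarrow> real \<Rightarrow> ('w \<Rightarrow> real) \<Rightarrow> ennreal" where
  "Lp_norm M p X =
     (let I = (\<integral>\<^sup>+ \<omega>. ennreal (\<bar>X \<omega>\<bar> powr p) \<partial>M)
      in if I = \<infinity> then \<infinity> else ennreal (enn2real I powr (1 / p)))"

end

theory Submission imports Defs
begin

text \<open>A form is determined by its coefficients against the wavelets. Choose \<open>b < \<beta>\<close> with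
  \<open>\<alpha> < b - d / p\<close>. By Markov's inequality, summed over the at most \<open>(C R 2\<^sup>n)\<^sup>d\<close> wavelets of level
  \<open>n\<close> meeting a ball of radius \<open>R\<close>, outside of an event of small probability the \<open>l\<^sup>p\<close> norm of these
  coefficients is at most \<open>L R * 2 powr (- n * (b + d / 2 - d / p))\<close> for all \<open>n\<close> and \<open>R\<close>, with the
  same \<open>L\<close> for all \<open>m\<close>. By Tychonoff's theorem the arrays of coefficients obeying these bounds form
  a compact set for pointwise convergence. Since \<open>\<alpha> < b - d / p\<close>, level \<open>n\<close> of such an array
  contributes at most \<open>C * 2 powr (- n * \<delta>)\<close> to each seminorm, so the synthesis of a distribution from
  its coefficients is continuous on this set, and its image is the required compact set.
  Wavelets of class \<open>C\<^sup>r\<close> have vanishing moments up to order \<open>r\<close> inclusive; hence the projections of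
  a test function converge to it in \<open>C\<^sup>r\<close>, and a continuous form agrees with its expansion.\<close>

subsection \<open>Calculus of iterated partial derivatives\<close>

text \<open>The forms are only linear, so every identity about them must be a finite linear
  combination before a limit is taken; compact supports provide this, since a ball meets finitely
  many wavelets of each level. The slack between b and \<beta> is spent on the union bound: it turns
  the Markov bounds into a geometric series in n, whereas for b = \<beta> they would not decay. The
  loss d / p comes from controlling the p-th powers of about 2^(n d) coefficients by their sum. The
  rate \<delta> is bounded by b + r besides b - d / p - \<alpha>, because a \<open>C\<^sup>r\<close>
  function of scale one gains a factor 2^(-n r) against level n; this is where \<beta> > - r enters.
  As \<delta> > 0, a tail of levels is uniformly small on the set of arrays, and on the remaining
  finitely many coordinates pointwise convergence is enough. Vanishing moments are not part of the
  definition of a wavelet family; they are derived from orthogonality and the nonzero mean of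
  \<phi>. The moments of degree r itself make the projections of a test function converge in
  \<open>C\<^sup>r\<close>: r derivatives cost 2^(n r), and r + 1 cancellations win one factor
  2^(-n) more.\<close>

abbreviation pd :: "'n list \<Rightarrow> (real ^ 'n \<Rightarrow> real) \<Rightarrow> real ^ 'n \<Rightarrow> real" where
  "pd xs f \<equiv> foldr partial xs f"

lemma partial_eqI: "(f has_derivative D) (at x) \<Longrightarrow> partial i f x = D (axis i 1)"
  by (simp add: partial_def frechet_derivative_at[symmetric])

lemma has_derivative_partial:
  assumes "f differentiable (at x)"
  shows "(f has_derivative (\<lambda>v. \<Sum>i\<in>UNIV. v $ i * partial i f x)) (at x)"
proof -
  let ?D = "frechet_derivative f (at x)"
  have D: "(f has_derivative ?D) (at x)" using assms frechet_derivative_works by blast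
  then interpret bounded_linear ?D by (rule has_derivative_bounded_linear)
  have "?D v = (\<Sum>i\<in>UNIV. v $ i * partial i f x)" for v
  proof -
    have "?D v = ?D (\<Sum>i\<in>UNIV. v $ i *\<^sub>R axis i 1)"
      using basis_expansion[of v] by (simp add: scalar_mult_eq_scaleR)
    then show ?thesis by (simp add: sum scaleR partial_def)
  qed
  then have "?D = (\<lambda>v. \<Sum>i\<in>UNIV. v $ i * partial i f x)" by auto
  then show ?thesis using D by simp
qed

lemma sum_axis: "(\<Sum>j\<in>UNIV. axis i (1::real) $ j * a j) = a (i::'n::finite)"
proof -
  have "(\<Sum>j\<in>UNIV. axis i (1::real) $ j * a j) = (\<Sum>j\<in>UNIV. if j = i then a j else 0)"
    by (intro sum.cong) (auto simp: axis_def)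
  then show ?thesis by simp
qed

text \<open>Since \<open>partial\<close> is defined by a choice of derivative, regularity is proved
  by exhibiting candidates for the partial derivatives; uniqueness of the derivative then identifies
  them.\<close>

lemma Cr_SucI:
  assumes "\<And>x. (f has_derivative (\<lambda>v. \<Sum>i\<in>UNIV. v $ i * g i x)) (at x)" "\<And>i. Cr r (g i)"
  shows "Cr (Suc r) f" and "partial i f = g i"
proof -
  have *: "partial i f = g i" for i
    using partial_eqI[OF assms(1)] by (auto simp: sum_axis)
  show "Cr (Suc r) f" using assms by (auto simp: * differentiable_def)
  show "partial i f = g i" by (rule *)
qed

lemma Cr_Suc_imp: "Cr (Suc r) f \<Longrightarrow> Cr r f"
proof (induction r arbitrary: f)
  case 0
  then show ?case
    by (auto intro!: differentiable_imp_continuous_on simp: differentiable_on_def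
        intro: differentiable_at_withinI)
next
  case (Suc r)
  then show ?case by (metis Cr.simps(2))
qed

lemma Cr_mono: "Cr r f \<Longrightarrow> s \<le> r \<Longrightarrow> Cr s f"
  by (induction r) (auto simp: le_Suc_eq simp del: Cr.simps dest: Cr_Suc_imp)

lemma Cr_continuous: "Cr r f \<Longrightarrow> continuous_on S f"
  using Cr_mono[of r f 0] continuous_on_subset by auto

lemma Cr_differentiable: "Cr (Suc r) f \<Longrightarrow> f differentiable (at x)"
  by simp

lemma Cr_partial: "Cr (Suc r) f \<Longrightarrow> Cr r (partial i f)"
  by simp

text \<open>\<open>foldr\<close> differentiates along the last entry first, which is the order in
  which \<open>Cr\<close> and \<open>Cbd\<close> recurse.\<close>

lemma pd_snoc: "pd (xs @ [i]) f = pd xs (partial i f)"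
  by simp

lemma Cr_pd: "Cr (r + length xs) f \<Longrightarrow> Cr r (pd xs f)"
proof (induction xs arbitrary: r)
  case (Cons i xs)
  then have "Cr (Suc r) (pd xs f)" by (simp del: Cr.simps)
  then show ?case by simp
qed simp

lemma partial_const [simp]: "partial i (\<lambda>x. c) = (\<lambda>x. 0)"
  by (rule ext, subst partial_eqI[where D = "\<lambda>v. 0"]) auto

lemma partial_add:
  "\<lbrakk>f differentiable (at x); g differentiable (at x)\<rbrakk> \<Longrightarrow>
    partial i (\<lambda>x. f x + g x) x = partial i f x + partial i g x"
  by (subst partial_eqI[OF has_derivative_add[OF has_derivative_partial has_derivative_partial]])
     (auto simp: sum_axis)

lemma partial_mult:
  "\<lbrakk>f differentiable (at x); g differentiable (at x)\<rbrakk> \<Longrightarrow>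
    partial i (\<lambda>x. f x * g x) x = partial i f x * g x + f x * partial i g x"
  by (subst partial_eqI[OF has_derivative_mult[OF has_derivative_partial has_derivative_partial]])
     (auto simp: sum_axis)

lemma partial_cmult:
  "f differentiable (at x) \<Longrightarrow> partial i (\<lambda>x. c * f x) x = c * partial i f x"
  by (subst partial_mult) auto

lemma partial_sum:
  assumes "\<And>k. k \<in> K \<Longrightarrow> f k differentiable (at x)"
  shows "partial i (\<lambda>x. \<Sum>k\<in>K. f k x) x = (\<Sum>k\<in>K. partial i (f k) x)"
proof -
  have "((\<lambda>x. \<Sum>k\<in>K. f k x) has_derivative (\<lambda>v. \<Sum>k\<in>K. \<Sum>j\<in>UNIV. v $ j * partial j (f k) x)) (at x)"
    by (intro has_derivative_sum has_derivative_partial assms)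
  from partial_eqI[OF this] show ?thesis by (simp add: sum_axis)
qed

lemma partial_affine:
  assumes "f differentiable (at (a *\<^sub>R x + b))"
  shows "partial i (\<lambda>x. f (a *\<^sub>R x + b)) x = a * partial i f (a *\<^sub>R x + b)"
    and "(\<lambda>x. f (a *\<^sub>R x + b)) differentiable (at x)"
proof -
  have "((\<lambda>x. a *\<^sub>R x + b) has_derivative (\<lambda>v. a *\<^sub>R v)) (at x)"
    by (auto intro!: derivative_eq_intros)
  then have *: "((\<lambda>x. f (a *\<^sub>R x + b)) has_derivative
     (\<lambda>v. \<Sum>i\<in>UNIV. (a *\<^sub>R v) $ i * partial i f (a *\<^sub>R x + b))) (at x)"
    using has_derivative_compose has_derivative_partial[OF assms] by fastforce
  show "partial i (\<lambda>x. f (a *\<^sub>R x + b)) x = a * partial i f (a *\<^sub>R x + b)"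
    using partial_eqI[OF *, of i] sum_axis[of i "\<lambda>j. a * partial j f (a *\<^sub>R x + b)"]
    by (simp add: mult_ac)
  show "(\<lambda>x. f (a *\<^sub>R x + b)) differentiable (at x)" using * differentiable_def by blast
qed

lemma Cr_const [simp]: "Cr r (\<lambda>x. c)"
  by (induction r arbitrary: c) auto

lemma Cr_add: "Cr r f \<Longrightarrow> Cr r g \<Longrightarrow> Cr r (\<lambda>x. f x + g x)"
proof (induction r arbitrary: f g)
  case (Suc r)
  then have "partial i (\<lambda>x. f x + g x) = (\<lambda>x. partial i f x + partial i g x)" for i
    by (auto intro!: partial_add)
  with Suc show ?case by (auto intro!: differentiable_add)
qed (auto intro: continuous_intros)

lemma Cr_mult: "Cr r f \<Longrightarrow> Cr r g \<Longrightarrow> Cr r (\<lambda>x. f x * g x)"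
proof (induction r arbitrary: f g)
  case (Suc r)
  then have "partial i (\<lambda>x. f x * g x) = (\<lambda>x. partial i f x * g x + f x * partial i g x)" for i
    by (auto intro!: partial_mult)
  with Suc show ?case
    by (auto intro!: differentiable_mult Cr_add Suc.IH intro: Cr_Suc_imp)
qed (auto intro: continuous_intros)

lemma Cr_cmult: "Cr r f \<Longrightarrow> Cr r (\<lambda>x. c * f x)"
  by (intro Cr_mult) auto

lemma Cr_diff: "Cr r f \<Longrightarrow> Cr r g \<Longrightarrow> Cr r (\<lambda>x. f x - g x)"
  using Cr_add[of r f "\<lambda>x. (-1) * g x"] Cr_cmult[of r g "-1"] by simp

lemma Cr_sum: "(\<And>k. k \<in> K \<Longrightarrow> Cr r (f k)) \<Longrightarrow> Cr r (\<lambda>x. \<Sum>k\<in>K. f k x)"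
  by (induction K rule: infinite_finite_induct) (auto intro: Cr_add)

lemma Cr_prod: "(\<And>k. k \<in> K \<Longrightarrow> Cr r (f k)) \<Longrightarrow> Cr r (\<lambda>x. \<Prod>k\<in>K. f k x)"
  by (induction K rule: infinite_finite_induct) (auto intro: Cr_mult)

lemma Cr_affine: "Cr r f \<Longrightarrow> Cr r (\<lambda>x. f (a *\<^sub>R x + b))"
proof (induction r arbitrary: f)
  case (Suc r)
  then have "partial i (\<lambda>x. f (a *\<^sub>R x + b)) = (\<lambda>x. a * partial i f (a *\<^sub>R x + b))" for i
    by (auto intro!: partial_affine)
  with Suc show ?case by (auto intro!: Cr_cmult partial_affine)
qed (auto intro!: continuous_intros elim: continuous_on_compose2)

lemma pd_affine:
  "Cr (length xs) f \<Longrightarrow> pd xs (\<lambda>x. f (a *\<^sub>R x + b)) = (\<lambda>x. a ^ length xs * pd xs f (a *\<^sub>R x + b))"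
proof (induction xs)
  case (Cons i xs)
  have 1: "Cr (Suc 0) (pd xs f)" using Cr_pd[of "Suc 0" xs f] Cons.prems by simp
  then have 2: "Cr (Suc 0) (\<lambda>x. pd xs f (a *\<^sub>R x + b))" by (rule Cr_affine)
  have "pd xs (\<lambda>x. f (a *\<^sub>R x + b)) = (\<lambda>x. a ^ length xs * pd xs f (a *\<^sub>R x + b))"
    using Cons Cr_Suc_imp by fastforce
  with 1 2 show ?case by (auto simp: partial_cmult partial_affine)
qed auto

lemma pd_sum:
  assumes "\<And>k. k \<in> K \<Longrightarrow> Cr (length xs) (f k)"
  shows "pd xs (\<lambda>x. \<Sum>k\<in>K. f k x) = (\<lambda>x. \<Sum>k\<in>K. pd xs (f k) x)"
  using assms
proof (induction xs)
  case (Cons i xs)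
  have "k \<in> K \<Longrightarrow> Cr (Suc 0) (pd xs (f k))" for k
    using Cr_pd[of "Suc 0" xs "f k"] Cons.prems by simp
  moreover have "pd xs (\<lambda>x. \<Sum>k\<in>K. f k x) = (\<lambda>x. \<Sum>k\<in>K. pd xs (f k) x)"
    using Cons Cr_Suc_imp by (metis length_Cons)
  ultimately show ?case by (auto intro!: partial_sum)
qed auto

lemma pd_cmult: "Cr (length xs) f \<Longrightarrow> pd xs (\<lambda>x. c * f x) = (\<lambda>x. c * pd xs f x)"
proof (induction xs)
  case (Cons i xs)
  have "Cr (Suc 0) (pd xs f)"
    using Cr_pd[of "Suc 0" xs "f"] Cons.prems by simp
  moreover have "pd xs (\<lambda>x. c * f x) = (\<lambda>x. c * pd xs f x)"
    using Cons Cr_Suc_imp by (metis length_Cons)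
  ultimately show ?case by (auto intro!: partial_cmult)
qed auto

text \<open>One constant for all derivatives, along the recursion of \<open>Cr\<close>, is easier to
  propagate than the sum of essential suprema in \<open>Cr_norm\<close>; the two are compared in
  \<open>Cr_norm_Cbd\<close> and \<open>Cbd_Cr_norm\<close>.\<close>

fun Cbd :: "nat \<Rightarrow> real \<Rightarrow> (real ^ 'n \<Rightarrow> real) \<Rightarrow> bool" where
  "Cbd 0 A f \<longleftrightarrow> continuous_on UNIV f \<and> (\<forall>x. \<bar>f x\<bar> \<le> A)"
| "Cbd (Suc r) A f \<longleftrightarrow> (\<forall>x. f differentiable (at x) \<and> \<bar>f x\<bar> \<le> A) \<and> (\<forall>i. Cbd r A (partial i f))"

lemma Cbd_Cr: "Cbd r A f \<Longrightarrow> Cr r f"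
  by (induction r arbitrary: f) auto

lemma Cbd_bound: "Cbd r A f \<Longrightarrow> \<bar>f x\<bar> \<le> A"
  by (cases r) auto

lemma Cbd_nonneg: "Cbd r A f \<Longrightarrow> 0 \<le> A"
  using Cbd_bound[of r A f 0] by linarith

lemma Cbd_SucD: "Cbd (Suc r) A f \<Longrightarrow> Cbd r A f"
proof (induction r arbitrary: f)
  case 0 then show ?case using Cr_Suc_imp[of 0 f] Cbd_Cr[of "Suc 0" A f] by auto
next
  case (Suc r) then show ?case by (metis Cbd.simps(2))
qed

lemma Cbd_mono: "Cbd r A f \<Longrightarrow> s \<le> r \<Longrightarrow> A \<le> B \<Longrightarrow> Cbd s B f"
proof -
  assume *: "Cbd r A f" "s \<le> r" "A \<le> B"
  then have "Cbd s A f"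
    by (induction r) (auto simp: le_Suc_eq simp del: Cbd.simps dest: Cbd_SucD)
  then show "Cbd s B f" using *(3)
    by (induction s arbitrary: f) (auto intro: order_trans)
qed

lemma Cbd_pd: "Cbd (r + length xs) A f \<Longrightarrow> Cbd r A (pd xs f)"
proof (induction xs arbitrary: r)
  case (Cons i xs)
  then have "Cbd (Suc r) A (pd xs f)" by (simp del: Cbd.simps)
  then show ?case by simp
qed simp

lemma Cbd_pd_bound: "Cbd r A f \<Longrightarrow> length xs \<le> r \<Longrightarrow> \<bar>pd xs f x\<bar> \<le> A"
  by (rule Cbd_bound[of "r - length xs"], rule Cbd_pd) simp

lemma CbdI:
  assumes "Cr r f" "\<And>xs x. length xs \<le> r \<Longrightarrow> \<bar>pd xs f x\<bar> \<le> A"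
  shows "Cbd r A f"
  using assms
proof (induction r arbitrary: f)
  case 0 then show ?case by (metis Cbd.simps(1) Cr.simps(1) foldr.simps(1) id_apply le_refl list.size(3))
next
  case (Suc r)
  have "Cbd r A (partial i f)" for i
    by (rule Suc.IH) (use Suc.prems in simp, metis Suc.prems(2) Suc_le_mono length_append_singleton pd_snoc)
  then show ?case using Suc.prems(1) Suc.prems(2)[of "[]"] by simp
qed

lemma Cbd_add: "Cbd r A f \<Longrightarrow> Cbd r B g \<Longrightarrow> Cbd r (A + B) (\<lambda>x. f x + g x)"
proof (induction r arbitrary: f g)
  case 0
  then show ?case by (auto intro!: continuous_intros intro: order_trans[OF abs_triangle_ineq] add_mono)
next
  case (Suc r)
  then have "partial i (\<lambda>x. f x + g x) = (\<lambda>x. partial i f x + partial i g x)" for i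
    by (auto intro!: partial_add)
  moreover have "\<bar>f x + g x\<bar> \<le> A + B" for x
    using Suc.prems by (intro order_trans[OF abs_triangle_ineq] add_mono) auto
  ultimately show ?case using Suc by auto
qed

text \<open>Each use of the product rule doubles the number of terms, hence the factor
  \<open>2 ^ r\<close>.\<close>

lemma Cbd_mult: "Cbd r A f \<Longrightarrow> Cbd r B g \<Longrightarrow> Cbd r (2 ^ r * A * B) (\<lambda>x. f x * g x)"
proof (induction r arbitrary: f g)
  case 0
  then show ?case by (auto intro!: continuous_intros mult_mono simp: abs_mult dest: order_trans[OF abs_ge_zero])
next
  case (Suc r)
  have A: "A \<ge> 0" "B \<ge> 0" using Suc.prems Cbd_nonneg by blast+
  have *: "partial i (\<lambda>x. f x * g x) = (\<lambda>x. partial i f x * g x + f x * partial i g x)" for i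
    using Suc.prems by (auto intro!: partial_mult)
  have "Cbd r (2 ^ Suc r * A * B) (\<lambda>x. partial i f x * g x + f x * partial i g x)" for i
    using Cbd_add[OF Suc.IH[OF _ Cbd_SucD] Suc.IH[OF Cbd_SucD], of "partial i f" g f "partial i g"]
      Suc.prems by (simp add: mult_ac)
  moreover have "\<bar>f x * g x\<bar> \<le> 2 ^ Suc r * A * B" for x
  proof -
    have "\<bar>f x * g x\<bar> \<le> A * B" using Suc.prems A by (auto simp: abs_mult intro!: mult_mono)
    also have "\<dots> \<le> 2 ^ Suc r * (A * B)"
      using A mult_right_mono[of 1 "2 ^ Suc r" "A * B"] one_le_power[of "2::real" "Suc r"] by simp
    finally show ?thesis by (simp add: mult.assoc)
  qed
  ultimately show ?case using Suc.prems
    by (simp add: * differentiable_mult del: power_Suc)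
qed

lemma Cbd_cmult: "Cbd r A f \<Longrightarrow> Cbd r (\<bar>c\<bar> * A) (\<lambda>x. c * f x)"
proof (induction r arbitrary: f)
  case (Suc r)
  then have "partial i (\<lambda>x. c * f x) = (\<lambda>x. c * partial i f x)" for i
    by (auto intro!: partial_cmult)
  with Suc show ?case
    by (auto intro!: differentiable_mult mult_left_mono simp: abs_mult)
qed (auto intro!: continuous_intros mult_left_mono simp: abs_mult)

lemma Cbd_zero: "0 \<le> A \<Longrightarrow> Cbd r A (\<lambda>x. 0)"
  by (induction r) auto

lemma Cbd_sum:
  "finite K \<Longrightarrow> (\<And>k. k \<in> K \<Longrightarrow> Cbd r (A k) (f k)) \<Longrightarrow> Cbd r (\<Sum>k\<in>K. A k) (\<lambda>x. \<Sum>k\<in>K. f k x)"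
  by (induction K rule: finite_induct) (auto intro: Cbd_add Cbd_zero)

lemma Cbd_diff: "Cbd r A f \<Longrightarrow> Cbd r B g \<Longrightarrow> Cbd r (A + B) (\<lambda>x. f x - g x)"
  using Cbd_add[of r A f B "\<lambda>x. (-1) * g x"] Cbd_cmult[of r B g "-1"] by simp

text \<open>Taking \<open>B\<close> at least 1 lets \<open>B ^ r\<close> dominate the factors from
  the chain rule at all orders up to r.\<close>

lemma Cbd_affine:
  assumes "Cbd r A f" "1 \<le> B" "\<bar>a\<bar> \<le> B"
  shows "Cbd r (A * B ^ r) (\<lambda>x. f (a *\<^sub>R x + b))"
proof (rule CbdI)
  show "Cr r (\<lambda>x. f (a *\<^sub>R x + b))" using Cbd_Cr[OF assms(1)] by (rule Cr_affine)
  fix xs :: "'a list" and x assume l: "length xs \<le> r"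
  have "Cr (length xs) f" using Cbd_Cr[OF assms(1)] l Cr_mono by blast
  then have "\<bar>pd xs (\<lambda>x. f (a *\<^sub>R x + b)) x\<bar> = \<bar>a\<bar> ^ length xs * \<bar>pd xs f (a *\<^sub>R x + b)\<bar>"
    by (simp add: pd_affine abs_mult power_abs)
  also have "\<dots> \<le> B ^ r * A"
  proof (rule mult_mono)
    have "\<bar>a\<bar> ^ length xs \<le> B ^ length xs" using assms by (intro power_mono) auto
    also have "\<dots> \<le> B ^ r" using assms l by (intro power_increasing) auto
    finally show "\<bar>a\<bar> ^ length xs \<le> B ^ r" .
    show "\<bar>pd xs f (a *\<^sub>R x + b)\<bar> \<le> A" using Cbd_pd_bound[OF assms(1) l] .
  qed (use assms in auto)
  finally show "\<bar>pd xs (\<lambda>x. f (a *\<^sub>R x + b)) x\<bar> \<le> A * B ^ r" by (simp add: mult.commute)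
qed

subsection \<open>Supports\<close>

lemma supp_subset_closed:
  assumes "closed S" "\<And>x. x \<notin> S \<Longrightarrow> f x = 0"
  shows "supp f \<subseteq> S"
  unfolding supp_def
proof (rule closure_minimal[OF _ assms(1)])
  show "{x. f x \<noteq> 0} \<subseteq> S"
  proof
    fix x assume "x \<in> {x. f x \<noteq> 0}"
    then show "x \<in> S" using assms(2)[of x] by (cases "x \<in> S") simp_all
  qed
qed

lemma not_in_supp: "x \<notin> supp f \<Longrightarrow> f x = 0"
  using subsetD[OF closure_subset, of x "{x. f x \<noteq> 0}"] by (auto simp: supp_def)

lemma closed_supp: "closed (supp f)"
  by (simp add: supp_def)

lemma compact_supp_cball:
  fixes f :: "'a::euclidean_space \<Rightarrow> real"
  shows "compact (supp f) \<longleftrightarrow> (\<exists>R. supp f \<subseteq> cball 0 R)"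
proof
  assume "compact (supp f)"
  then obtain R where "\<forall>x\<in>supp f. norm x \<le> R" by (meson bounded_iff compact_imp_bounded)
  then show "\<exists>R. supp f \<subseteq> cball 0 R" by (intro exI[of _ R]) auto
next
  assume "\<exists>R. supp f \<subseteq> cball 0 R"
  then show "compact (supp f)"
    using bounded_cball bounded_subset closed_supp compact_eq_bounded_closed by blast
qed

lemma partial_supp: "x \<notin> supp f \<Longrightarrow> partial i f x = 0"
proof -
  assume "x \<notin> supp f"
  have "eventually (\<lambda>y. y \<in> - supp f) (nhds x)"
    using \<open>x \<notin> supp f\<close> closed_supp by (intro eventually_nhds_in_open) auto
  then have e: "eventually (\<lambda>y. 0 = f y) (at x)"
    by (auto simp: not_in_supp eventually_at_filter elim: eventually_mono)
  have "((\<lambda>y. 0) has_derivative (\<lambda>v. 0)) (at x)" by simp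
  then have "(f has_derivative (\<lambda>v. 0)) (at x)"
    by (rule has_derivative_transform_eventually) (use e \<open>x \<notin> supp f\<close> not_in_supp in auto)
  then show ?thesis by (simp add: partial_eqI)
qed

lemma supp_partial: "supp (partial i f) \<subseteq> supp f"
  by (rule supp_subset_closed) (auto simp: closed_supp partial_supp)

lemma supp_pd: "supp (pd xs f) \<subseteq> supp f"
  proof (induction xs)
  case (Cons i xs)
  then show ?case using supp_partial[of i "pd xs f"] by auto
qed simp

lemma supp_mult: "supp (\<lambda>x. f x * g x) \<subseteq> supp f" "supp (\<lambda>x. g x * f x) \<subseteq> supp f"
  by (rule supp_subset_closed; auto simp: closed_supp not_in_supp)+

lemma compact_closed_subset: "compact K \<Longrightarrow> closed S \<Longrightarrow> S \<subseteq> K \<Longrightarrow> compact (S :: 'a::t2_space set)"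
  using compact_Int_closed[of K S] by (simp add: Int_absorb1)

lemma compact_supp_subset:
  fixes f g :: "'a::t2_space \<Rightarrow> real"
  shows "compact (supp f) \<Longrightarrow> supp g \<subseteq> supp f \<Longrightarrow> compact (supp g)"
  by (rule compact_closed_subset[OF _ closed_supp])

lemma compact_supp_finite_sum:
  assumes "finite K" "\<And>k. k \<in> K \<Longrightarrow> compact (supp (f k))"
  shows "compact (supp (\<lambda>x::'a::t2_space. \<Sum>k\<in>K. f k x))"
proof -
  have c: "compact (\<Union>k\<in>K. supp (f k))" by (rule compact_UN[OF assms])
  have "supp (\<lambda>x. \<Sum>k\<in>K. f k x) \<subseteq> (\<Union>k\<in>K. supp (f k))"
  proof (rule supp_subset_closed[OF compact_imp_closed[OF c]])
    fix x assume "x \<notin> (\<Union>k\<in>K. supp (f k))"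
    then have "\<forall>k\<in>K. f k x = 0" using not_in_supp[of x] by blast
    then show "(\<Sum>k\<in>K. f k x) = 0" by simp
  qed
  with c show ?thesis by (rule compact_closed_subset[OF _ closed_supp])
qed

lemma Cr_c_sum: "finite K \<Longrightarrow> (\<And>k. k \<in> K \<Longrightarrow> f k \<in> Cr_c r) \<Longrightarrow> (\<lambda>x. \<Sum>k\<in>K. f k x) \<in> Cr_c r"
  by (auto simp: Cr_c_def intro!: Cr_sum compact_supp_finite_sum)

lemma Cr_c_cmult: "f \<in> Cr_c r \<Longrightarrow> (\<lambda>x. c * f x) \<in> Cr_c r"
  using supp_mult(2)[of "\<lambda>x. c" f] by (auto simp: Cr_c_def intro!: Cr_cmult elim: compact_supp_subset)

lemma Cr_c_mult: "f \<in> Cr_c r \<Longrightarrow> Cr r g \<Longrightarrow> (\<lambda>x. f x * g x) \<in> Cr_c r"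
  using supp_mult(1)[of f g] by (auto simp: Cr_c_def intro!: Cr_mult elim: compact_supp_subset)

lemma Cr_c_add: "f \<in> Cr_c r \<Longrightarrow> g \<in> Cr_c r \<Longrightarrow> (\<lambda>x. f x + g x) \<in> Cr_c r"
  using Cr_c_sum[of "{True, False}" "\<lambda>b. if b then f else g" r] by (auto simp: UNIV_bool)

lemma Cr_c_diff: "f \<in> Cr_c r \<Longrightarrow> g \<in> Cr_c r \<Longrightarrow> (\<lambda>x. f x - g x) \<in> Cr_c r"
  using Cr_c_add[of f r "\<lambda>x. (-1) * g x"] Cr_c_cmult[of g r "-1"] by simp

lemma Cr_c_mono: "f \<in> Cr_c r \<Longrightarrow> s \<le> r \<Longrightarrow> f \<in> Cr_c s"
  by (auto simp: Cr_c_def intro: Cr_mono)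

lemma Cr_c_zero: "(\<lambda>x. 0) \<in> Cr_c r"
  by (simp add: Cr_c_def supp_def)

lemma Cr_c_affine:
  assumes "f \<in> Cr_c r" "a \<noteq> 0"
  shows "(\<lambda>x. f (a *\<^sub>R x + b)) \<in> Cr_c r"
proof -
  let ?g = "\<lambda>y. (1 / a) *\<^sub>R (y - b)"
  have c: "compact (?g ` supp f)"
    using assms by (auto simp: Cr_c_def intro!: compact_continuous_image continuous_intros)
  have "supp (\<lambda>x. f (a *\<^sub>R x + b)) \<subseteq> ?g ` supp f"
  proof (rule supp_subset_closed)
    fix x assume "x \<notin> ?g ` supp f"
    then have "a *\<^sub>R x + b \<notin> supp f" using assms(2) by (auto simp: image_iff dest: bspec[of _ _ "a *\<^sub>R x + b"])
    then show "f (a *\<^sub>R x + b) = 0" by (rule not_in_supp)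
  qed (rule compact_imp_closed[OF c])
  with c have "compact (supp (\<lambda>x. f (a *\<^sub>R x + b)))"
    by (rule compact_closed_subset[OF _ closed_supp])
  then show ?thesis using assms by (auto simp: Cr_c_def intro: Cr_affine)
qed

lemma Cr_c_partial: "f \<in> Cr_c (Suc r) \<Longrightarrow> partial i f \<in> Cr_c r"
  using supp_partial[of i f] by (auto simp: Cr_c_def elim: compact_supp_subset)

lemma continuous_compact_supp_bounded:
  fixes f :: "'a::euclidean_space \<Rightarrow> real"
  assumes "continuous_on UNIV f" "compact (supp f)"
  obtains B where "B > 0" "\<And>x. \<bar>f x\<bar> \<le> B"
proof -
  have "compact (f ` supp f)"
    using assms continuous_on_subset by (intro compact_continuous_image) auto
  then obtain B where B: "\<And>y. y \<in> f ` supp f \<Longrightarrow> norm y \<le> B"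
    by (meson bounded_iff compact_imp_bounded)
  have "\<bar>f x\<bar> \<le> max B 1" for x
    using B[of "f x"] not_in_supp[of x f] by (cases "x \<in> supp f") auto
  then show ?thesis using that[of "max B 1"] by auto
qed

lemma Cr_c_Cbd: "f \<in> Cr_c r \<Longrightarrow> \<exists>A>0. Cbd r A f"
proof (induction r arbitrary: f)
  case 0
  then show ?case using continuous_compact_supp_bounded[of f] by (auto simp: Cr_c_def)
next
  case (Suc r)
  have "\<exists>A>0. Cbd r A (partial i f)" for i
    using Suc.IH[OF Cr_c_partial[OF Suc.prems]] by auto
  then obtain A where A: "\<And>i. A i > 0" "\<And>i. Cbd r (A i) (partial i f)" by metis
  obtain B where B: "B > 0" "\<And>x. \<bar>f x\<bar> \<le> B"
    using Suc.prems continuous_compact_supp_bounded[of f] Cr_continuous[of "Suc r" f]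
    by (auto simp: Cr_c_def simp del: Cr.simps)
  let ?M = "B + (\<Sum>i\<in>UNIV. A i)"
  have S: "A i \<le> ?M" for i
  proof -
    have "A i \<le> (\<Sum>i\<in>UNIV. A i)" by (rule member_le_sum) (auto intro: less_imp_le A(1))
    then show ?thesis using B(1) by simp
  qed
  have "(\<Sum>i\<in>UNIV. A i) \<ge> 0" using A(1) by (intro sum_nonneg) (auto intro: less_imp_le)
  then have "Cbd (Suc r) ?M f" "?M > 0"
    using Suc.prems B A(2) S by (auto simp: Cr_c_def intro: Cbd_mono order_trans[of _ B])
  then show ?case by blast
qed

subsection \<open>Taylor's formula along a line\<close>

definition dd :: "real ^ 'n \<Rightarrow> (real ^ 'n \<Rightarrow> real) \<Rightarrow> real ^ 'n \<Rightarrow> real" where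
  "dd v h = (\<lambda>x. \<Sum>i\<in>UNIV. v $ i * partial i h x)"

text \<open>Lists instead of multi-indices: powers of a sum expand over all lists of a given length,
  without multinomial coefficients.\<close>

definition monom_at :: "'n list \<Rightarrow> real ^ 'n \<Rightarrow> real" where
  "monom_at xs v = prod_list (map (\<lambda>i. v $ i) xs)"

lemma monom_at_simps [simp]: "monom_at [] v = 1" "monom_at (i # xs) v = v $ i * monom_at xs v"
  by (simp_all add: monom_at_def)

lemma sum_lists_Suc:
  "(\<Sum>xs | length xs = Suc j. g (xs :: 'n::finite list)) = (\<Sum>i\<in>UNIV. \<Sum>xs | length xs = j. g (i # xs) :: real)"
proof -
  have "{xs :: 'n list. length xs = Suc j} = (\<lambda>(i, xs). i # xs) ` (UNIV \<times> {xs. length xs = j})"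
    by (auto simp: length_Suc_conv)
  then have "(\<Sum>xs | length xs = Suc j. g xs) = (\<Sum>(i, xs)\<in>UNIV \<times> {xs. length xs = j}. g (i # xs))"
    by (simp add: sum.reindex inj_on_def case_prod_unfold)
  then show ?thesis by (simp add: sum.cartesian_product)
qed

lemma dd_pow:
  "Cr j h \<Longrightarrow> (dd v ^^ j) h x = (\<Sum>xs | length xs = j. monom_at xs v * pd xs h x)"
proof (induction j arbitrary: x)
  case (Suc j)
  have "Cr j h" using Suc.prems by (rule Cr_Suc_imp)
  then have e: "(dd v ^^ j) h = (\<lambda>x. \<Sum>xs | length xs = j. monom_at xs v * pd xs h x)"
    using Suc.IH by auto
  have "Cr (Suc 0) (pd xs h)" if "length xs = j" for xs :: "'a list"
    using Cr_pd[of "Suc 0" xs h] Suc.prems that by simp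
  then have "partial i ((dd v ^^ j) h) x = (\<Sum>xs | length xs = j. monom_at xs v * pd (i # xs) h x)" for i
    unfolding e by (subst partial_sum) (auto simp: partial_cmult intro!: differentiable_mult)
  then have "(dd v ^^ Suc j) h x = (\<Sum>i\<in>UNIV. v $ i * (\<Sum>xs | length xs = j. monom_at xs v * pd (i # xs) h x))"
    by (simp add: dd_def)
  then show ?case by (simp add: sum_lists_Suc sum_distrib_left mult.assoc)
qed (auto simp: dd_def)

lemma Cr_dd_pow: "Cr (r + j) h \<Longrightarrow> Cr r ((dd v ^^ j) h)"
proof (induction j arbitrary: r)
  case (Suc j)
  then have "Cr (Suc r) ((dd v ^^ j) h)" by (metis add_Suc add_Suc_right)
  then have "Cr r (dd v ((dd v ^^ j) h))" unfolding dd_def[of v "(dd v ^^ j) h"] by (intro Cr_sum Cr_cmult) simp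
  then show ?case by simp
qed auto

lemma sum_monom_abs: "(\<Sum>xs | length xs = j. \<bar>monom_at xs (v :: real^'n)\<bar>) = (\<Sum>i\<in>UNIV. \<bar>v $ i\<bar>) ^ j"
proof (induction j)
  case (Suc j) then show ?case
    by (simp add: sum_lists_Suc abs_mult sum_distrib_left[symmetric] sum_distrib_right[symmetric])
qed auto

lemma dd_pow_bound:
  assumes "Cbd j A h"
  shows "\<bar>(dd v ^^ j) h x\<bar> \<le> A * (real CARD('n) * norm (v :: real ^ 'n)) ^ j"
proof -
  have A: "0 \<le> A" using assms Cbd_nonneg by blast
  have "\<bar>(dd v ^^ j) h x\<bar> \<le> (\<Sum>xs | length xs = j. \<bar>monom_at xs v * pd xs h x\<bar>)"
    by (simp add: dd_pow[OF Cbd_Cr[OF assms]] sum_abs)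
  also have "\<dots> \<le> (\<Sum>xs | length xs = j. \<bar>monom_at xs v\<bar> * A)"
    by (intro sum_mono) (auto simp: abs_mult intro!: mult_left_mono Cbd_pd_bound[OF assms])
  also have "\<dots> = A * (\<Sum>i\<in>UNIV. \<bar>v $ i\<bar>) ^ j"
    by (simp add: sum_distrib_right[symmetric] sum_monom_abs)
  also have "\<dots> \<le> A * (real CARD('n) * norm v) ^ j"
    using sum_bounded_above[of UNIV "\<lambda>i. \<bar>v $ i\<bar>" "norm v"] component_le_norm_cart A
    by (intro mult_left_mono power_mono sum_nonneg) auto
  finally show ?thesis .
qed

text \<open>Maclaurin's formula for the restriction of \<open>h\<close> to a line, whose derivatives
  are the iterates of \<open>dd v\<close>. A function of class \<open>C\<^sup>s\<close> is expanded
  to degree s - 1 with its derivatives of order s in the remainder, so that all of its regularity is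
  used.\<close>

lemma taylor_line:
  assumes "Cr s h"
  shows "\<exists>t. \<bar>t\<bar> \<le> 1 \<and> h (x + v) = (\<Sum>j<s. (dd v ^^ j) h x / fact j) + (dd v ^^ s) h (x + t *\<^sub>R v) / fact s"
proof -
  define diff where "diff j t = (dd v ^^ j) h (x + t *\<^sub>R v)" for j t
  have D: "DERIV (diff m) t :> diff (Suc m) t" if "m < s" for m t
  proof -
    have "Cr (Suc 0) ((dd v ^^ m) h)" using Cr_dd_pow[of "Suc 0" m h] Cr_mono[OF assms, of "Suc 0 + m"] that
      by (simp del: Cr.simps)
    then have "((dd v ^^ m) h has_derivative
       (\<lambda>w. \<Sum>i\<in>UNIV. w $ i * partial i ((dd v ^^ m) h) (x + t *\<^sub>R v))) (at (x + t *\<^sub>R v))"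
      by (intro has_derivative_partial) auto
    moreover have "((\<lambda>t. x + t *\<^sub>R v) has_derivative (\<lambda>u. u *\<^sub>R v)) (at t)"
      by (auto intro!: derivative_eq_intros)
    ultimately have "((\<lambda>t. (dd v ^^ m) h (x + t *\<^sub>R v)) has_derivative
       (\<lambda>u. \<Sum>i\<in>UNIV. (u *\<^sub>R v) $ i * partial i ((dd v ^^ m) h) (x + t *\<^sub>R v))) (at t)"
      using has_derivative_compose by fastforce
    then show ?thesis unfolding has_field_derivative_def diff_def
      by (rule has_derivative_eq_rhs) (auto simp: dd_def sum_distrib_left sum_distrib_right mult_ac)
  qed
  from Maclaurin_bi_le[of diff "diff 0" s 1] D
  obtain t where "\<bar>t\<bar> \<le> 1" "diff 0 1 = (\<Sum>m<s. diff m 0 / fact m) + diff s t / fact s" by auto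
  then show ?thesis unfolding diff_def by auto
qed

declare Cr.simps [simp del] Cbd.simps [simp del]

subsection \<open>Integrals of continuous functions with compact support\<close>

lemma Cr_c0: "f \<in> Cr_c r \<Longrightarrow> f \<in> Cr_c 0"
  by (rule Cr_c_mono) simp_all

lemma Cr_c_pd: "f \<in> Cr_c r \<Longrightarrow> length xs \<le> r \<Longrightarrow> pd xs f \<in> Cr_c (r - length xs)"
  using Cr_pd[of "r - length xs" xs f] compact_supp_subset[OF _ supp_pd[of xs f]]
  by (auto simp: Cr_c_def)

lemma Cr_c_continuous: "f \<in> Cr_c r \<Longrightarrow> continuous_on S f"
  by (auto simp: Cr_c_def intro: Cr_continuous)

lemma Cr_c_measurable [measurable_dest]: "f \<in> Cr_c r \<Longrightarrow> f \<in> borel_measurable borel"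
  by (intro borel_measurable_continuous_onI Cr_c_continuous)

lemma Cr_c_supp: "f \<in> Cr_c r \<Longrightarrow> \<exists>R>0. supp f \<subseteq> cball 0 R"
proof -
  assume "f \<in> Cr_c r"
  then obtain R where "supp f \<subseteq> cball 0 R" using compact_supp_cball[of f] by (auto simp: Cr_c_def)
  then show ?thesis by (intro exI[of _ "max R 1"]) auto
qed

lemma Cr_c0_mult: "f \<in> Cr_c 0 \<Longrightarrow> continuous_on UNIV g \<Longrightarrow> (\<lambda>x. f x * g x) \<in> Cr_c 0"
  by (intro Cr_c_mult) (auto simp: Cr.simps)

lemma integrable_Cc: "f \<in> Cr_c r \<Longrightarrow> integrable lborel f"
proof -
  assume f: "f \<in> Cr_c r"
  then have "integrable lborel (\<lambda>x. indicator (supp f) x *\<^sub>R f x)"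
    by (intro borel_integrable_compact Cr_c_continuous) (auto simp: Cr_c_def)
  also have "(\<lambda>x. indicator (supp f) x *\<^sub>R f x) = f"
    by (rule ext) (auto simp: indicator_def not_in_supp[of _ f])
  finally show ?thesis .
qed

lemma integrable_Cc_mult: "f \<in> Cr_c r \<Longrightarrow> continuous_on UNIV g \<Longrightarrow> integrable lborel (\<lambda>x. f x * g x)"
  by (intro integrable_Cc[of _ 0] Cr_c0_mult Cr_c0)

lemma integrable_Cc_mult': "f \<in> Cr_c r \<Longrightarrow> continuous_on UNIV g \<Longrightarrow> integrable lborel (\<lambda>x. g x * f x)"
  using integrable_Cc_mult[of f r g] by (simp add: mult.commute)

lemma integral_affine:
  fixes f :: "'a::euclidean_space \<Rightarrow> real"
  assumes "f \<in> borel_measurable borel" "a \<noteq> 0"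
  shows "(LINT x|lborel. f (a *\<^sub>R x + b)) = (LINT x|lborel. f x) / \<bar>a\<bar> ^ DIM('a)"
proof -
  note [measurable] = assms(1)
  have "(LINT x|lborel. f x) = (LINT x|density (distr lborel borel (\<lambda>x. b + a *\<^sub>R x)) (\<lambda>_. ennreal (\<bar>a\<bar> ^ DIM('a))). f x)"
    using lborel_affine[of a b] assms(2) by simp
  also have "\<dots> = (LINT x|lborel. \<bar>a\<bar> ^ DIM('a) * f (b + a *\<^sub>R x))"
    by (subst integral_density) (auto simp: integral_distr)
  also have "\<dots> = \<bar>a\<bar> ^ DIM('a) * (LINT x|lborel. f (a *\<^sub>R x + b))"
    by (simp add: add.commute)
  finally show ?thesis using assms(2) by simp
qed

lemma integral_bound_cball:
  fixes f :: "'a::euclidean_space \<Rightarrow> real"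
  assumes "f \<in> borel_measurable borel" "\<And>z. z \<notin> cball x R \<Longrightarrow> f z = 0" "\<And>z. z \<in> cball x R \<Longrightarrow> \<bar>f z\<bar> \<le> B"
  shows "\<bar>LINT z|lborel. f z\<bar> \<le> B * measure lborel (cball x R)"
proof -
  have i: "integrable lborel (\<lambda>z. B * indicator (cball x R) z)"
    by (intro integrable_mult_right integrable_real_indicator) (use emeasure_lborel_cball_finite[of x R] in auto)
  have le: "norm (f z) \<le> B * indicator (cball x R) z" for z
    using assms(2)[of z] assms(3)[of z] by (cases "z \<in> cball x R") (auto simp del: mem_cball)
  have "integrable lborel f"
    by (rule Bochner_Integration.integrable_bound[OF i]) (use assms(1) le order_trans[OF le abs_ge_self] in auto)
  then have "\<bar>LINT z|lborel. f z\<bar> \<le> (LINT z|lborel. norm (f z))"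
    using integral_norm_bound[of lborel f] by simp
  also have "\<dots> \<le> (LINT z|lborel. B * indicator (cball x R) z)"
    using \<open>integrable lborel f\<close> i le by (intro integral_mono) auto
  also have "\<dots> = B * measure lborel (cball x R)" by simp
  finally show ?thesis .
qed

text \<open>A nonempty open set is not negligible. This turns almost everywhere identities from
  \<open>L\<^sup>2\<close> into pointwise ones for continuous functions.\<close>

lemma AE_lborel_open:
  fixes P :: "'a::euclidean_space \<Rightarrow> bool"
  assumes "AE x in lborel. P x" "open {x. \<not> P x}"
  shows "P x"
proof (rule ccontr)
  assume "\<not> P x"
  have "{x. \<not> P x} \<in> sets lborel" using assms(2) by simp
  then have "{x. \<not> P x} \<in> null_sets lborel" using assms(1) AE_iff_null_sets by fastforce
  then have "negligible {x. \<not> P x}" by (simp add: negligible_iff_null_sets null_sets_completionI)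
  then show False using open_not_negligible[OF assms(2)] \<open>\<not> P x\<close> by auto
qed

lemma AE_lborel_eq:
  fixes f g :: "'a::euclidean_space \<Rightarrow> real"
  assumes "AE x in lborel. f x = g x" "continuous_on UNIV f" "continuous_on UNIV g"
  shows "f x = g x"
  by (rule AE_lborel_open[OF assms(1)]) (use assms open_Collect_neq in blast)

lemma uniformly_continuous_Cc:
  assumes "f \<in> Cr_c r" "e > 0"
  shows "\<exists>d>0. \<forall>x y. dist x y < d \<longrightarrow> \<bar>f x - f y\<bar> < e"
proof -
  obtain R where R: "supp f \<subseteq> cball 0 R" using Cr_c_supp[OF assms(1)] by auto
  \<comment> \<open>The margin 1 keeps both points in the ball when one is in the support and their
    distance is below 1.\<close>
  have "uniformly_continuous_on (cball 0 (R + 1)) f"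
    by (intro compact_uniformly_continuous Cr_c_continuous[OF assms(1)]) auto
  then obtain d where d: "d > 0" "\<And>x y. x \<in> cball 0 (R + 1) \<Longrightarrow> y \<in> cball 0 (R + 1) \<Longrightarrow> dist x y < d \<Longrightarrow> dist (f x) (f y) < e"
    using assms(2) unfolding uniformly_continuous_on_def by metis
  have "\<bar>f x - f y\<bar> < e" if xy: "dist x y < min d 1" for x y
  proof (cases "x \<in> cball 0 R \<or> y \<in> cball 0 R")
    case True
    have "norm x \<le> norm y + dist x y" "norm y \<le> norm x + dist x y"
      using norm_triangle_sub[of x y] norm_triangle_sub[of y x] by (simp_all add: dist_norm norm_minus_commute)
    then show ?thesis using d(2)[of x y] xy True by (auto simp: dist_real_def)
  next
    case False
    then have "f x = 0" "f y = 0" using R not_in_supp[of x f] not_in_supp[of y f] by blast+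
    then show ?thesis using assms(2) by simp
  qed
  then show ?thesis using d(1) by (intro exI[of _ "min d 1"]) auto
qed

subsection \<open>Convolution and mollification\<close>

definition conv :: "(real ^ 'n \<Rightarrow> real) \<Rightarrow> (real ^ 'n \<Rightarrow> real) \<Rightarrow> real ^ 'n \<Rightarrow> real" where
  "conv h g x = (LINT z|lborel. h z * g (x - z))"

lemma Cr_c_reflect: "g \<in> Cr_c r \<Longrightarrow> (\<lambda>z. g (x - z)) \<in> Cr_c r"
  using Cr_c_affine[of g r "-1" x] by simp

lemma conv_commute:
  fixes h g :: "real ^ 'n \<Rightarrow> real"
  assumes "continuous_on UNIV h" "continuous_on UNIV g"
  shows "conv h g = conv g h"
proof
  fix x
  have [measurable]: "h \<in> borel_measurable borel" "g \<in> borel_measurable borel"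
    using assms borel_measurable_continuous_onI by blast+
  have "(LINT z|lborel. h (x - ((-1) *\<^sub>R z + x)) * g ((-1) *\<^sub>R z + x)) = (LINT z|lborel. h (x - z) * g z)"
    using integral_affine[of "\<lambda>z. h (x - z) * g z" "-1" x] by simp
  then show "conv h g x = conv g h x" by (simp add: conv_def mult.commute)
qed

text \<open>The first order remainder is small uniformly in the base point because the partial
  derivatives are uniformly continuous; this justifies differentiation under the integral in
  \<open>conv_has_derivative\<close>.\<close>

lemma dd_uniform:
  fixes g :: "real ^ 'n \<Rightarrow> real"
  assumes "g \<in> Cr_c (Suc r)" "e > 0"
  shows "\<exists>d>0. \<forall>y v. norm v < d \<longrightarrow> \<bar>g (y + v) - g y - dd v g y\<bar> \<le> e * norm v"
proof -
  let ?N = "real CARD('n)"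
  have "\<exists>d>0. \<forall>x y. dist x y < d \<longrightarrow> \<bar>partial i g x - partial i g y\<bar> < e / ?N" for i
    using uniformly_continuous_Cc[OF Cr_c_partial[OF assms(1)], of "e / ?N" i] assms(2) by auto
  then obtain d where d: "\<And>i. d i > 0" "\<And>i x y. dist x y < d i \<Longrightarrow> \<bar>partial i g x - partial i g y\<bar> < e / ?N"
    by metis
  let ?d = "Min (range d)"
  have "\<bar>g (y + v) - g y - dd v g y\<bar> \<le> e * norm v" if v: "norm v < ?d" for y v
  proof -
    have "Cr 1 g" using Cr_mono[of "Suc r" g 1] assms(1) by (auto simp: Cr_c_def)
    then obtain t where t: "\<bar>t\<bar> \<le> 1" "g (y + v) = g y + dd v g (y + t *\<^sub>R v)"
      using taylor_line[of 1 g y v] by auto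
    have "dist (y + t *\<^sub>R v) y < d i" for i
    proof -
      have "norm (t *\<^sub>R v) \<le> norm v" using t(1) mult_right_mono[of "\<bar>t\<bar>" 1 "norm v"] by simp
      also have "\<dots> < d i" using v Min_le[of "range d" "d i"] by auto
      finally show ?thesis by (simp add: dist_norm)
    qed
    then have *: "\<bar>partial i g (y + t *\<^sub>R v) - partial i g y\<bar> \<le> e / ?N" for i using d(2) less_imp_le by blast
    have "\<bar>dd v g (y + t *\<^sub>R v) - dd v g y\<bar> = \<bar>\<Sum>i\<in>UNIV. v $ i * (partial i g (y + t *\<^sub>R v) - partial i g y)\<bar>"
      by (simp add: dd_def sum_subtractf right_diff_distrib)
    also have "\<dots> \<le> (\<Sum>i\<in>UNIV. \<bar>v $ i * (partial i g (y + t *\<^sub>R v) - partial i g y)\<bar>)" by (rule sum_abs)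
    also have "\<dots> \<le> (\<Sum>i\<in>(UNIV :: 'n set). norm v * (e / ?N))"
      unfolding abs_mult by (intro sum_mono mult_mono * component_le_norm_cart) auto
    also have "\<dots> = e * norm v" by simp
    finally show ?thesis using t(2) by simp
  qed
  then show ?thesis using d(1) by (intro exI[of _ ?d]) auto
qed

lemma conv_has_derivative:
  fixes g :: "real ^ 'n \<Rightarrow> real"
  assumes h: "continuous_on UNIV h" and g: "g \<in> Cr_c (Suc r)"
  shows "(conv h g has_derivative (\<lambda>v. \<Sum>i\<in>UNIV. v $ i * conv h (partial i g) x)) (at x)"
  unfolding has_derivative_at_alt
proof (intro conjI allI impI)
  show "bounded_linear (\<lambda>v::real^'n. \<Sum>i\<in>UNIV. v $ i * conv h (partial i g) x)"
    by (intro bounded_linear_sum bounded_linear_mult_const[OF bounded_linear_vec_nth])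
  fix e :: real assume e: "e > 0"
  obtain R where R: "R > 0" "supp g \<subseteq> cball 0 R" using Cr_c_supp[OF g] by auto
  \<comment> \<open>This ball contains the region where the integrand can be nonzero for all y
    within distance 1 of x.\<close>
  let ?K = "cball x (R + 1)"
  have "compact (h ` ?K)" by (intro compact_continuous_image continuous_on_subset[OF h]) auto
  then obtain H0 where H0: "\<And>y. y \<in> h ` ?K \<Longrightarrow> norm y \<le> H0"
    by (meson bounded_iff compact_imp_bounded)
  define H where "H = max H0 0"
  have H: "\<bar>h z\<bar> \<le> H" if "z \<in> ?K" for z using H0[of "h z"] that by (auto simp: H_def)
  \<comment> \<open>The summands 1 make \<open>m\<close> positive, so that \<open>e / m\<close> can
    be used as accuracy; \<open>m\<close> still dominates
    \<open>H * measure lborel ?K\<close>.\<close>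
  define m where "m = (H + 1) * (measure lborel ?K + 1)"
  have m: "m > 0" by (auto simp: m_def H_def intro!: mult_pos_pos add_nonneg_pos)
  obtain d where d: "d > 0" "\<And>y v. norm v < d \<Longrightarrow> \<bar>g (y + v) - g y - dd v g y\<bar> \<le> e / m * norm v"
    using dd_uniform[OF g, of "e / m"] e m by auto
  have "norm (conv h g y - conv h g x - (\<Sum>i\<in>UNIV. (y - x) $ i * conv h (partial i g) x)) \<le> e * norm (y - x)"
    if y: "norm (y - x) < min d 1" for y
  proof -
    let ?v = "y - x"
    define F where "F z = h z * (g (y - z) - g (x - z) - dd ?v g (x - z))" for z
    have g1: "g \<in> Cr_c 0" "\<And>i. partial i g \<in> Cr_c 0" using g Cr_c_partial[OF g] Cr_c0 by blast+
    have i: "integrable lborel (\<lambda>z. h z * g (w - z))" "integrable lborel (\<lambda>z. h z * partial i g (w - z))" for w i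
      by (rule integrable_Cc_mult'[OF Cr_c_reflect[OF g1(1)] h],
          rule integrable_Cc_mult'[OF Cr_c_reflect[OF g1(2)] h])
    have iS: "integrable lborel (\<lambda>z. \<Sum>i\<in>UNIV. ?v $ i * (h z * partial i g (x - z)))"
      by (intro Bochner_Integration.integrable_sum integrable_mult_right i)
    have "conv h g y - conv h g x - (\<Sum>i\<in>UNIV. ?v $ i * conv h (partial i g) x)
       = (LINT z|lborel. h z * g (y - z)) - (LINT z|lborel. h z * g (x - z))
          - (LINT z|lborel. (\<Sum>i\<in>UNIV. ?v $ i * (h z * partial i g (x - z))))"
      using i by (simp add: conv_def)
    also have "\<dots> = (LINT z|lborel. h z * g (y - z) - h z * g (x - z) - (\<Sum>i\<in>UNIV. ?v $ i * (h z * partial i g (x - z))))"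
      by (simp only: Bochner_Integration.integral_diff[OF Bochner_Integration.integrable_diff[OF i(1) i(1)] iS] Bochner_Integration.integral_diff[OF i(1) i(1)])
    also have "\<dots> = (LINT z|lborel. F z)"
      by (intro arg_cong[where f = "integral\<^sup>L lborel"]) (auto simp: fun_eq_iff F_def dd_def right_diff_distrib sum_distrib_left mult_ac)
    finally have eq: "conv h g y - conv h g x - (\<Sum>i\<in>UNIV. ?v $ i * conv h (partial i g) x) = (LINT z|lborel. F z)" .
    have "\<bar>LINT z|lborel. F z\<bar> \<le> (H * (e / m * norm ?v)) * measure lborel ?K"
    proof (rule integral_bound_cball)
      have [measurable]: "h \<in> borel_measurable borel" "g \<in> borel_measurable borel" "\<And>i. partial i g \<in> borel_measurable borel"
        using borel_measurable_continuous_onI[OF h] g1 Cr_c_measurable by blast+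
      show "F \<in> borel_measurable borel" unfolding F_def dd_def by measurable
      show "F z = 0" if "z \<notin> ?K" for z
      proof -
        have "norm (x - z) > R + 1" using that by (simp add: dist_norm)
        moreover from this have "norm (y - z) > R"
          using y norm_triangle_ineq2[of "x - z" "x - y"] by (simp add: norm_minus_commute)
        ultimately have "x - z \<notin> supp g" "y - z \<notin> supp g" using R by auto
        then show ?thesis by (simp add: F_def not_in_supp dd_def partial_supp)
      qed
      show "\<bar>F z\<bar> \<le> H * (e / m * norm ?v)" if "z \<in> ?K" for z
        unfolding F_def abs_mult
        by (intro mult_mono H that order_trans[OF _ d(2)[of ?v "x - z"]]) (use y in \<open>auto simp: H_def\<close>)
    qed
    also have "\<dots> = (e * norm ?v) * (H * measure lborel ?K / m)" by simp
    also have "\<dots> \<le> (e * norm ?v) * 1"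
    proof (rule mult_left_mono)
      have "H * measure lborel ?K \<le> m" unfolding m_def by (intro mult_mono) (auto simp: H_def)
      then show "H * measure lborel ?K / m \<le> 1" using m by simp
    qed (use e in auto)
    finally show ?thesis using eq by simp
  qed
  then show "\<exists>d>0. \<forall>y. norm (y - x) < d \<longrightarrow> norm (conv h g y - conv h g x - (\<Sum>i\<in>UNIV. (y - x) $ i * conv h (partial i g) x)) \<le> e * norm (y - x)"
    using d(1) by (intro exI[of _ "min d 1"]) auto
qed

lemma partial_conv:
  assumes "continuous_on UNIV h" "g \<in> Cr_c (Suc r)"
  shows "partial i (conv h g) = conv h (partial i g)"
  by (rule ext, subst partial_eqI[OF conv_has_derivative[OF assms]]) (simp add: sum_axis)

text \<open>Convolution of \<open>g\<close> with the constant 1 is the constant integral of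
  \<open>g\<close>. Its derivative is zero on the one hand, and by \<open>partial_conv\<close> the
  integral of the derivative of \<open>g\<close> on the other.\<close>

lemma integral_partial_eq_0:
  assumes "g \<in> Cr_c (Suc r)"
  shows "(LINT x|lborel. partial i g x) = 0"
proof -
  have g: "g \<in> borel_measurable borel" "partial i g \<in> borel_measurable borel"
    using assms Cr_c_partial[OF assms] Cr_c_measurable by blast+
  have c: "conv (\<lambda>x. 1) u x = (LINT x|lborel. u x)" if "u \<in> borel_measurable borel" for u x
    using integral_affine[of u "-1" x] that by (simp add: conv_def)
  have "conv (\<lambda>x. 1) g = (\<lambda>x. LINT x|lborel. g x)" by (rule ext, rule c[OF g(1)])
  then have "partial i (conv (\<lambda>x. 1) g) = (\<lambda>x. 0)" by simp
  then have "conv (\<lambda>x. 1) (partial i g) 0 = 0" by (metis partial_conv[OF _ assms] continuous_on_const)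
  then show ?thesis by (simp add: c[OF g(2)])
qed

lemma integral_by_parts:
  assumes "g \<in> Cr_c (Suc r)" "Cr (Suc r) w"
  shows "(LINT x|lborel. partial i g x * w x) = - (LINT x|lborel. g x * partial i w x)"
proof -
  have gw: "(\<lambda>x. g x * w x) \<in> Cr_c (Suc r)" by (rule Cr_c_mult[OF assms])
  have 1: "integrable lborel (\<lambda>x. partial i g x * w x)"
    by (intro integrable_Cc_mult[OF Cr_c_partial[OF assms(1)]] Cr_continuous[OF assms(2)])
  have 2: "integrable lborel (\<lambda>x. g x * partial i w x)"
    by (intro integrable_Cc_mult[OF assms(1)] Cr_continuous[OF Cr_partial[OF assms(2)]])
  have "partial i (\<lambda>x. g x * w x) = (\<lambda>x. partial i g x * w x + g x * partial i w x)"
    using assms by (auto intro!: partial_mult simp: Cr_c_def Cr.simps)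
  then have "0 = (LINT x|lborel. partial i g x * w x + g x * partial i w x)"
    using integral_partial_eq_0[OF gw, of i] by metis
  then show ?thesis using 1 2 by simp
qed

text \<open>One order of regularity of \<open>g\<close> is given up, as the base case gets
  continuity of the convolution from its differentiability; this costs nothing for smooth
  kernels.\<close>

lemma Cr_conv: "continuous_on UNIV h \<Longrightarrow> g \<in> Cr_c (Suc r) \<Longrightarrow> Cr r (conv h g)"
proof (induction r arbitrary: g)
  case 0
  have "conv h g differentiable (at x)" for x
    using conv_has_derivative[OF 0] differentiable_def by blast
  then show ?case
    by (auto intro!: differentiable_imp_continuous_on simp: Cr.simps differentiable_on_def
        intro: differentiable_at_withinI)
next
  case (Suc r)
  show ?case by (rule Cr_SucI(1)[OF conv_has_derivative[OF Suc.prems]]) (rule Suc.IH[OF Suc.prems(1) Cr_c_partial[OF Suc.prems(2)]])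
qed

lemma supp_conv:
  fixes h g :: "real ^ 'n \<Rightarrow> real"
  assumes "supp h \<subseteq> cball 0 R" "supp g \<subseteq> cball 0 S"
  shows "supp (conv h g) \<subseteq> cball 0 (R + S)"
proof (rule supp_subset_closed)
  fix x :: "real ^ 'n" assume x: "x \<notin> cball 0 (R + S)"
  have "h z * g (x - z) = 0" for z
  proof (rule ccontr)
    assume "h z * g (x - z) \<noteq> 0"
    then have "z \<in> supp h" "x - z \<in> supp g" using not_in_supp by fastforce+
    then have "norm z \<le> R" "norm (x - z) \<le> S" using assms by auto
    then show False using x norm_triangle_ineq[of z "x - z"] by simp
  qed
  then show "conv h g x = 0" unfolding conv_def by (simp only: integral_zero)
qed simp

lemma Cinf_c_D: "g \<in> Cinf_c \<Longrightarrow> g \<in> Cr_c r"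
  by (auto simp: Cinf_c_def)

lemma conv_Cinf_c:
  assumes "h \<in> Cr_c r" "g \<in> Cinf_c"
  shows "conv h g \<in> Cinf_c"
proof -
  obtain R where "supp h \<subseteq> cball 0 R" using Cr_c_supp[OF assms(1)] by blast
  moreover obtain S where "supp g \<subseteq> cball 0 S" using Cr_c_supp[OF Cinf_c_D[OF assms(2)]] by blast
  ultimately have "supp (conv h g) \<subseteq> cball 0 (R + S)" by (rule supp_conv)
  then have "compact (supp (conv h g))" using compact_supp_cball by blast
  moreover have "Cr r (conv h g)" for r
    by (rule Cr_conv[OF Cr_c_continuous[OF assms(1)] Cinf_c_D[OF assms(2)]])
  ultimately show ?thesis by (simp add: Cinf_c_def Cr_c_def)
qed

section \<open>A smooth bump function\<close>

definition smooth1 :: "(nat \<Rightarrow> real \<Rightarrow> real) \<Rightarrow> bool" where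
  "smooth1 D \<longleftrightarrow> (\<forall>n x. (D n has_real_derivative D (Suc n) x) (at x))"

text \<open>Carrying the whole sequence of derivatives lets the induction on \<open>r\<close> pass
  from \<open>D n\<close> to \<open>D (Suc n)\<close>; only the coordinate \<open>i\<close>
  contributes a nonzero partial derivative.\<close>

lemma Cr_smooth1: "smooth1 D \<Longrightarrow> Cr r (\<lambda>x. D n (a * x $ i + b))"
proof (induction r arbitrary: n)
  case 0
  have "continuous_on UNIV (D n)"
    using 0 unfolding smooth1_def by (meson DERIV_isCont continuous_at_imp_continuous_on)
  then show ?case unfolding Cr.simps by (auto intro!: continuous_intros elim: continuous_on_compose2)
next
  case (Suc r)
  show ?case
  proof (rule Cr_SucI(1)[where g = "\<lambda>j x. if j = i then a * D (Suc n) (a * x $ i + b) else 0"])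
    fix x :: "real ^ 'a"
    have 1: "((\<lambda>x. a * x $ i + b) has_derivative (\<lambda>v. a * v $ i)) (at x)"
      by (auto intro!: derivative_eq_intros bounded_linear.has_derivative[OF bounded_linear_vec_nth])
    have 2: "(D n has_derivative (\<lambda>u. u * D (Suc n) (a * x $ i + b))) (at (a * x $ i + b))"
      using Suc.prems unfolding smooth1_def has_field_derivative_def by (simp add: mult_commute_abs)
    have "((\<lambda>x. D n (a * x $ i + b)) has_derivative (\<lambda>v. (a * v $ i) * D (Suc n) (a * x $ i + b))) (at x)"
      using has_derivative_compose[OF 1 2] .
    then show "((\<lambda>x. D n (a * x $ i + b)) has_derivative
        (\<lambda>v. \<Sum>j\<in>UNIV. v $ j * (if j = i then a * D (Suc n) (a * x $ i + b) else 0))) (at x)"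
      by (rule has_derivative_eq_rhs) (auto simp: if_distrib[of "\<lambda>t. _ * t"] sum.delta cong: if_cong)
    fix j
    show "Cr r (\<lambda>x. if j = i then a * D (Suc n) (a * x $ i + b) else 0)"
      using Suc.IH[OF Suc.prems] by (cases "j = i") (auto intro: Cr_cmult)
  qed
qed

text \<open>The classical function exp(-1/t) on t > 0, with a polynomial in 1/t as a factor so that
  the class is closed under differentiation.\<close>

definition flat_fun :: "real poly \<Rightarrow> real \<Rightarrow> real" where
  "flat_fun P t = (if t > 0 then poly P (1 / t) * exp (- (1 / t)) else 0)"

text \<open>With x = 1/t the limit from the right becomes that of a polynomial divided by exp x. The
  extra division by t makes this the difference quotient at the origin.\<close>

lemma flat_quotient_tendsto: "((\<lambda>t. flat_fun P t / t) \<longlongrightarrow> 0) (at (0::real))"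
proof -
  have "((\<lambda>x. \<Sum>i\<le>degree P. coeff P i * (x ^ Suc i / exp x)) \<longlongrightarrow> (\<Sum>i\<le>degree P. coeff P i * 0)) at_top"
    by (intro tendsto_intros tendsto_power_div_exp_0)
  then have "((\<lambda>x. x * poly P x * exp (- x)) \<longlongrightarrow> 0) at_top"
    by (simp add: poly_altdef sum_distrib_left sum_distrib_right exp_minus divide_inverse mult_ac)
  then have r: "((\<lambda>t. inverse t * poly P (inverse t) * exp (- inverse t)) \<longlongrightarrow> 0) (at_right 0)"
    by (simp add: filterlim_at_right_to_top)
  have "eventually (\<lambda>t. inverse t * poly P (inverse t) * exp (- inverse t) = flat_fun P t / t) (at_right (0::real))"
    by (auto simp: eventually_at_filter flat_fun_def divide_inverse mult_ac)
  from Lim_transform_eventually[OF r this]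
  have "((\<lambda>t. flat_fun P t / t) \<longlongrightarrow> 0) (at_right 0)" .
  moreover have "((\<lambda>t. flat_fun P t / t) \<longlongrightarrow> 0) (at_left 0)"
    by (rule Lim_transform_eventually[of "\<lambda>t. 0"]) (auto simp: eventually_at_filter flat_fun_def)
  ultimately show ?thesis by (intro filterlim_split_at)
qed

text \<open>For t > 0 both factors depend on 1/t, whose derivative -1/t^2 produces the polynomial
  factor \<open>[:0, 0, 1:]\<close>; at 0 the difference quotient tends to 0.\<close>

lemma flat_deriv: "(flat_fun P has_real_derivative flat_fun ([:0, 0, 1:] * (P - pderiv P)) t) (at t)"
proof -
  consider "t > 0" | "t < 0" | "t = 0" by linarith
  then show ?thesis
  proof cases
    case 1
    have "((\<lambda>t. poly P (1 / t) * exp (- (1 / t))) has_real_derivative flat_fun ([:0, 0, 1:] * (P - pderiv P)) t) (at t)"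
      using 1 by (auto intro!: derivative_eq_intros DERIV_chain2[OF poly_DERIV] simp: flat_fun_def power2_eq_square field_simps)
    then show ?thesis
      by (rule has_field_derivative_transform_within_open[of _ _ _ "{0<..}"]) (use 1 in \<open>auto simp: flat_fun_def\<close>)
  next
    case 2
    have "((\<lambda>t. 0) has_real_derivative flat_fun ([:0, 0, 1:] * (P - pderiv P)) t) (at t)"
      using 2 by (auto simp: flat_fun_def)
    then show ?thesis
      by (rule has_field_derivative_transform_within_open[of _ _ _ "{..<0}"]) (use 2 in \<open>auto simp: flat_fun_def\<close>)
  next
    case 3
    then show ?thesis using flat_quotient_tendsto[of P]
      by (auto simp: has_field_derivative_iff flat_fun_def)
  qed
qed

fun flat_poly :: "nat \<Rightarrow> real poly" where
  "flat_poly 0 = 1"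
| "flat_poly (Suc n) = [:0, 0, 1:] * (flat_poly n - pderiv (flat_poly n))"

lemma smooth1_flat: "smooth1 (\<lambda>n. flat_fun (flat_poly n))"
  unfolding smooth1_def by (auto simp only: flat_poly.simps intro!: flat_deriv)

lemma bump_exists:
  "\<exists>b :: real ^ 'n \<Rightarrow> real. b \<in> Cinf_c \<and> (\<forall>x. b x \<ge> 0) \<and> supp b \<subseteq> cball 0 1 \<and> (LINT x|lborel. b x) = 1"
proof -
  \<comment> \<open>A box of half-width 1/d lies in the unit ball, since the norm is at most the sum
    of the absolute values of the coordinates.\<close>
  define c where "c = 1 / real CARD('n)"
  have c: "c > 0" by (simp add: c_def)
  define b0 :: "real ^ 'n \<Rightarrow> real" where
    "b0 x = (\<Prod>i\<in>UNIV. flat_fun (flat_poly 0) (1 * x $ i + c) * flat_fun (flat_poly 0) ((-1) * x $ i + c))" for x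
  have Cr: "Cr r b0" for r
    unfolding b0_def by (intro Cr_prod Cr_mult Cr_smooth1[OF smooth1_flat])
  have nn: "b0 x \<ge> 0" for x unfolding b0_def by (intro prod_nonneg) (auto simp: flat_fun_def)
  have supp: "supp b0 \<subseteq> cball 0 1"
  proof (rule supp_subset_closed)
    fix x :: "real ^ 'n" assume "x \<notin> cball 0 1"
    have "\<exists>i. \<bar>x $ i\<bar> > c"
    proof (rule ccontr)
      assume "\<nexists>i. \<bar>x $ i\<bar> > c"
      then have "(\<Sum>i\<in>UNIV. \<bar>x $ i\<bar>) \<le> (\<Sum>i\<in>(UNIV :: 'n set). c)"
        by (intro sum_mono) (simp add: not_less)
      then have "norm x \<le> (\<Sum>i\<in>(UNIV :: 'n set). c)" by (rule order_trans[OF norm_le_l1_cart])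
      then show False using \<open>x \<notin> cball 0 1\<close> by (simp add: c_def)
    qed
    then obtain i where "\<bar>x $ i\<bar> > c" by auto
    then have "flat_fun (flat_poly 0) (1 * x $ i + c) * flat_fun (flat_poly 0) ((-1) * x $ i + c) = 0"
      by (auto simp: flat_fun_def)
    then show "b0 x = 0" unfolding b0_def by (intro prod_zero finite bexI[OF _ UNIV_I])
  qed simp
  have b0: "b0 \<in> Cr_c r" for r using Cr supp compact_supp_cball by (auto simp: Cr_c_def)
  have "(LINT x|lborel. b0 x) \<noteq> 0"
  proof
    assume "(LINT x|lborel. b0 x) = 0"
    then have "AE x in lborel. b0 x = 0"
      using integral_nonneg_eq_0_iff_AE[OF integrable_Cc[OF b0[of 0]]] nn by simp
    then have "b0 0 = 0" using Cr_c_continuous[OF b0[of 0]] by (intro AE_lborel_eq) auto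
    moreover have "b0 0 > 0" unfolding b0_def using c by (auto simp: flat_fun_def intro!: prod_pos)
    ultimately show False by simp
  qed
  moreover have "(LINT x|lborel. b0 x) \<ge> 0" by (rule Bochner_Integration.integral_nonneg) (rule nn)
  ultimately have I: "(LINT x|lborel. b0 x) > 0" by linarith
  let ?b = "\<lambda>x. 1 / (LINT x|lborel. b0 x) * b0 x"
  have "?b \<in> Cinf_c" unfolding Cinf_c_def by (intro INT_I Cr_c_cmult b0)
  moreover have "supp ?b \<subseteq> cball 0 1" using supp_mult(2)[of "\<lambda>x. 1 / (LINT x|lborel. b0 x)" b0] supp by simp
  moreover have "(LINT x|lborel. ?b x) = 1" using I by simp
  ultimately show ?thesis using nn I by (intro exI[of _ ?b]) auto
qed

definition bump :: "real ^ 'n \<Rightarrow> real" where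
  "bump = (SOME b. b \<in> Cinf_c \<and> (\<forall>x. b x \<ge> 0) \<and> supp b \<subseteq> cball 0 1 \<and> (LINT x|lborel. b x) = 1)"

lemma bump:
  "(bump :: real ^ 'n \<Rightarrow> real) \<in> Cinf_c" "(bump x :: real) \<ge> 0" "supp (bump :: real ^ 'n \<Rightarrow> real) \<subseteq> cball 0 1"
  "(LINT x|lborel. (bump x :: real)) = 1"
  using someI_ex[OF bump_exists] unfolding bump_def[symmetric] by auto

text \<open>The \<open>+ 0\<close> gives the argument the shape to which \<open>Cr_c_affine\<close>
  and \<open>integral_affine\<close> apply.\<close>

definition bumpe :: "real \<Rightarrow> real ^ 'n \<Rightarrow> real" where
  "bumpe e x = (1 / e) ^ CARD('n) * bump ((1 / e) *\<^sub>R x + 0)"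

lemma bumpe:
  assumes "e > 0"
  shows "(bumpe e :: real ^ 'n \<Rightarrow> real) \<in> Cinf_c" "bumpe e (x :: real ^ 'n) \<ge> 0"
    "norm (x :: real ^ 'n) > e \<Longrightarrow> bumpe e x = 0" "(LINT x|lborel. bumpe e (x :: real ^ 'n)) = 1"
proof -
  show "(bumpe e :: real ^ 'n \<Rightarrow> real) \<in> Cinf_c"
    unfolding Cinf_c_def bumpe_def
    by (intro INT_I Cr_c_cmult Cr_c_affine bump(1)[THEN Cinf_c_D]) (use assms in auto)
  show "bumpe e (x :: real ^ 'n) \<ge> 0" using assms by (auto simp: bumpe_def intro!: mult_nonneg_nonneg bump)
  show "bumpe e x = 0" if "norm (x :: real ^ 'n) > e"
  proof -
    have "(1 / e) *\<^sub>R x \<notin> cball 0 1" using that assms by (simp add: field_simps)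
    then have "(1 / e) *\<^sub>R x \<notin> supp bump" using bump(3) by auto
    then show ?thesis by (simp add: bumpe_def not_in_supp)
  qed
  have "(bump :: real ^ 'n \<Rightarrow> real) \<in> borel_measurable borel"
    using bump(1)[where 'n = 'n] Cr_c_measurable[of bump 0] by (auto simp: Cinf_c_def)
  then have "(LINT x|lborel. bump ((1 / e) *\<^sub>R (x :: real^'n) + 0)) = 1 / (1 / e) ^ CARD('n)"
    using integral_affine[of "bump :: real ^ 'n \<Rightarrow> real" "1 / e" 0] assms by (simp add: bump(4))
  then show "(LINT x|lborel. bumpe e (x :: real ^ 'n)) = 1"
    unfolding bumpe_def using assms by (simp add: field_simps)
qed

section \<open>Approximation by mollification and symmetry of derivatives\<close>

lemma conv_bumpe_tendsto:
  fixes h :: "real ^ 'n \<Rightarrow> real"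
  assumes h: "h \<in> Cr_c r" and e: "e > 0"
  shows "\<exists>d>0. \<forall>t. 0 < t \<and> t < d \<longrightarrow> (\<forall>x. \<bar>conv h (bumpe t) x - h x\<bar> \<le> e)"
proof -
  obtain d where d: "d > 0" "\<And>x y. dist x y < d \<Longrightarrow> \<bar>h x - h y\<bar> < e"
    using uniformly_continuous_Cc[OF h e] by auto
  have "\<bar>conv h (bumpe t) x - h x\<bar> \<le> e" if t: "0 < t" "t < d" for t x
  proof -
    note b = bumpe(1)[OF t(1), where 'n = 'n, THEN Cinf_c_D, of 0]
    have "conv h (bumpe t) x = conv (bumpe t) h x"
      using conv_commute Cr_c_continuous[OF h] Cr_c_continuous[OF b] by metis
    moreover have i1: "integrable lborel (\<lambda>z. bumpe t z * h (x - z))"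
      by (intro integrable_Cc_mult[OF b] Cr_c_continuous[OF Cr_c_reflect[OF h]])
    moreover have i2: "integrable lborel (\<lambda>z :: real ^ 'n. bumpe t z * h x)"
      by (intro integrable_mult_left integrable_Cc[OF b])
    ultimately have "conv h (bumpe t) x - h x = (LINT z|lborel. bumpe t z * h (x - z)) - (LINT z :: real ^ 'n|lborel. bumpe t z * h x)"
      by (simp add: conv_def bumpe(4)[OF t(1)])
    also have "\<dots> = (LINT z|lborel. bumpe t z * h (x - z) - bumpe t z * h x)"
      using i1 i2 by simp
    finally have "\<bar>conv h (bumpe t) x - h x\<bar> \<le> (LINT z|lborel. \<bar>bumpe t z * h (x - z) - bumpe t z * h x\<bar>)"
      using integral_abs_bound by metis
    also have "\<dots> \<le> (LINT z :: real ^ 'n|lborel. bumpe t z * e)"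
    proof (rule integral_mono)
      show "integrable lborel (\<lambda>z. \<bar>bumpe t z * h (x - z) - bumpe t z * h x\<bar>)" using i1 i2 by auto
      show "integrable lborel (\<lambda>z. bumpe t (z :: real ^ 'n) * e)" by (intro integrable_mult_left integrable_Cc[OF b])
      fix z :: "real ^ 'n"
      show "\<bar>bumpe t z * h (x - z) - bumpe t z * h x\<bar> \<le> bumpe t z * e"
      proof (cases "norm z > t")
        case False
        then have "\<bar>h (x - z) - h x\<bar> \<le> e" using d(2)[of "x - z" x] t by (simp add: dist_norm)
        then show ?thesis using bumpe(2)[OF t(1), of z]
          by (simp add: right_diff_distrib[symmetric] abs_mult mult_left_mono)
      next
        case True
        then have "bumpe t z = 0" by (rule bumpe(3)[OF t(1)])
        then show ?thesis by simp
      qed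
    qed
    also have "\<dots> = e" by (simp add: bumpe(4)[OF t(1)])
    finally show ?thesis .
  qed
  then show ?thesis using d(1) by blast
qed

lemma partial_conv_left:
  fixes h :: "real ^ 'n \<Rightarrow> real"
  assumes "h \<in> Cr_c (Suc r)" "g \<in> Cinf_c"
  shows "partial i (conv h g) = conv (partial i h) g"
proof -
  have g: "continuous_on UNIV g" using assms(2) Cinf_c_D Cr_c_continuous by blast
  have "conv h g = conv g h" by (intro conv_commute g Cr_c_continuous[OF assms(1)])
  moreover have "conv g (partial i h) = conv (partial i h) g"
    by (intro conv_commute g Cr_c_continuous[OF Cr_c_partial[OF assms(1)]])
  ultimately show ?thesis using partial_conv[OF g assms(1)] by simp
qed

text \<open>Derivatives are moved onto \<open>h\<close> by \<open>partial_conv_left\<close>, so each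
  of order at most r is a mollification of a continuous function, for which uniform convergence is
  known.\<close>

lemma mollify_eventually:
  fixes h :: "real ^ 'n \<Rightarrow> real"
  assumes "h \<in> Cr_c r" "e > 0"
  shows "\<exists>d>0. \<forall>t. 0 < t \<and> t < d \<longrightarrow> Cbd r e (\<lambda>x. conv h (bumpe t) x - h x)"
  using assms
proof (induction r arbitrary: h)
  case 0
  have "continuous_on UNIV (\<lambda>x. conv h (bumpe t) x - h x)" if "0 < t" for t
    using Cr_c_continuous[OF conv_Cinf_c[OF 0(1) bumpe(1)[OF that], THEN Cinf_c_D]] Cr_c_continuous[OF 0(1)]
    by (intro continuous_on_diff)
  then show ?case using conv_bumpe_tendsto[OF 0] by (auto simp: Cbd.simps)
next
  case (Suc r)
  have "\<exists>d>0. \<forall>t. 0 < t \<and> t < d \<longrightarrow> Cbd r e (\<lambda>x. conv (partial i h) (bumpe t) x - partial i h x)" for i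
    by (rule Suc.IH[OF Cr_c_partial[OF Suc.prems(1)] Suc.prems(2)])
  then obtain d where d: "\<And>i. d i > 0"
     "\<And>i t. 0 < t \<Longrightarrow> t < d i \<Longrightarrow> Cbd r e (\<lambda>x. conv (partial i h) (bumpe t) x - partial i h x)"
    by metis
  obtain d' where d': "d' > 0" "\<And>t x. 0 < t \<Longrightarrow> t < d' \<Longrightarrow> \<bar>conv h (bumpe t) x - h x\<bar> \<le> e"
    using conv_bumpe_tendsto[OF Suc.prems] by auto
  let ?d = "min d' (Min (range d))"
  have "Cbd (Suc r) e (\<lambda>x. conv h (bumpe t) x - h x)" if t: "0 < t" "t < ?d" for t
  proof -
    have D: "conv h (bumpe t) differentiable (at x)" "h differentiable (at x)" for x
      using conv_Cinf_c[OF Suc.prems(1) bumpe(1)[OF t(1)], THEN Cinf_c_D, of "Suc 0"] Suc.prems(1)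
      by (auto simp: Cr_c_def Cr.simps)
    have P: "partial i (\<lambda>x. conv h (bumpe t) x - h x) = (\<lambda>x. conv (partial i h) (bumpe t) x - partial i h x)" for i
    proof
      fix x
      have "partial i (\<lambda>x. conv h (bumpe t) x + (-1) * h x) x = partial i (conv h (bumpe t)) x + (-1) * partial i h x"
        using D by (subst partial_add) (auto simp only: partial_cmult intro!: differentiable_mult differentiable_const)
      then show "partial i (\<lambda>x. conv h (bumpe t) x - h x) x = conv (partial i h) (bumpe t) x - partial i h x"
        by (simp add: partial_conv_left[OF Suc.prems(1) bumpe(1)[OF t(1)]])
    qed
    have "t < d i" for i using t(2) Min_le[of "range d" "d i"] by auto
    then show ?thesis unfolding Cbd.simps P using d(2) d'(2) D t by (auto intro: differentiable_diff)
  qed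
  moreover have "?d > 0" using d(1) d'(1) by auto
  ultimately show ?case by blast
qed

lemma mollify:
  fixes h :: "real ^ 'n \<Rightarrow> real"
  assumes "h \<in> Cr_c r" "e > 0"
  shows "\<exists>g\<in>Cinf_c. Cbd r e (\<lambda>x. g x - h x)"
proof -
  obtain d where d: "d > 0" "\<And>t. 0 < t \<Longrightarrow> t < d \<Longrightarrow> Cbd r e (\<lambda>x. conv h (bumpe t) x - h x)"
    using mollify_eventually[OF assms] by auto
  show ?thesis using d(1) d(2)[of "d / 2"] conv_Cinf_c[OF assms(1) bumpe(1)[of "d / 2"]] by auto
qed

text \<open>Mollifying reduces the symmetry of second derivatives to the commutation of convolution with
  differentiation in either argument.\<close>

lemma partial_commute:
  fixes f :: "real ^ 'n \<Rightarrow> real"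
  assumes "f \<in> Cr_c (Suc (Suc r))"
  shows "partial i (partial j f) = partial j (partial i f)"
proof
  fix x
  have 1: "partial k f \<in> Cr_c (Suc r)" for k by (rule Cr_c_partial[OF assms])
  have 2: "partial i (partial j f) \<in> Cr_c r" "partial j (partial i f) \<in> Cr_c r"
    using Cr_c_partial[OF 1] by auto
  have eq: "conv (partial i (partial j f)) (bumpe t) = conv (partial j (partial i f)) (bumpe t)" if t: "t > 0" for t
  proof -
    note b = bumpe(1)[OF t, where 'n = 'n]
    have f: "continuous_on UNIV f" using Cr_c_continuous[OF assms] .
    have fi: "continuous_on UNIV (partial i f)" using Cr_c_continuous[OF 1] .
    have "conv (partial i (partial j f)) (bumpe t) = partial i (conv (partial j f) (bumpe t))"
      by (simp add: partial_conv_left[OF 1 b])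
    also have "\<dots> = partial i (conv f (partial j (bumpe t)))"
      by (simp add: partial_conv_left[OF assms b, symmetric] partial_conv[OF f Cinf_c_D[OF b]])
    also have "\<dots> = conv (partial i f) (partial j (bumpe t))"
    proof -
      have "partial j (bumpe t) \<in> (Cinf_c :: (real ^ 'n \<Rightarrow> real) set)"
        using Cr_c_partial[OF Cinf_c_D[OF b]] by (auto simp: Cinf_c_def)
      then show ?thesis by (rule partial_conv_left[OF assms])
    qed
    also have "\<dots> = partial j (conv (partial i f) (bumpe t))"
      by (simp add: partial_conv[OF fi Cinf_c_D[OF b]])
    also have "\<dots> = conv (partial j (partial i f)) (bumpe t)"
      by (simp add: partial_conv_left[OF 1 b])
    finally show ?thesis .
  qed
  have "\<bar>partial i (partial j f) x - partial j (partial i f) x\<bar> \<le> e" if e: "e > 0" for e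
  proof -
    obtain d1 where d1: "d1 > 0" "\<And>t x. 0 < t \<Longrightarrow> t < d1 \<Longrightarrow> \<bar>conv (partial i (partial j f)) (bumpe t) x - partial i (partial j f) x\<bar> \<le> e / 2"
      using conv_bumpe_tendsto[OF 2(1), of "e / 2"] e by auto
    obtain d2 where d2: "d2 > 0" "\<And>t x. 0 < t \<Longrightarrow> t < d2 \<Longrightarrow> \<bar>conv (partial j (partial i f)) (bumpe t) x - partial j (partial i f) x\<bar> \<le> e / 2"
      using conv_bumpe_tendsto[OF 2(2), of "e / 2"] e by auto
    define t where "t = min d1 d2 / 2"
    have "t > 0" "t < d1" "t < d2" using d1(1) d2(1) by (auto simp: t_def)
    then show ?thesis using d1(2)[of t x] d2(2)[of t x] unfolding eq[OF \<open>t > 0\<close>] by arith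
  qed
  then have "\<bar>partial i (partial j f) x - partial j (partial i f) x\<bar> \<le> 0"
    by (meson dense_ge not_less)
  then show "partial i (partial j f) x = partial j (partial i f) x" by simp
qed

lemma partial_pd_commute:
  "f \<in> Cr_c (Suc (length xs)) \<Longrightarrow> partial i (pd xs f) = pd xs (partial i f)"
proof (induction xs)
  case (Cons j xs)
  have "pd xs f \<in> Cr_c (Suc (Suc 0))" using Cr_c_pd[OF Cons.prems, of xs] by (simp add: eval_nat_numeral)
  then have "partial i (partial j (pd xs f)) = partial j (partial i (pd xs f))"
    by (rule partial_commute)
  also have "partial i (pd xs f) = pd xs (partial i f)"
    using Cons Cr_c_mono[of f "Suc (length (j # xs))" "Suc (length xs)"] by simp
  finally show ?case by simp
qed simp

text \<open>Makes the ordering picked by \<open>SOME\<close> in \<open>mpartial\<close> immaterial.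
  The head of \<open>xs\<close> is located in \<open>ys\<close> and commuted past the entries before
  it.\<close>

lemma pd_mset:
  "f \<in> Cr_c (length xs) \<Longrightarrow> mset xs = mset ys \<Longrightarrow> pd xs f = pd ys f"
proof (induction xs arbitrary: ys)
  case (Cons i xs)
  obtain ys1 ys2 where ys: "ys = ys1 @ i # ys2"
    using Cons.prems(2) by (metis list.set_intros(1) set_mset_mset split_list)
  have l: "length xs = length ys1 + length ys2" and m: "mset xs = mset (ys1 @ ys2)"
    using Cons.prems(2) mset_eq_length[OF Cons.prems(2)] by (auto simp: ys)
  have "pd (i # xs) f = partial i (pd xs f)" by simp
  also have "pd xs f = pd (ys1 @ ys2) f"
    using Cons.IH[OF _ m] Cr_c_mono[OF Cons.prems(1)] by simp
  also have "partial i (pd (ys1 @ ys2) f) = partial i (pd ys1 (pd ys2 f))" by simp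
  also have "\<dots> = pd ys1 (partial i (pd ys2 f))"
    by (rule partial_pd_commute) (use Cr_c_pd[OF Cons.prems(1), of ys2] l in \<open>simp add: Suc_diff_le\<close>)
  finally show ?case by (simp add: ys)
qed simp

section \<open>Comparison of \<open>Cr_norm\<close> with pointwise bounds\<close>

lemma Linf_norm_le: "f \<in> borel_measurable borel \<Longrightarrow> AE x in lborel. \<bar>f x\<bar> \<le> c \<Longrightarrow> Linf_norm f \<le> ennreal c"
  unfolding Linf_norm_def by (intro esssup_I) (auto intro: ennreal_leI)

lemma Linf_norm_leD:
  assumes "continuous_on UNIV f" "Linf_norm f \<le> ennreal c" "0 \<le> c"
  shows "\<bar>f x\<bar> \<le> c"
proof (rule AE_lborel_open[where P = "\<lambda>x. \<bar>f x\<bar> \<le> c"])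
  have "AE x in lborel. ennreal \<bar>f x\<bar> \<le> Linf_norm f"
    unfolding Linf_norm_def by (rule esssup_AE)
  then show "AE x in lborel. \<bar>f x\<bar> \<le> c"
    by (rule AE_mp) (use assms in \<open>auto intro!: AE_I2 dest: order_trans simp flip: ennreal_le_iff\<close>)
  show "open {x. \<not> \<bar>f x\<bar> \<le> c}"
    unfolding not_le by (intro open_Collect_less continuous_intros assms(1))
qed

lemma Cr_norm_Cbd:
  fixes f :: "real ^ 'n \<Rightarrow> real"
  assumes "f \<in> Cr_c r" "Cr_norm r f \<le> ennreal c" "0 \<le> c"
  shows "Cbd r c f"
proof (rule CbdI)
  show "Cr r f" using assms by (simp add: Cr_c_def)
  fix xs :: "'n list" and x assume l: "length xs \<le> r"
  define ys where "ys = (SOME ys. mset ys = mset xs)"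
  have ys: "mset ys = mset xs" unfolding ys_def by (rule someI) simp
  have "Linf_norm (mpartial (mset xs) f) \<le> Cr_norm r f"
    unfolding Cr_norm_def by (rule member_le_sum) (use l finite_multi_indices in auto)
  also have "mpartial (mset xs) f = pd ys f" by (simp add: mpartial_def ys_def)
  also have "pd ys f = pd xs f"
    by (rule pd_mset[symmetric]) (use Cr_c_mono[OF assms(1) l] ys in auto)
  finally have "Linf_norm (pd xs f) \<le> ennreal c" using assms(2) by (rule order_trans)
  then show "\<bar>pd xs f x\<bar> \<le> c"
    by (rule Linf_norm_leD[rotated]) (use Cr_c_continuous[OF Cr_c_pd[OF assms(1) l]] assms(3) in auto)
qed

lemma Cbd_Cr_norm:
  fixes f :: "real ^ 'n \<Rightarrow> real"
  assumes "Cbd r c f"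
  shows "Cr_norm r f \<le> ennreal (real (card {k :: 'n multiset. size k \<le> r}) * c)"
proof -
  have "Linf_norm (mpartial k f) \<le> ennreal c" if k: "size k \<le> r" for k :: "'n multiset"
  proof -
    define ys where "ys = (SOME ys. mset ys = k)"
    have "\<exists>ys. mset ys = k" by (rule ex_mset)
    then have ys: "mset ys = k" unfolding ys_def by (rule someI_ex)
    then have l: "length ys \<le> r" using k size_mset[of ys] by simp
    have "continuous_on UNIV (pd ys f)"
      using Cr_pd[of "r - length ys" ys f] Cbd_Cr[OF assms] l Cr_continuous by auto
    then have "pd ys f \<in> borel_measurable borel" by (rule borel_measurable_continuous_onI)
    moreover have "mpartial k f = pd ys f" by (simp add: mpartial_def ys_def)
    ultimately show ?thesis using Cbd_pd_bound[OF assms l] by (auto intro: Linf_norm_le)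
  qed
  then have "Cr_norm r f \<le> (\<Sum>k | size (k :: 'n multiset) \<le> r. ennreal c)"
    unfolding Cr_norm_def by (intro sum_mono) auto
  then show ?thesis using Cbd_nonneg[OF assms] by (simp add: ennreal_mult ennreal_of_nat_eq_real_of_nat)
qed

subsection \<open>Orthogonal projections onto spans of orthonormal families\<close>

lemma Cr_c_L2: "f \<in> Cr_c r \<Longrightarrow> f \<in> L2"
  using integrable_Cc_mult[of f r f] Cr_c_continuous[of f r UNIV] Cr_c_measurable[of f r]
  by (simp add: L2_def power2_eq_square)

lemma L2_mult_integrable:
  assumes "f \<in> L2" "g \<in> L2"
  shows "integrable lborel (\<lambda>x. f x * g x)"
proof -
  have [measurable]: "f \<in> borel_measurable lborel" "g \<in> borel_measurable lborel"
    using assms by (auto simp: L2_def)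
  have i: "integrable lborel (\<lambda>x. (f x)\<^sup>2 + (g x)\<^sup>2)" using assms by (auto simp: L2_def)
  have le: "\<bar>f x * g x\<bar> \<le> (f x)\<^sup>2 + (g x)\<^sup>2" for x
  proof -
    have "2 * \<bar>f x * g x\<bar> \<le> (f x)\<^sup>2 + (g x)\<^sup>2"
      using sum_squares_bound[of "\<bar>f x\<bar>" "\<bar>g x\<bar>"] by (simp add: abs_mult)
    then show ?thesis using abs_ge_zero[of "f x * g x"] by linarith
  qed
  show ?thesis
    by (rule Bochner_Integration.integrable_bound[OF i]) (use le order_trans[OF le abs_ge_self] in auto)
qed

lemma L2_add: "f \<in> L2 \<Longrightarrow> g \<in> L2 \<Longrightarrow> (\<lambda>x. f x + g x) \<in> L2"
  using L2_mult_integrable[of f g] by (auto simp: L2_def power2_sum mult.assoc)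

lemma L2_cmult: "f \<in> L2 \<Longrightarrow> (\<lambda>x. c * f x) \<in> L2"
  by (auto simp: L2_def power_mult_distrib)

lemma L2_diff: "f \<in> L2 \<Longrightarrow> g \<in> L2 \<Longrightarrow> (\<lambda>x. f x - g x) \<in> L2"
  using L2_add[of f "\<lambda>x. (-1) * g x"] L2_cmult[of g "-1"] by simp

lemma L2_zero: "(\<lambda>x. 0) \<in> L2"
  by (simp add: L2_def)

lemma L2_sum: "(\<And>k. k \<in> K \<Longrightarrow> f k \<in> L2) \<Longrightarrow> (\<lambda>x. \<Sum>k\<in>K. f k x) \<in> L2"
  by (induction K rule: infinite_finite_induct) (auto intro: L2_add L2_zero)

lemma L2_inner_commute: "L2_inner f g = L2_inner g f"
  by (simp add: L2_inner_def mult.commute)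

lemma L2_inner_cmult: "L2_inner (\<lambda>x. c * f x) g = c * L2_inner f g"
  by (simp add: L2_inner_def mult.assoc)

lemma L2_inner_diff: "f \<in> L2 \<Longrightarrow> g \<in> L2 \<Longrightarrow> h \<in> L2 \<Longrightarrow> L2_inner (\<lambda>x. f x - g x) h = L2_inner f h - L2_inner g h"
  using L2_mult_integrable[of f h] L2_mult_integrable[of g h] by (simp add: L2_inner_def left_diff_distrib)

lemma L2_inner_sum:
  assumes "\<And>k. k \<in> K \<Longrightarrow> f k \<in> L2" "h \<in> L2"
  shows "L2_inner (\<lambda>x. \<Sum>k\<in>K. c k * f k x) h = (\<Sum>k\<in>K. c k * L2_inner (f k) h)"
proof -
  have "L2_inner (\<lambda>x. \<Sum>k\<in>K. c k * f k x) h = (LINT x|lborel. (\<Sum>k\<in>K. c k * (f k x * h x)))"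
    by (simp add: L2_inner_def sum_distrib_right mult.assoc)
  also have "\<dots> = (\<Sum>k\<in>K. (LINT x|lborel. c k * (f k x * h x)))"
    by (intro Bochner_Integration.integral_sum integrable_mult_right L2_mult_integrable assms)
  finally show ?thesis by (simp add: L2_inner_def)
qed

lemma L2_inner_self_0:
  assumes "f \<in> L2" "L2_inner f f = 0"
  shows "AE x in lborel. f x = 0"
proof -
  have "AE x in lborel. (f x)\<^sup>2 = 0"
    using assms integral_nonneg_eq_0_iff_AE[of lborel "\<lambda>x. (f x)\<^sup>2"] by (simp add: L2_inner_def L2_def power2_eq_square)
  then show ?thesis by simp
qed

text \<open>The square of a difference is nonnegative. The free weight \<open>t\<close> plays the
  part of Cauchy-Schwarz when an inner product is to be shown arbitrarily small.\<close>

lemma L2_inner_AMGM: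
  assumes "f \<in> L2" "g \<in> L2" "t > 0"
  shows "\<bar>L2_inner f g\<bar> \<le> t * L2_inner f f + L2_inner g g / t"
proof -
  have "\<bar>f x * g x\<bar> \<le> t * (f x * f x) + g x * g x / t" for x
  proof -
    have "0 \<le> (sqrt t * \<bar>f x\<bar> - \<bar>g x\<bar> / sqrt t)\<^sup>2" by simp
    also have "\<dots> = t * (f x * f x) + g x * g x / t - 2 * \<bar>f x * g x\<bar>"
      using assms(3) by (simp add: power2_diff power_mult_distrib power_divide abs_mult)
        (simp add: power2_eq_square)
    finally show ?thesis using abs_ge_zero[of "f x * g x"] by linarith
  qed
  then have "(LINT x|lborel. \<bar>f x * g x\<bar>) \<le> (LINT x|lborel. t * (f x * f x) + g x * g x / t)"
    by (intro integral_mono integrable_abs Bochner_Integration.integrable_add integrable_mult_right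
        integrable_divide L2_mult_integrable assms(1,2)) auto
  also have "\<dots> = t * L2_inner f f + L2_inner g g / t"
    by (simp add: L2_inner_def L2_mult_integrable assms(1,2))
  finally show ?thesis unfolding L2_inner_def by (rule order_trans[OF integral_abs_bound])
qed

lemma L2_dist_eq: "L2_dist f g = sqrt (L2_inner (\<lambda>x. f x - g x) (\<lambda>x. f x - g x))"
  by (simp add: L2_dist_def L2_inner_def power2_eq_square)

text \<open>Records the linear structure shared by \<open>V n\<close> and the wavelet spaces. The
  expansions below are finite sums, because a compactly supported function meets finitely many
  wavelets of a level.\<close>

definition lin_L2 :: "(real ^ 'n \<Rightarrow> real) set \<Rightarrow> bool" where
  "lin_L2 S \<longleftrightarrow> S \<subseteq> L2 \<and> (\<lambda>x. 0) \<in> S \<and> (\<forall>f\<in>S. \<forall>g\<in>S. (\<lambda>x. f x + g x) \<in> S) \<and>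
     (\<forall>f\<in>S. \<forall>c. (\<lambda>x. c * f x) \<in> S)"

lemma lin_L2_add: "lin_L2 S \<Longrightarrow> f \<in> S \<Longrightarrow> g \<in> S \<Longrightarrow> (\<lambda>x. f x + g x) \<in> S"
  and lin_L2_cmult: "lin_L2 S \<Longrightarrow> f \<in> S \<Longrightarrow> (\<lambda>x. c * f x) \<in> S"
  and lin_L2_zero: "lin_L2 S \<Longrightarrow> (\<lambda>x. 0) \<in> S"
  and lin_L2_L2: "lin_L2 S \<Longrightarrow> f \<in> S \<Longrightarrow> f \<in> L2"
  unfolding lin_L2_def by (simp_all add: subset_iff)

lemma lin_L2_sum: "lin_L2 S \<Longrightarrow> (\<And>k. k \<in> K \<Longrightarrow> f k \<in> S) \<Longrightarrow> (\<lambda>x. \<Sum>k\<in>K. c k * f k x) \<in> S"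
  by (induction K rule: infinite_finite_induct) (simp_all add: lin_L2_add lin_L2_cmult lin_L2_zero)

lemma lin_L2_diff: "lin_L2 S \<Longrightarrow> f \<in> S \<Longrightarrow> g \<in> S \<Longrightarrow> (\<lambda>x. f x - g x) \<in> S"
  using lin_L2_add[OF _ _ lin_L2_cmult[of S g "-1"], of f] by simp

text \<open>A finite combination of the basis within \<epsilon> of \<open>g\<close> is orthogonal to
  \<open>h\<close>; \<open>L2_inner_AMGM\<close> with weight \<epsilon> bounds the inner product
  with the rest by \<epsilon> times a constant that depends on \<open>h\<close> alone.\<close>

lemma orthogonal_to_basis:
  assumes S: "lin_L2 S" and onb: "orthonormal_basis_of S I e"
    and h: "h \<in> L2" and o: "\<And>i. i \<in> I \<Longrightarrow> L2_inner h (e i) = 0" and g: "g \<in> S"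
  shows "L2_inner h g = 0"
proof -
  have eL: "e i \<in> L2" if "i \<in> I" for i using that onb S by (auto simp: orthonormal_basis_of_def lin_L2_def)
  have gL: "g \<in> L2" using g S by (auto simp: lin_L2_def)
  have "\<bar>L2_inner h g\<bar> \<le> \<epsilon> * (L2_inner h h + 1)" if \<epsilon>: "\<epsilon> > 0" for \<epsilon>
  proof -
    from onb g \<epsilon> obtain J c where J: "finite J" "J \<subseteq> I" and d: "L2_dist g (\<lambda>x. \<Sum>j\<in>J. c j * e j x) < \<epsilon>"
      unfolding orthonormal_basis_of_def by meson
    define u where "u = (\<lambda>x. \<Sum>j\<in>J. c j * e j x)"
    have uL: "u \<in> L2" unfolding u_def using J eL by (intro L2_sum L2_cmult) auto
    have w: "(\<lambda>x. g x - u x) \<in> L2" by (intro L2_diff gL uL)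
    have "L2_inner u h = 0"
    proof -
      have "L2_inner u h = (\<Sum>j\<in>J. c j * L2_inner (e j) h)"
        unfolding u_def using J eL h by (intro L2_inner_sum) auto
      then show ?thesis using o J by (auto simp: L2_inner_commute[of _ h] intro!: sum.neutral)
    qed
    then have "L2_inner h g = L2_inner h (\<lambda>x. g x - u x)"
      using L2_inner_diff[OF gL uL h] by (simp add: L2_inner_commute[of h])
    moreover have "L2_inner (\<lambda>x. g x - u x) (\<lambda>x. g x - u x) \<le> \<epsilon>\<^sup>2"
    proof -
      have "sqrt (L2_inner (\<lambda>x. g x - u x) (\<lambda>x. g x - u x)) \<le> \<epsilon>" using d by (simp add: L2_dist_eq u_def)
      then show ?thesis by (rule sqrt_le_D)
    qed
    then have "L2_inner (\<lambda>x. g x - u x) (\<lambda>x. g x - u x) / \<epsilon> \<le> \<epsilon>"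
      using \<epsilon> by (simp add: divide_le_eq power2_eq_square)
    ultimately show ?thesis using L2_inner_AMGM[OF h w \<epsilon>] by (simp add: distrib_left)
  qed
  then have *: "\<bar>L2_inner h g\<bar> \<le> \<epsilon> * (L2_inner h h + 1)" if "\<epsilon> > 0" for \<epsilon> using that by blast
  have p: "L2_inner h h + 1 > 0"
    unfolding L2_inner_def by (intro add_nonneg_pos Bochner_Integration.integral_nonneg) auto
  have "\<bar>L2_inner h g\<bar> \<le> 0 + \<delta>" if "\<delta> > 0" for \<delta>
    using *[of "\<delta> / (L2_inner h h + 1)"] that p by simp
  then show ?thesis using field_le_epsilon[of "\<bar>L2_inner h g\<bar>" 0] by simp
qed

lemma projection_residual:
  assumes S: "lin_L2 S" and onb: "orthonormal_basis_of S I e" and f: "f \<in> L2"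
    and J: "finite J" "J \<subseteq> I" and z: "\<And>i. i \<in> I - J \<Longrightarrow> L2_inner f (e i) = 0"
  defines "g \<equiv> \<lambda>x. \<Sum>j\<in>J. L2_inner f (e j) * e j x"
  shows "g \<in> S" and "h \<in> S \<Longrightarrow> L2_inner (\<lambda>x. f x - g x) h = 0"
proof -
  have eS: "e i \<in> S" if "i \<in> I" for i using that onb by (auto simp: orthonormal_basis_of_def)
  then have eL: "e i \<in> L2" if "i \<in> I" for i using that S by (auto simp: lin_L2_def)
  show gS: "g \<in> S" unfolding g_def using J eS by (intro lin_L2_sum[OF S]) auto
  then have gL: "g \<in> L2" using S by (auto simp: lin_L2_def)
  have "L2_inner (\<lambda>x. f x - g x) (e i) = 0" if i: "i \<in> I" for i
  proof -
    have "L2_inner g (e i) = (\<Sum>j\<in>J. L2_inner f (e j) * L2_inner (e j) (e i))"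
      unfolding g_def using J eL i by (intro L2_inner_sum) auto
    also have "\<dots> = (\<Sum>j\<in>J. if j = i then L2_inner f (e i) else 0)"
      using onb J i by (intro sum.cong) (auto simp: orthonormal_basis_of_def subset_iff)
    also have "\<dots> = L2_inner f (e i)" using J z i by (auto simp: sum.delta)
    finally show ?thesis using L2_inner_diff[OF f gL eL[OF i]] by simp
  qed
  then show "L2_inner (\<lambda>x. f x - g x) h = 0" if "h \<in> S"
    using orthogonal_to_basis[OF S onb L2_diff[OF f gL] _ that] by blast
qed

text \<open>\<open>L2_proj\<close> is picked by \<open>SOME\<close> and only determined up to null
  sets. The difference of two admissible choices belongs to \<open>S\<close> and is orthogonal to
  \<open>S\<close>, hence to itself.\<close>

lemma L2_proj_eq:
  assumes S: "lin_L2 S" and onb: "orthonormal_basis_of S I e" and f: "f \<in> L2"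
    and J: "finite J" "J \<subseteq> I" and z: "\<And>i. i \<in> I - J \<Longrightarrow> L2_inner f (e i) = 0"
  shows "AE x in lborel. L2_proj S f x = (\<Sum>j\<in>J. L2_inner f (e j) * e j x)" and "L2_proj S f \<in> L2"
proof -
  define g where "g = (\<lambda>x. \<Sum>j\<in>J. L2_inner f (e j) * e j x)"
  have g: "g \<in> S" "\<And>h. h \<in> S \<Longrightarrow> L2_inner (\<lambda>x. f x - g x) h = 0"
    unfolding g_def using projection_residual[OF S onb f J z] by auto
  let ?p = "L2_proj S f"
  have p: "?p \<in> S" "\<And>h. h \<in> S \<Longrightarrow> L2_inner (\<lambda>x. f x - ?p x) h = 0"
  proof -
    have "g \<in> S \<and> (\<forall>h\<in>S. L2_inner (\<lambda>x. f x - g x) h = 0)" using g by simp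
    from someI[of "\<lambda>g. g \<in> S \<and> (\<forall>h\<in>S. L2_inner (\<lambda>x. f x - g x) h = 0)", OF this]
    have "?p \<in> S \<and> (\<forall>h\<in>S. L2_inner (\<lambda>x. f x - ?p x) h = 0)" unfolding L2_proj_def .
    then show "?p \<in> S" "\<And>h. h \<in> S \<Longrightarrow> L2_inner (\<lambda>x. f x - ?p x) h = 0" by simp_all
  qed
  have L: "g \<in> L2" "?p \<in> L2" using g(1) p(1) S by (auto simp: lin_L2_def)
  then show "L2_proj S f \<in> L2" by simp
  define d where "d = (\<lambda>x. ?p x - g x)"
  have dS: "d \<in> S" unfolding d_def by (rule lin_L2_diff[OF S p(1) g(1)])
  then have dL: "d \<in> L2" using S by (auto simp: lin_L2_def)
  have "L2_inner d d = L2_inner (\<lambda>x. (f x - g x) - (f x - ?p x)) d"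
    by (simp add: d_def)
  also have "\<dots> = 0" using L2_inner_diff[OF L2_diff[OF f L(1)] L2_diff[OF f L(2)] dL] g(2)[OF dS] p(2)[OF dS] by simp
  finally have "AE x in lborel. d x = 0" by (rule L2_inner_self_0[OF dL])
  then show "AE x in lborel. L2_proj S f x = (\<Sum>j\<in>J. L2_inner f (e j) * e j x)"
    by (auto simp: d_def g_def)
qed

lemma basis_expansion_AE:
  assumes S: "lin_L2 S" and onb: "orthonormal_basis_of S I e" and f: "f \<in> S"
    and J: "finite J" "J \<subseteq> I" and z: "\<And>i. i \<in> I - J \<Longrightarrow> L2_inner f (e i) = 0"
  shows "AE x in lborel. f x = (\<Sum>j\<in>J. L2_inner f (e j) * e j x)"
proof -
  define g where "g = (\<lambda>x. \<Sum>j\<in>J. L2_inner f (e j) * e j x)"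
  have fL: "f \<in> L2" using f S by (auto simp: lin_L2_def)
  have g: "g \<in> S" "\<And>h. h \<in> S \<Longrightarrow> L2_inner (\<lambda>x. f x - g x) h = 0"
    unfolding g_def using projection_residual[OF S onb fL J z] by auto
  have d: "(\<lambda>x. f x - g x) \<in> S" by (rule lin_L2_diff[OF S f g(1)])
  then have "AE x in lborel. f x - g x = 0" using S g(2)[OF d] by (intro L2_inner_self_0) (auto simp: lin_L2_def)
  then show ?thesis by (auto simp: g_def)
qed

subsection \<open>The integer lattice\<close>

definition near :: "real \<Rightarrow> real ^ 'n \<Rightarrow> (real ^ 'n) set" where
  "near t y = {k \<in> int_lattice. norm (k - y) \<le> t}"

abbreviation lat :: "real \<Rightarrow> (real ^ 'n) set" where "lat t \<equiv> near t 0"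

lemma card_int_interval: "a \<le> b \<Longrightarrow> real (card {\<lceil>a\<rceil>..\<lfloor>b\<rfloor>}) \<le> b - a + 1" for a b :: real
  by simp linarith

text \<open>Taking floors of the coordinates embeds the lattice points into a product of integer
  intervals of length \<open>2 * t\<close>.\<close>

lemma near_finite_card:
  fixes y :: "real ^ 'n"
  assumes "0 \<le> t"
  shows "finite (near t y)" and "real (card (near t y)) \<le> (2 * t + 1) ^ CARD('n)"
proof -
  let ?F = "\<lambda>k :: real ^ 'n. (\<lambda>i. \<lfloor>k $ i\<rfloor>)"
  let ?P = "PiE UNIV (\<lambda>i. {\<lceil>y $ i - t\<rceil>..\<lfloor>y $ i + t\<rfloor>})"
  have sub: "?F ` near t y \<subseteq> ?P"
  proof safe
    fix k i assume k: "k \<in> near t y"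
    have "\<bar>k $ i - y $ i\<bar> \<le> t"
      using component_le_norm_cart[of "k - y" i] k by (simp add: near_def)
    then have *: "y $ i - t \<le> k $ i" "k $ i \<le> y $ i + t" by auto
    have e: "of_int \<lfloor>k $ i\<rfloor> = k $ i" using k by (auto simp: near_def int_lattice_def elim!: Ints_cases)
    have "\<lceil>y $ i - t\<rceil> \<le> \<lfloor>k $ i\<rfloor>" unfolding ceiling_le_iff e by (rule *(1))
    then show "\<lfloor>k $ i\<rfloor> \<in> {\<lceil>y $ i - t\<rceil>..\<lfloor>y $ i + t\<rfloor>}" using *(2) by (auto intro: floor_mono)
  qed auto
  have inj: "inj_on ?F (near t y)"
  proof (rule inj_onI)
    fix k l assume kl: "k \<in> near t y" "l \<in> near t y" "?F k = ?F l"
    have "k $ i = l $ i" for i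
    proof -
      have "k $ i \<in> \<int>" "l $ i \<in> \<int>" using kl by (auto simp: near_def int_lattice_def)
      then have "k $ i = of_int \<lfloor>k $ i\<rfloor>" "l $ i = of_int \<lfloor>l $ i\<rfloor>" by (auto elim!: Ints_cases)
      then show ?thesis using fun_cong[OF kl(3), of i] by simp
    qed
    then show "k = l" by (simp add: vec_eq_iff)
  qed
  have fin: "finite ?P" by (intro finite_PiE) auto
  show "finite (near t y)" using finite_imageD[OF finite_subset[OF sub fin] inj] .
  have "card (near t y) = card (?F ` near t y)" using card_image[OF inj] by simp
  also have "\<dots> \<le> card ?P" by (rule card_mono[OF fin sub])
  also have "card ?P = (\<Prod>i\<in>(UNIV :: 'n set). card {\<lceil>y $ i - t\<rceil>..\<lfloor>y $ i + t\<rfloor>})"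
    by (rule card_PiE) simp
  finally have "real (card (near t y)) \<le> real (\<Prod>i\<in>(UNIV :: 'n set). card {\<lceil>y $ i - t\<rceil>..\<lfloor>y $ i + t\<rfloor>})"
    by (simp only: of_nat_le_iff)
  also have "\<dots> \<le> (\<Prod>i\<in>(UNIV :: 'n set). 2 * t + 1)"
    unfolding of_nat_prod using card_int_interval[of "y $ i - t" "y $ i + t" for i] assms
    by (intro prod_mono) (auto simp del: card_atLeastAtMost_int)
  finally show "real (card (near t y)) \<le> (2 * t + 1) ^ CARD('n)" by simp
qed

lemma near_finite [simp]: "finite (near t y)"
proof (cases "0 \<le> t")
  case False
  then have "near t y = {}" using order_trans[OF norm_ge_zero] by (fastforce simp: near_def)
  then show ?thesis by simp
qed (rule near_finite_card)

lemma near_int_lattice: "near t y \<subseteq> int_lattice"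
  by (auto simp: near_def)

lemma near_mono: "s \<le> t \<Longrightarrow> near s y \<subseteq> near t y"
  by (auto simp: near_def)

subsection \<open>Dilated and translated functions\<close>

lemma scaled_alt: "scaled \<theta> n k x = 2 powr (real (CARD('n) * n) / 2) * \<theta> (2 ^ n *\<^sub>R x + - k)"
  for \<theta> :: "real ^ 'n \<Rightarrow> real"
  by (simp add: scaled_def)

lemma scaled_Cr_c: "\<theta> \<in> Cr_c r \<Longrightarrow> scaled \<theta> n k \<in> Cr_c r"
  unfolding scaled_alt[abs_def] by (intro Cr_c_cmult Cr_c_affine) auto

lemma powr_half_sq: "2 powr (real m / 2) * 2 powr (real m / 2) = 2 ^ m"
  by (simp add: powr_add[symmetric] powr_realpow)

lemma integral_dilate:
  fixes F :: "real ^ 'n \<Rightarrow> real"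
  assumes "F \<in> borel_measurable borel"
  shows "(LINT x|lborel. F (2 ^ n *\<^sub>R x)) = (LINT x|lborel. F x) / 2 ^ (CARD('n) * n)"
  using integral_affine[OF assms, of "2 ^ n" 0] by (simp add: power_mult[symmetric] mult.commute)

definition dil :: "nat \<Rightarrow> (real ^ 'n \<Rightarrow> real) \<Rightarrow> real ^ 'n \<Rightarrow> real" where
  "dil n g x = 2 powr (real (CARD('n) * n) / 2) * g (2 ^ n *\<^sub>R x)"

lemma scaled_dil: "scaled \<theta> n k = dil n (\<lambda>x. \<theta> (x - k))"
  by (simp add: scaled_def dil_def fun_eq_iff)

lemma L2_inner_dil:
  fixes f g :: "real ^ 'n \<Rightarrow> real"
  assumes "f \<in> borel_measurable borel" "g \<in> borel_measurable borel"
  shows "L2_inner (dil n f) (dil n g) = L2_inner f g"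
proof -
  let ?c = "2 powr (real (CARD('n) * n) / 2)"
  have "L2_inner (dil n f) (dil n g) = (LINT x|lborel. (?c * ?c) * (f (2 ^ n *\<^sub>R x) * g (2 ^ n *\<^sub>R x)))"
    by (simp add: L2_inner_def dil_def mult_ac)
  also have "\<dots> = ?c * ?c * (LINT x|lborel. f (2 ^ n *\<^sub>R x) * g (2 ^ n *\<^sub>R x))" by simp
  also have "\<dots> = L2_inner f g"
    using assms integral_dilate[of "\<lambda>x. f x * g x" n] unfolding powr_half_sq by (simp add: L2_inner_def)
  finally show ?thesis .
qed

text \<open>\<open>dil n\<close> is an isometry of \<open>L\<^sup>2\<close> that maps
  \<open>S0\<close> onto \<open>S\<close>, so it carries the bases given at level 0 to level
  n.\<close>

lemma dil_orthonormal_basis: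
  fixes S S0 :: "(real ^ 'n \<Rightarrow> real) set"
  assumes S0: "lin_L2 S0" and onb: "orthonormal_basis_of S0 I e"
    and S: "\<And>f. f \<in> S \<longleftrightarrow> (\<lambda>x. f ((1 / 2 ^ n) *\<^sub>R x)) \<in> S0"
  shows "orthonormal_basis_of S I (\<lambda>i. dil n (e i))"
proof -
  let ?c = "2 powr (real (CARD('n) * n) / 2)"
  have meas: "g \<in> borel_measurable borel" if "g \<in> S0" for g using that S0 by (auto simp: lin_L2_def L2_def)
  have eS: "e i \<in> S0" if "i \<in> I" for i using that onb by (auto simp: orthonormal_basis_of_def)
  show ?thesis unfolding orthonormal_basis_of_def
  proof (intro conjI ballI allI impI)
    fix i assume i: "i \<in> I"
    have "(\<lambda>x. ?c * e i x) \<in> S0" using eS[OF i] S0 by (auto simp: lin_L2_def)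
    then show "dil n (e i) \<in> S" by (subst S) (simp add: dil_def)
    fix j assume j: "j \<in> I"
    show "L2_inner (dil n (e i)) (dil n (e j)) = (if i = j then 1 else 0)"
      using L2_inner_dil[OF meas[OF eS[OF i]] meas[OF eS[OF j]]] onb i j by (auto simp: orthonormal_basis_of_def)
  next
    fix f and \<epsilon> :: real assume f: "f \<in> S" and \<epsilon>: "\<epsilon> > 0"
    define g where "g = (\<lambda>x. (1 / ?c) * f ((1 / 2 ^ n) *\<^sub>R x))"
    have g: "g \<in> S0" using f S S0 by (auto simp only: g_def lin_L2_def)
    have fg: "f = dil n g" by (simp add: dil_def g_def fun_eq_iff)
    from onb g \<epsilon> obtain J c where J: "finite J" "J \<subseteq> I" and d: "L2_dist g (\<lambda>x. \<Sum>j\<in>J. c j * e j x) < \<epsilon>"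
      unfolding orthonormal_basis_of_def by meson
    have u: "(\<lambda>x. \<Sum>j\<in>J. c j * e j x) \<in> S0" using J eS by (intro lin_L2_sum[OF S0]) auto
    have "(\<lambda>x. f x - (\<Sum>j\<in>J. c j * dil n (e j) x)) = dil n (\<lambda>x. g x - (\<Sum>j\<in>J. c j * e j x))"
      by (simp add: fg dil_def fun_eq_iff right_diff_distrib sum_distrib_left mult_ac)
    then have "L2_dist f (\<lambda>x. \<Sum>j\<in>J. c j * dil n (e j) x) = L2_dist g (\<lambda>x. \<Sum>j\<in>J. c j * e j x)"
      unfolding L2_dist_eq using L2_inner_dil[OF meas[OF lin_L2_diff[OF S0 g u]] meas[OF lin_L2_diff[OF S0 g u]]] by simp
    then show "\<exists>J c. finite J \<and> J \<subseteq> I \<and> L2_dist f (\<lambda>x. \<Sum>j\<in>J. c j * dil n (e j) x) < \<epsilon>"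
      using J d by (intro exI[of _ J] exI[of _ c] conjI) simp_all
  qed
qed

text \<open>Expansion coefficients are arbitrary here; with \<open>c k = f (scaled \<theta> n k)\<close> this is
  \<open>form_proj\<close>.\<close>

definition wsum :: "(real ^ 'n \<Rightarrow> real) \<Rightarrow> nat \<Rightarrow> (real ^ 'n \<Rightarrow> real) \<Rightarrow> real ^ 'n \<Rightarrow> real" where
  "wsum \<theta> n c x = (\<Sum>k | k \<in> int_lattice \<and> scaled \<theta> n k x \<noteq> 0. c k * scaled \<theta> n k x)"

lemma form_proj_wsum: "form_proj \<theta> n f = wsum \<theta> n (\<lambda>k. f (scaled \<theta> n k))"
  by (simp add: form_proj_def wsum_def fun_eq_iff)

lemma scaled_nonzero:
  assumes "supp \<theta> \<subseteq> cball 0 \<rho>" "scaled \<theta> n k x \<noteq> 0"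
  shows "norm (2 ^ n *\<^sub>R x - k) \<le> \<rho>"
proof -
  have "\<theta> (2 ^ n *\<^sub>R x - k) \<noteq> 0" using assms(2) by (simp add: scaled_def)
  then have "2 ^ n *\<^sub>R x - k \<in> supp \<theta>" using not_in_supp by blast
  then show ?thesis using assms(1) by auto
qed

lemma scaled_nonzero_norm:
  assumes "supp \<theta> \<subseteq> cball 0 \<rho>" "scaled \<theta> n k x \<noteq> 0" "norm x \<le> R"
  shows "norm k \<le> 2 ^ n * R + \<rho>"
proof -
  have "norm k \<le> norm (2 ^ n *\<^sub>R x) + norm (2 ^ n *\<^sub>R x - k)"
    by (metis norm_minus_commute norm_triangle_sub)
  also have "norm (2 ^ n *\<^sub>R x) \<le> 2 ^ n * R" using assms(3) by simp
  finally show ?thesis using scaled_nonzero[OF assms(1,2)] by simp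
qed

lemma wsum_eq:
  assumes "finite K" "K \<subseteq> int_lattice" "\<And>k. k \<in> int_lattice \<Longrightarrow> scaled \<theta> n k x \<noteq> 0 \<Longrightarrow> k \<in> K"
  shows "wsum \<theta> n c x = (\<Sum>k\<in>K. c k * scaled \<theta> n k x)"
  unfolding wsum_def by (rule sum.mono_neutral_left) (use assms in auto)

text \<open>The index set in \<open>wsum\<close> varies with the point; on a ball it can be replaced
  by one fixed finite set, and then the sum commutes with integrals and linear forms.\<close>

lemma wsum_lat:
  assumes "supp \<theta> \<subseteq> cball 0 \<rho>" "norm x \<le> R" "2 ^ n * R + \<rho> \<le> t"
  shows "wsum \<theta> n c x = (\<Sum>k\<in>lat t. c k * scaled \<theta> n k x)"
proof (rule wsum_eq)
  fix k assume "k \<in> int_lattice" "scaled \<theta> n k x \<noteq> 0"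
  then show "k \<in> lat t" using scaled_nonzero_norm[OF assms(1) _ assms(2), of n k] assms(3) by (auto simp: near_def)
qed (auto simp: near_int_lattice)

lemma L2_inner_scaled_zero:
  assumes "supp \<theta> \<subseteq> cball 0 \<rho>" "supp f \<subseteq> cball 0 R" "k \<in> int_lattice" "k \<notin> lat t" "2 ^ n * R + \<rho> \<le> t"
  shows "L2_inner f (scaled \<theta> n k) = 0"
proof -
  have "f x * scaled \<theta> n k x = 0" for x
  proof (rule ccontr)
    assume *: "f x * scaled \<theta> n k x \<noteq> 0"
    then have "x \<in> supp f" using not_in_supp by fastforce
    then have "norm x \<le> R" using assms(2) by auto
    then have "k \<in> lat t" using scaled_nonzero_norm[OF assms(1), of n k x R] * assms(3,5) by (auto simp: near_def)
    then show False using assms(4) by simp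
  qed
  then show ?thesis unfolding L2_inner_def by (simp only: integral_zero)
qed

lemma linear_form_add: "linear_form r f \<Longrightarrow> \<eta> \<in> Cr_c r \<Longrightarrow> \<theta> \<in> Cr_c r \<Longrightarrow> f (\<lambda>x. \<eta> x + \<theta> x) = f \<eta> + f \<theta>"
  by (simp add: linear_form_def)

lemma linear_form_cmult: "linear_form r f \<Longrightarrow> \<eta> \<in> Cr_c r \<Longrightarrow> f (\<lambda>x. c * \<eta> x) = c * f \<eta>"
  by (simp add: linear_form_def)

lemma linear_form_sum:
  assumes "linear_form r f" "finite K" "\<And>k. k \<in> K \<Longrightarrow> g k \<in> Cr_c r"
  shows "f (\<lambda>x. \<Sum>k\<in>K. c k * g k x) = (\<Sum>k\<in>K. c k * f (g k))"
  using assms(2,3)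
proof (induction K rule: finite_induct)
  case empty
  show ?case using linear_form_cmult[OF assms(1) Cr_c_zero, of 0] by simp
next
  case (insert k K)
  have 1: "(\<lambda>x. c k * g k x) \<in> Cr_c r" using insert.prems by (intro Cr_c_cmult) simp
  have 2: "(\<lambda>x. \<Sum>k\<in>K. c k * g k x) \<in> Cr_c r"
    using insert.prems insert.hyps(1) by (intro Cr_c_sum Cr_c_cmult) auto
  have "f (\<lambda>x. c k * g k x + (\<Sum>k\<in>K. c k * g k x)) = f (\<lambda>x. c k * g k x) + f (\<lambda>x. \<Sum>k\<in>K. c k * g k x)"
    by (rule linear_form_add[OF assms(1) 1 2])
  also have "f (\<lambda>x. c k * g k x) = c k * f (g k)"
    using insert.prems by (intro linear_form_cmult[OF assms(1)]) simp
  finally show ?case using insert by simp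
qed

lemma supp_scaled:
  fixes \<theta> :: "real ^ 'n \<Rightarrow> real"
  assumes "supp \<theta> \<subseteq> cball 0 \<rho>'" "norm k \<le> m"
  shows "supp (scaled \<theta> n k) \<subseteq> cball 0 ((m + \<rho>') / 2 ^ n)"
proof (rule supp_subset_closed)
  fix x :: "real ^ 'n" assume x: "x \<notin> cball 0 ((m + \<rho>') / 2 ^ n)"
  show "scaled \<theta> n k x = 0"
  proof (rule ccontr)
    assume "scaled \<theta> n k x \<noteq> 0"
    then have "norm (2 ^ n *\<^sub>R x - k) \<le> \<rho>'" by (rule scaled_nonzero[OF assms(1)])
    then have "norm (2 ^ n *\<^sub>R x) \<le> m + \<rho>'"
      using norm_triangle_sub[of "2 ^ n *\<^sub>R x" k] assms(2) by linarith
    then show False using x by (simp add: field_simps)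
  qed
qed simp

subsection \<open>The spaces of a wavelet family\<close>

locale wavelets =
  fixes r :: nat and V :: "int \<Rightarrow> (real ^ 'n \<Rightarrow> real) set"
    and \<phi> :: "real ^ 'n \<Rightarrow> real" and \<psi> :: "nat \<Rightarrow> real ^ 'n \<Rightarrow> real"
    and II :: "nat set"
  defines "II \<equiv> {1..<2 ^ CARD('n)}"
  assumes r: "r \<ge> 1" and family: "wavelet_family r V \<phi> \<psi>"
begin

lemma finite_II [simp]: "finite II"
  by (simp add: II_def)

lemma mra: "multiresolution_analysis V \<phi>"
  using family by (simp add: wavelet_family_def)

lemmas mra' = mra[unfolded multiresolution_analysis_def]

lemma V_closed: "closed_subspace_L2 (V n)"
  by (rule mra'[THEN conjunct1, THEN spec])

lemma V_step: "V n \<subseteq> V (n + 1)"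
  by (rule mra'[THEN conjunct2, THEN conjunct1, THEN spec])

lemma V_dense: "f \<in> L2 \<Longrightarrow> \<epsilon> > 0 \<Longrightarrow> \<exists>n. \<exists>g\<in>V n. L2_dist f g < \<epsilon>"
  by (rule mra'[THEN conjunct2, THEN conjunct2, THEN conjunct1, rule_format])

lemma V_scale: "f \<in> V n \<longleftrightarrow> (\<lambda>x. f (2 powi (- n) *\<^sub>R x)) \<in> V 0"
  by (rule mra'[THEN conjunct2, THEN conjunct2, THEN conjunct2, THEN conjunct2, THEN conjunct1, rule_format])

lemma onb_V0: "orthonormal_basis_of (V 0) int_lattice (\<lambda>k x. \<phi> (x - k))"
  by (rule mra'[THEN conjunct2, THEN conjunct2, THEN conjunct2, THEN conjunct2, THEN conjunct2])

lemma \<phi>: "\<phi> \<in> Cr_c r" and \<psi>: "i \<in> II \<Longrightarrow> \<psi> i \<in> Cr_c r"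
  using family unfolding wavelet_family_def II_def by blast+

lemma lin_V: "lin_L2 (V n)"
proof -
  show ?thesis using V_closed[of n] unfolding closed_subspace_L2_def lin_L2_def by (elim conjE) (intro conjI)
qed

lemma V_mono: "m \<le> n \<Longrightarrow> V m \<subseteq> V n"
proof (induction n rule: int_ge_induct)
  case (step n) show ?case by (rule order_trans[OF step.IH V_step])
qed simp

lemma lin_W: "lin_L2 (wavelet_space V n)"
  unfolding lin_L2_def
proof (intro conjI ballI allI)
  note L = lin_V[of "n + 1", unfolded lin_L2_def] lin_V[of n, unfolded lin_L2_def]
  show "wavelet_space V n \<subseteq> L2" using L by (auto simp: wavelet_space_def)
  show "(\<lambda>x. 0) \<in> wavelet_space V n" using L by (auto simp: wavelet_space_def L2_inner_def)
  fix f assume f: "f \<in> wavelet_space V n"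
  show "(\<lambda>x. c * f x) \<in> wavelet_space V n" for c
    using f L by (auto simp: wavelet_space_def L2_inner_cmult)
  fix g assume g: "g \<in> wavelet_space V n"
  have fg: "f \<in> L2" "(\<lambda>x. (-1) * g x) \<in> L2" "g \<in> L2"
    using f g L L2_cmult[of g "-1"] by (auto simp: wavelet_space_def)
  have "L2_inner (\<lambda>x. f x + g x) h = 0" if "h \<in> V n" for h
    using L2_inner_diff[OF fg(1) fg(2), of h] L2_inner_cmult[of "-1" g h] f g L that
    by (auto simp: wavelet_space_def)
  then show "(\<lambda>x. f x + g x) \<in> wavelet_space V n" using f g L by (auto simp: wavelet_space_def)
qed

lemma V_scale_nat: "f \<in> V (int n) \<longleftrightarrow> (\<lambda>x. f ((1 / 2 ^ n) *\<^sub>R x)) \<in> V 0"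
  by (subst V_scale) (simp add: power_int_minus inverse_eq_divide)

lemma V_scale_succ: "f \<in> V (int n + 1) \<longleftrightarrow> (\<lambda>x. f ((1 / 2 ^ n) *\<^sub>R x)) \<in> V 1"
proof -
  have "f \<in> V (int n + 1) \<longleftrightarrow> (\<lambda>x. f ((1 / 2 ^ Suc n) *\<^sub>R x)) \<in> V 0"
    using V_scale_nat[of f "Suc n"] by (simp add: add.commute)
  also have "\<dots> \<longleftrightarrow> (\<lambda>x. f ((1 / 2 ^ n) *\<^sub>R x)) \<in> V 1"
    using V_scale_nat[of "\<lambda>x. f ((1 / 2 ^ n) *\<^sub>R x)" 1] by (simp add: mult.commute)
  finally show ?thesis .
qed

text \<open>The definition of a multiresolution analysis only scales the spaces \<open>V n\<close>.
  Their complements follow because dilation multiplies all inner products by the same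
  constant.\<close>

lemma W_scale: "f \<in> wavelet_space V (int n) \<longleftrightarrow> (\<lambda>x. f ((1 / 2 ^ n) *\<^sub>R x)) \<in> wavelet_space V 0"
proof -
  let ?D = "\<lambda>g x. g ((1 / 2 ^ n) *\<^sub>R x) :: real" and ?E = "\<lambda>g x. g (2 ^ n *\<^sub>R (x :: real ^ 'n)) :: real"
  have DE: "?D (?E g) = g" for g by (simp add: fun_eq_iff)
  have m: "g \<in> borel_measurable borel" if "g \<in> V k" for g k using that lin_V[of k] by (auto simp: lin_L2_def L2_def)
  have inner: "L2_inner f g = L2_inner (?D f) (?D g) / 2 ^ (CARD('n) * n)"
    if "f \<in> borel_measurable borel" "g \<in> borel_measurable borel" for f g :: "real ^ 'n \<Rightarrow> real"
    using integral_dilate[of "\<lambda>x. ?D f x * ?D g x" n] that by (simp add: L2_inner_def)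
  have "(\<forall>g\<in>V (int n). L2_inner f g = 0) \<longleftrightarrow> (\<forall>g\<in>V 0. L2_inner (?D f) g = 0)" if f: "f \<in> V (int n + 1)"
  proof safe
    fix g assume a: "\<forall>g\<in>V (int n). L2_inner f g = 0" "g \<in> V 0"
    then have "?E g \<in> V (int n)" by (subst V_scale_nat) (simp add: DE)
    then show "L2_inner (?D f) g = 0" using a(1) inner[OF m[OF f] m] DE[of g] by fastforce
  next
    fix g assume a: "\<forall>g\<in>V 0. L2_inner (?D f) g = 0" "g \<in> V (int n)"
    then show "L2_inner f g = 0" using inner[OF m[OF f] m[OF a(2)]] V_scale_nat[of g n] by simp
  qed
  then show ?thesis using V_scale_succ[of f n] by (auto simp: wavelet_space_def)
qed

lemma onb_V: "orthonormal_basis_of (V (int n)) int_lattice (scaled \<phi> n)"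
  using dil_orthonormal_basis[OF lin_V onb_V0 V_scale_nat[of _ n]] by (simp add: scaled_dil[abs_def])

lemma onb_W: "orthonormal_basis_of (wavelet_space V (int n)) (II \<times> int_lattice) (\<lambda>(i, k). scaled (\<psi> i) n k)"
proof -
  have "orthonormal_basis_of (wavelet_space V 0) (II \<times> int_lattice) (\<lambda>(i, k) x. \<psi> i (x - k))"
    using family unfolding wavelet_family_def II_def by blast
  from dil_orthonormal_basis[OF lin_W this W_scale[of _ n]] show ?thesis by (simp add: scaled_dil case_prod_unfold)
qed

lemma support_radius: "\<exists>\<rho>>0. supp \<phi> \<subseteq> cball 0 \<rho> \<and> (\<forall>i\<in>II. supp (\<psi> i) \<subseteq> cball 0 \<rho>)"
proof -
  obtain \<rho>0 where 0: "\<rho>0 > 0" "supp \<phi> \<subseteq> cball 0 \<rho>0" using Cr_c_supp[OF \<phi>] by auto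
  have "\<forall>i\<in>II. \<exists>R>0. supp (\<psi> i) \<subseteq> cball 0 R" using Cr_c_supp[OF \<psi>] by blast
  then obtain R where R: "\<And>i. i \<in> II \<Longrightarrow> R i > 0 \<and> supp (\<psi> i) \<subseteq> cball 0 (R i)" by metis
  let ?\<rho> = "\<rho>0 + (\<Sum>i\<in>II. R i)"
  have "R i \<le> ?\<rho>" if "i \<in> II" for i
    using member_le_sum[of i II R] R that 0(1) by (force intro: less_imp_le)
  moreover have "\<rho>0 \<le> ?\<rho>" using R by (simp add: sum_nonneg less_imp_le)
  ultimately have "supp \<phi> \<subseteq> cball 0 ?\<rho>" "\<forall>i\<in>II. supp (\<psi> i) \<subseteq> cball 0 ?\<rho>"
    using 0(2) R by (meson order_trans subset_cball)+
  then show ?thesis using 0(1) \<open>\<rho>0 \<le> ?\<rho>\<close> by (intro exI[of _ ?\<rho>]) auto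
qed

definition \<rho> :: real where "\<rho> = (SOME \<rho>. \<rho> > 0 \<and> supp \<phi> \<subseteq> cball 0 \<rho> \<and> (\<forall>i\<in>II. supp (\<psi> i) \<subseteq> cball 0 \<rho>))"

lemma \<rho>: "\<rho> > 0" "supp \<phi> \<subseteq> cball 0 \<rho>" "i \<in> II \<Longrightarrow> supp (\<psi> i) \<subseteq> cball 0 \<rho>"
  using someI_ex[OF support_radius] unfolding \<rho>_def[symmetric] by auto

lemma proj_V:
  assumes "f \<in> Cr_c 0" "supp f \<subseteq> cball 0 R" "2 ^ n * R + \<rho> \<le> t"
  shows "AE x in lborel. L2_proj (V (int n)) f x = (\<Sum>k\<in>lat t. L2_inner f (scaled \<phi> n k) * scaled \<phi> n k x)"
    and "L2_proj (V (int n)) f \<in> L2"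
proof -
  have z: "L2_inner f (scaled \<phi> n k) = 0" if "k \<in> int_lattice - lat t" for k
    using L2_inner_scaled_zero[OF \<rho>(2) assms(2) _ _ assms(3)] that by auto
  show "AE x in lborel. L2_proj (V (int n)) f x = (\<Sum>k\<in>lat t. L2_inner f (scaled \<phi> n k) * scaled \<phi> n k x)"
    and "L2_proj (V (int n)) f \<in> L2"
    by (rule L2_proj_eq[OF lin_V onb_V Cr_c_L2[OF assms(1)] near_finite near_int_lattice z], assumption)+
qed

lemma sum_II_lat:
  "(\<Sum>p\<in>II \<times> lat t. F (case p of (i, k) \<Rightarrow> scaled (\<psi> i) n k) * (case p of (i, k) \<Rightarrow> scaled (\<psi> i) n k) x)
     = (\<Sum>i\<in>II. \<Sum>k\<in>lat t. F (scaled (\<psi> i) n k) * scaled (\<psi> i) n k x)"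
  by (simp add: sum.cartesian_product case_prod_unfold)

lemma W_coeff_zero:
  assumes "supp f \<subseteq> cball 0 R" "2 ^ n * R + \<rho> \<le> t" "p \<in> II \<times> int_lattice - II \<times> lat t"
  shows "L2_inner f (case p of (i, k) \<Rightarrow> scaled (\<psi> i) n k) = 0"
  using L2_inner_scaled_zero[OF \<rho>(3) assms(1) _ _ assms(2)] assms(3) by auto

lemma proj_W:
  assumes "f \<in> Cr_c 0" "supp f \<subseteq> cball 0 R" "2 ^ n * R + \<rho> \<le> t"
  shows "AE x in lborel. L2_proj (wavelet_space V (int n)) f x
      = (\<Sum>i\<in>II. \<Sum>k\<in>lat t. L2_inner f (scaled (\<psi> i) n k) * scaled (\<psi> i) n k x)"
    and "L2_proj (wavelet_space V (int n)) f \<in> L2"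
proof -
  have sub: "II \<times> lat t \<subseteq> II \<times> (int_lattice :: (real ^ 'n) set)" using near_int_lattice by blast
  have fin: "finite (II \<times> (lat t :: (real ^ 'n) set))" by simp
  note * = L2_proj_eq[OF lin_W onb_W Cr_c_L2[OF assms(1)] fin sub W_coeff_zero[OF assms(2,3)]]
  show "AE x in lborel. L2_proj (wavelet_space V (int n)) f x
      = (\<Sum>i\<in>II. \<Sum>k\<in>lat t. L2_inner f (scaled (\<psi> i) n k) * scaled (\<psi> i) n k x)"
    using *(1) unfolding sum_II_lat .
  show "L2_proj (wavelet_space V (int n)) f \<in> L2" using *(2) .
qed

lemma scaled_V: "k \<in> int_lattice \<Longrightarrow> scaled \<phi> n k \<in> V (int n)"
  using onb_V unfolding orthonormal_basis_of_def by blast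

lemma scaled_W: "i \<in> II \<Longrightarrow> k \<in> int_lattice \<Longrightarrow> scaled (\<psi> i) n k \<in> wavelet_space V (int n)"
  using onb_W[of n] unfolding orthonormal_basis_of_def by fastforce

lemma W_orthogonal_V: "f \<in> V (int n) \<Longrightarrow> i \<in> II \<Longrightarrow> k \<in> int_lattice \<Longrightarrow> L2_inner f (scaled (\<psi> i) n k) = 0"
  using scaled_W[of i k n] by (simp add: wavelet_space_def L2_inner_commute)

lemma V_expansion:
  assumes f: "f \<in> Cr_c 0" "f \<in> V (int n)" "supp f \<subseteq> cball 0 R" "2 ^ n * R + \<rho> \<le> t"
  shows "f x = (\<Sum>k\<in>lat t. L2_inner f (scaled \<phi> n k) * scaled \<phi> n k x)"
proof (rule AE_lborel_eq[where f = f])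
  have z: "L2_inner f (scaled \<phi> n k) = 0" if "k \<in> int_lattice - lat t" for k
    using L2_inner_scaled_zero[OF \<rho>(2) f(3) _ _ f(4)] that by auto
  show "AE x in lborel. f x = (\<Sum>k\<in>lat t. L2_inner f (scaled \<phi> n k) * scaled \<phi> n k x)"
    by (rule basis_expansion_AE[OF lin_V onb_V f(2) near_finite near_int_lattice z])
  show "continuous_on UNIV f" by (rule Cr_c_continuous[OF f(1)])
  show "continuous_on UNIV (\<lambda>x. \<Sum>k\<in>lat t. L2_inner f (scaled \<phi> n k) * scaled \<phi> n k x)"
    by (intro continuous_intros Cr_c_continuous[OF scaled_Cr_c[OF \<phi>]])
qed

text \<open>What is left of \<open>f\<close> after projection onto \<open>V n\<close> lies in the
  wavelet space, with the wavelet coefficients of \<open>f\<close>, since \<open>V n\<close> is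
  orthogonal to the wavelets. Both sides are continuous, so the identity holds at every
  point.\<close>

lemma two_scale_expansion:
  assumes f: "f \<in> Cr_c 0" "f \<in> V (int n + 1)" "supp f \<subseteq> cball 0 R" "2 ^ n * R + \<rho> \<le> t"
  shows "f x = (\<Sum>k\<in>lat t. L2_inner f (scaled \<phi> n k) * scaled \<phi> n k x)
     + (\<Sum>i\<in>II. \<Sum>k\<in>lat t. L2_inner f (scaled (\<psi> i) n k) * scaled (\<psi> i) n k x)"
proof (rule AE_lborel_eq[where f = f])
  define g where "g = (\<lambda>x. \<Sum>k\<in>lat t. L2_inner f (scaled \<phi> n k) * scaled \<phi> n k x)"
  have z: "L2_inner f (scaled \<phi> n k) = 0" if "k \<in> int_lattice - lat t" for k
    using L2_inner_scaled_zero[OF \<rho>(2) f(3) _ _ f(4)] that by auto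
  note fL = Cr_c_L2[OF f(1)]
  have g: "g \<in> V (int n)" "\<And>h. h \<in> V (int n) \<Longrightarrow> L2_inner (\<lambda>x. f x - g x) h = 0"
    unfolding g_def using projection_residual[OF lin_V onb_V fL near_finite near_int_lattice z] by auto
  have gV: "g \<in> V (int n + 1)" using g(1) V_mono[of "int n" "int n + 1"] by auto
  have w: "(\<lambda>x. f x - g x) \<in> wavelet_space V (int n)"
    using lin_L2_diff[OF lin_V f(2) gV] g(2) by (simp add: wavelet_space_def)
  have gL: "g \<in> L2" by (rule lin_L2_L2[OF lin_V g(1)])
  have c: "L2_inner (\<lambda>x. f x - g x) (scaled (\<psi> i) n k) = L2_inner f (scaled (\<psi> i) n k)"
    if "i \<in> II" "k \<in> int_lattice" for i k
    using L2_inner_diff[OF fL gL Cr_c_L2[OF scaled_Cr_c[OF \<psi>[OF that(1)]]], of n k] W_orthogonal_V[OF g(1) that] by simp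
  have sub: "II \<times> lat t \<subseteq> II \<times> (int_lattice :: (real ^ 'n) set)" using near_int_lattice by blast
  have fin: "finite (II \<times> (lat t :: (real ^ 'n) set))" by simp
  have zz: "L2_inner (\<lambda>x. f x - g x) (case p of (i, k) \<Rightarrow> scaled (\<psi> i) n k) = 0"
    if "p \<in> II \<times> int_lattice - II \<times> lat t" for p
    using W_coeff_zero[OF f(3,4) that] c that by (cases p) auto
  have "AE x in lborel. f x - g x = (\<Sum>i\<in>II. \<Sum>k\<in>lat t. L2_inner (\<lambda>x. f x - g x) (scaled (\<psi> i) n k) * scaled (\<psi> i) n k x)"
    using basis_expansion_AE[OF lin_W onb_W w fin sub zz] unfolding sum_II_lat .
  also have "(\<lambda>x. \<Sum>i\<in>II. \<Sum>k\<in>lat t. L2_inner (\<lambda>x. f x - g x) (scaled (\<psi> i) n k) * scaled (\<psi> i) n k x)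
     = (\<lambda>x. \<Sum>i\<in>II. \<Sum>k\<in>lat t. L2_inner f (scaled (\<psi> i) n k) * scaled (\<psi> i) n k x)"
    by (intro ext sum.cong refl arg_cong2[where f = times] c) (auto dest: subsetD[OF near_int_lattice])
  finally show "AE x in lborel. f x = (\<Sum>k\<in>lat t. L2_inner f (scaled \<phi> n k) * scaled \<phi> n k x)
     + (\<Sum>i\<in>II. \<Sum>k\<in>lat t. L2_inner f (scaled (\<psi> i) n k) * scaled (\<psi> i) n k x)"
    by (rule AE_mp) (auto intro!: AE_I2 simp: g_def)
  show "continuous_on UNIV f" by (rule Cr_c_continuous[OF f(1)])
  show "continuous_on UNIV (\<lambda>x. (\<Sum>k\<in>lat t. L2_inner f (scaled \<phi> n k) * scaled \<phi> n k x)
     + (\<Sum>i\<in>II. \<Sum>k\<in>lat t. L2_inner f (scaled (\<psi> i) n k) * scaled (\<psi> i) n k x))"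
    by (intro continuous_intros Cr_c_continuous[OF scaled_Cr_c[OF \<phi>]] Cr_c_continuous[OF scaled_Cr_c[OF \<psi>]])
qed

text \<open>Only linearity of \<open>f\<close> is available, so everything is reduced to finite
  sums: the functions of level n + 1 that are nonzero at x are expanded at level n, \<open>f\<close>
  is applied termwise, and after exchanging the sums the inner products recombine, because functions
  of level n belong to the space of level n + 1.\<close>

lemma form_proj_Suc:
  assumes f: "linear_form r f"
  shows "form_proj \<phi> (Suc n) f x = form_proj \<phi> n f x + (\<Sum>i\<in>II. form_proj (\<psi> i) n f x)"
proof -
  \<comment> \<open>A function of level n + 1 that is nonzero at x is supported within
    \<open>2 * \<rho>\<close> of x.\<close>
  define R where "R = norm x + 2 * \<rho>"
  define t where "t = 2 ^ n * R + \<rho>"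
  let ?K = "lat t :: (real ^ 'n) set"
  define \<Lambda> where "\<Lambda> = lat (2 ^ Suc n * norm x + \<rho>) \<inter> {l. scaled \<phi> (Suc n) l x \<noteq> 0}"
  have fin: "finite \<Lambda>" "\<Lambda> \<subseteq> int_lattice" unfolding \<Lambda>_def using near_int_lattice by auto
  note S\<phi> = scaled_Cr_c[OF \<phi>] and S\<psi> = scaled_Cr_c[OF \<psi>]
  have supp\<Lambda>: "supp (scaled \<phi> (Suc n) l) \<subseteq> cball 0 R" if "l \<in> \<Lambda>" for l
  proof (rule supp_subset_closed)
    fix y :: "real ^ 'n" assume y: "y \<notin> cball 0 R"
    show "scaled \<phi> (Suc n) l y = 0"
    proof (rule ccontr)
      assume "scaled \<phi> (Suc n) l y \<noteq> 0"
      then have 1: "norm (2 ^ Suc n *\<^sub>R y - l) \<le> \<rho>" by (rule scaled_nonzero[OF \<rho>(2)])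
      have 2: "norm (2 ^ Suc n *\<^sub>R x - l) \<le> \<rho>" using that by (intro scaled_nonzero[OF \<rho>(2)]) (auto simp: \<Lambda>_def)
      have "norm (2 ^ Suc n *\<^sub>R (y - x)) = norm ((2 ^ Suc n *\<^sub>R y - l) - (2 ^ Suc n *\<^sub>R x - l))"
        by (simp add: scaleR_diff_right)
      also have "\<dots> \<le> 2 * \<rho>" using norm_triangle_ineq4[of "2 ^ Suc n *\<^sub>R y - l" "2 ^ Suc n *\<^sub>R x - l"] 1 2 by linarith
      finally have "2 ^ Suc n * norm (y - x) \<le> 2 * \<rho>" by simp
      moreover have "1 * norm (y - x) \<le> 2 ^ Suc n * norm (y - x)"
        by (intro mult_right_mono) (auto intro: one_le_power[of "2::real" "Suc n", simplified])
      ultimately have "norm (y - x) \<le> 2 * \<rho>" by linarith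
      then show False using y norm_triangle_sub[of y x] by (simp add: R_def)
    qed
  qed simp
  have exp: "f (scaled \<phi> (Suc n) l) = (\<Sum>k\<in>?K. L2_inner (scaled \<phi> (Suc n) l) (scaled \<phi> n k) * f (scaled \<phi> n k))
     + (\<Sum>i\<in>II. \<Sum>k\<in>?K. L2_inner (scaled \<phi> (Suc n) l) (scaled (\<psi> i) n k) * f (scaled (\<psi> i) n k))" if l: "l \<in> \<Lambda>" for l
  proof -
    have "scaled \<phi> (Suc n) l \<in> V (int n + 1)" using scaled_V[of l "Suc n"] l fin(2) by (auto simp: add.commute)
    then have e: "scaled \<phi> (Suc n) l = (\<lambda>x. (\<Sum>k\<in>?K. L2_inner (scaled \<phi> (Suc n) l) (scaled \<phi> n k) * scaled \<phi> n k x)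
     + (\<Sum>i\<in>II. 1 * (\<Sum>k\<in>?K. L2_inner (scaled \<phi> (Suc n) l) (scaled (\<psi> i) n k) * scaled (\<psi> i) n k x)))" (is "_ = (\<lambda>x. ?A x + (\<Sum>i\<in>II. 1 * ?B i x))")
      using two_scale_expansion[OF Cr_c0[OF S\<phi>] _ supp\<Lambda>[OF l], of n t] by (auto simp: t_def)
    have B: "?B i \<in> Cr_c r" if "i \<in> II" for i using S\<psi>[OF that] by (intro Cr_c_sum Cr_c_cmult) auto
    have "f (\<lambda>x. ?A x + (\<Sum>i\<in>II. 1 * ?B i x)) = f ?A + f (\<lambda>x. \<Sum>i\<in>II. 1 * ?B i x)"
      by (intro linear_form_add[OF f] Cr_c_sum Cr_c_cmult S\<phi> S\<psi>) auto
    also have "f (\<lambda>x. \<Sum>i\<in>II. 1 * ?B i x) = (\<Sum>i\<in>II. 1 * f (?B i))"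
      by (rule linear_form_sum[OF f _ B]) auto
    also have "f ?A = (\<Sum>k\<in>?K. L2_inner (scaled \<phi> (Suc n) l) (scaled \<phi> n k) * f (scaled \<phi> n k))"
      by (rule linear_form_sum[OF f near_finite S\<phi>])
    also have "(\<Sum>i\<in>II. 1 * f (?B i)) = (\<Sum>i\<in>II. \<Sum>k\<in>?K. L2_inner (scaled \<phi> (Suc n) l) (scaled (\<psi> i) n k) * f (scaled (\<psi> i) n k))"
      using linear_form_sum[OF f near_finite S\<psi>] by (intro sum.cong) auto
    finally show ?thesis using e by metis
  qed
  \<comment> \<open>The expansion of \<open>u\<close> at level n + 1 only involves \<Lambda> when
    evaluated at x, since all its other terms vanish there.\<close>
  have recon: "(\<Sum>l\<in>\<Lambda>. L2_inner (scaled \<phi> (Suc n) l) u * scaled \<phi> (Suc n) l x) = u x"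
    if u: "u \<in> Cr_c 0" "u \<in> V (int (Suc n))" for u
  proof -
    obtain R' where R': "supp u \<subseteq> cball 0 R'" using Cr_c_supp[OF u(1)] by auto
    define t' where "t' = 2 ^ Suc n * max R' (norm x) + \<rho>"
    have "u x = (\<Sum>l\<in>lat t'. L2_inner u (scaled \<phi> (Suc n) l) * scaled \<phi> (Suc n) l x)"
      using V_expansion[OF u R', of t' x] by (simp add: t'_def)
    also have "\<dots> = (\<Sum>l\<in>\<Lambda>. L2_inner u (scaled \<phi> (Suc n) l) * scaled \<phi> (Suc n) l x)"
    proof (rule sum.mono_neutral_right)
      show "\<Lambda> \<subseteq> lat t'" using near_mono[of "2 ^ Suc n * norm x + \<rho>" t' 0] by (auto simp: \<Lambda>_def t'_def)
      show "\<forall>l\<in>lat t' - \<Lambda>. L2_inner u (scaled \<phi> (Suc n) l) * scaled \<phi> (Suc n) l x = 0"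
        using scaled_nonzero_norm[OF \<rho>(2), of "Suc n" _ x "norm x"] by (auto simp: \<Lambda>_def near_def)
    qed simp
    finally show ?thesis by (simp add: L2_inner_commute)
  qed
  have tx: "2 ^ n * norm x + \<rho> \<le> t" using \<rho>(1) by (simp add: t_def R_def)
  have "form_proj \<phi> (Suc n) f x = (\<Sum>l\<in>\<Lambda>. f (scaled \<phi> (Suc n) l) * scaled \<phi> (Suc n) l x)"
    unfolding form_proj_wsum
    by (rule wsum_eq[OF fin]) (use scaled_nonzero_norm[OF \<rho>(2), of "Suc n" _ x "norm x"] in \<open>auto simp: \<Lambda>_def near_def\<close>)
  also have "\<dots> = (\<Sum>l\<in>\<Lambda>. (\<Sum>k\<in>?K. f (scaled \<phi> n k) * (L2_inner (scaled \<phi> (Suc n) l) (scaled \<phi> n k) * scaled \<phi> (Suc n) l x))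
     + (\<Sum>i\<in>II. \<Sum>k\<in>?K. f (scaled (\<psi> i) n k) * (L2_inner (scaled \<phi> (Suc n) l) (scaled (\<psi> i) n k) * scaled \<phi> (Suc n) l x)))"
    by (intro sum.cong refl) (simp only: exp distrib_right sum_distrib_right, simp add: mult_ac)
  also have "\<dots> = (\<Sum>l\<in>\<Lambda>. \<Sum>k\<in>?K. f (scaled \<phi> n k) * (L2_inner (scaled \<phi> (Suc n) l) (scaled \<phi> n k) * scaled \<phi> (Suc n) l x))
     + (\<Sum>l\<in>\<Lambda>. \<Sum>i\<in>II. \<Sum>k\<in>?K. f (scaled (\<psi> i) n k) * (L2_inner (scaled \<phi> (Suc n) l) (scaled (\<psi> i) n k) * scaled \<phi> (Suc n) l x))"
    by (rule sum.distrib)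
  also have "(\<Sum>l\<in>\<Lambda>. \<Sum>k\<in>?K. f (scaled \<phi> n k) * (L2_inner (scaled \<phi> (Suc n) l) (scaled \<phi> n k) * scaled \<phi> (Suc n) l x))
     = (\<Sum>k\<in>?K. f (scaled \<phi> n k) * scaled \<phi> n k x)"
  proof (subst sum.swap, intro sum.cong refl)
    fix k assume "k \<in> ?K"
    then have "scaled \<phi> n k \<in> V (int (Suc n))" using scaled_V[of k n] V_mono[of "int n" "int (Suc n)"] near_int_lattice by auto
    then show "(\<Sum>l\<in>\<Lambda>. f (scaled \<phi> n k) * (L2_inner (scaled \<phi> (Suc n) l) (scaled \<phi> n k) * scaled \<phi> (Suc n) l x)) = f (scaled \<phi> n k) * scaled \<phi> n k x"
      using recon[OF Cr_c0[OF S\<phi>]] by (simp add: sum_distrib_left[symmetric])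
  qed
  also have "(\<Sum>k\<in>?K. f (scaled \<phi> n k) * scaled \<phi> n k x) = form_proj \<phi> n f x"
    unfolding form_proj_wsum using wsum_lat[OF \<rho>(2) _ tx] by simp
  also have "(\<Sum>l\<in>\<Lambda>. \<Sum>i\<in>II. \<Sum>k\<in>?K. f (scaled (\<psi> i) n k) * (L2_inner (scaled \<phi> (Suc n) l) (scaled (\<psi> i) n k) * scaled \<phi> (Suc n) l x))
     = (\<Sum>i\<in>II. form_proj (\<psi> i) n f x)"
  proof (subst sum.swap, intro sum.cong refl)
    fix i assume i: "i \<in> II"
    have "(\<Sum>l\<in>\<Lambda>. \<Sum>k\<in>?K. f (scaled (\<psi> i) n k) * (L2_inner (scaled \<phi> (Suc n) l) (scaled (\<psi> i) n k) * scaled \<phi> (Suc n) l x))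
      = (\<Sum>k\<in>?K. f (scaled (\<psi> i) n k) * scaled (\<psi> i) n k x)"
    proof (subst sum.swap, intro sum.cong refl)
      fix k assume "k \<in> ?K"
      then have "scaled (\<psi> i) n k \<in> V (int (Suc n))"
        using scaled_W[OF i, of k n] near_int_lattice by (auto simp: wavelet_space_def add.commute)
      then show "(\<Sum>l\<in>\<Lambda>. f (scaled (\<psi> i) n k) * (L2_inner (scaled \<phi> (Suc n) l) (scaled (\<psi> i) n k) * scaled \<phi> (Suc n) l x)) = f (scaled (\<psi> i) n k) * scaled (\<psi> i) n k x"
        using recon[OF Cr_c0[OF S\<psi>[OF i]]] by (simp add: sum_distrib_left[symmetric])
    qed
    also have "\<dots> = form_proj (\<psi> i) n f x"
      unfolding form_proj_wsum using wsum_lat[OF \<rho>(3)[OF i] _ tx] by simp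
    finally show "(\<Sum>l\<in>\<Lambda>. \<Sum>k\<in>?K. f (scaled (\<psi> i) n k) * (L2_inner (scaled \<phi> (Suc n) l) (scaled (\<psi> i) n k) * scaled \<phi> (Suc n) l x)) = form_proj (\<psi> i) n f x" .
  qed
  finally show ?thesis .
qed

end

subsection \<open>Vanishing moments and decay of wavelet coefficients\<close>

text \<open>These are the moments, of degree below \<open>s\<close>, that occur in a Taylor
  expansion with remainder of order \<open>s\<close>; for \<open>s = 0\<close> the condition is
  empty.\<close>

definition vanish :: "nat \<Rightarrow> (real ^ 'n \<Rightarrow> real) \<Rightarrow> bool" where
  "vanish s \<theta> \<longleftrightarrow> (\<forall>xs. length xs < s \<longrightarrow> (LINT y|lborel. monom_at xs y * \<theta> y) = 0)"

lemma vanish_0: "vanish 0 \<theta>"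
  by (simp add: vanish_def)

lemma continuous_monom_at: "continuous_on S (monom_at xs)"
  by (induction xs) (auto simp: monom_at_def intro!: continuous_intros)

lemma monom_at_scaleR: "monom_at xs (\<epsilon> *\<^sub>R y) = \<epsilon> ^ length xs * monom_at xs y"
  by (induction xs) (auto simp: mult_ac)

lemma dd_pow_scaleR: "Cr j h \<Longrightarrow> (dd (\<epsilon> *\<^sub>R y) ^^ j) h x = \<epsilon> ^ j * (dd y ^^ j) h x"
  by (auto simp: dd_pow monom_at_scaleR sum_distrib_left mult.assoc intro!: sum.cong)

lemma integral_dd_pow:
  assumes "\<theta> \<in> Cr_c 0" "Cr j h"
  shows "integrable lborel (\<lambda>y. (dd y ^^ j) h x * \<theta> y)"
    and "(LINT y|lborel. (dd y ^^ j) h x * \<theta> y)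
      = (\<Sum>xs | length xs = j. (LINT y|lborel. monom_at xs y * \<theta> y) * pd xs h x)"
proof -
  have e: "(\<lambda>y. (dd y ^^ j) h x * \<theta> y) = (\<lambda>y. \<Sum>xs | length xs = j. (monom_at xs y * \<theta> y) * pd xs h x)"
    by (simp add: fun_eq_iff dd_pow[OF assms(2)] sum_distrib_left mult_ac)
  have i: "integrable lborel (\<lambda>y. monom_at xs y * \<theta> y)" for xs
    by (rule integrable_Cc_mult'[OF assms(1) continuous_monom_at])
  show "integrable lborel (\<lambda>y. (dd y ^^ j) h x * \<theta> y)" unfolding e
    by (intro Bochner_Integration.integrable_sum integrable_mult_left i)
  show "(LINT y|lborel. (dd y ^^ j) h x * \<theta> y)
      = (\<Sum>xs | length xs = j. (LINT y|lborel. monom_at xs y * \<theta> y) * pd xs h x)"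
    unfolding e by (subst Bochner_Integration.integral_sum) (auto intro: integrable_mult_left i)
qed

lemma integral_taylor_polynomial:
  fixes x :: "real ^ 'n" and \<epsilon> :: real
  assumes "\<theta> \<in> Cr_c 0" "vanish s \<theta>" "Cr s h"
  defines "T \<equiv> \<lambda>y. \<Sum>j<s. (dd (\<epsilon> *\<^sub>R y) ^^ j) h x / fact j"
  shows "integrable lborel (\<lambda>y. T y * \<theta> y)" "(LINT y|lborel. T y * \<theta> y) = 0"
proof -
  have C: "Cr j h" if "j < s" for j using Cr_mono[OF assms(3)] that by simp
  have e: "(\<lambda>y. T y * \<theta> y) = (\<lambda>y. \<Sum>j<s. \<epsilon> ^ j / fact j * ((dd y ^^ j) h x * \<theta> y))"
    by (simp add: T_def fun_eq_iff dd_pow_scaleR[OF C] sum_distrib_right mult.assoc cong: sum.cong_simp)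
  have i: "integrable lborel (\<lambda>y. \<epsilon> ^ j / fact j * ((dd y ^^ j) h x * \<theta> y))" if "j < s" for j
    by (intro integrable_mult_right integral_dd_pow(1)[OF assms(1) C[OF that]])
  show "integrable lborel (\<lambda>y. T y * \<theta> y)" unfolding e
    by (intro Bochner_Integration.integrable_sum i) simp
  have z: "(LINT y|lborel. (dd y ^^ j) h x * \<theta> y) = 0" if "j < s" for j
    using assms(2) that by (simp add: integral_dd_pow(2)[OF assms(1) C[OF that]] vanish_def)
  have "(LINT y|lborel. T y * \<theta> y) = (\<Sum>j<s. (LINT y|lborel. \<epsilon> ^ j / fact j * ((dd y ^^ j) h x * \<theta> y)))"
    unfolding e by (rule Bochner_Integration.integral_sum) (rule i, simp)
  also have "\<dots> = (\<Sum>j<s. \<epsilon> ^ j / fact j * (LINT y|lborel. (dd y ^^ j) h x * \<theta> y))"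
    by simp
  also have "\<dots> = 0" by (rule sum.neutral) (simp add: z)
  finally show "(LINT y|lborel. T y * \<theta> y) = 0" .
qed

lemma L2_inner_scaled:
  fixes \<theta> h :: "real ^ 'n \<Rightarrow> real"
  assumes "\<theta> \<in> borel_measurable borel" "h \<in> borel_measurable borel"
  shows "L2_inner h (scaled \<theta> n k)
     = (LINT y|lborel. h ((1 / 2 ^ n) *\<^sub>R k + (1 / 2 ^ n) *\<^sub>R y) * \<theta> y) / 2 powr (real (CARD('n) * n) / 2)"
proof -
  note [measurable] = assms
  let ?c = "2 powr (real (CARD('n) * n) / 2)"
  let ?F = "\<lambda>y. h ((1 / 2 ^ n) *\<^sub>R k + (1 / 2 ^ n) *\<^sub>R y) * \<theta> y"
  have e: "?F (2 ^ n *\<^sub>R x + - k) = h x * \<theta> (2 ^ n *\<^sub>R x - k)" for x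
    by (simp add: scaleR_diff_right)
  have "L2_inner h (scaled \<theta> n k) = (LINT x|lborel. ?c * ?F (2 ^ n *\<^sub>R x + - k))"
    unfolding e L2_inner_def scaled_def by (simp add: mult_ac)
  also have "\<dots> = ?c * (LINT x|lborel. ?F (2 ^ n *\<^sub>R x + - k))" by simp
  also have "(LINT x|lborel. ?F (2 ^ n *\<^sub>R x + - k)) = (LINT y|lborel. ?F y) / \<bar>2 ^ n\<bar> ^ DIM(real ^ 'n)"
    by (rule integral_affine) measurable
  also have "\<bar>2 ^ n\<bar> ^ DIM(real ^ 'n) = ?c * ?c"
    unfolding powr_half_sq by (simp add: power_mult[symmetric] mult.commute)
  finally show ?thesis by simp
qed

text \<open>The Taylor polynomial of \<open>h\<close> at the centre of the dilated function
  integrates to zero against it, and the remainder of order \<open>s\<close> is taken on a support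
  of radius \<open>\<rho> / 2 ^ n\<close>. For \<open>s = 0\<close> this is the bound by the
  supremum of \<open>h\<close>.\<close>

lemma coefficient_decay:
  fixes \<theta> h :: "real ^ 'n \<Rightarrow> real"
  assumes \<theta>: "\<theta> \<in> Cr_c 0" "vanish s \<theta>" "supp \<theta> \<subseteq> cball 0 \<rho>" "\<rho> \<ge> 0" and h: "Cbd s B h"
  shows "\<bar>L2_inner h (scaled \<theta> n k)\<bar>
     \<le> (real CARD('n) * \<rho>) ^ s * (LINT y|lborel. \<bar>\<theta> y\<bar>) * B / (2 ^ n) ^ s / 2 powr (real (CARD('n) * n) / 2)"
proof -
  define \<epsilon> where "\<epsilon> = (1 :: real) / 2 ^ n"
  define x where "x = \<epsilon> *\<^sub>R k"
  define T where "T = (\<lambda>y. \<Sum>j<s. (dd (\<epsilon> *\<^sub>R y) ^^ j) h x / fact j)"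
  have \<epsilon>: "\<epsilon> > 0" by (simp add: \<epsilon>_def)
  have hC: "Cr s h" using Cbd_Cr[OF h] .
  have B: "0 \<le> B" using Cbd_nonneg[OF h] .
  have hc: "continuous_on UNIV h" by (rule Cr_continuous[OF hC])
  have i1: "integrable lborel (\<lambda>y. h (x + \<epsilon> *\<^sub>R y) * \<theta> y)"
    by (rule integrable_Cc_mult'[OF \<theta>(1)]) (intro continuous_on_compose2[OF hc] continuous_intros subset_UNIV)
  have i2: "integrable lborel (\<lambda>y. T y * \<theta> y)" "(LINT y|lborel. T y * \<theta> y) = 0"
    unfolding T_def by (rule integral_taylor_polynomial[OF \<theta>(1,2) hC])+
  have ab: "integrable lborel (\<lambda>y. \<bar>\<theta> y\<bar>)" using integrable_Cc[OF \<theta>(1)] by simp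
  have "(LINT y|lborel. h (x + \<epsilon> *\<^sub>R y) * \<theta> y) = (LINT y|lborel. h (x + \<epsilon> *\<^sub>R y) * \<theta> y - T y * \<theta> y)"
    using i1 i2 by simp
  also have "\<bar>\<dots>\<bar> \<le> (LINT y|lborel. \<bar>h (x + \<epsilon> *\<^sub>R y) * \<theta> y - T y * \<theta> y\<bar>)"
    by (rule integral_abs_bound)
  also have "\<dots> \<le> (LINT y|lborel. (B * (real CARD('n) * (\<epsilon> * \<rho>)) ^ s) * \<bar>\<theta> y\<bar>)"
  proof (rule integral_mono)
    show "integrable lborel (\<lambda>y. \<bar>h (x + \<epsilon> *\<^sub>R y) * \<theta> y - T y * \<theta> y\<bar>)" using i1 i2 by auto
    show "integrable lborel (\<lambda>y. (B * (real CARD('n) * (\<epsilon> * \<rho>)) ^ s) * \<bar>\<theta> y\<bar>)" using ab by (intro integrable_mult_right)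
    fix y
    show "\<bar>h (x + \<epsilon> *\<^sub>R y) * \<theta> y - T y * \<theta> y\<bar> \<le> (B * (real CARD('n) * (\<epsilon> * \<rho>)) ^ s) * \<bar>\<theta> y\<bar>"
    proof (cases "\<theta> y = 0")
      case False
      then have "y \<in> supp \<theta>" using not_in_supp by blast
      then have y: "norm y \<le> \<rho>" using \<theta>(3) by auto
      obtain t where t: "h (x + \<epsilon> *\<^sub>R y) = T y + (dd (\<epsilon> *\<^sub>R y) ^^ s) h (x + t *\<^sub>R \<epsilon> *\<^sub>R y) / fact s"
        using taylor_line[OF hC, of x "\<epsilon> *\<^sub>R y"] unfolding T_def by blast
      have "\<bar>(dd (\<epsilon> *\<^sub>R y) ^^ s) h (x + t *\<^sub>R \<epsilon> *\<^sub>R y) / fact s\<bar> \<le> \<bar>(dd (\<epsilon> *\<^sub>R y) ^^ s) h (x + t *\<^sub>R \<epsilon> *\<^sub>R y)\<bar>"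
        unfolding abs_divide using fact_ge_1[of s, where 'a = real] by (simp add: divide_le_eq mult_left_le_one_le mult_le_cancel_left1)
      also have "\<dots> \<le> B * (real CARD('n) * norm (\<epsilon> *\<^sub>R y)) ^ s" by (rule dd_pow_bound[OF h])
      also have "\<dots> \<le> B * (real CARD('n) * (\<epsilon> * \<rho>)) ^ s"
        using B \<epsilon> y by (intro mult_left_mono power_mono) auto
      finally have *: "\<bar>h (x + \<epsilon> *\<^sub>R y) - T y\<bar> \<le> B * (real CARD('n) * (\<epsilon> * \<rho>)) ^ s" by (simp add: t)
      have "\<bar>h (x + \<epsilon> *\<^sub>R y) * \<theta> y - T y * \<theta> y\<bar> = \<bar>h (x + \<epsilon> *\<^sub>R y) - T y\<bar> * \<bar>\<theta> y\<bar>"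
        by (simp add: left_diff_distrib[symmetric] abs_mult)
      then show ?thesis using mult_right_mono[OF *] by simp
    qed simp
  qed
  also have "\<dots> = (real CARD('n) * \<rho>) ^ s * (LINT y|lborel. \<bar>\<theta> y\<bar>) * B / (2 ^ n) ^ s"
    by (simp add: \<epsilon>_def power_mult_distrib power_divide)
  finally have *: "\<bar>LINT y|lborel. h (x + \<epsilon> *\<^sub>R y) * \<theta> y\<bar> \<le> (real CARD('n) * \<rho>) ^ s * (LINT y|lborel. \<bar>\<theta> y\<bar>) * B / (2 ^ n) ^ s" .
  have "L2_inner h (scaled \<theta> n k) = (LINT y|lborel. h (x + \<epsilon> *\<^sub>R y) * \<theta> y) / 2 powr (real (CARD('n) * n) / 2)"
    using L2_inner_scaled[OF Cr_c_measurable[OF \<theta>(1)] borel_measurable_continuous_onI[OF hc], of n k]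
    by (simp add: x_def \<epsilon>_def)
  then have "\<bar>L2_inner h (scaled \<theta> n k)\<bar> = \<bar>LINT y|lborel. h (x + \<epsilon> *\<^sub>R y) * \<theta> y\<bar> / 2 powr (real (CARD('n) * n) / 2)"
    by (simp only: abs_divide abs_of_nonneg powr_ge_zero)
  also have "\<dots> \<le> (real CARD('n) * \<rho>) ^ s * (LINT y|lborel. \<bar>\<theta> y\<bar>) * B / (2 ^ n) ^ s / 2 powr (real (CARD('n) * n) / 2)"
    by (rule divide_right_mono[OF *]) simp
  finally show ?thesis .
qed

section \<open>Moments of powers of linear forms and polarization\<close>

lemma inner_power_derivative:
  "((\<lambda>x. (\<zeta> \<bullet> x) ^ m) has_derivative (\<lambda>v. \<Sum>i\<in>UNIV. v $ i * (real m * \<zeta> $ i * (\<zeta> \<bullet> x) ^ (m - 1)))) (at x)"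
  for \<zeta> :: "real ^ 'n"
proof -
  have "((\<lambda>x. (\<zeta> \<bullet> x) ^ m) has_derivative (\<lambda>v. real m * (\<zeta> \<bullet> v) * (\<zeta> \<bullet> x) ^ (m - 1))) (at x)"
    by (auto intro!: derivative_eq_intros)
  then show ?thesis
    by (rule has_derivative_eq_rhs) (simp add: inner_vec_def sum_distrib_left sum_distrib_right mult_ac)
qed

lemma Cr_inner_power: "Cr r (\<lambda>x. c * (\<zeta> \<bullet> x) ^ m)"
proof (induction r arbitrary: m c)
  case 0 then show ?case by (simp add: Cr.simps continuous_intros)
next
  case (Suc r)
  have "Cr r (\<lambda>x. real m * \<zeta> $ i * (\<zeta> \<bullet> x) ^ (m - 1))" for i by (rule Suc)
  then have "Cr (Suc r) (\<lambda>x. (\<zeta> \<bullet> x) ^ m)" by (rule Cr_SucI(1)[OF inner_power_derivative])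
  then show ?case by (rule Cr_cmult)
qed

text \<open>Repeated integration by parts. With \<open>length xs = m\<close> the power is
  differentiated away and the mean of \<open>f\<close> remains, which is how the mean of \<phi>
  enters \<open>vanish_\<psi>\<close>.\<close>

lemma integral_pd_inner_power:
  assumes "f \<in> Cr_c (length xs)" "length xs \<le> m"
  shows "(LINT x|lborel. pd xs f x * (\<zeta> \<bullet> x) ^ m)
    = (-1) ^ length xs * (fact m / fact (m - length xs)) * monom_at xs \<zeta> * (LINT x|lborel. f x * (\<zeta> \<bullet> x) ^ (m - length xs))"
  using assms
proof (induction xs arbitrary: m)
  case (Cons i xs)
  then obtain m' where m: "m = Suc m'" "length xs \<le> m'" by (cases m) auto
  have g: "pd xs f \<in> Cr_c (Suc 0)" using Cr_c_pd[OF Cons.prems(1), of xs] by simp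
  have p: "partial i (\<lambda>x. (\<zeta> \<bullet> x) ^ m) = (\<lambda>x. real m * \<zeta> $ i * (\<zeta> \<bullet> x) ^ m')"
    by (rule ext, subst partial_eqI[OF inner_power_derivative]) (simp add: sum_axis m)
  have C: "Cr (Suc 0) (\<lambda>x. (\<zeta> \<bullet> x) ^ m)" using Cr_inner_power[of "Suc 0" 1 \<zeta> m] by simp
  have "(LINT x|lborel. pd (i # xs) f x * (\<zeta> \<bullet> x) ^ m) = - (LINT x|lborel. pd xs f x * (real m * \<zeta> $ i * (\<zeta> \<bullet> x) ^ m'))"
    using integral_by_parts[OF g C, of i] by (simp add: p)
  also have "\<dots> = - (real m * \<zeta> $ i) * (LINT x|lborel. pd xs f x * (\<zeta> \<bullet> x) ^ m')"
  proof -
    have "(LINT x|lborel. pd xs f x * (real m * \<zeta> $ i * (\<zeta> \<bullet> x) ^ m')) = (LINT x|lborel. (real m * \<zeta> $ i) * (pd xs f x * (\<zeta> \<bullet> x) ^ m'))"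
      by (simp add: mult_ac)
    then show ?thesis by simp
  qed
  also have "(LINT x|lborel. pd xs f x * (\<zeta> \<bullet> x) ^ m') = (-1) ^ length xs * (fact m' / fact (m' - length xs)) * monom_at xs \<zeta> * (LINT x|lborel. f x * (\<zeta> \<bullet> x) ^ (m' - length xs))"
    using Cons.prems(1) by (intro Cons.IH Cr_c_mono[OF Cons.prems(1)] m(2)) simp
  finally show ?case by (simp add: m)
qed simp

lemma inner_power_expand: "(\<zeta> \<bullet> y) ^ l = (\<Sum>xs | length xs = l. monom_at xs \<zeta> * monom_at xs (y :: real ^ 'n))"
proof (induction l)
  case (Suc l)
  have "(\<zeta> \<bullet> y) ^ Suc l = (\<zeta> \<bullet> y) * (\<Sum>xs | length xs = l. monom_at xs \<zeta> * monom_at xs y)"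
    by (simp add: Suc)
  also have "\<dots> = (\<Sum>i\<in>UNIV. \<zeta> $ i * y $ i) * (\<Sum>xs | length xs = l. monom_at xs \<zeta> * monom_at xs y)"
    by (simp only: inner_vec_def inner_real_def)
  also have "\<dots> = (\<Sum>xs | length xs = Suc l. monom_at xs \<zeta> * monom_at xs y)"
    by (simp add: sum_lists_Suc sum_product mult_ac)
  finally show ?case .
qed simp

text \<open>Replacing \<zeta> by \<zeta> + t e_i gives a polynomial in t that vanishes identically;
  its coefficient of degree one is a nonzero multiple of the moment in which one factor \<zeta>
  \<bullet> y is replaced by y_i. Iteration recovers every monomial of degree
  \<open>l\<close>.\<close>

lemma polarization:
  fixes \<theta> :: "real ^ 'n \<Rightarrow> real"
  assumes \<theta>: "\<theta> \<in> Cr_c 0" and z: "\<And>\<zeta>. (LINT y|lborel. (\<zeta> \<bullet> y) ^ l * \<theta> y) = 0"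
  shows "length xs \<le> l \<Longrightarrow> (LINT y|lborel. monom_at xs y * (\<zeta> \<bullet> y) ^ (l - length xs) * \<theta> y) = 0"
proof (induction xs arbitrary: \<zeta>)
  case Nil then show ?case using z by simp
next
  case (Cons i xs)
  then obtain n where n: "l - length xs = Suc n" "l - length (i # xs) = n" by (metis Suc_diff_Suc Suc_le_eq length_Cons)
  define g where "g j y = (\<zeta> \<bullet> y) ^ (Suc n - j) * ((y $ i) ^ j * (monom_at xs y * \<theta> y))" for j y
  define c where "c j = real (Suc n choose j) * (LINT y|lborel. g j y)" for j
  have i: "integrable lborel (g j)" for j
  proof -
    have "integrable lborel (\<lambda>y. ((\<zeta> \<bullet> y) ^ (Suc n - j) * (y $ i) ^ j * monom_at xs y) * \<theta> y)"
      by (rule integrable_Cc_mult'[OF \<theta>]) (intro continuous_intros continuous_monom_at)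
    then show ?thesis by (simp add: g_def[abs_def] mult_ac)
  qed
  have "(\<Sum>j\<le>Suc n. c j * t ^ j) = 0" for t
  proof -
    have e: "monom_at xs y * ((\<zeta> + t *\<^sub>R axis i 1) \<bullet> y) ^ Suc n * \<theta> y
       = (\<Sum>j\<le>Suc n. (t ^ j * real (Suc n choose j)) * g j y)" for y
    proof -
      have "(\<zeta> + t *\<^sub>R axis i 1) \<bullet> y = t * y $ i + \<zeta> \<bullet> y" by (simp add: inner_add_left inner_axis')
      then have "((\<zeta> + t *\<^sub>R axis i 1) \<bullet> y) ^ Suc n
         = (\<Sum>j\<le>Suc n. real (Suc n choose j) * (t * y $ i) ^ j * (\<zeta> \<bullet> y) ^ (Suc n - j))"
        by (simp only: binomial_ring)
      then show ?thesis
        by (simp only: g_def sum_distrib_left sum_distrib_right power_mult_distrib mult_ac)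
    qed
    have "0 = (LINT y|lborel. monom_at xs y * ((\<zeta> + t *\<^sub>R axis i 1) \<bullet> y) ^ Suc n * \<theta> y)"
      using Cons.IH[of "\<zeta> + t *\<^sub>R axis i 1"] Cons.prems n by simp
    also have "\<dots> = (\<Sum>j\<le>Suc n. (LINT y|lborel. (t ^ j * real (Suc n choose j)) * g j y))"
      unfolding e by (intro Bochner_Integration.integral_sum integrable_mult_right i)
    also have "\<dots> = (\<Sum>j\<le>Suc n. c j * t ^ j)" by (simp add: c_def mult_ac)
    finally show ?thesis by simp
  qed
  then have "c j = 0" if "j \<le> Suc n" for j using polyfun_eq_0[of c "Suc n"] that by blast
  from this[of 1] have "(LINT y|lborel. g 1 y) = 0" by (simp add: c_def)
  then show ?case unfolding n(2) by (simp add: g_def mult_ac)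
qed

context wavelets
begin

lemma \<phi>_V: "\<phi> \<in> V (int n)"
proof -
  have "(0 :: real ^ 'n) \<in> int_lattice" by (simp add: int_lattice_def)
  then have "scaled \<phi> 0 0 \<in> V (int 0)" by (rule scaled_V)
  moreover have "scaled \<phi> 0 0 = \<phi>" by (simp add: scaled_def fun_eq_iff)
  ultimately show ?thesis using V_mono[of 0 "int n"] by auto
qed

lemma \<phi>_norm: "L2_inner \<phi> \<phi> = 1"
proof -
  have "(0 :: real ^ 'n) \<in> int_lattice" by (simp add: int_lattice_def)
  then show ?thesis using onb_V0 unfolding orthonormal_basis_of_def by fastforce
qed

text \<open>If \<open>\<phi>\<close> had mean zero, its coefficients at level \<open>n\<close> would be too small for \<open>\<phi> \<in> V n\<close> to
  have norm one.\<close>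

lemma \<phi>_mean_nonzero: "(LINT x|lborel. \<phi> x) \<noteq> 0"
proof
  assume "(LINT x|lborel. \<phi> x) = 0"
  then have v: "vanish (Suc 0) \<phi>" by (simp add: vanish_def)
  note \<phi>0 = Cr_c0[OF \<phi>]
  obtain B where B: "B > 0" "Cbd (Suc 0) B \<phi>" using Cr_c_Cbd[OF Cr_c_mono[OF \<phi>, of "Suc 0"]] r by auto
  define C where "C = real CARD('n) * \<rho> * (LINT y|lborel. \<bar>\<phi> y\<bar>) * B"
  \<comment> \<open>There are at most \<open>(2 ^ n * (4 * \<rho> + 1)) ^ CARD('n)\<close>
    coefficients. The factor 2^(n d) of this count cancels the one from the normalisation, and the
    squared gain 2^(-n) of the vanishing mean leaves \<open>K / 4 ^ n\<close>.\<close>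
  define K where "K = (4 * \<rho> + 1) ^ CARD('n) * C\<^sup>2"
  have "1 \<le> K / 4 ^ n" for n
  proof -
    let ?c = "2 powr (real (CARD('n) * n) / 2)"
    define t where "t = 2 ^ n * \<rho> + \<rho>"
    let ?L = "lat t :: (real ^ 'n) set"
    have dec: "\<bar>L2_inner \<phi> (scaled \<phi> n k)\<bar> \<le> C / 2 ^ n / ?c" for k
      using coefficient_decay[OF \<phi>0 v \<rho>(2) _ B(2), of n k] \<rho>(1) by (simp add: C_def)
    have e: "\<phi> = (\<lambda>x. \<Sum>k\<in>?L. L2_inner \<phi> (scaled \<phi> n k) * scaled \<phi> n k x)"
      by (rule ext, rule V_expansion[OF \<phi>0 \<phi>_V \<rho>(2)]) (simp add: t_def)
    have "1 = L2_inner \<phi> \<phi>" by (simp add: \<phi>_norm)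
    also have "L2_inner \<phi> \<phi> = L2_inner (\<lambda>x. \<Sum>k\<in>?L. L2_inner \<phi> (scaled \<phi> n k) * scaled \<phi> n k x) \<phi>"
      by (rule arg_cong[where f = "\<lambda>u. L2_inner u \<phi>", OF e])
    also have "\<dots> = (\<Sum>k\<in>?L. L2_inner \<phi> (scaled \<phi> n k) * L2_inner (scaled \<phi> n k) \<phi>)"
      by (intro L2_inner_sum Cr_c_L2[OF \<phi>] Cr_c_L2[OF scaled_Cr_c[OF \<phi>]])
    also have "\<dots> = (\<Sum>k\<in>?L. \<bar>L2_inner \<phi> (scaled \<phi> n k)\<bar>\<^sup>2)"
      by (simp add: power2_eq_square L2_inner_commute)
    also have "\<dots> \<le> (\<Sum>k\<in>?L. (C / 2 ^ n / ?c)\<^sup>2)"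
      by (intro sum_mono power_mono dec) auto
    also have "\<dots> = real (card ?L) * (C\<^sup>2 / 4 ^ n / 2 ^ (CARD('n) * n))"
    proof -
      have "(2 ^ n)\<^sup>2 = (4 :: real) ^ n" by (simp add: power2_eq_square power_mult_distrib[symmetric])
      moreover have "?c\<^sup>2 = 2 ^ (CARD('n) * n)" using powr_half_sq[of "CARD('n) * n"] by (simp add: power2_eq_square)
      ultimately show ?thesis by (simp add: power_divide power_mult_distrib)
    qed
    also have "\<dots> \<le> (2 ^ n * (4 * \<rho> + 1)) ^ CARD('n) * (C\<^sup>2 / 4 ^ n / 2 ^ (CARD('n) * n))"
    proof (rule mult_right_mono)
      have 1: "(1::real) \<le> 2 ^ n" by simp
      then have 2: "\<rho> \<le> 2 ^ n * \<rho>" using \<rho>(1) by simp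
      have 3: "2 ^ n * (4 * \<rho> + 1) = 4 * (2 ^ n * \<rho>) + 2 ^ n" by (simp add: algebra_simps)
      have "2 * t + 1 \<le> 2 ^ n * (4 * \<rho> + 1)" unfolding t_def 3 using 1 2 by argo
      moreover have "0 \<le> t" using \<rho>(1) by (simp add: t_def)
      ultimately show "real (card ?L) \<le> (2 ^ n * (4 * \<rho> + 1)) ^ CARD('n)"
        using near_finite_card(2)[of t 0] power_mono[of "2 * t + 1" "2 ^ n * (4 * \<rho> + 1)" "CARD('n)"] by (meson order_trans add_nonneg_nonneg mult_nonneg_nonneg zero_le_numeral zero_le_one)
    qed simp
    also have "\<dots> = K / 4 ^ n" by (simp add: K_def power_mult_distrib power_mult[symmetric] mult.commute)
    finally show ?thesis .
  qed
  moreover have "(\<lambda>n. K / 4 ^ n) \<longlonglongrightarrow> 0"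
    using tendsto_mult[OF tendsto_const[of K] LIMSEQ_power_zero[of "1 / 4 :: real"]] by (simp add: power_divide)
  ultimately have "(1::real) \<le> 0" by (intro LIMSEQ_le_const[of "\<lambda>n. K / 4 ^ n" 0 1]) auto
  then show False by simp
qed

lemma lattice_dyadic: "k \<in> int_lattice \<Longrightarrow> (2 ^ m) *\<^sub>R k \<in> int_lattice"
  by (auto simp: int_lattice_def)

text \<open>Orthogonality of \<open>\<phi>\<close> to the fine wavelets centred at a dyadic point, combined with Taylor's
  formula for \<open>\<phi>\<close> there.\<close>

lemma leading_moment_dyadic:
  assumes i: "i \<in> II" and l: "l \<le> r" and v: "vanish l (\<psi> i)" and k: "k \<in> int_lattice"
  shows "(LINT y|lborel. (dd y ^^ l) \<phi> ((1 / 2 ^ J) *\<^sub>R k) * \<psi> i y) = 0"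
proof -
  define x where "x = (1 / 2 ^ J) *\<^sub>R k"
  let ?\<theta> = "\<psi> i"
  have \<theta>: "?\<theta> \<in> Cr_c 0" using Cr_c0[OF \<psi>[OF i]] .
  have C: "Cr l \<phi>" using Cr_mono[OF _ l] \<phi> by (auto simp: Cr_c_def)
  obtain B where B: "B > 0" "Cbd l B \<phi>" using Cr_c_Cbd[OF Cr_c_mono[OF \<phi> l]] by auto
  have \<phi>c: "continuous_on UNIV \<phi>" using Cr_c_continuous[OF \<phi>] .
  define \<epsilon> where "\<epsilon> m = (1 :: real) / 2 ^ (J + m)" for m
  have \<epsilon>: "\<epsilon> m > 0" for m by (simp add: \<epsilon>_def)
  have \<epsilon>0: "\<epsilon> \<longlonglongrightarrow> 0"
  proof -
    have "(\<lambda>m. (1 / 2 ^ J) * (1 / 2) ^ m :: real) \<longlonglongrightarrow> (1 / 2 ^ J) * 0"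
      by (intro tendsto_intros LIMSEQ_power_zero) auto
    then show ?thesis by (simp add: \<epsilon>_def[abs_def] power_add power_divide)
  qed
  define T where "T m y = (\<Sum>j<l. (dd (\<epsilon> m *\<^sub>R y) ^^ j) \<phi> x / fact j)" for m y
  define g where "g m y = (\<phi> (x + \<epsilon> m *\<^sub>R y) - T m y) / \<epsilon> m ^ l * ?\<theta> y" for m y
  have i1: "integrable lborel (\<lambda>y. \<phi> (x + \<epsilon> m *\<^sub>R y) * ?\<theta> y)" for m
    by (rule integrable_Cc_mult'[OF \<theta>]) (intro continuous_on_compose2[OF \<phi>c] continuous_intros subset_UNIV)
  have i2: "integrable lborel (\<lambda>y. T m y * ?\<theta> y)" "(LINT y|lborel. T m y * ?\<theta> y) = 0" for m
    unfolding T_def by (rule integral_taylor_polynomial[OF \<theta> v C])+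
  have ge: "g m = (\<lambda>y. (1 / \<epsilon> m ^ l) * (\<phi> (x + \<epsilon> m *\<^sub>R y) * ?\<theta> y - T m y * ?\<theta> y))" for m
    by (simp add: g_def fun_eq_iff left_diff_distrib diff_divide_distrib)
  have gi: "integrable lborel (g m)" for m unfolding ge using i1 i2(1) by auto
  have g0: "(LINT y|lborel. g m y) = 0" for m
  proof -
    \<comment> \<open>A dyadic point of level J is also the centre of a wavelet of every finer level
      J + m, so x can stay fixed while the scale shrinks.\<close>
    have k': "2 ^ m *\<^sub>R k \<in> int_lattice" by (rule lattice_dyadic[OF k])
    have x': "(1 / 2 ^ (J + m)) *\<^sub>R 2 ^ m *\<^sub>R k = x" by (simp add: x_def power_add)
    have "L2_inner \<phi> (scaled ?\<theta> (J + m) (2 ^ m *\<^sub>R k)) = 0"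
      by (rule W_orthogonal_V[OF \<phi>_V i k'])
    then have "(LINT y|lborel. \<phi> (x + \<epsilon> m *\<^sub>R y) * ?\<theta> y) = 0"
      using L2_inner_scaled[OF Cr_c_measurable[OF \<theta>] Cr_c_measurable[OF \<phi>], of "J + m" "2 ^ m *\<^sub>R k"]
      unfolding x' by (simp add: \<epsilon>_def)
    then show ?thesis unfolding ge using i1[of m] i2[of m] by simp
  qed
  have rem: "\<exists>t. \<bar>t\<bar> \<le> 1 \<and> g m y = (dd y ^^ l) \<phi> (x + (t * \<epsilon> m) *\<^sub>R y) / fact l * ?\<theta> y" for m y
  proof -
    obtain t where t: "\<bar>t\<bar> \<le> 1" "\<phi> (x + \<epsilon> m *\<^sub>R y) = T m y + (dd (\<epsilon> m *\<^sub>R y) ^^ l) \<phi> (x + t *\<^sub>R \<epsilon> m *\<^sub>R y) / fact l"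
      using taylor_line[OF C, of x "\<epsilon> m *\<^sub>R y"] unfolding T_def by blast
    then show ?thesis using \<epsilon>[of m] by (intro exI[of _ t]) (simp add: g_def dd_pow_scaleR[OF C])
  qed
  have lim: "(\<lambda>m. g m y) \<longlonglongrightarrow> (dd y ^^ l) \<phi> x / fact l * ?\<theta> y" for y
  proof -
    from rem[of _ y] obtain t where t: "\<And>m. \<bar>t m\<bar> \<le> 1" "\<And>m. g m y = (dd y ^^ l) \<phi> (x + (t m * \<epsilon> m) *\<^sub>R y) / fact l * ?\<theta> y"
      by metis
    have "(\<lambda>m. t m * \<epsilon> m) \<longlonglongrightarrow> 0"
      by (rule Lim_null_comparison[OF _ \<epsilon>0])
         (use t(1) \<epsilon> in \<open>auto simp: abs_mult abs_of_pos intro!: always_eventually mult_left_le_one_le[of "\<epsilon> _" "\<bar>t _\<bar>"] less_imp_le\<close>)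
    then have "(\<lambda>m. x + (t m * \<epsilon> m) *\<^sub>R y) \<longlonglongrightarrow> x + 0 *\<^sub>R y" by (intro tendsto_intros)
    moreover have "isCont ((dd y ^^ l) \<phi>) x"
      using Cr_continuous[OF Cr_dd_pow[of 0 l \<phi> y], of UNIV] C by (simp add: continuous_on_eq_continuous_at)
    ultimately have "(\<lambda>m. (dd y ^^ l) \<phi> (x + (t m * \<epsilon> m) *\<^sub>R y)) \<longlonglongrightarrow> (dd y ^^ l) \<phi> x"
      using isCont_tendsto_compose[of x] by force
    then show ?thesis unfolding t(2) by (intro tendsto_intros) auto
  qed
  have bound: "\<bar>g m y\<bar> \<le> B * (real CARD('n) * \<rho>) ^ l * \<bar>?\<theta> y\<bar>" for m y
  proof (cases "?\<theta> y = 0")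
    case False
    then have "y \<in> supp ?\<theta>" using not_in_supp by blast
    then have y: "norm y \<le> \<rho>" using \<rho>(3)[OF i] by auto
    obtain t where t: "g m y = (dd y ^^ l) \<phi> (x + (t * \<epsilon> m) *\<^sub>R y) / fact l * ?\<theta> y" using rem by blast
    have "\<bar>(dd y ^^ l) \<phi> (x + (t * \<epsilon> m) *\<^sub>R y) / fact l\<bar> \<le> \<bar>(dd y ^^ l) \<phi> (x + (t * \<epsilon> m) *\<^sub>R y)\<bar>"
      unfolding abs_divide using fact_ge_1[of l, where 'a = real] by (simp add: divide_le_eq mult_le_cancel_left1)
    also have "\<dots> \<le> B * (real CARD('n) * norm y) ^ l" by (rule dd_pow_bound[OF B(2)])
    also have "\<dots> \<le> B * (real CARD('n) * \<rho>) ^ l"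
      using B y by (intro mult_left_mono power_mono) auto
    finally show ?thesis unfolding t abs_mult by (intro mult_right_mono) auto
  qed (simp add: g_def)
  have [measurable]: "?\<theta> \<in> borel_measurable borel" using Cr_c_measurable[OF \<theta>] .
  have "(\<lambda>m. LINT y|lborel. g m y) \<longlonglongrightarrow> (LINT y|lborel. (dd y ^^ l) \<phi> x / fact l * ?\<theta> y)"
  proof (rule integral_dominated_convergence[where w = "\<lambda>y. B * (real CARD('n) * \<rho>) ^ l * \<bar>?\<theta> y\<bar>"])
    show "integrable lborel (\<lambda>y. B * (real CARD('n) * \<rho>) ^ l * \<bar>?\<theta> y\<bar>)"
      using integrable_Cc[OF \<theta>] by auto
    show "(\<lambda>y. (dd y ^^ l) \<phi> x / fact l * ?\<theta> y) \<in> borel_measurable lborel"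
      using borel_measurable_integrable[OF integral_dd_pow(1)[OF \<theta> C, of x]]
        borel_measurable_divide[OF _ borel_measurable_const, of _ lborel "fact l"] by fastforce
    show "g m \<in> borel_measurable lborel" for m using borel_measurable_integrable[OF gi] .
  qed (use lim bound in auto)
  then have "(LINT y|lborel. (dd y ^^ l) \<phi> x / fact l * ?\<theta> y) = 0"
    using LIMSEQ_unique by (simp add: g0 LIMSEQ_const_iff)
  then show ?thesis by (simp add: x_def)
qed

lemma dyadic_dense:
  fixes Q :: "real ^ 'n \<Rightarrow> real"
  assumes "continuous_on UNIV Q" "\<And>J k. k \<in> int_lattice \<Longrightarrow> Q ((1 / 2 ^ J) *\<^sub>R k) = 0"
  shows "Q x = 0"
proof -
  define a :: "nat \<Rightarrow> real ^ 'n" where "a J = (\<chi> i. of_int \<lfloor>2 ^ J * x $ i\<rfloor>)" for J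
  have a: "a J \<in> int_lattice" for J by (simp add: a_def int_lattice_def)
  have "(\<lambda>J. (1 / 2 ^ J) *\<^sub>R a J) \<longlonglongrightarrow> x"
  proof (rule vec_tendstoI)
    fix i
    have "(\<lambda>J. (1 / 2 ^ J) * of_int \<lfloor>2 ^ J * x $ i\<rfloor> - x $ i) \<longlonglongrightarrow> 0"
    proof (rule Lim_null_comparison)
      show "\<forall>\<^sub>F J in sequentially. norm ((1 / 2 ^ J) * of_int \<lfloor>2 ^ J * x $ i\<rfloor> - x $ i) \<le> (1 / 2) ^ J"
      proof (rule always_eventually, rule allI)
        fix J :: nat
        have "\<bar>of_int \<lfloor>2 ^ J * x $ i\<rfloor> - 2 ^ J * x $ i\<bar> \<le> 1" by linarith
        moreover have "(1 / 2 ^ J) * of_int \<lfloor>2 ^ J * x $ i\<rfloor> - x $ i = (1 / 2 ^ J) * (of_int \<lfloor>2 ^ J * x $ i\<rfloor> - 2 ^ J * x $ i)"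
          by (simp add: right_diff_distrib)
        then have "norm ((1 / 2 ^ J) * of_int \<lfloor>2 ^ J * x $ i\<rfloor> - x $ i) = (1 / 2 ^ J) * \<bar>of_int \<lfloor>2 ^ J * x $ i\<rfloor> - 2 ^ J * x $ i\<bar>"
          unfolding real_norm_def by (simp only: abs_mult) simp
        ultimately have "norm ((1 / 2 ^ J) * of_int \<lfloor>2 ^ J * x $ i\<rfloor> - x $ i) \<le> (1 / 2 ^ J) * 1"
          by (simp only:) (intro mult_left_mono, auto)
        also have "\<dots> = (1 / 2) ^ J" by (simp add: power_divide)
        finally show "norm ((1 / 2 ^ J) * of_int \<lfloor>2 ^ J * x $ i\<rfloor> - x $ i) \<le> (1 / 2) ^ J" .
      qed
      show "(\<lambda>J. (1 / 2 :: real) ^ J) \<longlonglongrightarrow> 0" by (intro LIMSEQ_power_zero) auto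
    qed
    then show "(\<lambda>J. ((1 / 2 ^ J) *\<^sub>R a J) $ i) \<longlonglongrightarrow> x $ i"
      using LIM_zero_cancel[of "\<lambda>J. (1 / 2 ^ J) * of_int \<lfloor>2 ^ J * x $ i\<rfloor>" "x $ i"] by (simp add: a_def)
  qed
  moreover have "isCont Q x" using assms(1) by (simp add: continuous_on_eq_continuous_at)
  ultimately have "(\<lambda>J. Q ((1 / 2 ^ J) *\<^sub>R a J)) \<longlonglongrightarrow> Q x" by (rule isCont_tendsto_compose[rotated])
  then show ?thesis using assms(2)[OF a] by (simp add: LIMSEQ_const_iff)
qed

text \<open>The order of vanishing of the moments matches the regularity: by the previous lemmas the
  leading moments form a constant coefficient operator annihilating \<open>\<phi>\<close>; testing this against
  powers of linear forms brings in the nonzero mean of \<open>\<phi>\<close>.\<close>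

lemma vanish_\<psi>:
  assumes i: "i \<in> II"
  shows "l \<le> Suc r \<Longrightarrow> vanish l (\<psi> i)"
proof (induction l)
  case 0 then show ?case by (simp add: vanish_0)
next
  case (Suc l)
  \<comment> \<open>Moments of degree \<open>l\<close> only require derivatives of \<phi> of order
    \<open>l\<close>, so degree r is still reached and \<open>Suc r\<close> degrees vanish.\<close>
  then have l: "l \<le> r" and v: "vanish l (\<psi> i)" by auto
  let ?\<theta> = "\<psi> i"
  have \<theta>: "?\<theta> \<in> Cr_c 0" using Cr_c0[OF \<psi>[OF i]] .
  have C: "Cr l \<phi>" using Cr_mono[OF _ l] \<phi> by (auto simp: Cr_c_def)
  define M where "M xs = (LINT y|lborel. monom_at xs y * ?\<theta> y)" for xs
  define Q where "Q x = (\<Sum>xs | length xs = l. M xs * pd xs \<phi> x)" for x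
  have pc: "pd xs \<phi> \<in> Cr_c 0" if "length xs = l" for xs
    using Cr_c0[OF Cr_c_pd[OF \<phi>, of xs]] that l by simp
  have Qc: "continuous_on UNIV Q" unfolding Q_def
    by (intro continuous_intros Cr_c_continuous[OF pc]) simp
  have Q0: "Q x = 0" for x
  proof (rule dyadic_dense[OF Qc])
    fix J k assume "k \<in> (int_lattice :: (real ^ 'n) set)"
    from leading_moment_dyadic[OF i l v this, of J]
    show "Q ((1 / 2 ^ J) *\<^sub>R k) = 0" unfolding integral_dd_pow(2)[OF \<theta> C] by (simp add: Q_def M_def)
  qed
  have "(LINT y|lborel. (\<zeta> \<bullet> y) ^ l * ?\<theta> y) = 0" for \<zeta>
  proof -
    have i1: "integrable lborel (\<lambda>x. M xs * (pd xs \<phi> x * (\<zeta> \<bullet> x) ^ l))" if "length xs = l" for xs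
      by (intro integrable_mult_right integrable_Cc_mult[OF pc[OF that]] continuous_intros)
    have "0 = (LINT x|lborel. Q x * (\<zeta> \<bullet> x) ^ l)" by (simp add: Q0)
    also have "\<dots> = (LINT x|lborel. (\<Sum>xs | length xs = l. M xs * (pd xs \<phi> x * (\<zeta> \<bullet> x) ^ l)))"
      by (simp add: Q_def sum_distrib_right mult.assoc)
    also have "\<dots> = (\<Sum>xs | length xs = l. (LINT x|lborel. M xs * (pd xs \<phi> x * (\<zeta> \<bullet> x) ^ l)))"
      by (rule Bochner_Integration.integral_sum) (rule i1, simp)
    also have "\<dots> = (\<Sum>xs | length xs = l. M xs * ((-1) ^ l * fact l * monom_at xs \<zeta> * (LINT x|lborel. \<phi> x)))"
    proof (rule sum.cong[OF refl])
      fix xs :: "'n list" assume "xs \<in> {xs. length xs = l}"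
      then have xs: "length xs = l" by simp
      then show "(LINT x|lborel. M xs * (pd xs \<phi> x * (\<zeta> \<bullet> x) ^ l)) = M xs * ((-1) ^ l * fact l * monom_at xs \<zeta> * (LINT x|lborel. \<phi> x))"
        using integral_pd_inner_power[of \<phi> xs l \<zeta>] Cr_c_mono[OF \<phi> l] by simp
    qed
    also have "\<dots> = ((-1) ^ l * fact l * (LINT x|lborel. \<phi> x)) * (\<Sum>xs | length xs = l. monom_at xs \<zeta> * M xs)"
      by (simp add: sum_distrib_left mult_ac)
    finally have s: "(\<Sum>xs | length xs = l. monom_at xs \<zeta> * M xs) = 0" using \<phi>_mean_nonzero by simp
    have i2: "integrable lborel (\<lambda>y. monom_at xs \<zeta> * (monom_at xs y * ?\<theta> y))" for xs
      by (intro integrable_mult_right integrable_Cc_mult'[OF \<theta> continuous_monom_at])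
    have "(LINT y|lborel. (\<zeta> \<bullet> y) ^ l * ?\<theta> y) = (LINT y|lborel. (\<Sum>xs | length xs = l. monom_at xs \<zeta> * (monom_at xs y * ?\<theta> y)))"
      by (simp add: inner_power_expand sum_distrib_right mult.assoc)
    also have "\<dots> = (\<Sum>xs | length xs = l. (LINT y|lborel. monom_at xs \<zeta> * (monom_at xs y * ?\<theta> y)))"
      by (rule Bochner_Integration.integral_sum) (rule i2)
    also have "\<dots> = 0" using s by (simp add: M_def)
    finally show ?thesis .
  qed
  from polarization[OF \<theta> this]
  have "(LINT y|lborel. monom_at xs y * ?\<theta> y) = 0" if "length xs = l" for xs
    using that by fastforce
  then show ?case using v by (auto simp: vanish_def less_Suc_eq)
qed

end

subsection \<open>Bounds for sums of dilated functions\<close>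

definition lp :: "real \<Rightarrow> 'a set \<Rightarrow> ('a \<Rightarrow> real) \<Rightarrow> real" where
  "lp p K c = (\<Sum>k\<in>K. \<bar>c k\<bar> powr p) powr (1 / p)"

lemma lp_nonneg: "0 \<le> lp p K c"
  by (simp add: lp_def)

lemma lp_mono:
  assumes "finite K" "S \<subseteq> K" "1 \<le> p"
  shows "lp p S c \<le> lp p K c"
  unfolding lp_def using assms by (intro powr_mono2 sum_mono2 sum_nonneg) auto

lemma abs_le_lp:
  assumes "finite K" "k \<in> K" "1 \<le> p"
  shows "\<bar>c k\<bar> \<le> lp p K c"
proof -
  have "lp p {k} c = \<bar>c k\<bar>" using assms(3) by (simp add: lp_def powr_powr)
  then show ?thesis using lp_mono[of K "{k}" p c] assms by simp
qed

text \<open>Young's inequality with weights 1/p and 1 - 1/p and second factor 1.\<close>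

lemma powr_root_le:
  fixes y :: real
  assumes "0 \<le> y" "1 \<le> p"
  shows "y powr (1 / p) \<le> y / p + (1 - 1 / p)"
proof (cases "y = 0")
  case False
  then show ?thesis using Youngs_inequality_0[of "1 / p" "1 - 1 / p" y 1] assms by simp
qed (use assms in auto)

text \<open>Hoelder's inequality, obtained by adding up \<open>powr_root_le\<close> over the terms
  divided by their power mean \<open>M\<close>.\<close>

lemma sum_abs_le_lp:
  assumes S: "finite S" and p: "1 \<le> p"
  shows "(\<Sum>k\<in>S. \<bar>c k\<bar>) \<le> real (card S) powr (1 - 1 / p) * lp p S c"
proof (cases "(\<Sum>k\<in>S. \<bar>c k\<bar> powr p) = 0")
  case True
  then have "\<bar>c k\<bar> powr p = 0" if "k \<in> S" for k
    using S that sum_nonneg_eq_0_iff[of S "\<lambda>k. \<bar>c k\<bar> powr p"] by simp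
  then show ?thesis using lp_nonneg[of p S c] by (simp add: mult_nonneg_nonneg)
next
  case False
  define N where "N = real (card S)"
  define T where "T = (\<Sum>k\<in>S. \<bar>c k\<bar> powr p)"
  have T: "T > 0" using False sum_nonneg[of S "\<lambda>k. \<bar>c k\<bar> powr p"] unfolding T_def by simp
  have N: "N > 0" using False S by (auto simp: N_def card_gt_0_iff)
  define M where "M = (T / N) powr (1 / p)"
  have M: "M > 0" using T N by (simp add: M_def)
  have "\<bar>c k\<bar> / M \<le> \<bar>c k\<bar> powr p / (T / N) / p + (1 - 1 / p)" for k
  proof -
    have "(\<bar>c k\<bar> powr p / (T / N)) powr (1 / p) = \<bar>c k\<bar> / M"
    proof -
      have "(\<bar>c k\<bar> powr p / (T / N)) powr (1 / p) = (\<bar>c k\<bar> powr p) powr (1 / p) / M"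
        unfolding M_def by (rule powr_divide)
      then show ?thesis using p by (simp add: powr_powr)
    qed
    then show ?thesis using powr_root_le[of "\<bar>c k\<bar> powr p / (T / N)" p] T N p by simp
  qed
  then have "(\<Sum>k\<in>S. \<bar>c k\<bar> / M) \<le> (\<Sum>k\<in>S. \<bar>c k\<bar> powr p / (T / N) / p + (1 - 1 / p))" by (intro sum_mono)
  also have "\<dots> = T / (T / N) / p + N * (1 - 1 / p)"
    unfolding sum.distrib sum_divide_distrib[symmetric] T_def[symmetric] by (simp add: N_def)
  also have "\<dots> = N" using T N p by (simp add: field_simps)
  finally have "(\<Sum>k\<in>S. \<bar>c k\<bar>) \<le> N * M" using M by (simp add: sum_divide_distrib[symmetric] divide_le_eq)
  also have "N * M = N powr (1 - 1 / p) * T powr (1 / p)"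
    using N T by (simp add: M_def powr_divide powr_diff)
  finally show ?thesis by (simp add: lp_def T_def N_def)
qed

text \<open>At most \<open>(2 * \<rho> + 1) ^ CARD('n)\<close> of the functions are nonzero at a
  given point, whatever the level, so the largest coefficient controls the sum.\<close>

lemma sum_scaled_bound:
  fixes \<theta> :: "real ^ 'n \<Rightarrow> real"
  assumes "supp \<theta> \<subseteq> cball 0 \<rho>" "0 \<le> \<rho>" "\<And>x. \<bar>\<theta> x\<bar> \<le> A" "finite K" "K \<subseteq> int_lattice" "\<And>k. k \<in> K \<Longrightarrow> \<bar>c k\<bar> \<le> m" "0 \<le> m"
  shows "\<bar>\<Sum>k\<in>K. c k * scaled \<theta> n k x\<bar> \<le> (2 * \<rho> + 1) ^ CARD('n) * A * m * 2 powr (real (CARD('n) * n) / 2)"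
proof -
  let ?c = "2 powr (real (CARD('n) * n) / 2)"
  let ?N = "near \<rho> (2 ^ n *\<^sub>R x)"
  have A: "0 \<le> A" using assms(3)[of 0] by linarith
  have "(\<Sum>k\<in>K. c k * scaled \<theta> n k x) = (\<Sum>k\<in>K \<inter> ?N. c k * scaled \<theta> n k x)"
  proof (rule sum.mono_neutral_right[OF assms(4)])
    show "\<forall>k\<in>K - K \<inter> ?N. c k * scaled \<theta> n k x = 0"
      using scaled_nonzero[OF assms(1), of n _ x] assms(5) by (auto simp: near_def norm_minus_commute)
  qed simp
  also have "\<bar>\<dots>\<bar> \<le> (\<Sum>k\<in>K \<inter> ?N. \<bar>c k * scaled \<theta> n k x\<bar>)" by (rule sum_abs)
  also have "\<dots> \<le> (\<Sum>k\<in>K \<inter> ?N. m * (?c * A))"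
    unfolding abs_mult scaled_def by (intro sum_mono mult_mono assms(6) assms(3)) (auto simp: assms(7))
  also have "\<dots> = real (card (K \<inter> ?N)) * (m * (?c * A))" by simp
  also have "\<dots> \<le> (2 * \<rho> + 1) ^ CARD('n) * (m * (?c * A))"
  proof (rule mult_right_mono)
    have "real (card (K \<inter> ?N)) \<le> real (card ?N)" by (simp add: card_mono)
    also have "\<dots> \<le> (2 * \<rho> + 1) ^ CARD('n)" by (rule near_finite_card(2)[OF assms(2)])
    finally show "real (card (K \<inter> ?N)) \<le> (2 * \<rho> + 1) ^ CARD('n)" .
  qed (use A assms(7) in simp)
  finally show ?thesis by (simp add: mult_ac)
qed

lemma pd_scaled:
  fixes \<theta> :: "real ^ 'n \<Rightarrow> real"
  assumes "Cr (length xs) \<theta>"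
  shows "pd xs (scaled \<theta> n k) x = 2 ^ (n * length xs) * scaled (pd xs \<theta>) n k x"
proof -
  have "Cr (length xs) (\<lambda>x. \<theta> (2 ^ n *\<^sub>R x + - k))" by (rule Cr_affine[OF assms])
  then have "pd xs (scaled \<theta> n k) = (\<lambda>x. 2 powr (real (CARD('n) * n) / 2) * pd xs (\<lambda>x. \<theta> (2 ^ n *\<^sub>R x + - k)) x)"
    unfolding scaled_alt[abs_def] by (rule pd_cmult)
  also have "\<dots> = (\<lambda>x. 2 powr (real (CARD('n) * n) / 2) * ((2 ^ n) ^ length xs * pd xs \<theta> (2 ^ n *\<^sub>R x + - k)))"
    by (simp only: pd_affine[OF assms])
  finally show ?thesis by (simp only: scaled_alt power_mult mult_ac)
qed

text \<open>Derivatives of dilated functions are dilated derivatives, with a factor 2^n for each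
  order, and \<open>sum_scaled_bound\<close> applies to them.\<close>

lemma sum_scaled_Cbd:
  fixes \<theta> :: "real ^ 'n \<Rightarrow> real"
  assumes "supp \<theta> \<subseteq> cball 0 \<rho>" "0 \<le> \<rho>" "Cbd s A \<theta>" "finite K" "K \<subseteq> int_lattice" "\<And>k. k \<in> K \<Longrightarrow> \<bar>c k\<bar> \<le> m" "0 \<le> m"
  shows "Cbd s ((2 * \<rho> + 1) ^ CARD('n) * A * m * 2 powr (real (CARD('n) * n) / 2) * 2 ^ (n * s)) (\<lambda>x. \<Sum>k\<in>K. c k * scaled \<theta> n k x)"
proof (rule CbdI)
  have C: "Cr s \<theta>" using Cbd_Cr[OF assms(3)] .
  have Cs: "Cr s (scaled \<theta> n k)" for k unfolding scaled_alt[abs_def] by (intro Cr_cmult Cr_affine C)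
  show "Cr s (\<lambda>x. \<Sum>k\<in>K. c k * scaled \<theta> n k x)" by (intro Cr_sum Cr_cmult Cs)
  fix xs :: "'n list" and x assume l: "length xs \<le> s"
  have C': "Cr (length xs) \<theta>" "\<And>k. Cr (length xs) (scaled \<theta> n k)" using Cr_mono[OF C l] Cr_mono[OF Cs l] by auto
  have "pd xs (\<lambda>x. \<Sum>k\<in>K. c k * scaled \<theta> n k x) x = (\<Sum>k\<in>K. pd xs (\<lambda>x. c k * scaled \<theta> n k x) x)"
    by (subst pd_sum) (auto intro: Cr_cmult C')
  also have "\<dots> = (\<Sum>k\<in>K. c k * (2 ^ (n * length xs) * scaled (pd xs \<theta>) n k x))"
    by (simp add: pd_cmult[OF C'(2)] pd_scaled[OF C'(1)])
  also have "\<dots> = 2 ^ (n * length xs) * (\<Sum>k\<in>K. c k * scaled (pd xs \<theta>) n k x)"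
    by (simp add: sum_distrib_left mult_ac)
  also have "\<bar>\<dots>\<bar> = 2 ^ (n * length xs) * \<bar>\<Sum>k\<in>K. c k * scaled (pd xs \<theta>) n k x\<bar>"
    by (simp add: abs_mult)
  also have "\<dots> \<le> 2 ^ (n * s) * ((2 * \<rho> + 1) ^ CARD('n) * A * m * 2 powr (real (CARD('n) * n) / 2))"
    using l sum_scaled_bound[OF order_trans[OF supp_pd assms(1)] assms(2) Cbd_pd_bound[OF assms(3) l] assms(4-7)]
    by (intro mult_mono power_increasing) auto
  finally show "\<bar>pd xs (\<lambda>x. \<Sum>k\<in>K. c k * scaled \<theta> n k x) x\<bar>
      \<le> (2 * \<rho> + 1) ^ CARD('n) * A * m * 2 powr (real (CARD('n) * n) / 2) * 2 ^ (n * s)"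
    by (simp add: mult_ac)
qed

subsection \<open>The Hoelder norm on compactly supported functions\<close>

text \<open>Not an equality, because \<open>ennreal\<close> sends negative numbers to zero.\<close>

lemma ennreal_add_le: "ennreal (a + b) \<le> ennreal a + ennreal b"
proof (cases "0 \<le> a \<and> 0 \<le> b")
  case False
  then have "ennreal (a + b) \<le> ennreal (max a b)" by (intro ennreal_leI) auto
  also have "\<dots> \<le> ennreal a + ennreal b" by (cases "a \<le> b") (auto simp: max_def add_increasing add_increasing2)
  finally show ?thesis .
qed (simp add: ennreal_plus)

lemma Linf_norm_add:
  assumes "u \<in> borel_measurable borel" "AE x in lborel. u x = v x + w x"
  shows "Linf_norm u \<le> Linf_norm v + Linf_norm w"
  unfolding Linf_norm_def[of u]
proof (rule esssup_I)
  show "(\<lambda>x. ennreal \<bar>u x\<bar>) \<in> borel_measurable lborel" using assms(1) by simp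
  have "AE x in lborel. ennreal \<bar>v x\<bar> \<le> Linf_norm v" "AE x in lborel. ennreal \<bar>w x\<bar> \<le> Linf_norm w"
    unfolding Linf_norm_def by (rule esssup_AE)+
  then show "AE x in lborel. ennreal \<bar>u x\<bar> \<le> Linf_norm v + Linf_norm w"
    using assms(2)
  proof eventually_elim
    case (elim x)
    have "ennreal \<bar>u x\<bar> \<le> ennreal (\<bar>v x\<bar> + \<bar>w x\<bar>)" using elim(3) by (intro ennreal_leI) auto
    also have "\<dots> = ennreal \<bar>v x\<bar> + ennreal \<bar>w x\<bar>" by (simp add: ennreal_plus)
    finally show ?case using add_mono[OF elim(1,2)] by (rule order_trans)
  qed
qed

lemma L2_borel: "f \<in> L2 \<Longrightarrow> f \<in> borel_measurable borel"
  by (simp add: L2_def)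

definition hpair :: "real \<Rightarrow> (real ^ 'n \<Rightarrow> real) \<Rightarrow> real \<Rightarrow> real ^ 'n \<Rightarrow> (real ^ 'n \<Rightarrow> real) \<Rightarrow> real" where
  "hpair \<alpha> f l x \<eta> = l powr (- \<alpha>) * (LINT y|lborel. f y * (l powr (- real CARD('n)) * \<eta> ((1 / l) *\<^sub>R (y - x))))"

lemma holder_norm_neg:
  "\<alpha> < 0 \<Longrightarrow> holder_norm V \<alpha> f = (SUP l\<in>{0<..1}. SUP x. SUP \<eta>\<in>test_ball (nat (- \<lfloor>\<alpha>\<rfloor>)). ennreal (hpair \<alpha> f l x \<eta>))"
  by (simp add: holder_norm_def hpair_def)

lemma hpair_le_holder_norm:
  assumes "\<alpha> < 0" "0 < l" "l \<le> 1" "\<eta> \<in> test_ball (nat (- \<lfloor>\<alpha>\<rfloor>))"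
  shows "ennreal (hpair \<alpha> f l x \<eta>) \<le> holder_norm V \<alpha> f"
  unfolding holder_norm_neg[OF assms(1)]
  by (rule SUP_upper2[of l], use assms in simp, rule SUP_upper2[of x], simp, rule SUP_upper[OF assms(4)])

lemma holder_norm_neg_le:
  assumes "\<alpha> < 0" "\<And>l x \<eta>. 0 < l \<Longrightarrow> l \<le> 1 \<Longrightarrow> \<eta> \<in> test_ball (nat (- \<lfloor>\<alpha>\<rfloor>)) \<Longrightarrow> ennreal (hpair \<alpha> f l x \<eta>) \<le> C"
  shows "holder_norm V \<alpha> f \<le> C"
  unfolding holder_norm_neg[OF assms(1)] using assms(2) by (intro SUP_least) auto

lemma test_ball_Cbd: "\<eta> \<in> test_ball s \<Longrightarrow> Cbd s 1 \<eta>" and test_ball_Cr_c: "\<eta> \<in> test_ball s \<Longrightarrow> \<eta> \<in> Cr_c s"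
proof -
  assume \<eta>: "\<eta> \<in> test_ball s"
  then show *: "\<eta> \<in> Cr_c s" using compact_supp_cball[of \<eta>] by (auto simp: test_ball_def Cr_c_def)
  then show "Cbd s 1 \<eta>" using \<eta> by (intro Cr_norm_Cbd) (auto simp: test_ball_def)
qed

lemma scale_test_Cbd:
  assumes "\<eta> \<in> test_ball s" "0 < l" "l \<le> 1" "s' \<le> s"
  shows "Cbd s' ((1 / l) ^ s') (\<lambda>y. \<eta> ((1 / l) *\<^sub>R (y - x)))" and "(\<lambda>y. \<eta> ((1 / l) *\<^sub>R (y - x))) \<in> Cr_c s"
proof -
  have e: "(\<lambda>y. \<eta> ((1 / l) *\<^sub>R (y - x))) = (\<lambda>y. \<eta> ((1 / l) *\<^sub>R y + - ((1 / l) *\<^sub>R x)))"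
    by (simp add: scaleR_diff_right)
  show "Cbd s' ((1 / l) ^ s') (\<lambda>y. \<eta> ((1 / l) *\<^sub>R (y - x)))"
    unfolding e using Cbd_affine[OF Cbd_mono[OF test_ball_Cbd[OF assms(1)] assms(4) order_refl], of "1 / l" "1 / l" "- ((1 / l) *\<^sub>R x)"] assms(2,3)
    by simp
  show "(\<lambda>y. \<eta> ((1 / l) *\<^sub>R (y - x))) \<in> Cr_c s"
    unfolding e using assms by (intro Cr_c_affine test_ball_Cr_c) auto
qed

lemma scale_test_zero:
  assumes "\<eta> \<in> test_ball s" "0 < l" "norm (y - x) > l"
  shows "\<eta> ((1 / l) *\<^sub>R (y - x)) = 0"
proof (rule not_in_supp[where f = \<eta>])
  have "norm ((1 / l) *\<^sub>R (y - x)) > 1" using assms(2,3) by simp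
  then show "(1 / l) *\<^sub>R (y - x) \<notin> supp \<eta>" using assms(1) by (force simp: test_ball_def)
qed

lemma integral_scale_test_abs:
  fixes \<eta> :: "real ^ 'n \<Rightarrow> real"
  assumes "\<eta> \<in> test_ball s" "0 < l"
  shows "(LINT y|lborel. \<bar>\<eta> ((1 / l) *\<^sub>R (y - x))\<bar>) \<le> l ^ CARD('n) * measure lborel (cball (0 :: real ^ 'n) 1)"
proof -
  have m: "\<eta> \<in> borel_measurable borel" using Cr_c_measurable[OF test_ball_Cr_c[OF assms(1)]] .
  have "(LINT y|lborel. \<bar>\<eta> ((1 / l) *\<^sub>R (y - x))\<bar>) = (LINT y|lborel. \<bar>\<eta> ((1 / l) *\<^sub>R y + - ((1 / l) *\<^sub>R x))\<bar>)"
    by (simp add: scaleR_diff_right)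
  also have "\<dots> = (LINT y|lborel. \<bar>\<eta> y\<bar>) / \<bar>1 / l\<bar> ^ DIM(real ^ 'n)"
    using m assms(2) by (intro integral_affine[of "\<lambda>y. \<bar>\<eta> y\<bar>"]) auto
  also have "\<dots> = l ^ CARD('n) * (LINT y|lborel. \<bar>\<eta> y\<bar>)" using assms(2) by (simp add: power_divide)
  also have "(LINT y|lborel. \<bar>\<eta> y\<bar>) \<le> 1 * measure lborel (cball (0 :: real ^ 'n) 1)"
  proof -
    have "\<bar>LINT y|lborel. \<bar>\<eta> y\<bar>\<bar> \<le> 1 * measure lborel (cball (0 :: real ^ 'n) 1)"
    proof (rule integral_bound_cball)
      show "\<bar>\<eta> z\<bar> = 0" if "z \<notin> cball 0 1" for z
      proof -
        have "z \<notin> supp \<eta>" using that assms(1) by (auto simp: test_ball_def)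
        then show ?thesis by (simp add: not_in_supp)
      qed
      show "\<bar>\<bar>\<eta> z\<bar>\<bar> \<le> 1" for z using Cbd_bound[OF test_ball_Cbd[OF assms(1)]] by simp
    qed (use m in simp)
    then show ?thesis by linarith
  qed
  finally show ?thesis using assms(2) by (simp add: mult_left_mono)
qed

text \<open>The rescaled test functions have mass at most the volume of the unit ball, uniformly in
  the scale. An upper bound is enough, as \<open>ennreal\<close> sends negative pairings to
  zero.\<close>

lemma hpair_sup_bound:
  fixes f :: "real ^ 'n \<Rightarrow> real"
  assumes "\<alpha> < 0" "0 < l" "\<eta> \<in> test_ball s" "f \<in> Cr_c 0" "\<And>x. \<bar>f x\<bar> \<le> B"
  shows "hpair \<alpha> f l x \<eta> \<le> l powr (- \<alpha>) * (B * measure lborel (cball (0 :: real ^ 'n) 1))"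
proof -
  let ?\<eta> = "\<lambda>y. \<eta> ((1 / l) *\<^sub>R (y - x))"
  let ?L = "l powr (- real CARD('n))"
  have L: "?L * l ^ CARD('n) = 1" using assms(2) by (simp add: powr_minus powr_realpow)
  have B: "0 \<le> B" using assms(5)[of 0] by linarith
  have e: "?\<eta> = (\<lambda>y. \<eta> ((1 / l) *\<^sub>R y + - ((1 / l) *\<^sub>R x)))" by (simp add: scaleR_diff_right)
  have c: "?\<eta> \<in> Cr_c s" unfolding e using assms(2) by (intro Cr_c_affine test_ball_Cr_c assms(3)) auto
  have i: "integrable lborel (\<lambda>y. f y * (?L * ?\<eta> y))"
    by (intro integrable_Cc_mult[OF assms(4)] continuous_on_mult continuous_on_const Cr_c_continuous[OF c])
  have i2: "integrable lborel (\<lambda>y. B * ?L * \<bar>?\<eta> y\<bar>)"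
    using integrable_Cc[OF c] by (intro integrable_mult_right) simp
  have "(LINT y|lborel. f y * (?L * ?\<eta> y)) \<le> (LINT y|lborel. B * ?L * \<bar>?\<eta> y\<bar>)"
  proof (rule integral_mono[OF i i2])
    fix y
    have "f y * (?L * ?\<eta> y) \<le> \<bar>f y\<bar> * (?L * \<bar>?\<eta> y\<bar>)"
      using abs_ge_self[of "f y * (?L * ?\<eta> y)"] by (simp add: abs_mult)
    also have "\<dots> \<le> B * (?L * \<bar>?\<eta> y\<bar>)" by (intro mult_right_mono assms(5)) auto
    finally show "f y * (?L * ?\<eta> y) \<le> B * ?L * \<bar>?\<eta> y\<bar>" by (simp add: mult.assoc)
  qed
  also have "\<dots> = B * ?L * (LINT y|lborel. \<bar>?\<eta> y\<bar>)" by simp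
  also have "\<dots> \<le> B * ?L * (l ^ CARD('n) * measure lborel (cball (0 :: real ^ 'n) 1))"
    using B by (intro mult_left_mono integral_scale_test_abs[OF assms(3,2)]) auto
  also have "\<dots> = B * measure lborel (cball (0 :: real ^ 'n) 1)"
  proof -
    have "B * ?L * (l ^ CARD('n) * measure lborel (cball (0 :: real ^ 'n) 1)) = (?L * l ^ CARD('n)) * (B * measure lborel (cball (0 :: real ^ 'n) 1))"
      by (simp only: mult_ac)
    then show ?thesis by (simp only: L mult_1)
  qed
  finally show ?thesis unfolding hpair_def by (intro mult_left_mono) auto
qed

text \<open>Index \<open>0\<close> stands for the scaling function, which only occurs at level \<open>0\<close>.\<close>

definition levels :: "nat set \<Rightarrow> nat \<Rightarrow> nat set" where
  "levels I n = (if n = 0 then insert 0 I else I)"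

context wavelets
begin

definition gen :: "nat \<Rightarrow> real ^ 'n \<Rightarrow> real" where
  "gen i = (if i = 0 then \<phi> else \<psi> i)"

lemma finite_levels [simp]: "finite (levels II n)"
  by (simp add: levels_def)

lemma zero_notin_II: "0 \<notin> II"
  by (simp add: II_def)

lemma gen_II: "i \<in> II \<Longrightarrow> gen i = \<psi> i"
  by (auto simp: gen_def zero_notin_II)

lemma levels_subset: "levels II n \<subseteq> insert 0 II"
  by (auto simp: levels_def)

lemma gen_Cr_c: "i \<in> insert 0 II \<Longrightarrow> gen i \<in> Cr_c r"
  using \<phi> \<psi> by (auto simp: gen_def)

lemma gen_supp: "i \<in> insert 0 II \<Longrightarrow> supp (gen i) \<subseteq> cball 0 \<rho>"
  using \<rho> by (auto simp: gen_def)

lemma gen_vanish: "i \<in> levels II n \<Longrightarrow> n \<noteq> 0 \<Longrightarrow> s \<le> Suc r \<Longrightarrow> vanish s (gen i)"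
  using vanish_\<psi>[of i s] by (simp add: levels_def gen_II)

lemma gen_bounds: "\<exists>A>0. \<forall>i\<in>insert 0 II. Cbd r A (gen i) \<and> (LINT y|lborel. \<bar>gen i y\<bar>) \<le> A"
proof -
  have "\<exists>A>0. Cbd r A (gen i) \<and> (LINT y|lborel. \<bar>gen i y\<bar>) \<le> A" if i: "i \<in> insert 0 II" for i
  proof -
    obtain A where "A > 0" "Cbd r A (gen i)" using Cr_c_Cbd[OF gen_Cr_c[OF i]] by auto
    then show ?thesis
      by (intro exI[of _ "max A (LINT y|lborel. \<bar>gen i y\<bar>)"]) (auto intro: Cbd_mono)
  qed
  then obtain A where A: "\<And>i. i \<in> insert 0 II \<Longrightarrow> A i > 0 \<and> Cbd r (A i) (gen i) \<and> (LINT y|lborel. \<bar>gen i y\<bar>) \<le> A i"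
    by metis
  let ?A = "\<Sum>i\<in>insert 0 II. A i"
  have le: "A i \<le> ?A" if "i \<in> insert 0 II" for i
    by (rule member_le_sum) (use that A in \<open>auto intro: less_imp_le\<close>)
  have "?A > 0" using A le[of 0] by force
  moreover have "Cbd r ?A (gen i) \<and> (LINT y|lborel. \<bar>gen i y\<bar>) \<le> ?A" if "i \<in> insert 0 II" for i
    using A[OF that] le[OF that] Cbd_mono order_trans by blast
  ultimately show ?thesis by blast
qed

definition A :: real where
  "A = (SOME A. A > 0 \<and> (\<forall>i\<in>insert 0 II. Cbd r A (gen i) \<and> (LINT y|lborel. \<bar>gen i y\<bar>) \<le> A))"

lemma A: "A > 0" "i \<in> insert 0 II \<Longrightarrow> Cbd r A (gen i)" "i \<in> insert 0 II \<Longrightarrow> (LINT y|lborel. \<bar>gen i y\<bar>) \<le> A"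
  using someI_ex[OF gen_bounds] unfolding A_def[symmetric] by auto

definition N0 :: real where "N0 = (2 * \<rho> + 1) ^ CARD('n)"

lemma N0: "N0 > 0" using \<rho>(1) by (simp add: N0_def)

lemma gen_coefficient_decay:
  assumes "i \<in> insert 0 II" "vanish s (gen i)" "Cbd s B h"
  shows "\<bar>L2_inner h (scaled (gen i) n k)\<bar> \<le> (real CARD('n) * \<rho>) ^ s * A * B / (2 ^ n) ^ s / 2 powr (real (CARD('n) * n) / 2)"
proof -
  have B: "0 \<le> B" using Cbd_nonneg[OF assms(3)] .
  have "\<bar>L2_inner h (scaled (gen i) n k)\<bar> \<le> (real CARD('n) * \<rho>) ^ s * (LINT y|lborel. \<bar>gen i y\<bar>) * B / (2 ^ n) ^ s / 2 powr (real (CARD('n) * n) / 2)"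
    using \<rho>(1) by (intro coefficient_decay Cr_c0[OF gen_Cr_c[OF assms(1)]] assms gen_supp) auto
  also have "\<dots> \<le> (real CARD('n) * \<rho>) ^ s * A * B / (2 ^ n) ^ s / 2 powr (real (CARD('n) * n) / 2)"
    using B \<rho>(1) A(3)[OF assms(1)] by (intro divide_right_mono mult_right_mono mult_left_mono) auto
  finally show ?thesis .
qed

text \<open>The choice in \<open>L2_proj\<close> is additive only almost everywhere; this is read
  off from finite expansions over a common index set.\<close>

lemma L2_proj_add:
  assumes "f \<in> Cr_c 0" "g \<in> Cr_c 0"
  shows "Linf_norm (L2_proj (V (int n)) (\<lambda>x. f x + g x)) \<le> Linf_norm (L2_proj (V (int n)) f) + Linf_norm (L2_proj (V (int n)) g)" (is ?V)
    and "Linf_norm (L2_proj (wavelet_space V (int n)) (\<lambda>x. f x + g x))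
      \<le> Linf_norm (L2_proj (wavelet_space V (int n)) f) + Linf_norm (L2_proj (wavelet_space V (int n)) g)" (is ?W)
proof -
  have fg: "(\<lambda>x. f x + g x) \<in> Cr_c 0" by (rule Cr_c_add[OF assms])
  obtain R1 R2 R3 where "supp f \<subseteq> cball 0 R1" "supp g \<subseteq> cball 0 R2" "supp (\<lambda>x. f x + g x) \<subseteq> cball 0 R3"
    using Cr_c_supp[OF assms(1)] Cr_c_supp[OF assms(2)] Cr_c_supp[OF fg] by meson
  then have R: "supp f \<subseteq> cball 0 (max R1 (max R2 R3))" "supp g \<subseteq> cball 0 (max R1 (max R2 R3))" "supp (\<lambda>x. f x + g x) \<subseteq> cball 0 (max R1 (max R2 R3))"
    by (auto intro: order_trans)
  have inner: "L2_inner (\<lambda>x. f x + g x) (scaled \<theta> n k) = L2_inner f (scaled \<theta> n k) + L2_inner g (scaled \<theta> n k)"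
    if "\<theta> \<in> Cr_c r" for \<theta> k
    using integrable_Cc_mult[OF assms(1) Cr_c_continuous[OF scaled_Cr_c[OF that]]]
      integrable_Cc_mult[OF assms(2) Cr_c_continuous[OF scaled_Cr_c[OF that]]]
    by (simp add: L2_inner_def distrib_right)
  note pV = proj_V[OF assms(1) R(1) order_refl, of n] proj_V[OF assms(2) R(2) order_refl, of n] proj_V[OF fg R(3) order_refl, of n]
  note pW = proj_W[OF assms(1) R(1) order_refl, of n] proj_W[OF assms(2) R(2) order_refl, of n] proj_W[OF fg R(3) order_refl, of n]
  show ?V
  proof (rule Linf_norm_add[OF L2_borel[OF pV(6)]])
    show "AE x in lborel. L2_proj (V (int n)) (\<lambda>x. f x + g x) x = L2_proj (V (int n)) f x + L2_proj (V (int n)) g x"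
      using pV(1) pV(3) pV(5) by eventually_elim (simp add: inner[OF \<phi>] sum.distrib distrib_right)
  qed
  show ?W
  proof (rule Linf_norm_add[OF L2_borel[OF pW(6)]])
    show "AE x in lborel. L2_proj (wavelet_space V (int n)) (\<lambda>x. f x + g x) x
       = L2_proj (wavelet_space V (int n)) f x + L2_proj (wavelet_space V (int n)) g x"
      using pW(1) pW(3) pW(5) by eventually_elim (simp add: inner[OF \<psi>] sum.distrib distrib_right)
  qed
qed

lemma holder_norm_triangle:
  assumes "f \<in> Cr_c 0" "g \<in> Cr_c 0"
  shows "holder_norm V \<alpha> (\<lambda>x. f x + g x) \<le> holder_norm V \<alpha> f + holder_norm V \<alpha> g"
proof (cases "\<alpha> < 0")
  case True
  show ?thesis
  proof (rule holder_norm_neg_le[OF True])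
    fix l :: real and x and \<eta> :: "real ^ 'n \<Rightarrow> real"
    assume l: "0 < l" "l \<le> 1" and \<eta>: "\<eta> \<in> test_ball (nat (- \<lfloor>\<alpha>\<rfloor>))"
    have c: "continuous_on UNIV (\<lambda>y. l powr (- real CARD('n)) * \<eta> ((1 / l) *\<^sub>R (y - x)))"
      by (intro continuous_on_mult continuous_on_const Cr_c_continuous[OF scale_test_Cbd(2)[OF \<eta> l]]) auto
    have "hpair \<alpha> (\<lambda>x. f x + g x) l x \<eta> = hpair \<alpha> f l x \<eta> + hpair \<alpha> g l x \<eta>"
      unfolding hpair_def using integrable_Cc_mult[OF assms(1) c] integrable_Cc_mult[OF assms(2) c]
      by (simp add: distrib_right distrib_left)
    then have "ennreal (hpair \<alpha> (\<lambda>x. f x + g x) l x \<eta>) \<le> ennreal (hpair \<alpha> f l x \<eta>) + ennreal (hpair \<alpha> g l x \<eta>)"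
      using ennreal_add_le by simp
    also have "\<dots> \<le> holder_norm V \<alpha> f + holder_norm V \<alpha> g"
      by (intro add_mono hpair_le_holder_norm True l \<eta>)
    finally show "ennreal (hpair \<alpha> (\<lambda>x. f x + g x) l x \<eta>) \<le> holder_norm V \<alpha> f + holder_norm V \<alpha> g" .
  qed
next
  case False
  let ?S = "\<lambda>f. SUP n::nat. ennreal (2 powr (\<alpha> * real n)) * Linf_norm (L2_proj (wavelet_space V (int n)) f)"
  have "?S (\<lambda>x. f x + g x) \<le> ?S f + ?S g"
  proof (rule SUP_least)
    fix n :: nat
    have "ennreal (2 powr (\<alpha> * real n)) * Linf_norm (L2_proj (wavelet_space V (int n)) (\<lambda>x. f x + g x))
      \<le> ennreal (2 powr (\<alpha> * real n)) * Linf_norm (L2_proj (wavelet_space V (int n)) f)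
        + ennreal (2 powr (\<alpha> * real n)) * Linf_norm (L2_proj (wavelet_space V (int n)) g)"
      unfolding distrib_left[symmetric] by (intro mult_left_mono L2_proj_add assms) auto
    also have "\<dots> \<le> ?S f + ?S g" by (intro add_mono SUP_upper UNIV_I)
    finally show "ennreal (2 powr (\<alpha> * real n)) * Linf_norm (L2_proj (wavelet_space V (int n)) (\<lambda>x. f x + g x)) \<le> ?S f + ?S g" .
  qed
  from add_mono[OF L2_proj_add(1)[OF assms, of 0] this]
  show ?thesis using False by (simp add: holder_norm_def ac_simps)
qed

lemma coefficient_sum_bound:
  assumes "i \<in> insert 0 II" "\<And>k. k \<in> K \<Longrightarrow> \<bar>c k\<bar> \<le> m" "0 \<le> m" "finite K" "K \<subseteq> int_lattice"
  shows "\<bar>\<Sum>k\<in>K. c k * scaled (gen i) n k x\<bar> \<le> N0 * A * m * 2 powr (real (CARD('n) * n) / 2)"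
  unfolding N0_def
  by (rule sum_scaled_bound[OF gen_supp[OF assms(1)] less_imp_le[OF \<rho>(1)] Cbd_bound[OF A(2)[OF assms(1)]] assms(4,5,2,3)])

text \<open>For \<open>j \<le> n\<close> the projection at level \<open>j\<close> is bounded by the supremum of \<open>h\<close>, for \<open>j > n\<close>
  by the decay of wavelet coefficients of order \<open>r\<close>.\<close>

lemma holder_norm_nonneg_bound:
  assumes \<alpha>: "0 \<le> \<alpha>" "\<alpha> < real r" and h: "h \<in> Cr_c r" "\<And>x. \<bar>h x\<bar> \<le> B" "Cbd r (B * 2 ^ (n * r)) h"
  shows "holder_norm V \<alpha> h \<le> ennreal ((1 + real (card II) * max 1 ((real CARD('n) * \<rho>) ^ r)) * (N0 * A * A) * B * 2 powr (real n * \<alpha>))"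
proof -
  have B: "0 \<le> B" using h(2)[of 0] by linarith
  have h0: "h \<in> Cr_c 0" using Cr_c0[OF h(1)] .
  have hB: "Cbd 0 B h" using h(2) Cr_c_continuous[OF h(1)] by (simp add: Cbd.simps)
  obtain R where R: "supp h \<subseteq> cball 0 R" using Cr_c_supp[OF h(1)] by auto
  define D where "D = max 1 ((real CARD('n) * \<rho>) ^ r)"
  have D: "D \<ge> 1" by (simp add: D_def)
  define E where "E = N0 * A * A * B"
  have E: "E \<ge> 0" using N0 A(1) B by (simp add: E_def)
  let ?c = "\<lambda>j. 2 powr (real (CARD('n) * j) / 2)"
  have c0: "\<bar>L2_inner h (scaled (gen i) j k)\<bar> \<le> A * B / ?c j" if "i \<in> insert 0 II" for i j k
    using gen_coefficient_decay[OF that vanish_0 hB, of j k] by simp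
  have one: "1 \<le> 2 powr (real n * \<alpha>)" using \<alpha> by (simp add: ge_one_powr_ge_zero)
  have "Linf_norm (L2_proj (V (int 0)) h) \<le> ennreal E"
  proof (rule Linf_norm_le)
    note p = proj_V[OF h0 R order_refl, of 0]
    show "L2_proj (V (int 0)) h \<in> borel_measurable borel" using L2_borel[OF p(2)] .
    show "AE x in lborel. \<bar>L2_proj (V (int 0)) h x\<bar> \<le> E"
      using p(1)
    proof eventually_elim
      case (elim x)
      have "\<bar>\<Sum>k\<in>lat (2 ^ 0 * R + \<rho>). L2_inner h (scaled (gen 0) 0 k) * scaled (gen 0) 0 k x\<bar> \<le> N0 * A * (A * B / ?c 0) * ?c 0"
        using A(1) B by (intro coefficient_sum_bound c0 near_finite near_int_lattice) auto
      then show ?case using elim by (simp add: gen_def E_def mult_ac)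
    qed
  qed
  also have "\<dots> \<le> ennreal (E * 2 powr (real n * \<alpha>))"
    using mult_left_mono[OF one E] by (intro ennreal_leI) simp
  finally have V0: "Linf_norm (L2_proj (V 0) h) \<le> ennreal (E * 2 powr (real n * \<alpha>))" by simp
  have W: "ennreal (2 powr (\<alpha> * real j)) * Linf_norm (L2_proj (wavelet_space V (int j)) h)
      \<le> ennreal (real (card II) * D * E * 2 powr (real n * \<alpha>))" for j
  proof -
    \<comment> \<open>Two bounds at once: the supremum of \<open>h\<close> gives the 1, and
      \<open>r\<close> vanishing moments give the power of two. They cross at
      \<open>j = n\<close>.\<close>
    define m where "m = D * A * B / ?c j * min 1 (2 powr (real r * (real n - real j)))"
    have m0: "0 \<le> m" using D A(1) B by (simp add: m_def)
    have cm: "\<bar>L2_inner h (scaled (gen i) j k)\<bar> \<le> m" if i: "i \<in> II" for i k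
    proof -
      have "\<bar>L2_inner h (scaled (gen i) j k)\<bar> \<le> A * B / ?c j" using c0[of i j k] i by simp
      also have "\<dots> \<le> D * A * B / ?c j"
        using mult_right_mono[OF D, of "A * B"] A(1) B by (intro divide_right_mono) (auto simp: mult.assoc)
      finally have 1: "\<bar>L2_inner h (scaled (gen i) j k)\<bar> \<le> D * A * B / ?c j" .
      have v: "vanish r (gen i)" using vanish_\<psi>[OF i, of r] gen_II[OF i] by simp
      have "\<bar>L2_inner h (scaled (gen i) j k)\<bar> \<le> (real CARD('n) * \<rho>) ^ r * A * (B * 2 ^ (n * r)) / (2 ^ j) ^ r / ?c j"
        using gen_coefficient_decay[OF _ v h(3)] i by blast
      also have "\<dots> \<le> D * A * (B * 2 ^ (n * r)) / (2 ^ j) ^ r / ?c j"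
        using A(1) B by (intro divide_right_mono mult_right_mono) (auto simp: D_def)
      also have "\<dots> = D * A * B / ?c j * (2 ^ (n * r) / 2 ^ (j * r))" by (simp add: power_mult mult_ac)
      also have "2 ^ (n * r) / 2 ^ (j * r) = (2 :: real) powr (real r * (real n - real j))"
        by (simp add: powr_diff powr_realpow[symmetric] right_diff_distrib mult.commute)
      finally have 2: "\<bar>L2_inner h (scaled (gen i) j k)\<bar> \<le> D * A * B / ?c j * 2 powr (real r * (real n - real j))" .
      show ?thesis using 1 2 by (auto simp: m_def min_def)
    qed
    have "Linf_norm (L2_proj (wavelet_space V (int j)) h) \<le> ennreal (real (card II) * (N0 * A * m * ?c j))"
    proof (rule Linf_norm_le)
      note p = proj_W[OF h0 R order_refl, of j]
      show "L2_proj (wavelet_space V (int j)) h \<in> borel_measurable borel" using L2_borel[OF p(2)] .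
      show "AE x in lborel. \<bar>L2_proj (wavelet_space V (int j)) h x\<bar> \<le> real (card II) * (N0 * A * m * ?c j)"
        using p(1)
      proof eventually_elim
        case (elim x)
        have "\<bar>\<Sum>i\<in>II. \<Sum>k\<in>lat (2 ^ j * R + \<rho>). L2_inner h (scaled (gen i) j k) * scaled (gen i) j k x\<bar>
           \<le> (\<Sum>i\<in>II. \<bar>\<Sum>k\<in>lat (2 ^ j * R + \<rho>). L2_inner h (scaled (gen i) j k) * scaled (gen i) j k x\<bar>)"
          by (rule sum_abs)
        also have "\<dots> \<le> (\<Sum>i\<in>II. N0 * A * m * ?c j)"
          by (intro sum_mono coefficient_sum_bound cm m0 near_finite near_int_lattice) auto
        finally show ?case using elim by (simp add: gen_II)
      qed
    qed
    then have "ennreal (2 powr (\<alpha> * real j)) * Linf_norm (L2_proj (wavelet_space V (int j)) h)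
       \<le> ennreal (2 powr (\<alpha> * real j)) * ennreal (real (card II) * (N0 * A * m * ?c j))"
      by (intro mult_left_mono) auto
    also have "\<dots> = ennreal (2 powr (\<alpha> * real j) * (real (card II) * (N0 * A * m * ?c j)))"
      using N0 A(1) m0 by (intro ennreal_mult[symmetric]) auto
    also have "2 powr (\<alpha> * real j) * (real (card II) * (N0 * A * m * ?c j))
       = real (card II) * D * E * (2 powr (\<alpha> * real j) * min 1 (2 powr (real r * (real n - real j))))"
      by (simp add: m_def E_def mult_ac)
    \<comment> \<open>Up to level n the weight is largest at \<open>j = n\<close> since \<alpha>
      \<ge> 0; beyond it the decay of order r beats the weight since \<alpha> < r.\<close>
    also have "2 powr (\<alpha> * real j) * min 1 (2 powr (real r * (real n - real j))) \<le> 2 powr (real n * \<alpha>)"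
    proof (cases "j \<le> n")
      case True
      have "2 powr (\<alpha> * real j) * min 1 (2 powr (real r * (real n - real j))) \<le> 2 powr (\<alpha> * real j) * 1"
        by (intro mult_left_mono) auto
      also have "\<dots> \<le> 2 powr (real n * \<alpha>)" using True \<alpha> by (simp add: mult.commute mult_left_mono)
      finally show ?thesis .
    next
      case False
      have "2 powr (\<alpha> * real j) * min 1 (2 powr (real r * (real n - real j))) \<le> 2 powr (\<alpha> * real j) * 2 powr (real r * (real n - real j))"
        by (intro mult_left_mono) auto
      also have "\<dots> = 2 powr (\<alpha> * real j + real r * (real n - real j))" by (simp add: powr_add)
      also have "\<dots> \<le> 2 powr (real n * \<alpha>)"
      proof (rule powr_mono)
        have "(real r - \<alpha>) * (real n - real j) \<le> 0" using False \<alpha> by (intro mult_nonneg_nonpos) auto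
        then show "\<alpha> * real j + real r * (real n - real j) \<le> real n * \<alpha>" by (simp add: algebra_simps)
      qed simp
      finally show ?thesis .
    qed
    finally show ?thesis using D E by (simp add: mult_left_mono ennreal_leI)
  qed
  have "holder_norm V \<alpha> h \<le> ennreal (E * 2 powr (real n * \<alpha>)) + ennreal (real (card II) * D * E * 2 powr (real n * \<alpha>))"
  proof -
    have "(\<alpha> < 0) = False" using \<alpha> by simp
    then show ?thesis unfolding holder_norm_def by (simp only: if_False) (intro add_mono V0 SUP_least W)
  qed
  also have "\<dots> = ennreal (E * 2 powr (real n * \<alpha>) + real (card II) * D * E * 2 powr (real n * \<alpha>))"
    using D E by (intro ennreal_plus[symmetric]) auto
  finally show ?thesis by (simp add: D_def E_def algebra_simps)
qed

end

section \<open>Contribution of a single level to norms and pairings\<close>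

context wavelets
begin

lemma levels_pos: "i \<in> levels II n \<Longrightarrow> i \<in> insert 0 II"
  using levels_subset by blast

definition gsum :: "nat \<Rightarrow> nat \<Rightarrow> (real ^ 'n) set \<Rightarrow> (real ^ 'n \<Rightarrow> real) \<Rightarrow> real ^ 'n \<Rightarrow> real" where
  "gsum i n K c x = (\<Sum>k\<in>K. c k * scaled (gen i) n k x)"

lemma gsum_Cr_c:
  assumes "i \<in> insert 0 II" "finite K"
  shows "gsum i n K c \<in> Cr_c r"
  unfolding gsum_def[abs_def] by (intro Cr_c_sum Cr_c_cmult scaled_Cr_c gen_Cr_c assms)

lemma gsum_bound:
  assumes "i \<in> insert 0 II" "finite K" "K \<subseteq> int_lattice" "1 \<le> p"
  shows "\<bar>gsum i n K c x\<bar> \<le> N0 * A * lp p K c * 2 powr (real (CARD('n) * n) / 2)"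
    and "Cbd r (N0 * A * lp p K c * 2 powr (real (CARD('n) * n) / 2) * 2 ^ (n * r)) (gsum i n K c)"
proof -
  show "\<bar>gsum i n K c x\<bar> \<le> N0 * A * lp p K c * 2 powr (real (CARD('n) * n) / 2)"
    unfolding gsum_def by (intro coefficient_sum_bound assms abs_le_lp lp_nonneg)
  show "Cbd r (N0 * A * lp p K c * 2 powr (real (CARD('n) * n) / 2) * 2 ^ (n * r)) (gsum i n K c)"
    unfolding gsum_def[abs_def] N0_def
    by (rule sum_scaled_Cbd[OF gen_supp[OF assms(1)] less_imp_le[OF \<rho>(1)] A(2)[OF assms(1)] assms(2,3) abs_le_lp[OF assms(2) _ assms(4)] lp_nonneg])
qed

text \<open>Controls the mollification errors of \<open>appr\<close> and gives finiteness of the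
  norm on test functions. For \<alpha> \<ge> 0 it is \<open>holder_norm_nonneg_bound\<close> at
  scale one, that is with n = 0.\<close>

lemma holder_norm_smooth:
  assumes \<alpha>: "\<alpha> < real r" and \<kappa>: "\<kappa> \<in> Cinf_c"
  shows "\<exists>C\<ge>0. \<forall>e u. Cbd r e u \<longrightarrow> holder_norm V \<alpha> (\<lambda>x. \<kappa> x * u x) \<le> ennreal (C * e)"
proof -
  obtain X where X: "X > 0" "Cbd r X \<kappa>" using Cr_c_Cbd[OF Cinf_c_D[OF \<kappa>]] by auto
  have h: "(\<lambda>x. \<kappa> x * u x) \<in> Cr_c r" "Cbd r (2 ^ r * X * e) (\<lambda>x. \<kappa> x * u x)" if "Cbd r e u" for e u
    using Cr_c_mult[OF Cinf_c_D[OF \<kappa>] Cbd_Cr[OF that]] Cbd_mult[OF X(2) that] by auto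
  show ?thesis
  proof (cases "\<alpha> < 0")
    case True
    let ?v = "measure lborel (cball (0 :: real ^ 'n) 1)"
    have "holder_norm V \<alpha> (\<lambda>x. \<kappa> x * u x) \<le> ennreal (2 ^ r * X * ?v * e)" if u: "Cbd r e u" for e u
    proof (rule holder_norm_neg_le[OF True])
      fix l :: real and x and \<eta> :: "real ^ 'n \<Rightarrow> real"
      assume l: "0 < l" "l \<le> 1" and \<eta>: "\<eta> \<in> test_ball (nat (- \<lfloor>\<alpha>\<rfloor>))"
      have e: "0 \<le> e" using Cbd_nonneg[OF u] .
      have "hpair \<alpha> (\<lambda>x. \<kappa> x * u x) l x \<eta> \<le> l powr (- \<alpha>) * (2 ^ r * X * e * ?v)"
        by (rule hpair_sup_bound[OF True l(1) \<eta> Cr_c0[OF h(1)[OF u]] Cbd_bound[OF h(2)[OF u]]])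
      also have "\<dots> \<le> 1 * (2 ^ r * X * e * ?v)"
        using True l e X by (intro mult_right_mono powr_le1) auto
      finally show "ennreal (hpair \<alpha> (\<lambda>x. \<kappa> x * u x) l x \<eta>) \<le> ennreal (2 ^ r * X * ?v * e)"
        by (intro ennreal_leI) (simp add: mult_ac)
    qed
    then show ?thesis using X by (intro exI[of _ "2 ^ r * X * ?v"]) auto
  next
    case False
    define C where "C = (1 + real (card II) * max 1 ((real CARD('n) * \<rho>) ^ r)) * (N0 * A * A) * (2 ^ r * X)"
    have "holder_norm V \<alpha> (\<lambda>x. \<kappa> x * u x) \<le> ennreal (C * e)" if u: "Cbd r e u" for e u
    proof -
      have "Cbd r (2 ^ r * X * e * 2 ^ (0 * r)) (\<lambda>x. \<kappa> x * u x)" using h(2)[OF u] by simp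
      from holder_norm_nonneg_bound[OF _ \<alpha> h(1)[OF u] Cbd_bound[OF h(2)[OF u]] this] False
      show ?thesis by (simp add: C_def mult_ac)
    qed
    moreover have "0 \<le> C" using N0 A(1) X by (simp add: C_def)
    ultimately show ?thesis by blast
  qed
qed

text \<open>The rate gained per level. The first entry is the room between \<alpha> and the exponent
  \<open>\<beta> - d / p\<close> of the Besov embedding; the second is what remains when a function
  of class \<open>C\<^sup>r\<close> and scale one is tested against the wavelets of a level.\<close>

definition order_gap :: "real \<Rightarrow> real \<Rightarrow> real \<Rightarrow> real" where
  "order_gap \<alpha> \<beta> p = min (\<beta> - real CARD('n) / p - \<alpha>) (real r + \<beta>)"

text \<open>The decay exponent of the \<open>l\<^sup>p\<close> norm of the level n coefficients:
  \<beta> is the assumed decay, \<open>d / 2\<close> accounts for the \<open>L\<^sup>2\<close>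
  normalisation, and \<open>d / p\<close> is lost by summing about 2^(n d) terms.\<close>

definition wt :: "real \<Rightarrow> real \<Rightarrow> real" where
  "wt \<beta> p = \<beta> + real CARD('n) / 2 - real CARD('n) / p"

text \<open>The \<open>l\<^sup>p\<close> norm enters as a bound on the largest coefficient. The
  product with \<kappa> then behaves like a function varying at scale 2^(-n), the situation of
  \<open>holder_norm_nonneg_bound\<close>.\<close>

lemma level_bound_nonneg:
  assumes \<alpha>: "0 \<le> \<alpha>" "\<alpha> < real r" and p: "1 \<le> p" and \<kappa>: "\<kappa> \<in> Cinf_c"
  shows "\<exists>C\<ge>0. \<forall>n i K c. i \<in> levels II n \<longrightarrow> finite K \<longrightarrow> K \<subseteq> int_lattice \<longrightarrow>
    holder_norm V \<alpha> (\<lambda>x. \<kappa> x * gsum i n K c x) \<le> ennreal (C * 2 powr (real n * (wt \<beta> p - order_gap \<alpha> \<beta> p)) * lp p K c)"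
proof -
  obtain X where X: "X > 0" "Cbd r X \<kappa>" using Cr_c_Cbd[OF Cinf_c_D[OF \<kappa>]] by auto
  define C where "C = (1 + real (card II) * max 1 ((real CARD('n) * \<rho>) ^ r)) * (N0 * A * A) * (2 ^ r * X * (N0 * A))"
  have C: "0 \<le> C" using N0 A(1) X by (simp add: C_def)
  have "holder_norm V \<alpha> (\<lambda>x. \<kappa> x * gsum i n K c x) \<le> ennreal (C * 2 powr (real n * (wt \<beta> p - order_gap \<alpha> \<beta> p)) * lp p K c)"
    if i: "i \<in> levels II n" and K: "finite K" "K \<subseteq> int_lattice" for n i K c
  proof -
    let ?c = "2 powr (real (CARD('n) * n) / 2)" and ?q = "lp p K c"
    have q: "0 \<le> ?q" by (rule lp_nonneg)
    note g = gsum_bound[OF levels_pos[OF i] K p]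
    define B where "B = 2 ^ r * X * (N0 * A * ?q * ?c)"
    have B0: "N0 * A * ?q * ?c \<ge> 0" using N0 A(1) q by simp
    have 1: "(\<lambda>x. \<kappa> x * gsum i n K c x) \<in> Cr_c r"
      by (rule Cr_c_mult[OF Cinf_c_D[OF \<kappa>]]) (rule Cbd_Cr[OF g(2)])
    have 2: "\<bar>\<kappa> x * gsum i n K c x\<bar> \<le> B" for x
    proof -
      have "\<bar>\<kappa> x * gsum i n K c x\<bar> \<le> X * (N0 * A * ?q * ?c)"
        unfolding abs_mult using X by (intro mult_mono g(1) Cbd_bound[OF X(2)]) auto
      also have "\<dots> \<le> 2 ^ r * (X * (N0 * A * ?q * ?c))"
        using X B0 mult_right_mono[of 1 "2 ^ r" "X * (N0 * A * ?q * ?c)"] by simp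
      finally show ?thesis by (simp add: B_def mult.assoc)
    qed
    have 3: "Cbd r (B * 2 ^ (n * r)) (\<lambda>x. \<kappa> x * gsum i n K c x)"
      using Cbd_mult[OF X(2) g(2)] by (simp add: B_def mult_ac)
    have "holder_norm V \<alpha> (\<lambda>x. \<kappa> x * gsum i n K c x)
      \<le> ennreal ((1 + real (card II) * max 1 ((real CARD('n) * \<rho>) ^ r)) * (N0 * A * A) * B * 2 powr (real n * \<alpha>))"
      by (rule holder_norm_nonneg_bound[OF \<alpha> 1 2 3])
    also have "\<dots> = ennreal (C * ?q * (?c * 2 powr (real n * \<alpha>)))" by (simp add: C_def B_def mult_ac)
    also have "?c * 2 powr (real n * \<alpha>) = 2 powr (real n * (real CARD('n) / 2 + \<alpha>))"
      by (simp add: powr_add[symmetric] algebra_simps)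
    also have "ennreal (C * ?q * 2 powr (real n * (real CARD('n) / 2 + \<alpha>)))
       \<le> ennreal (C * ?q * 2 powr (real n * (wt \<beta> p - order_gap \<alpha> \<beta> p)))"
      using C q by (intro ennreal_leI mult_left_mono powr_mono) (auto simp: wt_def order_gap_def)
    finally show ?thesis by (simp add: mult_ac)
  qed
  then show ?thesis using C by blast
qed

lemma mult_max_le: "X * a * q \<le> Z \<Longrightarrow> X * b * q \<le> Z \<Longrightarrow> X * q * max a b \<le> (Z :: real)"
  by (cases "a \<le> b") (simp_all add: max_def mult_ac)

text \<open>A power is monotone, so on the interval from 1 to y it is largest at an
  endpoint.\<close>

lemma powr_le_max: "1 \<le> t \<Longrightarrow> t \<le> y \<Longrightarrow> (t :: real) powr a \<le> max 1 (y powr a)"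
proof (cases "0 \<le> a")
  case True
  assume "1 \<le> t" "t \<le> y"
  then have "t powr a \<le> y powr a" using True by (intro powr_mono2) auto
  then show ?thesis by simp
next
  case False
  assume "1 \<le> t" "t \<le> y"
  then have "t powr a \<le> t powr 0" using False by (intro powr_mono) auto
  then show ?thesis using \<open>1 \<le> t\<close> by simp
qed

text \<open>Test functions at scale \<open>l \<le> 2\<^sup>-\<^sup>n\<close> only see the supremum of the sum, those at a
  coarser scale see the vanishing moments of the wavelets, and only the \<open>(2\<^sup>n l)\<^sup>d\<close> wavelets
  meeting their support matter.\<close>

lemma level_bound_neg:
  assumes \<alpha>: "\<alpha> < 0" "\<alpha> < \<beta> - real CARD('n) / p" and p: "1 \<le> p" and \<kappa>: "\<kappa> \<in> Cinf_c"
  shows "\<exists>C\<ge>0. \<forall>n i K c. i \<in> levels II n \<longrightarrow> finite K \<longrightarrow> K \<subseteq> int_lattice \<longrightarrow>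
    holder_norm V \<alpha> (\<lambda>x. \<kappa> x * gsum i n K c x) \<le> ennreal (C * 2 powr (real n * (wt \<beta> p - order_gap \<alpha> \<beta> p)) * lp p K c)"
proof -
  let ?d = "real CARD('n)"
  define r0 where "r0 = nat (- \<lfloor>\<alpha>\<rfloor>)"
  \<comment> \<open>The usable order of cancellation is limited both by the \<open>r0\<close>
    derivatives of a test function and by the regularity \<open>r\<close> of the wavelets.\<close>
  define s where "s = min r r0"
  have r0: "- \<alpha> \<le> real r0" using \<alpha>(1) unfolding r0_def by linarith
  define \<delta> where "\<delta> = order_gap \<alpha> \<beta> p"
  have dp: "?d / p \<ge> 0" using p by simp
  have \<delta>1: "\<delta> \<le> \<beta> - ?d / p - \<alpha>" by (simp add: \<delta>_def order_gap_def)
  have \<delta>2: "\<delta> \<le> \<beta> + real s" using r0 dp unfolding \<delta>_def order_gap_def s_def by (auto simp: min_def)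
  obtain X where X: "X > 0" "Cbd s X \<kappa>" using Cr_c_Cbd[OF Cinf_c_D[OF \<kappa>]] by auto
  let ?v = "measure lborel (cball (0 :: real ^ 'n) 1)"
  define C1 where "C1 = X * (N0 * A) * ?v"
  \<comment> \<open>Chosen so that \<open>2 * (t + \<rho>) + 1 \<le> N1 * t\<close> for t at least
    1.\<close>
  define N1 where "N1 = 3 + 2 * \<rho>"
  have N1: "N1 > 0" using \<rho>(1) by (simp add: N1_def)
  define W where "W = (?d * \<rho>) ^ s * A * (2 ^ s * X)"
  have W: "W \<ge> 0" using \<rho>(1) A(1) X by (simp add: W_def)
  define C2 where "C2 = W * N1 powr (?d * (1 - 1 / p))"
  have C: "0 \<le> C1" "0 \<le> C2" using N0 A(1) X W by (auto simp: C1_def C2_def)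
  have "holder_norm V \<alpha> (\<lambda>x. \<kappa> x * gsum i n K c x) \<le> ennreal (max C1 C2 * 2 powr (real n * (wt \<beta> p - \<delta>)) * lp p K c)"
    if i: "i \<in> levels II n" and K: "finite K" "K \<subseteq> int_lattice" for n i K c
  proof (rule holder_norm_neg_le[OF \<alpha>(1)])
    fix l :: real and x and \<eta> :: "real ^ 'n \<Rightarrow> real"
    assume l: "0 < l" "l \<le> 1" and \<eta>: "\<eta> \<in> test_ball (nat (- \<lfloor>\<alpha>\<rfloor>))"
    let ?c = "2 powr (real (CARD('n) * n) / 2)" and ?q = "lp p K c" and ?y = "2 powr real n"
    let ?g = "gsum i n K c"
    have ce: "?c = ?y powr (?d / 2)" by (simp add: powr_powr mult.commute)
    have y1: "1 \<le> ?y" by (simp add: ge_one_powr_ge_zero)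
    have q: "0 \<le> ?q" by (rule lp_nonneg)
    have i': "i \<in> insert 0 II" by (rule levels_pos[OF i])
    note g = gsum_bound[OF i' K p]
    have target: "2 powr (real n * (wt \<beta> p - \<delta>)) = ?y powr (wt \<beta> p - \<delta>)" by (simp add: powr_powr)
    have mxC: "Z * ?y powr a * ?q \<le> max C1 C2 * 2 powr (real n * (wt \<beta> p - \<delta>)) * ?q"
      if "Z \<in> {C1, C2}" "a \<le> wt \<beta> p - \<delta>" for Z a
      unfolding target using that q C y1 by (intro mult_right_mono mult_mono powr_mono) auto
    have "hpair \<alpha> (\<lambda>x. \<kappa> x * ?g x) l x \<eta> \<le> max C1 C2 * 2 powr (real n * (wt \<beta> p - \<delta>)) * ?q"
    proof (cases "l * ?y \<le> 1")
      case True
      have 1: "(\<lambda>x. \<kappa> x * ?g x) \<in> Cr_c 0"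
        by (rule Cr_c_mult[OF Cinf_c_D[OF \<kappa>] Cr_mono[OF Cbd_Cr[OF g(2)]]]) simp
      have 2: "\<bar>\<kappa> x * ?g x\<bar> \<le> X * (N0 * A * ?q * ?c)" for x
        unfolding abs_mult using X by (intro mult_mono g(1) Cbd_bound[OF X(2)]) auto
      have nn: "0 \<le> X * (N0 * A * ?q * ?c) * ?v" using N0 A(1) q X by simp
      have "hpair \<alpha> (\<lambda>x. \<kappa> x * ?g x) l x \<eta> \<le> l powr (- \<alpha>) * (X * (N0 * A * ?q * ?c) * ?v)"
        by (rule hpair_sup_bound[OF \<alpha>(1) l(1) \<eta> 1 2])
      also have "\<dots> \<le> ?y powr \<alpha> * (X * (N0 * A * ?q * ?c) * ?v)"
      proof (rule mult_right_mono[OF _ nn])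
        have "l \<le> ?y powr (- 1)" using True by (simp add: powr_minus field_simps)
        then have "l powr (- \<alpha>) \<le> (?y powr (- 1)) powr (- \<alpha>)" using l \<alpha> by (intro powr_mono2) auto
        then show "l powr (- \<alpha>) \<le> ?y powr \<alpha>" by (simp only: powr_powr) simp
      qed
      also have "\<dots> = C1 * ?y powr (\<alpha> + ?d / 2) * ?q"
        unfolding ce C1_def by (simp add: powr_add mult_ac)
      also have "\<dots> \<le> max C1 C2 * 2 powr (real n * (wt \<beta> p - \<delta>)) * ?q"
        using \<delta>1 by (intro mxC) (auto simp: wt_def)
      finally show ?thesis .
    next
      case False
      \<comment> \<open>Scales coarser than 2^(-n) do not occur at level 0 since
        \<open>l \<le> 1\<close>, so the scaling function never has to supply vanishing
        moments.\<close>
      then have n: "n \<noteq> 0" using l by (intro notI) simp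
      define t where "t = l * ?y"
      have t: "1 \<le> t" "t \<le> ?y" using False l mult_right_mono[of l 1 ?y] by (auto simp: t_def)
      have le: "l = t / ?y" by (simp add: t_def)
      \<comment> \<open>The cut-off \<kappa> is moved onto the test function, so that the moments of
        the wavelets themselves can be used.\<close>
      define h where "h y = \<kappa> y * \<eta> ((1 / l) *\<^sub>R (y - x))" for y
      have sr0: "s \<le> nat (- \<lfloor>\<alpha>\<rfloor>)" by (simp add: s_def r0_def)
      have hC: "Cbd s (2 ^ s * X * (1 / l) ^ s) h"
        unfolding h_def[abs_def] by (rule Cbd_mult[OF X(2) scale_test_Cbd(1)[OF \<eta> l sr0]])
      have hc: "h \<in> Cr_c 0" unfolding h_def[abs_def]
        by (intro Cr_c0_mult Cr_c_continuous[OF scale_test_Cbd(2)[OF \<eta> l order_refl]] Cinf_c_D[OF \<kappa>])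
      have v: "vanish s (gen i)" using gen_vanish[OF i n, of s] by (simp add: s_def)
      have dec: "\<bar>L2_inner h (scaled (gen i) n k)\<bar> \<le> W / t ^ s / ?c" for k
      proof -
        have "\<bar>L2_inner h (scaled (gen i) n k)\<bar> \<le> (?d * \<rho>) ^ s * A * (2 ^ s * X * (1 / l) ^ s) / (2 ^ n) ^ s / ?c"
          by (rule gen_coefficient_decay[OF i' v hC])
        also have "\<dots> = W / t ^ s / ?c"
          using l by (simp add: W_def t_def powr_realpow power_mult_distrib power_divide mult_ac)
        finally show ?thesis .
      qed
      define S where "S = K \<inter> near (2 ^ n * l + \<rho>) (2 ^ n *\<^sub>R x)"
      have S: "finite S" "S \<subseteq> K" using K by (auto simp: S_def)
      have zero: "L2_inner h (scaled (gen i) n k) = 0" if k: "k \<in> K - S" for k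
      proof -
        have "h y * scaled (gen i) n k y = 0" for y
        proof (rule ccontr)
          assume "h y * scaled (gen i) n k y \<noteq> 0"
          then have a: "scaled (gen i) n k y \<noteq> 0" and b: "\<eta> ((1 / l) *\<^sub>R (y - x)) \<noteq> 0" by (auto simp: h_def)
          have 1: "norm (2 ^ n *\<^sub>R y - k) \<le> \<rho>" by (rule scaled_nonzero[OF gen_supp[OF i'] a])
          have "norm (y - x) \<le> l" using scale_test_zero[OF \<eta> l(1), of y x] b by (meson not_le)
          then have 2: "norm (2 ^ n *\<^sub>R y - 2 ^ n *\<^sub>R x) \<le> 2 ^ n * l"
            unfolding scaleR_diff_right[symmetric] by simp
          have "norm (k - 2 ^ n *\<^sub>R x) \<le> norm (2 ^ n *\<^sub>R y - 2 ^ n *\<^sub>R x) + norm (2 ^ n *\<^sub>R y - k)"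
            using norm_triangle_ineq4[of "2 ^ n *\<^sub>R y - 2 ^ n *\<^sub>R x" "2 ^ n *\<^sub>R y - k"] by simp
          then have "k \<in> S" using 1 2 k K by (auto simp: S_def near_def)
          then show False using k by simp
        qed
        then show ?thesis unfolding L2_inner_def by (simp only: integral_zero)
      qed
      have "(LINT y|lborel. \<kappa> y * ?g y * (l powr (- ?d) * \<eta> ((1 / l) *\<^sub>R (y - x))))
         = (LINT y|lborel. l powr (- ?d) * ((\<Sum>k\<in>K. c k * scaled (gen i) n k y) * h y))"
        by (simp add: gsum_def h_def mult_ac)
      also have "\<dots> = l powr (- ?d) * L2_inner (\<lambda>y. \<Sum>k\<in>K. c k * scaled (gen i) n k y) h"
        by (simp add: L2_inner_def)
      also have "L2_inner (\<lambda>y. \<Sum>k\<in>K. c k * scaled (gen i) n k y) h = (\<Sum>k\<in>K. c k * L2_inner (scaled (gen i) n k) h)"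
        by (intro L2_inner_sum Cr_c_L2[OF scaled_Cr_c[OF gen_Cr_c[OF i']]] Cr_c_L2[OF hc])
      also have "\<dots> = (\<Sum>k\<in>S. c k * L2_inner (scaled (gen i) n k) h)"
        by (rule sum.mono_neutral_right[OF K(1) S(2)]) (use zero in \<open>auto simp: L2_inner_commute[of _ h]\<close>)
      also have "\<dots> \<le> (\<Sum>k\<in>S. \<bar>c k\<bar> * (W / t ^ s / ?c))"
      proof (rule sum_mono)
        fix k
        have "c k * L2_inner (scaled (gen i) n k) h \<le> \<bar>c k\<bar> * \<bar>L2_inner h (scaled (gen i) n k)\<bar>"
          unfolding abs_mult[symmetric] L2_inner_commute[of _ h] by (rule abs_ge_self)
        also have "\<dots> \<le> \<bar>c k\<bar> * (W / t ^ s / ?c)" by (intro mult_left_mono dec) auto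
        finally show "c k * L2_inner (scaled (gen i) n k) h \<le> \<bar>c k\<bar> * (W / t ^ s / ?c)" .
      qed
      also have "\<dots> = (\<Sum>k\<in>S. \<bar>c k\<bar>) * (W / t ^ s / ?c)" by (simp only: sum_distrib_right)
      also have "\<dots> \<le> ((N1 * t) powr (?d * (1 - 1 / p)) * ?q) * (W / t ^ s / ?c)"
      proof (rule mult_right_mono)
        have "(\<Sum>k\<in>S. \<bar>c k\<bar>) \<le> real (card S) powr (1 - 1 / p) * lp p S c" by (rule sum_abs_le_lp[OF S(1) p])
        also have "\<dots> \<le> ((N1 * t) ^ CARD('n)) powr (1 - 1 / p) * ?q"
        proof (intro mult_mono powr_mono2 lp_mono K S p lp_nonneg)
          have "real (card S) \<le> real (card (near (2 ^ n * l + \<rho>) (2 ^ n *\<^sub>R x)))"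
            unfolding S_def by (simp add: card_mono)
          also have "\<dots> \<le> (2 * (2 ^ n * l + \<rho>) + 1) ^ CARD('n)"
            using l \<rho>(1) by (intro near_finite_card(2)) auto
          also have "\<dots> \<le> (N1 * t) ^ CARD('n)"
          proof (rule power_mono)
            have e: "2 ^ n * l = t" by (simp add: t_def powr_realpow mult.commute)
            have "\<rho> \<le> \<rho> * t" using t(1) \<rho>(1) by simp
            then have "2 * (t + \<rho>) + 1 \<le> 3 * t + 2 * (\<rho> * t)" using t(1) by argo
            then show "2 * (2 ^ n * l + \<rho>) + 1 \<le> N1 * t" unfolding e by (simp add: N1_def algebra_simps)
          qed (use l \<rho>(1) in auto)
          finally show "real (card S) \<le> (N1 * t) ^ CARD('n)" .
        qed (use p in auto)
        also have "((N1 * t) ^ CARD('n)) powr (1 - 1 / p) = (N1 * t) powr (?d * (1 - 1 / p))"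
          using N1 t(1) by (simp add: powr_realpow[symmetric] powr_powr)
        finally show "(\<Sum>k\<in>S. \<bar>c k\<bar>) \<le> (N1 * t) powr (?d * (1 - 1 / p)) * ?q" .
      qed (use W t in simp)
      finally have I: "(LINT y|lborel. \<kappa> y * ?g y * (l powr (- ?d) * \<eta> ((1 / l) *\<^sub>R (y - x))))
        \<le> l powr (- ?d) * (((N1 * t) powr (?d * (1 - 1 / p)) * ?q) * (W / t ^ s / ?c))"
        by (simp add: mult_left_mono)
      have "hpair \<alpha> (\<lambda>x. \<kappa> x * ?g x) l x \<eta>
        \<le> l powr (- \<alpha>) * (l powr (- ?d) * (((N1 * t) powr (?d * (1 - 1 / p)) * ?q) * (W / t ^ s / ?c)))"
        unfolding hpair_def by (rule mult_left_mono[OF I]) simp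
      also have "\<dots> = C2 * ?q * (?y powr (\<alpha> + ?d / 2) * t powr (- \<alpha> - real s - ?d / p))"
      proof -
        have t0: "t > 0" using t(1) by simp
        have 1: "l powr (- \<alpha>) * l powr (- ?d) = t powr (- \<alpha> - ?d) * ?y powr (\<alpha> + ?d)"
        proof -
          have "l powr (- \<alpha>) * l powr (- ?d) = l powr (- \<alpha> - ?d)" by (simp add: powr_add[symmetric])
          also have "\<dots> = t powr (- \<alpha> - ?d) / ?y powr (- \<alpha> - ?d)" unfolding le by (rule powr_divide)
          also have "\<dots> = t powr (- \<alpha> - ?d) * ?y powr (- (- \<alpha> - ?d))" by (simp only: powr_minus divide_inverse)
          finally show ?thesis by (simp add: add.commute)
        qed
        have 2: "(N1 * t) powr (?d * (1 - 1 / p)) = N1 powr (?d * (1 - 1 / p)) * t powr (?d * (1 - 1 / p))"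
          using N1 t0 by (intro powr_mult)
        have 3: "W / t ^ s / ?c = W * (t powr (- real s) * ?y powr (- (?d / 2)))"
          unfolding ce powr_minus powr_realpow[OF t0] by (simp only: divide_inverse mult_ac)
        have "l powr (- \<alpha>) * (l powr (- ?d) * (((N1 * t) powr (?d * (1 - 1 / p)) * ?q) * (W / t ^ s / ?c)))
           = (l powr (- \<alpha>) * l powr (- ?d)) * (N1 powr (?d * (1 - 1 / p)) * t powr (?d * (1 - 1 / p)) * ?q * (W * (t powr (- real s) * ?y powr (- (?d / 2)))))"
          unfolding 2 3 by (simp only: mult_ac)
        also have "\<dots> = C2 * ?q * ((?y powr (\<alpha> + ?d) * ?y powr (- (?d / 2))) * (t powr (- \<alpha> - ?d) * t powr (?d * (1 - 1 / p)) * t powr (- real s)))"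
          unfolding 1 C2_def by (simp only: mult_ac)
        also have "?y powr (\<alpha> + ?d) * ?y powr (- (?d / 2)) = ?y powr (\<alpha> + ?d / 2)"
          unfolding powr_add[symmetric] by (rule arg_cong[where f = "\<lambda>u. ?y powr u"]) simp
        also have "t powr (- \<alpha> - ?d) * t powr (?d * (1 - 1 / p)) * t powr (- real s) = t powr (- \<alpha> - real s - ?d / p)"
          unfolding powr_add[symmetric] by (rule arg_cong[where f = "\<lambda>u. t powr u"]) (simp add: algebra_simps)
        finally show ?thesis .
      qed
      \<comment> \<open>The exponent of \<open>t\<close> may have either sign. The endpoint
        \<open>t = 1\<close> is absorbed by \<delta>1, the endpoint \<open>t = 2 ^ n\<close> by
        \<delta>2.\<close>
      also have "\<dots> \<le> C2 * ?q * (?y powr (\<alpha> + ?d / 2) * max 1 (?y powr (- \<alpha> - real s - ?d / p)))"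
        using C q by (intro mult_left_mono powr_le_max t) auto
      also have "?y powr (\<alpha> + ?d / 2) * max 1 (?y powr (- \<alpha> - real s - ?d / p))
         = max (?y powr (\<alpha> + ?d / 2)) (?y powr (?d / 2 - real s - ?d / p))"
      proof -
        have "?y powr (\<alpha> + ?d / 2) * ?y powr (- \<alpha> - real s - ?d / p) = ?y powr (?d / 2 - real s - ?d / p)"
          unfolding powr_add[symmetric] by (rule arg_cong[where f = "\<lambda>u. ?y powr u"]) simp
        then show ?thesis by (simp add: max_mult_distrib_left)
      qed
      also have "C2 * ?q * max (?y powr (\<alpha> + ?d / 2)) (?y powr (?d / 2 - real s - ?d / p))
          \<le> max C1 C2 * 2 powr (real n * (wt \<beta> p - \<delta>)) * ?q"
      proof -
        have "C2 * ?y powr (\<alpha> + ?d / 2) * ?q \<le> max C1 C2 * 2 powr (real n * (wt \<beta> p - \<delta>)) * ?q"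
          using \<delta>1 by (intro mxC) (auto simp: wt_def)
        moreover have "C2 * ?y powr (?d / 2 - real s - ?d / p) * ?q \<le> max C1 C2 * 2 powr (real n * (wt \<beta> p - \<delta>)) * ?q"
          using \<delta>2 by (intro mxC) (auto simp: wt_def)
        ultimately show ?thesis by (rule mult_max_le)
      qed
      finally show ?thesis .
    qed
    then show "ennreal (hpair \<alpha> (\<lambda>x. \<kappa> x * gsum i n K c x) l x \<eta>) \<le> ennreal (max C1 C2 * 2 powr (real n * (wt \<beta> p - \<delta>)) * lp p K c)"
      by (rule ennreal_leI)
  qed
  then show ?thesis using C unfolding \<delta>_def by (intro exI[of _ "max C1 C2"]) auto
qed

lemma level_bound:
  assumes "\<alpha> < real r" "\<alpha> < \<beta> - real CARD('n) / p" "1 \<le> p" "\<kappa> \<in> Cinf_c"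
  shows "\<exists>C\<ge>0. \<forall>n i K c. i \<in> levels II n \<longrightarrow> finite K \<longrightarrow> K \<subseteq> int_lattice \<longrightarrow>
    holder_norm V \<alpha> (\<lambda>x. \<kappa> x * gsum i n K c x) \<le> ennreal (C * 2 powr (real n * (wt \<beta> p - order_gap \<alpha> \<beta> p)) * lp p K c)"
  using level_bound_neg[OF _ assms(2-4)] level_bound_nonneg[OF _ assms(1,3,4)] by (meson not_le)

text \<open>Makes the expansion converge as a distribution. The estimate combines Hoelder's
  inequality over the wavelets meeting the ball with decay of order \<open>r\<close> of the
  coefficients of \<eta>.\<close>

lemma pairing_bound:
  assumes p: "1 \<le> p" and \<eta>: "\<eta> \<in> Cr_c r" and R: "0 \<le> R"
  shows "\<exists>C\<ge>0. \<forall>n i c. i \<in> levels II n \<longrightarrow>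
    \<bar>LINT x|lborel. gsum i n (lat (2 ^ n * R + \<rho>)) c x * \<eta> x\<bar>
      \<le> C * 2 powr (real n * (wt \<beta> p - order_gap \<alpha> \<beta> p)) * lp p (lat (2 ^ n * R + \<rho>)) c"
proof -
  let ?d = "real CARD('n)"
  obtain B where B: "B > 0" "Cbd r B \<eta>" using Cr_c_Cbd[OF \<eta>] by auto
  have B0: "Cbd 0 B \<eta>" using Cbd_mono[OF B(2)] by simp
  define D where "D = max 1 ((?d * \<rho>) ^ r)"
  have D: "1 \<le> D" by (simp add: D_def)
  define N1 where "N1 = 2 * R + 2 * \<rho> + 1"
  have N1: "N1 > 0" using R \<rho>(1) by (simp add: N1_def)
  define C where "C = N1 powr (?d * (1 - 1 / p)) * (D * A * B)"
  have C: "0 \<le> C" using D A(1) B by (simp add: C_def)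
  have "\<bar>LINT x|lborel. gsum i n (lat (2 ^ n * R + \<rho>)) c x * \<eta> x\<bar>
      \<le> C * 2 powr (real n * (wt \<beta> p - order_gap \<alpha> \<beta> p)) * lp p (lat (2 ^ n * R + \<rho>)) c"
    if i: "i \<in> levels II n" for n i c
  proof -
    let ?K = "lat (2 ^ n * R + \<rho>) :: (real ^ 'n) set"
    let ?c = "2 powr (real (CARD('n) * n) / 2)" and ?q = "lp p ?K c" and ?y = "2 powr real n"
    have ce: "?c = ?y powr (?d / 2)" by (simp add: powr_powr mult.commute)
    have y1: "1 \<le> ?y" by (simp add: ge_one_powr_ge_zero)
    have q: "0 \<le> ?q" by (rule lp_nonneg)
    have i': "i \<in> insert 0 II" by (rule levels_pos[OF i])
    have dec: "\<bar>L2_inner \<eta> (scaled (gen i) n k)\<bar> \<le> D * A * B * (?y powr (- real r) * ?y powr (- (?d / 2)))" for k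
    proof (cases "n = 0")
      \<comment> \<open>At level 0 the gain 2^(-n r) is 1, so the bound by the supremum of \<eta> is
        enough; \<open>D \<ge> 1\<close> lets both cases share a constant.\<close>
      case True
      have "\<bar>L2_inner \<eta> (scaled (gen i) n k)\<bar> \<le> A * B" using gen_coefficient_decay[OF i' vanish_0 B0, of n k] True by simp
      also have "\<dots> \<le> D * (A * B)" using mult_right_mono[OF D, of "A * B"] A(1) B by simp
      finally show ?thesis using True by (simp add: mult.assoc)
    next
      case False
      have "\<bar>L2_inner \<eta> (scaled (gen i) n k)\<bar> \<le> (?d * \<rho>) ^ r * A * B / (2 ^ n) ^ r / ?c"
        by (rule gen_coefficient_decay[OF i' gen_vanish[OF i False] B(2)]) simp
      also have "\<dots> \<le> D * A * B / (2 ^ n) ^ r / ?c"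
        using A(1) B by (intro divide_right_mono mult_right_mono) (auto simp: D_def)
      also have "\<dots> = D * A * B * (?y powr (- real r) * ?y powr (- (?d / 2)))"
      proof -
        have "(2 ^ n) ^ r = ?y powr real r" by (simp add: powr_realpow)
        then show ?thesis unfolding ce by (simp only: powr_minus divide_inverse mult_ac)
      qed
      finally show ?thesis .
    qed
    have "(LINT x|lborel. gsum i n ?K c x * \<eta> x) = L2_inner (\<lambda>y. \<Sum>k\<in>?K. c k * scaled (gen i) n k y) \<eta>"
      by (simp add: L2_inner_def gsum_def)
    also have "\<dots> = (\<Sum>k\<in>?K. c k * L2_inner (scaled (gen i) n k) \<eta>)" (is "_ = ?S")
      by (intro L2_inner_sum Cr_c_L2[OF scaled_Cr_c[OF gen_Cr_c[OF i']]] Cr_c_L2[OF \<eta>])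
    finally have e: "(LINT x|lborel. gsum i n ?K c x * \<eta> x) = ?S" .
    have "\<bar>?S\<bar> \<le> (\<Sum>k\<in>?K. \<bar>c k\<bar> * (D * A * B * (?y powr (- real r) * ?y powr (- (?d / 2)))))"
    proof (rule order_trans[OF sum_abs], rule sum_mono)
      fix k
      have "\<bar>c k * L2_inner (scaled (gen i) n k) \<eta>\<bar> = \<bar>c k\<bar> * \<bar>L2_inner \<eta> (scaled (gen i) n k)\<bar>"
        unfolding abs_mult by (subst L2_inner_commute) (rule refl)
      also have "\<dots> \<le> \<bar>c k\<bar> * (D * A * B * (?y powr (- real r) * ?y powr (- (?d / 2))))"
        by (rule mult_left_mono[OF dec abs_ge_zero])
      finally show "\<bar>c k * L2_inner (scaled (gen i) n k) \<eta>\<bar> \<le> \<bar>c k\<bar> * (D * A * B * (?y powr (- real r) * ?y powr (- (?d / 2))))" .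
    qed
    also have "\<dots> = (\<Sum>k\<in>?K. \<bar>c k\<bar>) * (D * A * B * (?y powr (- real r) * ?y powr (- (?d / 2))))" by (simp only: sum_distrib_right)
    also have "\<dots> \<le> ((N1 * ?y) powr (?d * (1 - 1 / p)) * ?q) * (D * A * B * (?y powr (- real r) * ?y powr (- (?d / 2))))"
    proof (rule mult_right_mono)
      have "(\<Sum>k\<in>?K. \<bar>c k\<bar>) \<le> real (card ?K) powr (1 - 1 / p) * ?q" by (rule sum_abs_le_lp[OF near_finite p])
      also have "\<dots> \<le> ((N1 * ?y) ^ CARD('n)) powr (1 - 1 / p) * ?q"
      proof (intro mult_right_mono powr_mono2 lp_nonneg)
        have "real (card ?K) \<le> (2 * (2 ^ n * R + \<rho>) + 1) ^ CARD('n)"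
          using R \<rho>(1) by (intro near_finite_card(2)) auto
        also have "\<dots> \<le> (N1 * ?y) ^ CARD('n)"
        proof (rule power_mono)
          have "2 ^ n = ?y" by (simp add: powr_realpow)
          moreover have "\<rho> \<le> \<rho> * ?y" using y1 \<rho>(1) by simp
          ultimately show "2 * (2 ^ n * R + \<rho>) + 1 \<le> N1 * ?y" using y1 unfolding N1_def by (simp add: algebra_simps)
        qed (use R \<rho>(1) in auto)
        finally show "real (card ?K) \<le> (N1 * ?y) ^ CARD('n)" .
      qed (use p in auto)
      also have "((N1 * ?y) ^ CARD('n)) powr (1 - 1 / p) = (N1 * ?y) powr (?d * (1 - 1 / p))"
        using N1 by (simp add: powr_realpow[symmetric] powr_powr)
      finally show "(\<Sum>k\<in>?K. \<bar>c k\<bar>) \<le> (N1 * ?y) powr (?d * (1 - 1 / p)) * ?q" .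
    qed (use D A(1) B in simp)
    also have "(N1 * ?y) powr (?d * (1 - 1 / p)) = N1 powr (?d * (1 - 1 / p)) * ?y powr (?d * (1 - 1 / p))"
      using N1 by (intro powr_mult)
    also have "(N1 powr (?d * (1 - 1 / p)) * ?y powr (?d * (1 - 1 / p)) * ?q) * (D * A * B * (?y powr (- real r) * ?y powr (- (?d / 2))))
       = C * (?y powr (?d * (1 - 1 / p)) * ?y powr (- real r) * ?y powr (- (?d / 2))) * ?q"
      unfolding C_def by (simp only: mult_ac)
    also have "?y powr (?d * (1 - 1 / p)) * ?y powr (- real r) * ?y powr (- (?d / 2)) = ?y powr (wt \<beta> p - (real r + \<beta>))"
      unfolding powr_add[symmetric] wt_def by (rule arg_cong[where f = "\<lambda>u. ?y powr u"]) (simp add: algebra_simps)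
    also have "C * ?y powr (wt \<beta> p - (real r + \<beta>)) * ?q \<le> C * ?y powr (wt \<beta> p - order_gap \<alpha> \<beta> p) * ?q"
      using C q y1 by (intro mult_right_mono mult_left_mono powr_mono) (auto simp: order_gap_def)
    finally show ?thesis unfolding e by (simp add: powr_powr)
  qed
  then show ?thesis using C by blast
qed

end

subsection \<open>Synthesis of distributions and compactness\<close>

text \<open>A quasi-triangle inequality with a crude constant takes the place of Minkowski's; the
  constant only enlarges the bounds \<open>L\<close>.\<close>

lemma lp_diff_le:
  assumes "1 \<le> p"
  shows "lp p K (\<lambda>k. a k - b k) \<le> 4 * (lp p K a + lp p K b)"
proof -
  let ?a = "\<Sum>k\<in>K. \<bar>a k\<bar> powr p" and ?b = "\<Sum>k\<in>K. \<bar>b k\<bar> powr p"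
  have nn: "0 \<le> ?a" "0 \<le> ?b" by (auto intro: sum_nonneg)
  have "\<bar>a k - b k\<bar> powr p \<le> 2 powr p * (\<bar>a k\<bar> powr p + \<bar>b k\<bar> powr p)" for k
  proof -
    have "\<bar>a k - b k\<bar> \<le> 2 * max \<bar>a k\<bar> \<bar>b k\<bar>" by (auto simp: max_def)
    then have "\<bar>a k - b k\<bar> powr p \<le> (2 * max \<bar>a k\<bar> \<bar>b k\<bar>) powr p" using assms by (intro powr_mono2) auto
    also have "\<dots> = 2 powr p * (max \<bar>a k\<bar> \<bar>b k\<bar>) powr p" by (rule powr_mult)
    also have "(max \<bar>a k\<bar> \<bar>b k\<bar>) powr p \<le> \<bar>a k\<bar> powr p + \<bar>b k\<bar> powr p" by (simp add: max_def)
    finally show ?thesis by simp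
  qed
  then have "(\<Sum>k\<in>K. \<bar>a k - b k\<bar> powr p) \<le> (\<Sum>k\<in>K. 2 powr p * (\<bar>a k\<bar> powr p + \<bar>b k\<bar> powr p))" by (intro sum_mono)
  also have "\<dots> = 2 powr p * (?a + ?b)" by (simp add: sum_distrib_left sum.distrib distrib_left)
  also have "\<dots> \<le> 4 powr p * max ?a ?b"
  proof -
    have "?a + ?b \<le> 2 * max ?a ?b" by (simp add: max_def)
    moreover have "2 \<le> 2 powr p" using powr_mono[of 1 p "2::real"] assms by simp
    ultimately have "?a + ?b \<le> 2 powr p * max ?a ?b" using nn by (meson max.coboundedI1 mult_right_mono order_trans)
    then have "2 powr p * (?a + ?b) \<le> 2 powr p * (2 powr p * max ?a ?b)" by (intro mult_left_mono) auto
    also have "\<dots> = 4 powr p * max ?a ?b" using powr_mult[of 2 2 p] by (simp add: mult.assoc[symmetric])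
    finally show ?thesis .
  qed
  finally have "lp p K (\<lambda>k. a k - b k) \<le> (4 powr p * max ?a ?b) powr (1 / p)"
    unfolding lp_def using assms by (intro powr_mono2) (auto intro: sum_nonneg)
  also have "\<dots> = 4 * (max ?a ?b) powr (1 / p)" using assms nn by (simp add: powr_mult powr_powr)
  also have "(max ?a ?b) powr (1 / p) \<le> lp p K a + lp p K b" unfolding lp_def by (simp add: max_def)
  finally show ?thesis by simp
qed

lemma lp_uminus [simp]: "lp p K (\<lambda>k. - c k) = lp p K c"
  by (simp add: lp_def)

lemma lp_zero [simp]: "lp p K (\<lambda>k. 0) = 0"
  by (simp add: lp_def)

lemma ennreal_less_self_add: "x < top \<Longrightarrow> 0 < e \<Longrightarrow> x < x + ennreal e"
  by (cases x) (auto simp: ennreal_plus[symmetric] ennreal_less_iff simp del: ennreal_plus)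

lemma ennreal_half_sum: "x / 2 + x / 2 = (x :: ennreal)"
  by (cases x) (auto simp: ennreal_divide_numeral ennreal_plus[symmetric] ennreal_top_divide simp del: ennreal_plus)

lemma ennreal_real_below: "0 < x \<Longrightarrow> \<exists>e>0. ennreal e \<le> x"
  by (cases x) (auto intro: exI[of _ 1])

lemma ennreal_less_top_real: "x < top \<Longrightarrow> \<exists>t\<ge>0. x = ennreal t"
  by (cases x) auto

text \<open>Inside this locale \<beta> is the smaller auxiliary exponent, called b in the overview;
  in the moment estimates below, \<open>b\<close> is the exponent of the hypothesis.\<close>

locale wavelet_scale = wavelets r V \<phi> \<psi> II for r V and \<phi> :: "real ^ 'n \<Rightarrow> real" and \<psi> II +
  fixes \<alpha> \<beta> p :: real
  assumes \<alpha>r: "\<alpha> < real r" and \<alpha>\<beta>: "\<alpha> < \<beta> - real CARD('n) / p" and p: "1 \<le> p" and \<beta>: "- real r < \<beta>"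
begin

definition \<delta> :: real where "\<delta> = order_gap \<alpha> \<beta> p"

lemma \<delta>: "\<delta> > 0"
  using \<alpha>\<beta> \<beta> by (simp add: \<delta>_def order_gap_def)

definition lev :: "nat \<Rightarrow> (nat \<times> nat \<times> (real ^ 'n) \<Rightarrow> real) \<Rightarrow> real ^ 'n \<Rightarrow> real" where
  "lev n c x = (\<Sum>i\<in>levels II n. wsum (gen i) n (\<lambda>k. c (n, i, k)) x)"

text \<open>Agrees with \<open>lev\<close> on the ball of radius \<open>R\<close> and, unlike
  \<open>lev\<close>, has compact support.\<close>

definition levK :: "nat \<Rightarrow> real \<Rightarrow> (nat \<times> nat \<times> (real ^ 'n) \<Rightarrow> real) \<Rightarrow> real ^ 'n \<Rightarrow> real" where
  "levK n R c x = (\<Sum>i\<in>levels II n. gsum i n (lat (2 ^ n * R + \<rho>)) (\<lambda>k. c (n, i, k)) x)"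

definition q :: "nat \<Rightarrow> real \<Rightarrow> (nat \<times> nat \<times> (real ^ 'n) \<Rightarrow> real) \<Rightarrow> real" where
  "q n R c = (\<Sum>i\<in>levels II n. lp p (lat (2 ^ n * R + \<rho>)) (\<lambda>k. c (n, i, k)))"

lemma q_nonneg: "0 \<le> q n R c"
  by (simp add: q_def sum_nonneg lp_nonneg)

lemma q_diff_le: "q n R (\<lambda>j. a j - b j) \<le> 4 * (q n R a + q n R b)"
  unfolding q_def using lp_diff_le[OF p] by (auto simp: sum_distrib_left sum.distrib[symmetric] intro!: sum_mono)

lemma q_uminus [simp]: "q n R (\<lambda>j. - c j) = q n R c"
  by (simp add: q_def)

lemma q_zero [simp]: "q n R (\<lambda>j. 0) = 0"
  by (simp add: q_def)

lemma lev_levK: "norm x \<le> R \<Longrightarrow> lev n c x = levK n R c x"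
  unfolding lev_def levK_def gsum_def
  by (intro sum.cong refl wsum_lat[OF gen_supp[OF levels_pos]]) auto

lemma levK_Cr_c: "levK n R c \<in> Cr_c r"
  unfolding levK_def[abs_def] by (intro Cr_c_sum gsum_Cr_c levels_pos finite_levels near_finite)

lemma levK_uminus: "levK n R (\<lambda>j. - c j) x = - levK n R c x"
  by (simp add: levK_def gsum_def sum_negf)

lemma levK_diff: "levK n R (\<lambda>j. a j - b j) x = levK n R a x - levK n R b x"
  by (simp add: levK_def gsum_def sum_subtractf left_diff_distrib)

lemma lev_diff: "lev n (\<lambda>j. a j - b j) x = lev n a x - lev n b x"
  using lev_levK[of x "norm x"] levK_diff by simp

lemma lev_uminus: "lev n (\<lambda>j. - c j) x = - lev n c x"
  using lev_levK[of x "norm x"] levK_uminus by simp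

lemma mult_lev:
  assumes "supp \<kappa> \<subseteq> cball 0 R"
  shows "\<kappa> x * lev n c x = \<kappa> x * levK n R c x"
proof (cases "x \<in> supp \<kappa>")
  case True then show ?thesis using assms lev_levK[of x R] by auto
qed (simp add: not_in_supp)

lemma holder_norm_zero: "holder_norm V \<alpha> (\<lambda>x. 0) = 0"
proof -
  have "(\<lambda>x. 0) \<in> (Cinf_c :: (real ^ 'n \<Rightarrow> real) set)" by (simp add: Cinf_c_def Cr_c_zero)
  from holder_norm_smooth[OF \<alpha>r this] obtain C
    where "\<forall>e u. Cbd r e u \<longrightarrow> holder_norm V \<alpha> (\<lambda>x. (0 :: real) * u x) \<le> ennreal (C * e)" by auto
  from this[rule_format, OF Cbd_zero[of 0 r]] show ?thesis by simp
qed

lemma holder_norm_sum: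
  assumes "finite S" "\<And>s. s \<in> S \<Longrightarrow> f s \<in> Cr_c 0"
  shows "holder_norm V \<alpha> (\<lambda>x. \<Sum>s\<in>S. f s x) \<le> (\<Sum>s\<in>S. holder_norm V \<alpha> (f s))"
  using assms
proof (induction S rule: finite_induct)
  case empty then show ?case by (simp add: holder_norm_zero)
next
  case (insert s S)
  have "holder_norm V \<alpha> (\<lambda>x. f s x + (\<Sum>s\<in>S. f s x)) \<le> holder_norm V \<alpha> (f s) + holder_norm V \<alpha> (\<lambda>x. \<Sum>s\<in>S. f s x)"
    using insert by (intro holder_norm_triangle Cr_c_sum) auto
  also have "\<dots> \<le> holder_norm V \<alpha> (f s) + (\<Sum>s\<in>S. holder_norm V \<alpha> (f s))"
    using insert by (intro add_left_mono) auto
  finally show ?case using insert by simp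
qed

definition lev_norm :: "real \<Rightarrow> real \<Rightarrow> (nat \<times> nat \<times> (real ^ 'n) \<Rightarrow> real) \<Rightarrow> nat \<Rightarrow> real" where
  "lev_norm C R c n = C * 2 powr (real n * (wt \<beta> p - \<delta>)) * q n R c"

lemma lev_norm_nonneg: "0 \<le> C \<Longrightarrow> 0 \<le> lev_norm C R c n"
  by (simp add: lev_norm_def q_nonneg)

lemma holder_norm_lev:
  assumes \<kappa>: "\<kappa> \<in> Cinf_c" "supp \<kappa> \<subseteq> cball 0 R"
  shows "\<exists>C\<ge>0. \<forall>n c. holder_norm V \<alpha> (\<lambda>x. \<kappa> x * lev n c x) \<le> ennreal (lev_norm C R c n)"
proof -
  obtain C where C: "C \<ge> 0" "\<And>n i K c. i \<in> levels II n \<Longrightarrow> finite K \<Longrightarrow> K \<subseteq> int_lattice \<Longrightarrow>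
      holder_norm V \<alpha> (\<lambda>x. \<kappa> x * gsum i n K c x) \<le> ennreal (C * 2 powr (real n * (wt \<beta> p - \<delta>)) * lp p K c)"
    using level_bound[OF \<alpha>r \<alpha>\<beta> p \<kappa>(1)] unfolding \<delta>_def by blast
  have "holder_norm V \<alpha> (\<lambda>x. \<kappa> x * lev n c x) \<le> ennreal (lev_norm C R c n)" for n c
  proof -
    let ?K = "lat (2 ^ n * R + \<rho>)"
    have "holder_norm V \<alpha> (\<lambda>x. \<kappa> x * lev n c x) = holder_norm V \<alpha> (\<lambda>x. \<Sum>i\<in>levels II n. \<kappa> x * gsum i n ?K (\<lambda>k. c (n, i, k)) x)"
      by (simp add: mult_lev[OF \<kappa>(2)] levK_def sum_distrib_left)
    also have "\<dots> \<le> (\<Sum>i\<in>levels II n. holder_norm V \<alpha> (\<lambda>x. \<kappa> x * gsum i n ?K (\<lambda>k. c (n, i, k)) x))"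
      by (intro holder_norm_sum finite_levels Cr_c0_mult Cinf_c_D[OF \<kappa>(1)] Cr_c_continuous[OF gsum_Cr_c] levels_pos near_finite)
    also have "\<dots> \<le> (\<Sum>i\<in>levels II n. ennreal (C * 2 powr (real n * (wt \<beta> p - \<delta>)) * lp p ?K (\<lambda>k. c (n, i, k))))"
      by (intro sum_mono C(2) near_finite near_int_lattice)
    also have "\<dots> = ennreal (\<Sum>i\<in>levels II n. C * 2 powr (real n * (wt \<beta> p - \<delta>)) * lp p ?K (\<lambda>k. c (n, i, k)))"
      using C(1) by (intro sum_ennreal) (auto simp: lp_nonneg)
    finally show ?thesis by (simp add: lev_norm_def q_def sum_distrib_left)
  qed
  then show ?thesis using C(1) by blast
qed

text \<open>\<open>L\<close> depends on the radius because the number of wavelets meeting a ball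
  grows with it. Integer radii keep the number of conditions countable, as the union bound
  requires.\<close>

definition good :: "(nat \<Rightarrow> real) \<Rightarrow> (nat \<times> nat \<times> (real ^ 'n) \<Rightarrow> real) \<Rightarrow> bool" where
  "good L c \<longleftrightarrow> (\<forall>n R. q n (real R) c \<le> L R * 2 powr (- (real n * wt \<beta> p)))"

lemma good_diff: "good L a \<Longrightarrow> good L b \<Longrightarrow> good (\<lambda>R. 8 * L R) (\<lambda>j. a j - b j)"
  unfolding good_def
proof (intro allI)
  fix n R assume "\<forall>n R. q n (real R) a \<le> L R * 2 powr (- (real n * wt \<beta> p))" "\<forall>n R. q n (real R) b \<le> L R * 2 powr (- (real n * wt \<beta> p))"
  then have "q n (real R) a \<le> L R * 2 powr (- (real n * wt \<beta> p))" "q n (real R) b \<le> L R * 2 powr (- (real n * wt \<beta> p))" by auto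
  then show "q n (real R) (\<lambda>j. a j - b j) \<le> 8 * L R * 2 powr (- (real n * wt \<beta> p))"
    using q_diff_le[of n "real R" a b] by simp
qed

lemma geometric: "summable (\<lambda>n. K * 2 powr (- (real n * \<delta>)))"
proof -
  have e: "2 powr (- (real n * \<delta>)) = (2 powr (- \<delta>)) ^ n" for n
    by (simp add: powr_realpow[symmetric] powr_powr mult.commute)
  have "2 powr (- \<delta>) < 2 powr 0" using \<delta> by (intro powr_less_mono) auto
  then show ?thesis unfolding e by (intro summable_mult summable_geometric) auto
qed

lemma good_lev_norm_le:
  assumes "good L c" "0 \<le> C"
  shows "lev_norm C (real R) c n \<le> C * L R * 2 powr (- (real n * \<delta>))"
proof -
  have "lev_norm C (real R) c n \<le> C * 2 powr (real n * (wt \<beta> p - \<delta>)) * (L R * 2 powr (- (real n * wt \<beta> p)))"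
    unfolding lev_norm_def using assms by (intro mult_left_mono) (auto simp: good_def)
  also have "\<dots> = C * L R * (2 powr (real n * (wt \<beta> p - \<delta>)) * 2 powr (- (real n * wt \<beta> p)))" by simp
  also have "2 powr (real n * (wt \<beta> p - \<delta>)) * 2 powr (- (real n * wt \<beta> p)) = 2 powr (- (real n * \<delta>))"
    unfolding powr_add[symmetric] by (rule arg_cong[where f = "\<lambda>u. 2 powr u"]) (simp add: algebra_simps)
  finally show ?thesis .
qed

lemma good_summable:
  assumes "good L c" "0 \<le> C"
  shows "summable (lev_norm C (real R) c)"
  by (rule summable_comparison_test'[OF geometric[of "C * L R"], of 0])
     (use good_lev_norm_le[OF assms] lev_norm_nonneg[OF assms(2)] in auto)

lemma nat_radius: "\<eta> \<in> Cr_c s \<Longrightarrow> \<exists>R :: nat. supp \<eta> \<subseteq> cball 0 (real R)" for \<eta> :: "real ^ 'n \<Rightarrow> real"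
proof -
  assume "\<eta> \<in> Cr_c s"
  then obtain R where "supp \<eta> \<subseteq> cball 0 R" using Cr_c_supp by blast
  then have "supp \<eta> \<subseteq> cball 0 (real (nat \<lceil>R\<rceil>))" using subset_cball[of R "real (nat \<lceil>R\<rceil>)" 0] by (meson order_trans real_nat_ceiling_ge)
  then show ?thesis by blast
qed

lemma lev_mult_integrable:
  assumes "\<eta> \<in> Cr_c s"
  shows "integrable lborel (\<lambda>x. lev n c x * \<eta> x)"
proof -
  obtain R where R: "supp \<eta> \<subseteq> cball 0 R" using Cr_c_supp[OF assms] by blast
  have "(\<lambda>x. lev n c x * \<eta> x) = (\<lambda>x. \<eta> x * levK n R c x)"
    by (rule ext, subst mult.commute, rule mult_lev[OF R])
  then show ?thesis using integrable_Cc_mult[OF assms Cr_c_continuous[OF levK_Cr_c]] by simp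
qed

lemma pairing_lev:
  assumes \<eta>: "\<eta> \<in> Cr_c r" "supp \<eta> \<subseteq> cball 0 R" "0 \<le> R"
  shows "\<exists>C\<ge>0. \<forall>n c. \<bar>LINT x|lborel. lev n c x * \<eta> x\<bar> \<le> lev_norm C R c n"
proof -
  obtain C where C: "C \<ge> 0" "\<And>n i c. i \<in> levels II n \<Longrightarrow>
    \<bar>LINT x|lborel. gsum i n (lat (2 ^ n * R + \<rho>)) c x * \<eta> x\<bar>
      \<le> C * 2 powr (real n * (wt \<beta> p - \<delta>)) * lp p (lat (2 ^ n * R + \<rho>)) c"
    using pairing_bound[OF p \<eta>(1,3), of \<beta> \<alpha>] unfolding \<delta>_def by blast
  have "\<bar>LINT x|lborel. lev n c x * \<eta> x\<bar> \<le> lev_norm C R c n" for n c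
  proof -
    let ?g = "\<lambda>i. gsum i n (lat (2 ^ n * R + \<rho>)) (\<lambda>k. c (n, i, k))"
    have "(LINT x|lborel. lev n c x * \<eta> x) = (LINT x|lborel. (\<Sum>i\<in>levels II n. ?g i x * \<eta> x))"
      using mult_lev[OF \<eta>(2)] by (simp add: mult.commute[of _ "\<eta> _"] levK_def sum_distrib_left)
    also have "\<dots> = (\<Sum>i\<in>levels II n. (LINT x|lborel. ?g i x * \<eta> x))"
      by (intro Bochner_Integration.integral_sum integrable_Cc_mult'[OF \<eta>(1)] Cr_c_continuous[OF gsum_Cr_c] levels_pos near_finite)
    finally have e: "(LINT x|lborel. lev n c x * \<eta> x) = (\<Sum>i\<in>levels II n. (LINT x|lborel. ?g i x * \<eta> x))" .
    have "\<bar>\<Sum>i\<in>levels II n. (LINT x|lborel. ?g i x * \<eta> x)\<bar> \<le> (\<Sum>i\<in>levels II n. \<bar>LINT x|lborel. ?g i x * \<eta> x\<bar>)" by (rule sum_abs)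
    also have "\<dots> \<le> (\<Sum>i\<in>levels II n. C * 2 powr (real n * (wt \<beta> p - \<delta>)) * lp p (lat (2 ^ n * R + \<rho>)) (\<lambda>k. c (n, i, k)))"
      by (intro sum_mono C(2))
    finally show ?thesis unfolding e by (simp add: lev_norm_def q_def sum_distrib_left)
  qed
  then show ?thesis using C(1) by blast
qed

lemma pairing_summable:
  assumes "good L c" "\<eta> \<in> Cinf_c"
  shows "summable (\<lambda>n. LINT x|lborel. lev n c x * \<eta> x)"
proof -
  obtain R :: nat where R: "supp \<eta> \<subseteq> cball 0 (real R)" using nat_radius[OF Cinf_c_D[OF assms(2)]] by blast
  obtain C where C: "C \<ge> 0" "\<And>n. \<bar>LINT x|lborel. lev n c x * \<eta> x\<bar> \<le> lev_norm C (real R) c n"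
    using pairing_lev[OF Cinf_c_D[OF assms(2)] R] by auto
  show ?thesis
    by (rule summable_comparison_test'[OF good_summable[OF assms(1) C(1), of R], of 0]) (simp add: C(2))
qed

text \<open>Restricted to \<open>Cinf_c\<close> because elements of \<open>holder_loc\<close> are
  extensional there.\<close>

definition T :: "(nat \<times> nat \<times> (real ^ 'n) \<Rightarrow> real) \<Rightarrow> (real ^ 'n \<Rightarrow> real) \<Rightarrow> real" where
  "T c = (\<lambda>\<eta>\<in>Cinf_c. \<Sum>n. LINT x|lborel. lev n c x * \<eta> x)"

lemma T_diff:
  assumes "good L a" "good L b" "\<eta> \<in> Cinf_c"
  shows "T (\<lambda>j. a j - b j) \<eta> = T a \<eta> - T b \<eta>"
proof -
  have "(LINT x|lborel. lev n (\<lambda>j. a j - b j) x * \<eta> x) = (LINT x|lborel. lev n a x * \<eta> x) - (LINT x|lborel. lev n b x * \<eta> x)" for n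
    using lev_mult_integrable[OF Cinf_c_D[OF assms(3)]] by (simp add: lev_diff left_diff_distrib)
  then show ?thesis
    using suminf_diff[OF pairing_summable[OF assms(1,3)] pairing_summable[OF assms(2,3)]] assms(3) by (simp add: T_def)
qed

text \<open>The partial sums are only of class \<open>C\<^sup>r\<close>, so they are mollified to approximate \<open>T c\<close> by
  test functions.\<close>

definition psum :: "(nat \<times> nat \<times> (real ^ 'n) \<Rightarrow> real) \<Rightarrow> nat \<Rightarrow> real ^ 'n \<Rightarrow> real" where
  "psum c N x = (\<Sum>n<N. levK n (real N) c x)"

definition appr :: "(nat \<times> nat \<times> (real ^ 'n) \<Rightarrow> real) \<Rightarrow> nat \<Rightarrow> real ^ 'n \<Rightarrow> real" where
  "appr c N = (SOME g. g \<in> Cinf_c \<and> Cbd r (inverse (real (Suc N))) (\<lambda>x. g x - psum c N x))"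

lemma psum_Cr_c: "psum c N \<in> Cr_c r"
  unfolding psum_def[abs_def] by (intro Cr_c_sum levK_Cr_c) simp

lemma appr: "appr c N \<in> Cinf_c" "Cbd r (inverse (real (Suc N))) (\<lambda>x. appr c N x - psum c N x)"
proof -
  have "\<exists>g. g \<in> Cinf_c \<and> Cbd r (inverse (real (Suc N))) (\<lambda>x. g x - psum c N x)"
    using mollify[OF psum_Cr_c, of "inverse (real (Suc N))" c N] by auto
  from someI_ex[OF this] show "appr c N \<in> Cinf_c" "Cbd r (inverse (real (Suc N))) (\<lambda>x. appr c N x - psum c N x)"
    unfolding appr_def[symmetric] by auto
qed

text \<open>In the N-th partial sum all levels are cut off at radius N, which makes the sum
  compactly supported; a fixed \<kappa> sees the full levels as soon as N exceeds the radius of its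
  support.\<close>

lemma mult_psum:
  assumes "supp \<kappa> \<subseteq> cball 0 (real R)" "R \<le> N"
  shows "\<kappa> x * psum c N x = (\<Sum>n<N. \<kappa> x * lev n c x)"
proof -
  have "supp \<kappa> \<subseteq> cball 0 (real N)" using assms by (meson of_nat_mono order_trans subset_cball)
  then show ?thesis unfolding psum_def by (simp add: mult_lev sum_distrib_left)
qed

lemma mult_lev_Cr_c: "\<kappa> \<in> Cinf_c \<Longrightarrow> (\<lambda>x. \<kappa> x * lev n c x) \<in> Cr_c 0"
proof -
  assume \<kappa>: "\<kappa> \<in> Cinf_c"
  obtain R where R: "supp \<kappa> \<subseteq> cball 0 R" using Cr_c_supp[OF Cinf_c_D[OF \<kappa>]] by blast
  show ?thesis unfolding mult_lev[OF R] by (intro Cr_c0_mult Cinf_c_D[OF \<kappa>] Cr_c_continuous[OF levK_Cr_c])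
qed

lemma holder_norm_levs:
  assumes C: "\<And>n c. holder_norm V \<alpha> (\<lambda>x. \<kappa> x * lev n c x) \<le> ennreal (lev_norm C R c n)" "0 \<le> C"
    and \<kappa>: "\<kappa> \<in> Cinf_c" and S: "finite S"
  shows "holder_norm V \<alpha> (\<lambda>x. \<Sum>n\<in>S. \<kappa> x * lev n c x) \<le> ennreal (\<Sum>n\<in>S. lev_norm C R c n)"
proof -
  have "holder_norm V \<alpha> (\<lambda>x. \<Sum>n\<in>S. \<kappa> x * lev n c x) \<le> (\<Sum>n\<in>S. holder_norm V \<alpha> (\<lambda>x. \<kappa> x * lev n c x))"
    by (intro holder_norm_sum S mult_lev_Cr_c \<kappa>)
  also have "\<dots> \<le> (\<Sum>n\<in>S. ennreal (lev_norm C R c n))" by (intro sum_mono C(1))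
  also have "\<dots> = ennreal (\<Sum>n\<in>S. lev_norm C R c n)" by (intro sum_ennreal lev_norm_nonneg C(2))
  finally show ?thesis .
qed

lemma appr_diff_bound:
  assumes C: "\<And>n c. holder_norm V \<alpha> (\<lambda>x. \<kappa> x * lev n c x) \<le> ennreal (lev_norm C (real R) c n)" "0 \<le> C"
    and C': "\<And>e u. Cbd r e u \<Longrightarrow> holder_norm V \<alpha> (\<lambda>x. \<kappa> x * u x) \<le> ennreal (C' * e)" "0 \<le> C'"
    and \<kappa>: "\<kappa> \<in> Cinf_c" "supp \<kappa> \<subseteq> cball 0 (real R)" and ij: "R \<le> i" "R \<le> j"
  shows "holder_norm V \<alpha> (\<lambda>x. \<kappa> x * (appr c i x - appr c j x))
    \<le> ennreal (C' * (inverse (real (Suc i)) + inverse (real (Suc j))) + (\<Sum>n\<in>{min i j..<max i j}. lev_norm C (real R) c n))"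
proof -
  let ?e = "\<lambda>x. (appr c i x - psum c i x) - (appr c j x - psum c j x)"
  let ?S = "{min i j..<max i j}"
  \<comment> \<open>The sign makes the cases i < j and j \<le> i symmetric; \<open>lev_norm\<close>
    does not see it.\<close>
  define c' where "c' = (if j \<le> i then c else (\<lambda>j. - c j))"
  have nc: "lev_norm C (real R) c' n = lev_norm C (real R) c n" for n by (simp add: c'_def lev_norm_def)
  have diff: "\<kappa> x * psum c i x - \<kappa> x * psum c j x = (\<Sum>n\<in>?S. \<kappa> x * lev n c' x)" for x
  proof (cases "j \<le> i")
    case True
    have "{..<i} = {..<j} \<union> {j..<i}" "{..<j} \<inter> {j..<i} = {}" using True by auto
    then have "(\<Sum>n<i. \<kappa> x * lev n c x) = (\<Sum>n<j. \<kappa> x * lev n c x) + (\<Sum>n=j..<i. \<kappa> x * lev n c x)"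
      by (metis finite_atLeastLessThan finite_lessThan sum.union_disjoint)
    then show ?thesis using True by (simp add: mult_psum[OF \<kappa>(2)] ij c'_def)
  next
    case False
    have "{..<j} = {..<i} \<union> {i..<j}" "{..<i} \<inter> {i..<j} = {}" using False by auto
    then have "(\<Sum>n<j. \<kappa> x * lev n c x) = (\<Sum>n<i. \<kappa> x * lev n c x) + (\<Sum>n=i..<j. \<kappa> x * lev n c x)"
      by (metis finite_atLeastLessThan finite_lessThan sum.union_disjoint)
    then show ?thesis using False by (simp add: mult_psum[OF \<kappa>(2)] ij c'_def lev_uminus sum_negf min_def max_def)
  qed
  have eq: "(\<lambda>x. \<kappa> x * (appr c i x - appr c j x)) = (\<lambda>x. \<kappa> x * ?e x + (\<Sum>n\<in>?S. \<kappa> x * lev n c' x))"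
  proof
    fix x
    show "\<kappa> x * (appr c i x - appr c j x) = \<kappa> x * ?e x + (\<Sum>n\<in>?S. \<kappa> x * lev n c' x)"
      unfolding diff[symmetric] by (simp add: algebra_simps)
  qed
  have e: "Cbd r (inverse (real (Suc i)) + inverse (real (Suc j))) ?e" by (intro Cbd_diff appr)
  have "holder_norm V \<alpha> (\<lambda>x. \<kappa> x * (appr c i x - appr c j x))
     \<le> holder_norm V \<alpha> (\<lambda>x. \<kappa> x * ?e x) + holder_norm V \<alpha> (\<lambda>x. \<Sum>n\<in>?S. \<kappa> x * lev n c' x)"
    unfolding eq by (intro holder_norm_triangle Cr_c0_mult Cinf_c_D[OF \<kappa>(1)] Cr_continuous[OF Cbd_Cr[OF e]] Cr_c_sum mult_lev_Cr_c[OF \<kappa>(1)]) simp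
  also have "\<dots> \<le> ennreal (C' * (inverse (real (Suc i)) + inverse (real (Suc j)))) + ennreal (\<Sum>n\<in>?S. lev_norm C (real R) c' n)"
    by (intro add_mono C'(1) e holder_norm_levs C \<kappa>) auto
  also have "\<dots> = ennreal (C' * (inverse (real (Suc i)) + inverse (real (Suc j))) + (\<Sum>n\<in>?S. lev_norm C (real R) c' n))"
    using C' C(2) by (intro ennreal_plus[symmetric]) (auto intro: sum_nonneg lev_norm_nonneg)
  finally show ?thesis by (simp add: nc)
qed

lemma approximates_T:
  assumes c: "good L c"
  shows "approximates V \<alpha> (appr c) (T c)"
  unfolding approximates_def
proof (intro conjI allI ballI impI)
  show "appr c j \<in> Cinf_c" for j by (rule appr)
next
  fix \<kappa> :: "real ^ 'n \<Rightarrow> real" and \<epsilon> :: ennreal assume \<kappa>: "\<kappa> \<in> Cinf_c" and \<epsilon>: "0 < \<epsilon>"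
  obtain e where e: "0 < e" "ennreal e \<le> \<epsilon>"
    using ennreal_real_below[OF \<epsilon>] by blast
  obtain R :: nat where R: "supp \<kappa> \<subseteq> cball 0 (real R)" using nat_radius[OF Cinf_c_D[OF \<kappa>]] by blast
  obtain C where C: "C \<ge> 0" "\<And>n c. holder_norm V \<alpha> (\<lambda>x. \<kappa> x * lev n c x) \<le> ennreal (lev_norm C (real R) c n)"
    using holder_norm_lev[OF \<kappa> R] by auto
  obtain C' where C': "C' \<ge> 0" "\<And>e u. Cbd r e u \<Longrightarrow> holder_norm V \<alpha> (\<lambda>x. \<kappa> x * u x) \<le> ennreal (C' * e)"
    using holder_norm_smooth[OF \<alpha>r \<kappa>] by auto
  have "(\<lambda>n. C' * inverse (real (Suc n))) \<longlonglongrightarrow> C' * 0" by (intro tendsto_intros LIMSEQ_inverse_real_of_nat)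
  then have "\<forall>\<^sub>F n in sequentially. C' * inverse (real (Suc n)) < e / 4"
    using e(1) by (intro order_tendstoD) auto
  then obtain N1 where N1: "\<And>n. n \<ge> N1 \<Longrightarrow> C' * inverse (real (Suc n)) < e / 4"
    by (auto simp: eventually_sequentially)
  obtain N2 where N2: "\<And>m n. m \<ge> N2 \<Longrightarrow> norm (\<Sum>k=m..<n. lev_norm C (real R) c k) < e / 2"
    using good_summable[OF c C(1), of R] e(1) unfolding summable_Cauchy by (meson half_gt_zero)
  show "\<exists>N. \<forall>i\<ge>N. \<forall>j\<ge>N. holder_norm V \<alpha> (\<lambda>x. \<kappa> x * (appr c i x - appr c j x)) < \<epsilon>"
  proof (intro exI allI impI)
    fix i j assume ij: "max R (max N1 N2) \<le> i" "max R (max N1 N2) \<le> j"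
    have "holder_norm V \<alpha> (\<lambda>x. \<kappa> x * (appr c i x - appr c j x))
      \<le> ennreal (C' * (inverse (real (Suc i)) + inverse (real (Suc j))) + (\<Sum>n\<in>{min i j..<max i j}. lev_norm C (real R) c n))"
      using ij by (intro appr_diff_bound C C' \<kappa> R) auto
    also have "\<dots> < ennreal e"
    proof (rule ennreal_lessI[OF e(1)])
      have "C' * (inverse (real (Suc i)) + inverse (real (Suc j))) < e / 2"
        using N1[of i] N1[of j] ij unfolding distrib_left by simp
      moreover have "(\<Sum>n\<in>{min i j..<max i j}. lev_norm C (real R) c n) < e / 2"
        using N2[of "min i j" "max i j"] ij by simp
      ultimately show "C' * (inverse (real (Suc i)) + inverse (real (Suc j))) + (\<Sum>n\<in>{min i j..<max i j}. lev_norm C (real R) c n) < e" by simp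
    qed
    finally show "holder_norm V \<alpha> (\<lambda>x. \<kappa> x * (appr c i x - appr c j x)) < \<epsilon>" using e(2) by (rule less_le_trans)
  qed
next
  fix \<eta> :: "real ^ 'n \<Rightarrow> real" assume \<eta>: "\<eta> \<in> Cinf_c"
  obtain R :: nat where R: "supp \<eta> \<subseteq> cball 0 (real R)" using nat_radius[OF Cinf_c_D[OF \<eta>]] by blast
  note \<eta>0 = Cinf_c_D[OF \<eta>, of 0]
  have i1: "integrable lborel (\<lambda>x. appr c N x * \<eta> x)" for N
    by (intro integrable_Cc_mult'[OF \<eta>0] Cr_c_continuous[OF Cinf_c_D[OF appr(1)]])
  have i2: "integrable lborel (\<lambda>x. psum c N x * \<eta> x)" for N
    by (intro integrable_Cc_mult'[OF \<eta>0] Cr_c_continuous[OF psum_Cr_c])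
  have P: "(LINT x|lborel. psum c N x * \<eta> x) = (\<Sum>n<N. LINT x|lborel. lev n c x * \<eta> x)" if "R \<le> N" for N
  proof -
    have "(LINT x|lborel. psum c N x * \<eta> x) = (LINT x|lborel. (\<Sum>n<N. lev n c x * \<eta> x))"
      using mult_psum[OF R that, of _ c] by (simp add: mult.commute)
    also have "\<dots> = (\<Sum>n<N. LINT x|lborel. lev n c x * \<eta> x)"
      by (intro Bochner_Integration.integral_sum lev_mult_integrable[OF \<eta>0])
    finally show ?thesis .
  qed
  have "(\<lambda>N. (\<Sum>n<N. LINT x|lborel. lev n c x * \<eta> x)) \<longlonglongrightarrow> T c \<eta>"
    using summable_LIMSEQ[OF pairing_summable[OF c \<eta>]] \<eta> by (simp add: T_def)
  then have L1: "(\<lambda>N. LINT x|lborel. psum c N x * \<eta> x) \<longlonglongrightarrow> T c \<eta>"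
    by (rule Lim_transform_eventually) (use P in \<open>auto simp: eventually_sequentially intro!: exI[of _ R]\<close>)
  have "(\<lambda>N. (LINT x|lborel. appr c N x * \<eta> x) - (LINT x|lborel. psum c N x * \<eta> x)) \<longlonglongrightarrow> 0"
  proof (rule Lim_null_comparison)
    show "\<forall>\<^sub>F N in sequentially. norm ((LINT x|lborel. appr c N x * \<eta> x) - (LINT x|lborel. psum c N x * \<eta> x))
       \<le> inverse (real (Suc N)) * (LINT x|lborel. \<bar>\<eta> x\<bar>)"
    proof (rule always_eventually, rule allI)
      fix N
      have "(LINT x|lborel. appr c N x * \<eta> x) - (LINT x|lborel. psum c N x * \<eta> x) = (LINT x|lborel. (appr c N x * \<eta> x - psum c N x * \<eta> x))"
        using i1 i2 by simp
      also have "norm \<dots> \<le> (LINT x|lborel. \<bar>appr c N x * \<eta> x - psum c N x * \<eta> x\<bar>)"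
        unfolding real_norm_def by (rule integral_abs_bound)
      also have "\<dots> \<le> (LINT x|lborel. inverse (real (Suc N)) * \<bar>\<eta> x\<bar>)"
      proof (rule integral_mono)
        show "integrable lborel (\<lambda>x. \<bar>appr c N x * \<eta> x - psum c N x * \<eta> x\<bar>)" using i1 i2 by auto
        show "integrable lborel (\<lambda>x. inverse (real (Suc N)) * \<bar>\<eta> x\<bar>)" using integrable_Cc[OF \<eta>0] by auto
        fix x
        have "\<bar>appr c N x - psum c N x\<bar> * \<bar>\<eta> x\<bar> \<le> inverse (real (Suc N)) * \<bar>\<eta> x\<bar>"
          by (rule mult_right_mono[OF Cbd_bound[OF appr(2)] abs_ge_zero])
        then show "\<bar>appr c N x * \<eta> x - psum c N x * \<eta> x\<bar> \<le> inverse (real (Suc N)) * \<bar>\<eta> x\<bar>"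
          by (simp add: left_diff_distrib[symmetric] abs_mult)
      qed
      also have "\<dots> = inverse (real (Suc N)) * (LINT x|lborel. \<bar>\<eta> x\<bar>)" by simp
      finally show "norm ((LINT x|lborel. appr c N x * \<eta> x) - (LINT x|lborel. psum c N x * \<eta> x))
       \<le> inverse (real (Suc N)) * (LINT x|lborel. \<bar>\<eta> x\<bar>)" .
    qed
    have "(\<lambda>N. inverse (real (Suc N)) * (LINT x|lborel. \<bar>\<eta> x\<bar>)) \<longlonglongrightarrow> 0 * (LINT x|lborel. \<bar>\<eta> x\<bar>)"
      by (intro tendsto_intros LIMSEQ_inverse_real_of_nat)
    then show "(\<lambda>N. inverse (real (Suc N)) * (LINT x|lborel. \<bar>\<eta> x\<bar>)) \<longlonglongrightarrow> 0" by simp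
  qed
  from tendsto_add[OF this L1] show "(\<lambda>N. LINT x|lborel. appr c N x * \<eta> x) \<longlonglongrightarrow> T c \<eta>" by simp
qed

lemma T_holder_loc: "good L c \<Longrightarrow> T c \<in> holder_loc V \<alpha>"
  using approximates_T by (auto simp: holder_loc_def T_def)

section \<open>The seminorms on the completion\<close>

lemma holder_norm_finite:
  assumes "\<kappa> \<in> Cinf_c" "g \<in> Cinf_c"
  shows "holder_norm V \<alpha> (\<lambda>x. \<kappa> x * g x) < \<infinity>"
proof -
  obtain e where "Cbd r e g" using Cr_c_Cbd[OF Cinf_c_D[OF assms(2)]] by blast
  then obtain C where "holder_norm V \<alpha> (\<lambda>x. \<kappa> x * g x) \<le> ennreal C"
    using holder_norm_smooth[OF \<alpha>r assms(1)] by blast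
  then show ?thesis by (rule le_less_trans) simp
qed

text \<open>\<open>lim\<close> says nothing about a sequence that diverges. Here the norms are
  finite and, by the triangle inequality, Cauchy, so \<open>holder_loc_seminorm\<close> is an
  infimum of true limits.\<close>

lemma seminorm_limit_exists:
  assumes g: "approximates V \<alpha> g u" and \<kappa>: "\<kappa> \<in> Cinf_c"
  shows "(\<lambda>j. holder_norm V \<alpha> (\<lambda>x. \<kappa> x * g j x)) \<longlonglongrightarrow> lim (\<lambda>j. holder_norm V \<alpha> (\<lambda>x. \<kappa> x * g j x))"
proof -
  let ?X = "\<lambda>j. holder_norm V \<alpha> (\<lambda>x. \<kappa> x * g j x)"
  have gC: "g j \<in> Cinf_c" for j using g by (simp add: approximates_def)
  have fin: "?X j < \<infinity>" for j by (rule holder_norm_finite[OF \<kappa> gC])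
  define y where "y j = enn2real (?X j)" for j
  have Xy: "?X j = ennreal (y j)" for j using fin[of j] by (simp add: y_def less_top)
  have y0: "0 \<le> y j" for j by (simp add: y_def)
  have tri: "?X i \<le> ?X j + holder_norm V \<alpha> (\<lambda>x. \<kappa> x * (g i x - g j x))" for i j
  proof -
    have "(\<lambda>x. \<kappa> x * g i x) = (\<lambda>x. \<kappa> x * g j x + \<kappa> x * (g i x - g j x))" by (simp add: algebra_simps)
    then show ?thesis
      using holder_norm_triangle[of "\<lambda>x. \<kappa> x * g j x" "\<lambda>x. \<kappa> x * (g i x - g j x)" \<alpha>]
        Cr_c0_mult[OF Cinf_c_D[OF \<kappa>] Cr_c_continuous[OF Cinf_c_D[OF gC[of j]]]]
        Cr_c0_mult[OF Cinf_c_D[OF \<kappa>] continuous_on_diff[OF Cr_c_continuous[OF Cinf_c_D[OF gC[of i]]] Cr_c_continuous[OF Cinf_c_D[OF gC[of j]]]]]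
      by simp
  qed
  have "Cauchy y"
  proof (rule metric_CauchyI)
    fix e :: real assume e: "0 < e"
    then obtain N where N: "\<And>i j. i \<ge> N \<Longrightarrow> j \<ge> N \<Longrightarrow> holder_norm V \<alpha> (\<lambda>x. \<kappa> x * (g i x - g j x)) < ennreal e"
      using g \<kappa> unfolding approximates_def by (metis ennreal_less_zero_iff)
    have "y i < y j + e" if "i \<ge> N" "j \<ge> N" for i j
    proof -
      have "?X i < ?X j + ennreal e"
      proof (rule le_less_trans[OF tri[of i j]])
        show "?X j + holder_norm V \<alpha> (\<lambda>x. \<kappa> x * (g i x - g j x)) < ?X j + ennreal e"
          using N[OF that] fin[of j] by (simp add: ennreal_add_left_cancel_less)
      qed
      then have "ennreal (y i) < ennreal (y j + e)" unfolding Xy using y0 e by (simp add: ennreal_plus)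
      then show ?thesis using y0[of i] by (simp add: ennreal_less_iff)
    qed
    then have "dist (y i) (y j) < e" if "i \<ge> N" "j \<ge> N" for i j
    proof -
      have "y i < y j + e" "y j < y i + e" using \<open>\<And>i j. N \<le> i \<Longrightarrow> N \<le> j \<Longrightarrow> y i < y j + e\<close> that by blast+
      then show ?thesis by (simp add: dist_real_def abs_less_iff)
    qed
    then show "\<exists>M. \<forall>m\<ge>M. \<forall>n\<ge>M. dist (y m) (y n) < e" by blast
  qed
  then obtain l where "y \<longlonglongrightarrow> l" by (auto simp: Cauchy_convergent_iff convergent_def)
  then have "?X \<longlonglongrightarrow> ennreal l" unfolding Xy by (rule tendsto_ennrealI)
  then show ?thesis by (simp add: limI)
qed

text \<open>The infimum is bounded through the one sequence \<open>appr c\<close>, whose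
  mollification error tends to zero and leaves the sum over the levels.\<close>

lemma seminorm_T_le:
  assumes c: "good L c" and \<kappa>: "\<kappa> \<in> Cinf_c" "supp \<kappa> \<subseteq> cball 0 (real R)"
    and C: "\<And>n c. holder_norm V \<alpha> (\<lambda>x. \<kappa> x * lev n c x) \<le> ennreal (lev_norm C (real R) c n)" "0 \<le> C"
  shows "holder_loc_seminorm V \<alpha> \<kappa> (T c) \<le> ennreal (\<Sum>n. lev_norm C (real R) c n)"
proof -
  let ?X = "\<lambda>j. holder_norm V \<alpha> (\<lambda>x. \<kappa> x * appr c j x)"
  let ?s = "\<Sum>n. lev_norm C (real R) c n"
  note sm = good_summable[OF c C(2), of R]
  have s0: "0 \<le> ?s" by (intro suminf_nonneg sm lev_norm_nonneg C(2))
  obtain C' where C': "C' \<ge> 0" "\<And>e u. Cbd r e u \<Longrightarrow> holder_norm V \<alpha> (\<lambda>x. \<kappa> x * u x) \<le> ennreal (C' * e)"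
    using holder_norm_smooth[OF \<alpha>r \<kappa>(1)] by auto
  have "?X N \<le> ennreal (C' * inverse (real (Suc N)) + ?s)" if N: "R \<le> N" for N
  proof -
    let ?e = "\<lambda>x. appr c N x - psum c N x"
    have eq: "(\<lambda>x. \<kappa> x * appr c N x) = (\<lambda>x. \<kappa> x * ?e x + (\<Sum>n<N. \<kappa> x * lev n c x))"
      by (simp add: fun_eq_iff mult_psum[OF \<kappa>(2) N, symmetric] algebra_simps)
    have "?X N \<le> holder_norm V \<alpha> (\<lambda>x. \<kappa> x * ?e x) + holder_norm V \<alpha> (\<lambda>x. \<Sum>n<N. \<kappa> x * lev n c x)"
      unfolding eq by (intro holder_norm_triangle Cr_c0_mult Cinf_c_D[OF \<kappa>(1)] Cr_continuous[OF Cbd_Cr[OF appr(2)]] Cr_c_sum mult_lev_Cr_c[OF \<kappa>(1)]) simp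
    also have "\<dots> \<le> ennreal (C' * inverse (real (Suc N))) + ennreal (\<Sum>n<N. lev_norm C (real R) c n)"
      by (intro add_mono C'(2) appr holder_norm_levs C \<kappa>) auto
    also have "\<dots> = ennreal (C' * inverse (real (Suc N)) + (\<Sum>n<N. lev_norm C (real R) c n))"
      using C' C(2) by (intro ennreal_plus[symmetric]) (auto intro: sum_nonneg lev_norm_nonneg)
    also have "\<dots> \<le> ennreal (C' * inverse (real (Suc N)) + ?s)"
      by (intro ennreal_leI add_left_mono sum_le_suminf sm) (auto intro: lev_norm_nonneg C(2))
    finally show ?thesis .
  qed
  moreover have "(\<lambda>N. ennreal (C' * inverse (real (Suc N)) + ?s)) \<longlonglongrightarrow> ennreal (C' * 0 + ?s)"
    by (intro tendsto_ennrealI tendsto_intros LIMSEQ_inverse_real_of_nat)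
  ultimately have "lim ?X \<le> ennreal (C' * 0 + ?s)"
    by (intro LIMSEQ_le[OF seminorm_limit_exists[OF approximates_T[OF c] \<kappa>(1)]]) auto
  moreover have "holder_loc_seminorm V \<alpha> \<kappa> (T c) \<le> lim ?X"
    unfolding holder_loc_seminorm_def by (rule INF_lower) (simp add: approximates_T[OF c])
  ultimately show ?thesis by simp
qed

lemma approximates_add:
  assumes g: "approximates V \<alpha> g u" and h: "approximates V \<alpha> h v"
  shows "approximates V \<alpha> (\<lambda>j x. g j x + h j x) (\<lambda>\<eta>\<in>Cinf_c. u \<eta> + v \<eta>)"
  unfolding approximates_def
proof (intro conjI allI ballI impI)
  have gC: "g j \<in> Cinf_c" and hC: "h j \<in> Cinf_c" for j using g h by (simp_all add: approximates_def)
  show "(\<lambda>x. g j x + h j x) \<in> Cinf_c" for j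
    unfolding Cinf_c_def by (intro INT_I Cr_c_add Cinf_c_D gC hC)
  show "(\<lambda>j. LINT x|lborel. (g j x + h j x) * \<eta> x) \<longlonglongrightarrow> (\<lambda>\<eta>\<in>Cinf_c. u \<eta> + v \<eta>) \<eta>" if \<eta>: "\<eta> \<in> Cinf_c" for \<eta>
  proof -
    have "(\<lambda>j. (LINT x|lborel. g j x * \<eta> x) + (LINT x|lborel. h j x * \<eta> x)) \<longlonglongrightarrow> u \<eta> + v \<eta>"
      using g h \<eta> by (intro tendsto_add) (auto simp: approximates_def)
    moreover have "(LINT x|lborel. (g j x + h j x) * \<eta> x) = (LINT x|lborel. g j x * \<eta> x) + (LINT x|lborel. h j x * \<eta> x)" for j
      using integrable_Cc_mult'[OF Cinf_c_D[OF \<eta>, of 0] Cr_c_continuous[OF Cinf_c_D[OF gC[of j], of 0]]]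
        integrable_Cc_mult'[OF Cinf_c_D[OF \<eta>, of 0] Cr_c_continuous[OF Cinf_c_D[OF hC[of j], of 0]]] by (simp add: distrib_right)
    ultimately show ?thesis using \<eta> by simp
  qed
  fix \<kappa> :: "real ^ 'n \<Rightarrow> real" and \<epsilon> :: ennreal assume \<kappa>: "\<kappa> \<in> Cinf_c" and \<epsilon>: "0 < \<epsilon>"
  have \<epsilon>2: "0 < \<epsilon> / 2" using \<epsilon> by (simp add: ennreal_zero_less_divide)
  obtain N1 where N1: "\<And>i j. i \<ge> N1 \<Longrightarrow> j \<ge> N1 \<Longrightarrow> holder_norm V \<alpha> (\<lambda>x. \<kappa> x * (g i x - g j x)) < \<epsilon> / 2"
    using g \<kappa> \<epsilon>2 unfolding approximates_def by meson
  obtain N2 where N2: "\<And>i j. i \<ge> N2 \<Longrightarrow> j \<ge> N2 \<Longrightarrow> holder_norm V \<alpha> (\<lambda>x. \<kappa> x * (h i x - h j x)) < \<epsilon> / 2"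
    using h \<kappa> \<epsilon>2 unfolding approximates_def by meson
  show "\<exists>N. \<forall>i\<ge>N. \<forall>j\<ge>N. holder_norm V \<alpha> (\<lambda>x. \<kappa> x * (g i x + h i x - (g j x + h j x))) < \<epsilon>"
  proof (intro exI allI impI)
    fix i j assume ij: "max N1 N2 \<le> i" "max N1 N2 \<le> j"
    have eq: "(\<lambda>x. \<kappa> x * (g i x + h i x - (g j x + h j x))) = (\<lambda>x. \<kappa> x * (g i x - g j x) + \<kappa> x * (h i x - h j x))"
      by (simp add: algebra_simps)
    have "holder_norm V \<alpha> (\<lambda>x. \<kappa> x * (g i x + h i x - (g j x + h j x)))
      \<le> holder_norm V \<alpha> (\<lambda>x. \<kappa> x * (g i x - g j x)) + holder_norm V \<alpha> (\<lambda>x. \<kappa> x * (h i x - h j x))"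
      unfolding eq
      by (intro holder_norm_triangle Cr_c0_mult Cinf_c_D[OF \<kappa>] continuous_on_diff Cr_c_continuous[OF Cinf_c_D[OF gC]] Cr_c_continuous[OF Cinf_c_D[OF hC]])
    also have "\<dots> < \<epsilon> / 2 + \<epsilon> / 2" using ij by (intro add_strict_mono N1 N2) auto
    also have "\<dots> = \<epsilon>" by (rule ennreal_half_sum)
    finally show "holder_norm V \<alpha> (\<lambda>x. \<kappa> x * (g i x + h i x - (g j x + h j x))) < \<epsilon>" .
  qed
qed

text \<open>Sequences that are optimal up to \<open>e / 2\<close> for \<open>u\<close> and
  \<open>v\<close> are added, which gives an admissible sequence for the sum; so subadditivity comes
  directly from the infimum.\<close>

lemma seminorm_add:
  assumes \<kappa>: "\<kappa> \<in> Cinf_c"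
  shows "holder_loc_seminorm V \<alpha> \<kappa> (\<lambda>\<eta>\<in>Cinf_c. u \<eta> + v \<eta>) \<le> holder_loc_seminorm V \<alpha> \<kappa> u + holder_loc_seminorm V \<alpha> \<kappa> v"
proof (rule ennreal_le_epsilon)
  fix e :: real assume fin: "holder_loc_seminorm V \<alpha> \<kappa> u + holder_loc_seminorm V \<alpha> \<kappa> v < top" and e: "0 < e"
  then have fu: "holder_loc_seminorm V \<alpha> \<kappa> u < top" and fv: "holder_loc_seminorm V \<alpha> \<kappa> v < top" by auto
  have "holder_loc_seminorm V \<alpha> \<kappa> u < holder_loc_seminorm V \<alpha> \<kappa> u + ennreal (e / 2)"
    using fu e by (intro ennreal_less_self_add) auto
  then obtain g where g: "approximates V \<alpha> g u" "lim (\<lambda>j. holder_norm V \<alpha> (\<lambda>x. \<kappa> x * g j x)) < holder_loc_seminorm V \<alpha> \<kappa> u + ennreal (e / 2)"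
    unfolding holder_loc_seminorm_def[of V \<alpha> \<kappa> u] INF_less_iff by auto
  have "holder_loc_seminorm V \<alpha> \<kappa> v < holder_loc_seminorm V \<alpha> \<kappa> v + ennreal (e / 2)"
    using fv e by (intro ennreal_less_self_add) auto
  then obtain h where h: "approximates V \<alpha> h v" "lim (\<lambda>j. holder_norm V \<alpha> (\<lambda>x. \<kappa> x * h j x)) < holder_loc_seminorm V \<alpha> \<kappa> v + ennreal (e / 2)"
    unfolding holder_loc_seminorm_def[of V \<alpha> \<kappa> v] INF_less_iff by auto
  have gC: "g j \<in> Cinf_c" and hC: "h j \<in> Cinf_c" for j using g(1) h(1) by (simp_all add: approximates_def)
  note gh = approximates_add[OF g(1) h(1)]
  have "holder_norm V \<alpha> (\<lambda>x. \<kappa> x * (g j x + h j x)) \<le> holder_norm V \<alpha> (\<lambda>x. \<kappa> x * g j x) + holder_norm V \<alpha> (\<lambda>x. \<kappa> x * h j x)" for j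
    unfolding distrib_left
    by (intro holder_norm_triangle Cr_c0_mult Cinf_c_D[OF \<kappa>] Cr_c_continuous[OF Cinf_c_D[OF gC]] Cr_c_continuous[OF Cinf_c_D[OF hC]])
  then have "lim (\<lambda>j. holder_norm V \<alpha> (\<lambda>x. \<kappa> x * (g j x + h j x)))
     \<le> lim (\<lambda>j. holder_norm V \<alpha> (\<lambda>x. \<kappa> x * g j x)) + lim (\<lambda>j. holder_norm V \<alpha> (\<lambda>x. \<kappa> x * h j x))"
    by (intro LIMSEQ_le[OF seminorm_limit_exists[OF gh \<kappa>] tendsto_add[OF seminorm_limit_exists[OF g(1) \<kappa>] seminorm_limit_exists[OF h(1) \<kappa>]]]) auto
  moreover have "holder_loc_seminorm V \<alpha> \<kappa> (\<lambda>\<eta>\<in>Cinf_c. u \<eta> + v \<eta>) \<le> lim (\<lambda>j. holder_norm V \<alpha> (\<lambda>x. \<kappa> x * (g j x + h j x)))"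
    unfolding holder_loc_seminorm_def by (rule INF_lower) (simp add: gh)
  ultimately have "holder_loc_seminorm V \<alpha> \<kappa> (\<lambda>\<eta>\<in>Cinf_c. u \<eta> + v \<eta>)
     \<le> lim (\<lambda>j. holder_norm V \<alpha> (\<lambda>x. \<kappa> x * g j x)) + lim (\<lambda>j. holder_norm V \<alpha> (\<lambda>x. \<kappa> x * h j x))" by (rule order_trans[rotated])
  also have "\<dots> \<le> (holder_loc_seminorm V \<alpha> \<kappa> u + ennreal (e / 2)) + (holder_loc_seminorm V \<alpha> \<kappa> v + ennreal (e / 2))"
    using g(2) h(2) by (intro add_mono) auto
  also have "\<dots> = holder_loc_seminorm V \<alpha> \<kappa> u + holder_loc_seminorm V \<alpha> \<kappa> v + (ennreal (e / 2) + ennreal (e / 2))"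
    by (simp only: ac_simps)
  also have "ennreal (e / 2) + ennreal (e / 2) = ennreal e"
    using e by (subst ennreal_plus[symmetric]) auto
  finally show "holder_loc_seminorm V \<alpha> \<kappa> (\<lambda>\<eta>\<in>Cinf_c. u \<eta> + v \<eta>) \<le> holder_loc_seminorm V \<alpha> \<kappa> u + holder_loc_seminorm V \<alpha> \<kappa> v + ennreal e" .
qed

section \<open>The compact set of coefficient arrays and its image\<close>

definition goodset :: "(nat \<Rightarrow> real) \<Rightarrow> (nat \<times> nat \<times> (real ^ 'n) \<Rightarrow> real) set" where
  "goodset L = {c. good L c \<and> (\<forall>n i k. \<not> (i \<in> levels II n \<and> k \<in> int_lattice) \<longrightarrow> c (n, i, k) = 0)}"

lemma continuous_q: "continuous_on UNIV (\<lambda>c. q n R (\<lambda>j. c j - c0 j))"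
proof -
  have "0 < p" using p by simp
  then show ?thesis unfolding q_def lp_def
    by (intro continuous_intros continuous_on_powr' continuous_on_product_coordinates)
       (auto intro: sum_nonneg)
qed

text \<open>Each condition involves finitely many coordinates and is closed for pointwise
  convergence. The coefficient at \<open>k\<close> is bounded by the condition for the ball of
  radius \<open>\<lceil>norm k\<rceil>\<close>, and coordinates outside of the index set are frozen
  at zero, so the set lies in a product of compact intervals.\<close>

lemma compact_goodset: "compact (goodset L)"
proof -
  let ?b = "\<lambda>j :: nat \<times> nat \<times> (real ^ 'n). max 0 (L (nat \<lceil>norm (snd (snd j))\<rceil>) * 2 powr (- (real (fst j) * wt \<beta> p)))"
  have "compactin (product_topology (\<lambda>_. euclidean) UNIV) (PiE UNIV (\<lambda>j. {- ?b j..?b j}))"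
    by (simp add: compactin_PiE)
  then have cP: "compact (PiE UNIV (\<lambda>j. {- ?b j..?b j}))" by (simp add: euclidean_product_topology)
  have "closed (goodset L)"
  proof -
    have e: "goodset L = (\<Inter>n. \<Inter>R. {c. q n (real R) c \<le> L R * 2 powr (- (real n * wt \<beta> p))})
      \<inter> (\<Inter>j\<in>{(n, i, k). \<not> (i \<in> levels II n \<and> k \<in> int_lattice)}. {c. c j = 0})"
      by (auto simp: goodset_def good_def)
    have "continuous_on UNIV (\<lambda>c. q n R c)" for n R using continuous_q[of n R "\<lambda>_. 0"] by simp
    then show ?thesis unfolding e
      by (intro closed_Int closed_INT ballI closed_Collect_le closed_Collect_eq continuous_on_const continuous_on_product_coordinates)
  qed
  moreover have "goodset L \<subseteq> PiE UNIV (\<lambda>j. {- ?b j..?b j})"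
  proof
    fix c assume c: "c \<in> goodset L"
    have "\<bar>c (n, i, k)\<bar> \<le> ?b (n, i, k)" for n i k
    proof (cases "i \<in> levels II n \<and> k \<in> int_lattice")
      case True
      let ?R = "nat \<lceil>norm k\<rceil>"
      have "norm k \<le> 2 ^ n * real ?R + \<rho>"
      proof -
        have "norm k \<le> 1 * real ?R" unfolding mult_1 by (rule real_nat_ceiling_ge)
        also have "\<dots> \<le> 2 ^ n * real ?R" by (rule mult_right_mono[OF _ of_nat_0_le_iff]) simp
        finally show ?thesis using \<rho>(1) by linarith
      qed
      then have k: "k \<in> lat (2 ^ n * real ?R + \<rho>)" using True by (simp add: near_def)
      have "\<bar>c (n, i, k)\<bar> \<le> lp p (lat (2 ^ n * real ?R + \<rho>)) (\<lambda>k. c (n, i, k))"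
        using abs_le_lp[OF near_finite k p, of "\<lambda>k. c (n, i, k)"] .
      also have "\<dots> \<le> q n (real ?R) c" unfolding q_def by (rule member_le_sum) (use True lp_nonneg in auto)
      also have "\<dots> \<le> L ?R * 2 powr (- (real n * wt \<beta> p))"
      proof -
        have "good L c" using c by (simp add: goodset_def)
        then show ?thesis unfolding good_def by blast
      qed
      finally show ?thesis by simp
    qed (use c in \<open>auto simp: goodset_def\<close>)
    note le = this
    have "c j \<in> {- ?b j..?b j}" for j
    proof -
      obtain n i k where j: "j = (n, i, k)" by (cases j)
      from abs_le_D1[OF le[of n i k]] abs_le_D2[OF le[of n i k]] show ?thesis
        unfolding j atLeastAtMost_iff by (intro conjI; linarith)
    qed
    then show "c \<in> PiE UNIV (\<lambda>j. {- ?b j..?b j})" by blast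
  qed
  ultimately show ?thesis using compact_Int_closed[OF cP, of "goodset L"] by (simp add: Int_absorb1)
qed

text \<open>The tail of levels is small uniformly over \<open>goodset L\<close>, and the finitely
  many levels before it depend on finitely many coordinates, continuously.\<close>

lemma T_near:
  assumes c0: "c0 \<in> goodset L" and L: "\<And>R. 0 \<le> L R" and \<kappa>: "\<kappa> \<in> Cinf_c" and e: "0 < e"
  shows "\<exists>U. open U \<and> c0 \<in> U \<and> (\<forall>c\<in>goodset L \<inter> U. holder_loc_seminorm V \<alpha> \<kappa> (T (\<lambda>j. c j - c0 j)) \<le> ennreal e)"
proof -
  obtain R :: nat where R: "supp \<kappa> \<subseteq> cball 0 (real R)" using nat_radius[OF Cinf_c_D[OF \<kappa>]] by blast
  obtain C where C: "C \<ge> 0" "\<And>n c. holder_norm V \<alpha> (\<lambda>x. \<kappa> x * lev n c x) \<le> ennreal (lev_norm C (real R) c n)"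
    using holder_norm_lev[OF \<kappa> R] by auto
  \<comment> \<open>The factor 8 is the one of \<open>good_diff\<close>: the difference of two
    arrays obeys the same bounds with this loss.\<close>
  define g where "g n = C * (8 * L R) * 2 powr (- (real n * \<delta>))" for n
  have gs: "summable g" unfolding g_def by (rule geometric)
  have "(\<lambda>N. \<Sum>n. g (n + N)) \<longlonglongrightarrow> 0" by (rule suminf_exist_split2[OF gs])
  then have "\<forall>\<^sub>F N in sequentially. (\<Sum>n. g (n + N)) < e / 2" using e by (intro order_tendstoD) auto
  then obtain N where N: "(\<Sum>n. g (n + N)) < e / 2" by (auto simp: eventually_sequentially)
  define \<Phi> where "\<Phi> c = (\<Sum>n<N. lev_norm C (real R) (\<lambda>j. c j - c0 j) n)" for c
  have "continuous_on UNIV \<Phi>" unfolding \<Phi>_def[abs_def] lev_norm_def by (intro continuous_intros continuous_q)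
  then have "open {c. \<Phi> c < e / 2}" by (intro open_Collect_less continuous_on_const)
  moreover have "c0 \<in> {c. \<Phi> c < e / 2}" using e by (simp add: \<Phi>_def lev_norm_def)
  moreover have "holder_loc_seminorm V \<alpha> \<kappa> (T (\<lambda>j. c j - c0 j)) \<le> ennreal e"
    if c: "c \<in> goodset L" "\<Phi> c < e / 2" for c
  proof -
    let ?d = "\<lambda>j. c j - c0 j"
    have gd: "good (\<lambda>R. 8 * L R) ?d" using c(1) c0 by (intro good_diff) (auto simp: goodset_def)
    note sm = good_summable[OF gd C(1), of R]
    have 1: "holder_loc_seminorm V \<alpha> \<kappa> (T ?d) \<le> ennreal (\<Sum>n. lev_norm C (real R) ?d n)"
      by (rule seminorm_T_le[OF gd \<kappa> R C(2,1)])
    have "(\<Sum>n. lev_norm C (real R) ?d n) = (\<Sum>n. lev_norm C (real R) ?d (n + N)) + \<Phi> c"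
      unfolding \<Phi>_def by (rule suminf_split_initial_segment[OF sm])
    also have "\<dots> \<le> (\<Sum>n. g (n + N)) + \<Phi> c"
      unfolding g_def
      by (intro add_right_mono suminf_le good_lev_norm_le[OF gd C(1)] sm[THEN summable_ignore_initial_segment]
          geometric[THEN summable_ignore_initial_segment])
    finally have "(\<Sum>n. lev_norm C (real R) ?d n) \<le> e" using N c(2) by linarith
    then show ?thesis by (rule order_trans[OF 1 ennreal_leI])
  qed
  ultimately show ?thesis by blast
qed

lemma compactin_T:
  assumes L: "\<And>R. 0 \<le> L R"
  shows "compactin (holder_loc_topology V \<alpha>) (T ` goodset L)"
proof (rule image_compactin)
  show "compactin (top_of_set (goodset L)) (goodset L)"
    by (simp add: compactin_subtopology compact_goodset)
  show "continuous_map (top_of_set (goodset L)) (holder_loc_topology V \<alpha>) T"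
    unfolding holder_loc_topology_def
  proof (rule continuous_on_generated_topo)
    let ?B = "\<lambda>u \<kappa> \<epsilon>. {v \<in> holder_loc V \<alpha>. holder_loc_seminorm V \<alpha> \<kappa> (\<lambda>\<eta>\<in>Cinf_c. v \<eta> - u \<eta>) < \<epsilon>}"
    fix U assume "U \<in> {?B u \<kappa> \<epsilon> |u \<kappa> \<epsilon>. u \<in> holder_loc V \<alpha> \<and> \<kappa> \<in> Cinf_c \<and> 0 < \<epsilon>}"
    then obtain u \<kappa> \<epsilon> where U: "U = ?B u \<kappa> \<epsilon>" and \<kappa>: "\<kappa> \<in> Cinf_c" by auto
    have "\<exists>W. open W \<and> c0 \<in> W \<and> W \<inter> goodset L \<subseteq> T -` U \<inter> goodset L" if c0: "c0 \<in> T -` U \<inter> goodset L" for c0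
    proof -
      let ?s = "holder_loc_seminorm V \<alpha> \<kappa> (\<lambda>\<eta>\<in>Cinf_c. T c0 \<eta> - u \<eta>)"
      have "?s < \<epsilon>" using c0 by (simp add: U)
      \<comment> \<open>An intermediate \<open>t\<close> is finite even if \<epsilon> is infinite,
        so the room left by \<open>c0\<close> is a positive real number.\<close>
      then obtain t where t: "?s < t" "t < \<epsilon>" using dense by blast
      obtain s' where s': "?s = ennreal s'" "0 \<le> s'" using ennreal_less_top_real[OF less_le_trans[OF t(1) top_greatest]] by blast
      obtain t' where t': "t = ennreal t'" "0 \<le> t'" using ennreal_less_top_real[OF less_le_trans[OF t(2) top_greatest]] by blast
      have st: "0 < t' - s'" using t(1) unfolding s'(1) t'(1) using s'(2) by (simp add: ennreal_less_iff)
      obtain W where W: "open W" "c0 \<in> W" "\<And>c. c \<in> goodset L \<inter> W \<Longrightarrow> holder_loc_seminorm V \<alpha> \<kappa> (T (\<lambda>j. c j - c0 j)) \<le> ennreal (t' - s')"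
      proof -
        have "c0 \<in> goodset L" using c0 by simp
        from T_near[OF this L \<kappa> st] show ?thesis using that by blast
      qed
      have "c \<in> T -` U" if c: "c \<in> goodset L \<inter> W" for c
      proof -
        have gc: "good L c" "good L c0" using c c0 by (auto simp: goodset_def)
        have eq: "(\<lambda>\<eta>\<in>Cinf_c. T c \<eta> - u \<eta>) = (\<lambda>\<eta>\<in>Cinf_c. T (\<lambda>j. c j - c0 j) \<eta> + (\<lambda>\<eta>\<in>Cinf_c. T c0 \<eta> - u \<eta>) \<eta>)"
          by (rule restrict_ext) (simp add: T_diff[OF gc])
        have "holder_loc_seminorm V \<alpha> \<kappa> (\<lambda>\<eta>\<in>Cinf_c. T c \<eta> - u \<eta>) \<le> holder_loc_seminorm V \<alpha> \<kappa> (T (\<lambda>j. c j - c0 j)) + ?s"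
          unfolding eq by (rule seminorm_add[OF \<kappa>])
        also have "\<dots> \<le> ennreal (t' - s') + ennreal s'" unfolding s'(1) by (intro add_right_mono W(3) c)
        also have "\<dots> = ennreal t'" using st s'(2) by (subst ennreal_plus[symmetric]) auto
        also have "\<dots> < \<epsilon>" using t(2) t'(1) by simp
        finally show ?thesis using T_holder_loc[OF gc(1)] by (simp add: U)
      qed
      then show ?thesis using W(1,2) by blast
    qed
    note near = this
    have "openin (top_of_set (goodset L)) (T -` U \<inter> goodset L)"
    proof (subst openin_subopen, rule ballI)
      fix c0 assume "c0 \<in> T -` U \<inter> goodset L"
      from near[OF this] obtain W where W: "open W" "c0 \<in> W" "W \<inter> goodset L \<subseteq> T -` U \<inter> goodset L" by blast
      have "openin (top_of_set (goodset L)) (goodset L \<inter> W)" by (rule openin_open_Int[OF W(1)])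
      then show "\<exists>W. openin (top_of_set (goodset L)) W \<and> c0 \<in> W \<and> W \<subseteq> T -` U \<inter> goodset L"
        using W \<open>c0 \<in> T -` U \<inter> goodset L\<close> by (intro exI[of _ "goodset L \<inter> W"]) blast
    qed
    then show "openin (top_of_set (goodset L)) (T -` U \<inter> topspace (top_of_set (goodset L)))" by simp
  next
    show "T ` topspace (top_of_set (goodset L)) \<subseteq> \<Union> {{v \<in> holder_loc V \<alpha>. holder_loc_seminorm V \<alpha> \<rho> (\<lambda>\<eta>\<in>Cinf_c. v \<eta> - u \<eta>) < \<epsilon>} |u \<rho> \<epsilon>.
        u \<in> holder_loc V \<alpha> \<and> \<rho> \<in> Cinf_c \<and> 0 < \<epsilon>}"
    proof
      fix v assume "v \<in> T ` topspace (top_of_set (goodset L))"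
      then obtain c where c: "c \<in> goodset L" "v = T c" by auto
      then have gc: "good L c" by (simp add: goodset_def)
      \<comment> \<open>The topology has no carrier beyond its subbasic sets, so the image must be
        covered by them: \<open>v\<close> lies in the set centred at itself with zero cut-off and
        radius 2.\<close>
      have \<kappa>: "(\<lambda>x. 0) \<in> (Cinf_c :: (real ^ 'n \<Rightarrow> real) set)" by (simp add: Cinf_c_def Cr_c_zero)
      obtain W where "c \<in> W" "\<forall>c'\<in>goodset L \<inter> W. holder_loc_seminorm V \<alpha> (\<lambda>x. 0) (T (\<lambda>j. c' j - c j)) \<le> ennreal 1"
        using T_near[OF c(1) L \<kappa>, of 1] by auto
      then have "holder_loc_seminorm V \<alpha> (\<lambda>x. 0) (T (\<lambda>j. c j - c j)) \<le> ennreal 1" using c(1) by blast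
      moreover have "T (\<lambda>j. c j - c j) = (\<lambda>\<eta>\<in>Cinf_c. T c \<eta> - T c \<eta>)"
      proof -
        have "T (\<lambda>j. c j - c j) = restrict (T (\<lambda>j. c j - c j)) Cinf_c" by (simp add: T_def)
        also have "\<dots> = (\<lambda>\<eta>\<in>Cinf_c. T c \<eta> - T c \<eta>)" by (rule restrict_ext) (rule T_diff[OF gc gc])
        finally show ?thesis .
      qed
      ultimately have lt: "holder_loc_seminorm V \<alpha> (\<lambda>x. 0) (\<lambda>\<eta>\<in>Cinf_c. v \<eta> - v \<eta>) < 2"
        unfolding c(2) by (metis ennreal_1 le_less_trans one_less_numeral_iff semiring_norm(76))
      show "v \<in> \<Union> {{v \<in> holder_loc V \<alpha>. holder_loc_seminorm V \<alpha> \<rho> (\<lambda>\<eta>\<in>Cinf_c. v \<eta> - u \<eta>) < \<epsilon>} |u \<rho> \<epsilon>.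
        u \<in> holder_loc V \<alpha> \<and> \<rho> \<in> Cinf_c \<and> 0 < \<epsilon>}"
      proof (rule UnionI)
        let ?W = "{v' \<in> holder_loc V \<alpha>. holder_loc_seminorm V \<alpha> (\<lambda>x. 0) (\<lambda>\<eta>\<in>Cinf_c. v' \<eta> - v \<eta>) < 2}"
        have vh: "v \<in> holder_loc V \<alpha>" unfolding c(2) by (rule T_holder_loc[OF gc])
        show "?W \<in> {{v \<in> holder_loc V \<alpha>. holder_loc_seminorm V \<alpha> \<rho> (\<lambda>\<eta>\<in>Cinf_c. v \<eta> - u \<eta>) < \<epsilon>} |u \<rho> \<epsilon>.
          u \<in> holder_loc V \<alpha> \<and> \<rho> \<in> Cinf_c \<and> 0 < \<epsilon>}"
          by (rule CollectI, intro exI[of _ v] exI[of _ "\<lambda>x. 0"] exI[of _ 2] conjI refl vh \<kappa>) simp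
        show "v \<in> ?W" using vh lt by blast
      qed
    qed
  qed
qed

end

subsection \<open>Convergence of the multiresolution expansion in \<open>C\<^sup>r\<close>\<close>

text \<open>Together with its converse \<open>axis_increment_bound\<close> it trades bounds on
  derivatives for bounds on increments, and the latter survive pointwise limits.\<close>

lemma line_derivative_bound:
  fixes g :: "real ^ 'n \<Rightarrow> real"
  assumes g: "g differentiable (at x)" and b: "\<And>t. \<bar>g (x + t *\<^sub>R axis i 1) - g x\<bar> \<le> K * \<bar>t\<bar>"
  shows "\<bar>partial i g x\<bar> \<le> K"
proof -
  have 1: "((\<lambda>t. x + t *\<^sub>R axis i 1) has_derivative (\<lambda>t. t *\<^sub>R axis i 1)) (at 0)"
    by (auto intro!: derivative_eq_intros)
  have 2: "(g has_derivative (\<lambda>v. \<Sum>j\<in>UNIV. v $ j * partial j g x)) (at (x + 0 *\<^sub>R axis i 1))"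
    using has_derivative_partial[OF g] by simp
  have "((\<lambda>t. g (x + t *\<^sub>R axis i 1)) has_derivative (\<lambda>t. \<Sum>j\<in>UNIV. (t *\<^sub>R axis i 1) $ j * partial j g x)) (at 0)"
    by (rule has_derivative_compose[OF 1 2])
  moreover have "(\<Sum>j\<in>UNIV. (t *\<^sub>R axis i 1) $ j * partial j g x) = partial i g x * t" for t
    using sum_axis[of i "\<lambda>j. t * partial j g x"] by (simp add: mult_ac)
  ultimately have "((\<lambda>t. g (x + t *\<^sub>R axis i 1)) has_real_derivative partial i g x) (at 0)"
    by (simp add: has_field_derivative_def)
  then have "((\<lambda>t. (g (x + t *\<^sub>R axis i 1) - g x) / t) \<longlongrightarrow> partial i g x) (at 0)"
    by (simp add: has_field_derivative_iff)
  then have "((\<lambda>t. \<bar>(g (x + t *\<^sub>R axis i 1) - g x) / t\<bar>) \<longlongrightarrow> \<bar>partial i g x\<bar>) (at 0)"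
    by (rule tendsto_rabs)
  moreover have "\<forall>\<^sub>F t in at 0. \<bar>(g (x + t *\<^sub>R axis i 1) - g x) / t\<bar> \<le> K"
    using b by (auto simp: eventually_at_filter divide_le_eq)
  ultimately show ?thesis by (rule tendsto_upperbound) simp
qed

lemma axis_increment_bound:
  fixes g :: "real ^ 'n \<Rightarrow> real"
  assumes "Cr (Suc 0) g" "\<And>x. \<bar>partial i g x\<bar> \<le> K"
  shows "\<bar>g (x + t *\<^sub>R axis i 1) - g x\<bar> \<le> K * \<bar>t\<bar>"
proof -
  obtain s where "g (x + t *\<^sub>R axis i 1) = g x + dd (t *\<^sub>R axis i 1) g (x + s *\<^sub>R t *\<^sub>R axis i 1)"
    using taylor_line[OF assms(1), of x "t *\<^sub>R axis i 1"] by auto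
  moreover have "dd (t *\<^sub>R axis i 1) g y = t * partial i g y" for y
    using sum_axis[of i "\<lambda>j. t * partial j g y"] by (simp add: dd_def mult_ac)
  ultimately show ?thesis using assms(2) by (simp add: abs_mult mult.commute[of K] mult_left_mono)
qed

text \<open>Derivative bounds on \<open>g n - g m\<close> become Lipschitz bounds along the axes,
  pass to the limit in m, and return as derivative bounds on \<open>g n\<close>. In particular the
  first derivatives tend to zero pointwise, so the induction applies to them.\<close>

lemma Cbd_limit_zero:
  fixes g :: "nat \<Rightarrow> real ^ 'n \<Rightarrow> real"
  assumes "\<And>n m. n \<le> m \<Longrightarrow> Cbd s (\<epsilon> n) (\<lambda>x. g n x - g m x)" "\<And>n. Cr s (g n)" "\<epsilon> \<longlonglongrightarrow> 0" "\<And>x. (\<lambda>m. g m x) \<longlonglongrightarrow> 0"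
  shows "Cbd s (\<epsilon> n) (g n)"
  using assms
proof (induction s arbitrary: g n)
  case (0 g n)
  have b: "\<bar>g n x\<bar> \<le> \<epsilon> n" for n x
  proof -
    have "(\<lambda>m. \<bar>g n x - g m x\<bar>) \<longlonglongrightarrow> \<bar>g n x - 0\<bar>" by (intro tendsto_intros 0)
    moreover have "\<forall>\<^sub>F m in sequentially. \<bar>g n x - g m x\<bar> \<le> \<epsilon> n"
      by (rule eventually_sequentiallyI[of n]) (rule Cbd_bound[OF 0(1)])
    ultimately have "\<bar>g n x - 0\<bar> \<le> \<epsilon> n" by (rule tendsto_upperbound) simp
    then show ?thesis by simp
  qed
  then show ?case using 0(2) by (simp add: Cbd.simps Cr.simps)
next
  case (Suc s g n)
  have D: "g n differentiable (at x)" for n x by (rule Cr_differentiable[OF Suc.prems(2)])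
  have C1: "Cr (Suc 0) (g n)" for n using Cr_mono[OF Suc.prems(2), of "Suc 0"] by simp
  have P: "partial i (\<lambda>x. g n x - g m x) = (\<lambda>x. partial i (g n) x - partial i (g m) x)" for i n m
  proof
    fix x
    have "partial i (\<lambda>x. g n x + (-1) * g m x) x = partial i (g n) x + (-1) * partial i (g m) x"
      using D by (subst partial_add) (auto simp only: partial_cmult intro!: differentiable_mult differentiable_const)
    then show "partial i (\<lambda>x. g n x - g m x) x = partial i (g n) x - partial i (g m) x" by simp
  qed
  have b0: "\<bar>g n x\<bar> \<le> \<epsilon> n" for n x
  proof -
    have "(\<lambda>m. \<bar>g n x - g m x\<bar>) \<longlonglongrightarrow> \<bar>g n x - 0\<bar>" by (intro tendsto_intros Suc.prems)
    moreover have "\<forall>\<^sub>F m in sequentially. \<bar>g n x - g m x\<bar> \<le> \<epsilon> n"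
      by (rule eventually_sequentiallyI[of n]) (rule Cbd_bound[OF Suc.prems(1)])
    ultimately have "\<bar>g n x - 0\<bar> \<le> \<epsilon> n" by (rule tendsto_upperbound) simp
    then show ?thesis by simp
  qed
  have b1: "\<bar>partial i (g n) x\<bar> \<le> \<epsilon> n" for n i x
  proof (rule line_derivative_bound[OF D])
    fix t
    let ?v = "t *\<^sub>R axis i (1 :: real)"
    have "(\<lambda>m. \<bar>(g n (x + ?v) - g m (x + ?v)) - (g n x - g m x)\<bar>) \<longlonglongrightarrow> \<bar>(g n (x + ?v) - 0) - (g n x - 0)\<bar>"
      by (intro tendsto_intros Suc.prems)
    moreover have "\<forall>\<^sub>F m in sequentially. \<bar>(g n (x + ?v) - g m (x + ?v)) - (g n x - g m x)\<bar> \<le> \<epsilon> n * \<bar>t\<bar>"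
    proof -
      have "\<bar>(g n (x + ?v) - g m (x + ?v)) - (g n x - g m x)\<bar> \<le> \<epsilon> n * \<bar>t\<bar>" if "n \<le> m" for m
      proof (rule axis_increment_bound[of "\<lambda>x. g n x - g m x"])
        show "Cr (Suc 0) (\<lambda>x. g n x - g m x)" by (rule Cr_diff[OF C1 C1])
        show "\<bar>partial i (\<lambda>x. g n x - g m x) x\<bar> \<le> \<epsilon> n" for x
          using Suc.prems(1)[OF that] Cbd_bound by (fastforce simp: Cbd.simps)
      qed
      then show ?thesis by (rule eventually_sequentiallyI[of n])
    qed
    ultimately have "\<bar>(g n (x + ?v) - 0) - (g n x - 0)\<bar> \<le> \<epsilon> n * \<bar>t\<bar>" by (rule tendsto_upperbound) simp
    then show "\<bar>g n (x + ?v) - g n x\<bar> \<le> \<epsilon> n * \<bar>t\<bar>" by simp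
  qed
  have "Cbd s (\<epsilon> n) (partial i (g n))" for i
  proof (rule Suc.IH[of "\<lambda>n. partial i (g n)"])
    show "Cbd s (\<epsilon> n) (\<lambda>x. partial i (g n) x - partial i (g m) x)" if "n \<le> m" for n m
      unfolding P[symmetric] using Suc.prems(1)[OF that] by (simp add: Cbd.simps)
    show "Cr s (partial i (g n))" for n by (rule Cr_partial[OF Suc.prems(2)])
    show "\<epsilon> \<longlonglongrightarrow> 0" by (rule Suc.prems)
    show "(\<lambda>m. partial i (g m) x) \<longlonglongrightarrow> 0" for x
      by (rule Lim_null_comparison[OF _ Suc.prems(3)]) (simp add: b1)
  qed
  then show ?case using b0 D by (simp add: Cbd.simps)
qed

text \<open>If \<open>e n\<close> exceeded \<open>2 * \<epsilon> n\<close> at a point, it would do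
  so on a ball, and every later \<open>e m\<close> would exceed \<open>\<epsilon> n\<close> there,
  which keeps its \<open>L\<^sup>2\<close> norm away from zero.\<close>

lemma uniform_small_of_L2:
  fixes e :: "nat \<Rightarrow> real ^ 'n \<Rightarrow> real"
  assumes e: "\<And>n. e n \<in> Cr_c 0" and u: "\<And>n m x. n \<le> m \<Longrightarrow> \<bar>e n x - e m x\<bar> \<le> \<epsilon> n" and \<epsilon>: "\<And>n. 0 < \<epsilon> n"
    and L: "(\<lambda>m. L2_inner (e m) (e m)) \<longlonglongrightarrow> 0"
  shows "\<bar>e n x\<bar> \<le> 2 * \<epsilon> n"
proof (rule ccontr)
  assume "\<not> \<bar>e n x\<bar> \<le> 2 * \<epsilon> n"
  have "open {y. 2 * \<epsilon> n < \<bar>e n y\<bar>}"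
    by (intro open_Collect_less continuous_intros Cr_c_continuous[OF e])
  then obtain d where d: "d > 0" "ball x d \<subseteq> {y. 2 * \<epsilon> n < \<bar>e n y\<bar>}"
    using \<open>\<not> \<bar>e n x\<bar> \<le> 2 * \<epsilon> n\<close> openE[of "{y. 2 * \<epsilon> n < \<bar>e n y\<bar>}" x] by auto
  let ?K = "(\<epsilon> n)\<^sup>2 * measure lborel (ball x d)"
  have K: "0 < ?K" using \<epsilon>[of n] d(1) content_ball_pos[of d x] by simp
  have "?K \<le> L2_inner (e m) (e m)" if "n \<le> m" for m
  proof -
    have "?K = (LINT y|lborel. (\<epsilon> n)\<^sup>2 * indicator (ball x d) y)" by simp
    also have "\<dots> \<le> (LINT y|lborel. e m y * e m y)"
    proof (rule integral_mono)
      show "integrable lborel (\<lambda>y. (\<epsilon> n)\<^sup>2 * indicator (ball x d) y)"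
        by (intro integrable_mult_right integrable_real_indicator) (use emeasure_lborel_ball_finite[of x d] in auto)
      show "integrable lborel (\<lambda>y. e m y * e m y)" by (intro integrable_Cc_mult[OF e] Cr_c_continuous[OF e])
      fix y
      show "(\<epsilon> n)\<^sup>2 * indicator (ball x d) y \<le> e m y * e m y"
      proof (cases "y \<in> ball x d")
        case True
        then have "2 * \<epsilon> n < \<bar>e n y\<bar>" using d(2) by blast
        then have "\<epsilon> n \<le> \<bar>e m y\<bar>" using u[OF that, of y] by linarith
        then have "(\<epsilon> n)\<^sup>2 \<le> \<bar>e m y\<bar>\<^sup>2" using \<epsilon>[of n] by (intro power_mono) auto
        then show ?thesis using True by (simp add: power2_eq_square)
      qed simp
    qed
    finally show ?thesis by (simp add: L2_inner_def)
  qed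
  then have "?K \<le> 0" by (intro LIMSEQ_le_const[OF L]) auto
  then show False using K by simp
qed

section \<open>Projections of test functions and of continuous forms\<close>

context wavelets
begin

definition coef :: "((real ^ 'n \<Rightarrow> real) \<Rightarrow> real) \<Rightarrow> nat \<times> nat \<times> (real ^ 'n) \<Rightarrow> real" where
  "coef f = (\<lambda>(n, i, k). if i \<in> levels II n \<and> k \<in> int_lattice then f (scaled (gen i) n k) else 0)"

text \<open>A test function regarded as a linear form, so that \<open>form_proj\<close> is its
  orthogonal projection and \<open>form_proj_Suc\<close> applies to it.\<close>

definition pairing :: "(real ^ 'n \<Rightarrow> real) \<Rightarrow> (real ^ 'n \<Rightarrow> real) \<Rightarrow> real" where
  "pairing \<eta> g = L2_inner \<eta> g"

lemma pairing_linear: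
  assumes \<eta>: "\<eta> \<in> Cr_c 0"
  shows "linear_form r (pairing \<eta>)"
  unfolding linear_form_def
proof (intro conjI ballI allI)
  fix f g :: "real ^ 'n \<Rightarrow> real" assume fg: "f \<in> Cr_c r" "g \<in> Cr_c r"
  show "pairing \<eta> (\<lambda>x. f x + g x) = pairing \<eta> f + pairing \<eta> g"
    using integrable_Cc_mult[OF \<eta> Cr_c_continuous[OF fg(1)]] integrable_Cc_mult[OF \<eta> Cr_c_continuous[OF fg(2)]]
    by (simp add: pairing_def L2_inner_def distrib_left)
next
  fix f :: "real ^ 'n \<Rightarrow> real" and c :: real
  show "pairing \<eta> (\<lambda>x. c * f x) = c * pairing \<eta> f"
    by (simp add: pairing_def L2_inner_def mult.left_commute)
qed

lemma form_proj_pairing: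
  assumes "supp \<theta> \<subseteq> cball 0 \<rho>" "supp \<eta> \<subseteq> cball 0 R" "2 ^ n * R + \<rho> \<le> t"
  shows "form_proj \<theta> n (pairing \<eta>) x = (\<Sum>k\<in>lat t. L2_inner \<eta> (scaled \<theta> n k) * scaled \<theta> n k x)"
proof -
  have fin: "finite {k. k \<in> int_lattice \<and> scaled \<theta> n k x \<noteq> 0}"
    by (rule finite_subset[OF _ near_finite[of "2 ^ n * norm x + \<rho>" 0]])
       (use scaled_nonzero_norm[OF assms(1), of n _ x "norm x"] in \<open>auto simp: near_def\<close>)
  show ?thesis unfolding form_proj_def pairing_def
  proof (rule sum.mono_neutral_cong[OF near_finite fin])
    fix k assume k: "k \<in> {k. k \<in> int_lattice \<and> scaled \<theta> n k x \<noteq> 0} - lat t"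
    have "L2_inner \<eta> (scaled \<theta> n k) = 0"
      by (rule L2_inner_scaled_zero[OF assms(1,2) _ _ assms(3)]) (use k in auto)
    then show "L2_inner \<eta> (scaled \<theta> n k) * scaled \<theta> n k x = 0" by simp
  qed (auto simp: near_def)
qed

text \<open>The projections of a test function converge to it in \<open>C\<^sup>r\<close>, because the wavelets have
  vanishing moments up to order \<open>r\<close> inclusive.\<close>

lemma projection_converges:
  assumes \<eta>: "\<eta> \<in> Cinf_c" and R: "supp \<eta> \<subseteq> cball 0 R" "0 \<le> R"
  shows "\<exists>C>0. \<forall>n. Cbd r (C / 2 ^ n) (\<lambda>x. \<eta> x - form_proj \<phi> n (pairing \<eta>) x)"
proof -
  let ?P = "\<lambda>n. form_proj \<phi> n (pairing \<eta>)"
  note \<eta>0 = Cinf_c_D[OF \<eta>]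
  obtain B where B: "B > 0" "Cbd (Suc r) B \<eta>" using Cr_c_Cbd[OF \<eta>0] by blast
  have PK: "?P n = (\<lambda>x. \<Sum>k\<in>lat (2 ^ n * R + \<rho>). L2_inner \<eta> (scaled \<phi> n k) * scaled \<phi> n k x)" for n
    by (rule ext) (rule form_proj_pairing[OF \<rho>(2) R(1) order_refl])
  have Pc: "?P n \<in> Cr_c r" for n unfolding PK by (intro Cr_c_sum near_finite Cr_c_cmult scaled_Cr_c \<phi>)
  have ec: "(\<lambda>x. \<eta> x - ?P n x) \<in> Cr_c r" for n by (rule Cr_c_diff[OF \<eta>0 Pc])
  define Q where "Q j x = (\<Sum>i\<in>II. form_proj (\<psi> i) j (pairing \<eta>) x)" for j x
  have PS: "?P (Suc n) x = ?P n x + Q n x" for n x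
    unfolding Q_def by (rule form_proj_Suc[OF pairing_linear[OF \<eta>0]])
  define D where "D = (real CARD('n) * \<rho>) ^ Suc r * A * B"
  have D: "0 \<le> D" using \<rho>(1) A(1) B(1) by (simp add: D_def)
  \<comment> \<open>The summand 1 makes the bounds \<open>\<epsilon> n\<close> below strictly
    positive, as \<open>uniform_small_of_L2\<close> requires.\<close>
  define E where "E = real (card II) * (N0 * A * D) + 1"
  have E: "0 < E" using N0 A(1) D by (auto simp: E_def intro: add_nonneg_pos)
  have Qb: "Cbd r (E / 2 ^ j) (Q j)" for j
  proof -
    let ?c = "2 powr (real (CARD('n) * j) / 2)"
    \<comment> \<open>Decay of order \<open>Suc r\<close>, against a loss of
      \<open>2 ^ (j * r)\<close> from taking r derivatives, leaves a summable factor
      \<open>1 / 2 ^ j\<close>.\<close>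
    let ?m = "D / (2 ^ j) ^ Suc r / ?c"
    have "Cbd r (N0 * A * ?m * ?c * 2 ^ (j * r)) (form_proj (\<psi> i) j (pairing \<eta>))" if i: "i \<in> II" for i
    proof -
      have "Cbd r ((2 * \<rho> + 1) ^ CARD('n) * A * ?m * ?c * 2 ^ (j * r))
        (\<lambda>x. \<Sum>k\<in>lat (2 ^ j * R + \<rho>). L2_inner \<eta> (scaled (\<psi> i) j k) * scaled (\<psi> i) j k x)"
      proof (rule sum_scaled_Cbd[OF \<rho>(3)[OF i] less_imp_le[OF \<rho>(1)] _ near_finite near_int_lattice])
        show "Cbd r A (\<psi> i)" using A(2)[of i] i by (simp add: gen_II)
        have "vanish (Suc r) (gen i)" using vanish_\<psi>[OF i] by (simp add: gen_II[OF i])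
        from gen_coefficient_decay[OF _ this B(2), of j] i
        show "\<bar>L2_inner \<eta> (scaled (\<psi> i) j k)\<bar> \<le> ?m" for k by (simp add: gen_II D_def)
        show "0 \<le> ?m" using D by simp
      qed
      moreover have "form_proj (\<psi> i) j (pairing \<eta>) = (\<lambda>x. \<Sum>k\<in>lat (2 ^ j * R + \<rho>). L2_inner \<eta> (scaled (\<psi> i) j k) * scaled (\<psi> i) j k x)"
        by (rule ext) (rule form_proj_pairing[OF \<rho>(3)[OF i] R(1) order_refl])
      ultimately show ?thesis by (simp add: N0_def)
    qed
    then have "Cbd r (\<Sum>i\<in>II. N0 * A * ?m * ?c * 2 ^ (j * r)) (Q j)" unfolding Q_def[abs_def] by (intro Cbd_sum finite_II)
    moreover have "(\<Sum>i\<in>II. N0 * A * ?m * ?c * 2 ^ (j * r)) \<le> E / 2 ^ j"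
    proof -
      have "(\<Sum>i\<in>II. N0 * A * ?m * ?c * 2 ^ (j * r)) = real (card II) * (N0 * A * D) / 2 ^ j"
        by (simp add: power_mult)
      then show ?thesis by (simp add: E_def divide_right_mono)
    qed
    ultimately show ?thesis by (rule Cbd_mono[OF _ order_refl])
  qed
  define \<epsilon> where "\<epsilon> n = 2 * E / 2 ^ n" for n :: nat
  have \<epsilon>pos: "0 < \<epsilon> n" for n using E by (simp add: \<epsilon>_def)
  have \<epsilon>0: "\<epsilon> \<longlonglongrightarrow> 0"
    using tendsto_mult[OF tendsto_const[of "2 * E"] LIMSEQ_power_zero[of "1 / 2 :: real"]] by (simp add: \<epsilon>_def[abs_def] power_divide)
  have diff: "Cbd r (\<epsilon> n) (\<lambda>x. (\<eta> x - ?P n x) - (\<eta> x - ?P m x))" if "n \<le> m" for n m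
  proof -
    have "?P m x = ?P n x + (\<Sum>j=n..<m. Q j x)" for x
      using that by (induction m rule: dec_induct) (simp_all add: PS)
    then have e: "(\<lambda>x. (\<eta> x - ?P n x) - (\<eta> x - ?P m x)) = (\<lambda>x. \<Sum>j=n..<m. Q j x)" by simp
    have "(\<Sum>j=n..<m. E / 2 ^ j) \<le> \<epsilon> n"
    proof -
      have "(\<Sum>j=n..<m. E / 2 ^ j) = 2 * E / 2 ^ n - 2 * E / 2 ^ m"
        using that
      proof (induction m rule: dec_induct)
        case (step k)
        have "E / 2 ^ k = 2 * E / 2 ^ k - 2 * E / 2 ^ Suc k" by simp
        then show ?case using step by simp
      qed simp
      then show ?thesis using E by (simp add: \<epsilon>_def)
    qed
    moreover have "Cbd r (\<Sum>j=n..<m. E / 2 ^ j) (\<lambda>x. \<Sum>j=n..<m. Q j x)" by (intro Cbd_sum Qb) simp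
    ultimately show ?thesis unfolding e by (rule Cbd_mono[OF _ order_refl, rotated])
  qed
  have L2: "(\<lambda>m. L2_inner (\<lambda>x. \<eta> x - ?P m x) (\<lambda>x. \<eta> x - ?P m x)) \<longlonglongrightarrow> 0"
  proof (rule LIMSEQ_I)
    fix e :: real assume e: "0 < e"
    have \<eta>L: "\<eta> \<in> L2" by (rule Cr_c_L2[OF \<eta>0])
    obtain n0 g where g: "g \<in> V n0" "L2_dist \<eta> g < sqrt e" using V_dense[OF \<eta>L, of "sqrt e"] e by auto
    have "norm (L2_inner (\<lambda>x. \<eta> x - ?P m x) (\<lambda>x. \<eta> x - ?P m x) - 0) < e" if m: "nat n0 \<le> m" for m
    proof -
      have "n0 \<le> int m" using m by simp
      then have gm: "g \<in> V (int m)" using V_mono g(1) by blast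
      have z: "L2_inner \<eta> (scaled \<phi> m k) = 0" if "k \<in> int_lattice - lat (2 ^ m * R + \<rho>)" for k
        using L2_inner_scaled_zero[OF \<rho>(2) R(1) _ _ order_refl] that by auto
      have P: "?P m \<in> V (int m)"
        unfolding PK by (rule projection_residual(1)[OF lin_V onb_V \<eta>L near_finite near_int_lattice z])
      have ortho: "L2_inner (\<lambda>x. \<eta> x - ?P m x) h = 0" if "h \<in> V (int m)" for h
        unfolding PK by (rule projection_residual(2)[OF lin_V onb_V \<eta>L near_finite near_int_lattice z that])
      define a where "a = (\<lambda>x. \<eta> x - ?P m x)"
      define b where "b = (\<lambda>x. ?P m x - g x)"
      have bV: "b \<in> V (int m)" unfolding b_def by (rule lin_L2_diff[OF lin_V P gm])
      have aL: "a \<in> L2" unfolding a_def by (intro L2_diff \<eta>L lin_L2_L2[OF lin_V P])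
      have bL: "b \<in> L2" by (rule lin_L2_L2[OF lin_V bV])
      \<comment> \<open>Pythagoras: the projection error \<open>a\<close> is orthogonal to
        \<open>V m\<close>, so it is at most the distance from \<eta> to \<open>g\<close>.\<close>
      have ab: "L2_inner a b = 0" unfolding a_def by (rule ortho[OF bV])
      have "L2_inner (\<lambda>x. \<eta> x - g x) (\<lambda>x. \<eta> x - g x) = (LINT x|lborel. a x * a x + 2 * (a x * b x) + b x * b x)"
        unfolding L2_inner_def by (intro arg_cong[where f = "integral\<^sup>L lborel"]) (simp add: fun_eq_iff a_def b_def algebra_simps)
      also have "\<dots> = L2_inner a a + 2 * L2_inner a b + L2_inner b b"
        using L2_mult_integrable[OF aL aL] L2_mult_integrable[OF aL bL] L2_mult_integrable[OF bL bL] by (simp add: L2_inner_def)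
      finally have "L2_inner a a + L2_inner b b = L2_inner (\<lambda>x. \<eta> x - g x) (\<lambda>x. \<eta> x - g x)" using ab by simp
      moreover have "sqrt (L2_inner (\<lambda>x. \<eta> x - g x) (\<lambda>x. \<eta> x - g x)) < sqrt e" using g(2) by (simp add: L2_dist_eq)
      moreover have "0 \<le> L2_inner b b" "0 \<le> L2_inner a a"
        unfolding L2_inner_def by (auto intro: Bochner_Integration.integral_nonneg)
      ultimately have "L2_inner a a < e" "0 \<le> L2_inner a a" by (simp_all add: real_sqrt_less_iff)
      then show ?thesis by (simp add: a_def)
    qed
    then show "\<exists>no. \<forall>m\<ge>no. norm (L2_inner (\<lambda>x. \<eta> x - ?P m x) (\<lambda>x. \<eta> x - ?P m x) - 0) < e" by blast
  qed
  \<comment> \<open>The projections are Cauchy in \<open>C\<^sup>r\<close>; convergence in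
    \<open>L\<^sup>2\<close> identifies the limit as \<eta>.\<close>
  have small: "\<bar>\<eta> x - ?P n x\<bar> \<le> 2 * \<epsilon> n" for n x
    by (rule uniform_small_of_L2[of "\<lambda>n x. \<eta> x - ?P n x", OF Cr_c0[OF ec] Cbd_bound[OF diff] \<epsilon>pos L2])
  have pt: "(\<lambda>n. \<eta> x - ?P n x) \<longlonglongrightarrow> 0" for x
  proof (rule Lim_null_comparison)
    show "\<forall>\<^sub>F n in sequentially. norm (\<eta> x - ?P n x) \<le> 2 * \<epsilon> n" using small by (simp add: always_eventually)
    show "(\<lambda>n. 2 * \<epsilon> n) \<longlonglongrightarrow> 0" using tendsto_mult[OF tendsto_const[of 2] \<epsilon>0] by simp
  qed
  have "Cbd r (\<epsilon> n) (\<lambda>x. \<eta> x - ?P n x)" for n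
  proof (rule Cbd_limit_zero[of r \<epsilon> "\<lambda>n x. \<eta> x - ?P n x", OF diff _ \<epsilon>0 pt])
    show "Cr r (\<lambda>x. \<eta> x - ?P n x)" for n using ec by (simp add: Cr_c_def)
  qed
  then show ?thesis using E by (intro exI[of _ "2 * E"]) (simp add: \<epsilon>_def)
qed

text \<open>Projection is self-adjoint: pairing the projection of \<open>f\<close> with \<eta> is
  the same as applying \<open>f\<close> to the projection of \<eta>. The latter tends to \<eta> in
  \<open>C\<^sup>r\<close> within a fixed ball, where \<open>f\<close> is bounded by the
  norm.\<close>

lemma continuous_form_proj_tendsto:
  assumes f: "linear_form r f" "continuous_form r f" and \<eta>: "\<eta> \<in> Cinf_c"
  shows "(\<lambda>n. LINT x|lborel. form_proj \<phi> n f x * \<eta> x) \<longlonglongrightarrow> f \<eta>"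
proof -
  let ?P = "\<lambda>n. form_proj \<phi> n (pairing \<eta>)"
  note \<eta>0 = Cinf_c_D[OF \<eta>]
  obtain R where R: "supp \<eta> \<subseteq> cball 0 R" "0 < R" using Cr_c_supp[OF \<eta>0] by blast
  let ?K = "\<lambda>n. lat (2 ^ n * R + \<rho>) :: (real ^ 'n) set"
  have PK: "?P n = (\<lambda>x. \<Sum>k\<in>?K n. L2_inner \<eta> (scaled \<phi> n k) * scaled \<phi> n k x)" for n
    by (rule ext) (rule form_proj_pairing[OF \<rho>(2) R(1) order_refl])
  have Pc: "?P n \<in> Cr_c r" for n unfolding PK by (intro Cr_c_sum near_finite Cr_c_cmult scaled_Cr_c \<phi>)
  have ec: "(\<lambda>x. \<eta> x - ?P n x) \<in> Cr_c r" for n by (rule Cr_c_diff[OF \<eta>0 Pc])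
  obtain C where C: "C > 0" "\<And>n. Cbd r (C / 2 ^ n) (\<lambda>x. \<eta> x - ?P n x)"
    using projection_converges[OF \<eta> R(1)] R(2) by auto
  have int: "(LINT x|lborel. form_proj \<phi> n f x * \<eta> x) = f (?P n)" for n
  proof -
    have e: "form_proj \<phi> n f x * \<eta> x = (\<Sum>k\<in>?K n. f (scaled \<phi> n k) * scaled \<phi> n k x) * \<eta> x" for x
    proof (cases "x \<in> supp \<eta>")
      case True
      then have "norm x \<le> R" using R(1) by auto
      then show ?thesis unfolding form_proj_wsum using wsum_lat[OF \<rho>(2) _ order_refl] by simp
    qed (simp add: not_in_supp)
    have "(LINT x|lborel. form_proj \<phi> n f x * \<eta> x) = L2_inner (\<lambda>x. \<Sum>k\<in>?K n. f (scaled \<phi> n k) * scaled \<phi> n k x) \<eta>"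
      by (simp only: e L2_inner_def)
    also have "\<dots> = (\<Sum>k\<in>?K n. f (scaled \<phi> n k) * L2_inner (scaled \<phi> n k) \<eta>)"
      by (intro L2_inner_sum Cr_c_L2[OF scaled_Cr_c[OF \<phi>]] Cr_c_L2[OF \<eta>0])
    also have "\<dots> = (\<Sum>k\<in>?K n. L2_inner \<eta> (scaled \<phi> n k) * f (scaled \<phi> n k))"
      by (simp add: L2_inner_commute mult.commute)
    also have "\<dots> = f (?P n)" unfolding PK by (intro linear_form_sum[OF f(1), symmetric] near_finite scaled_Cr_c \<phi>)
    finally show ?thesis .
  qed
  \<comment> \<open>A function of level n that meets the support of \<eta> extends beyond it by at
    most \<open>2 * \<rho> / 2 ^ n\<close>, so one ball serves all levels.\<close>
  let ?B = "cball 0 (R + 2 * \<rho>) :: (real ^ 'n) set"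
  have supp: "supp (\<lambda>x. \<eta> x - ?P n x) \<subseteq> ?B" for n
  proof (rule supp_subset_closed)
    fix x :: "real ^ 'n" assume x: "x \<notin> ?B"
    then have "x \<notin> cball 0 R" using \<rho>(1) by simp
    then have "\<eta> x = 0" using R(1) not_in_supp by blast
    moreover have "scaled \<phi> n k x = 0" if k: "k \<in> ?K n" for k
    proof -
      have "norm k \<le> 2 ^ n * R + \<rho>" using k by (simp add: near_def)
      then have s: "supp (scaled \<phi> n k) \<subseteq> cball 0 ((2 ^ n * R + \<rho> + \<rho>) / 2 ^ n)" by (rule supp_scaled[OF \<rho>(2)])
      have "(2 ^ n * R + \<rho> + \<rho>) / 2 ^ n = R + 2 * \<rho> / 2 ^ n" by (simp add: field_simps)
      also have "\<dots> \<le> R + 2 * \<rho>" using \<rho>(1) by (simp add: divide_le_eq mult_le_cancel_left1)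
      finally have "cball 0 ((2 ^ n * R + \<rho> + \<rho>) / 2 ^ n) \<subseteq> ?B" by (rule subset_cball)
      then have "x \<notin> supp (scaled \<phi> n k)" using s x by blast
      then show ?thesis by (rule not_in_supp)
    qed
    ultimately show "\<eta> x - ?P n x = 0" by (simp add: PK)
  qed simp
  obtain b where b: "\<And>\<theta>. \<theta> \<in> Cr_c r \<Longrightarrow> supp \<theta> \<subseteq> ?B \<Longrightarrow> ennreal \<bar>f \<theta>\<bar> \<le> ennreal b * Cr_norm r \<theta>"
    using f(2) unfolding continuous_form_def by (meson compact_cball)
  define N where "N = real (card {k :: 'n multiset. size k \<le> r})"
  have bound: "\<bar>f (\<lambda>x. \<eta> x - ?P n x)\<bar> \<le> (max b 0 * N * C) * (1 / 2) ^ n" for n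
  proof -
    have "ennreal \<bar>f (\<lambda>x. \<eta> x - ?P n x)\<bar> \<le> ennreal b * Cr_norm r (\<lambda>x. \<eta> x - ?P n x)" by (rule b[OF ec supp])
    also have "\<dots> \<le> ennreal (max b 0) * ennreal (N * (C / 2 ^ n))"
      unfolding N_def by (intro mult_mono Cbd_Cr_norm C(2) ennreal_leI) auto
    also have "\<dots> = ennreal (max b 0 * (N * (C / 2 ^ n)))" using C(1) by (intro ennreal_mult[symmetric]) (auto simp: N_def)
    finally have "\<bar>f (\<lambda>x. \<eta> x - ?P n x)\<bar> \<le> max b 0 * (N * (C / 2 ^ n))"
      by (subst (asm) ennreal_le_iff) (use C(1) in \<open>auto simp: N_def\<close>)
    then show ?thesis by (simp add: power_divide mult.assoc)
  qed
  have "(\<lambda>n. f (\<lambda>x. \<eta> x - ?P n x)) \<longlonglongrightarrow> 0"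
  proof (rule Lim_null_comparison)
    show "\<forall>\<^sub>F n in sequentially. norm (f (\<lambda>x. \<eta> x - ?P n x)) \<le> (max b 0 * N * C) * (1 / 2) ^ n"
      using bound by (simp add: always_eventually)
    have "(\<lambda>n. (max b 0 * N * C) * (1 / 2) ^ n) \<longlonglongrightarrow> (max b 0 * N * C) * 0" by (intro tendsto_intros LIMSEQ_power_zero) auto
    then show "(\<lambda>n. (max b 0 * N * C) * (1 / 2) ^ n) \<longlonglongrightarrow> 0" by simp
  qed
  then have "(\<lambda>n. f \<eta> - f (\<lambda>x. \<eta> x - ?P n x)) \<longlonglongrightarrow> f \<eta> - 0" by (intro tendsto_intros)
  moreover have "f \<eta> - f (\<lambda>x. \<eta> x - ?P n x) = f (?P n)" for n
    using linear_form_add[OF f(1) Pc[of n] ec[of n]] by simp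
  ultimately show ?thesis by (simp add: int)
qed

end

context wavelet_scale
begin

text \<open>\<open>form_proj_Suc\<close> telescopes. Level 0 contains the scaling function as well
  as wavelets, hence the levels 0 to N make up the projection of index N + 1.\<close>

lemma form_proj_lev:
  assumes "linear_form r f"
  shows "form_proj \<phi> (Suc N) f x = (\<Sum>n<Suc N. lev n (coef f) x)"
proof -
  have w: "wsum (gen i) n (\<lambda>k. coef f (n, i, k)) x = form_proj (gen i) n f x" if "i \<in> levels II n" for n i
    unfolding wsum_def form_proj_def using that by (intro sum.cong) (auto simp: coef_def)
  have l: "lev n (coef f) x = (\<Sum>i\<in>levels II n. form_proj (gen i) n f x)" for n
    unfolding lev_def using w by (intro sum.cong) auto
  have g: "(\<Sum>i\<in>II. form_proj (gen i) n f x) = (\<Sum>i\<in>II. form_proj (\<psi> i) n f x)" for n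
    by (intro sum.cong) (auto simp: gen_II)
  show ?thesis
  proof (induction N)
    case 0
    have "lev 0 (coef f) x = form_proj (gen 0) 0 f x + (\<Sum>i\<in>II. form_proj (gen i) 0 f x)"
      unfolding l using zero_notin_II finite_II by (simp add: levels_def)
    also have "\<dots> = form_proj \<phi> (Suc 0) f x"
      unfolding g using form_proj_Suc[OF assms, of 0 x] by (simp add: gen_def)
    finally show ?case by simp
  next
    case (Suc N)
    have "lev (Suc N) (coef f) x = (\<Sum>i\<in>II. form_proj (gen i) (Suc N) f x)"
      unfolding l by (simp add: levels_def)
    then show ?case using Suc form_proj_Suc[OF assms, of "Suc N" x] by (simp add: g)
  qed
qed

text \<open>The expansion tends to \<open>T (coef f)\<close> by summability of the levels. If
  \<open>f\<close> is continuous it also tends to \<open>f\<close>, and uniqueness of limits gives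
  the remaining clause.\<close>

lemma form_is_distribution_T:
  assumes f: "linear_form r f" and g: "good L (coef f)"
  shows "form_is_distribution r \<phi> f (T (coef f))"
proof -
  have lim: "(\<lambda>n. LINT x|lborel. form_proj \<phi> n f x * \<eta> x) \<longlonglongrightarrow> T (coef f) \<eta>" if \<eta>: "\<eta> \<in> Cinf_c" for \<eta>
  proof -
    have e: "(LINT x|lborel. form_proj \<phi> (Suc N) f x * \<eta> x) = (\<Sum>n<Suc N. LINT x|lborel. lev n (coef f) x * \<eta> x)" for N
      unfolding form_proj_lev[OF f] sum_distrib_right
      by (intro Bochner_Integration.integral_sum lev_mult_integrable[OF Cinf_c_D[OF \<eta>]])
    have "(\<lambda>N. \<Sum>n<N. LINT x|lborel. lev n (coef f) x * \<eta> x) \<longlonglongrightarrow> T (coef f) \<eta>"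
      using summable_LIMSEQ[OF pairing_summable[OF g \<eta>]] \<eta> by (simp add: T_def)
    from LIMSEQ_Suc[OF this] show ?thesis unfolding e[symmetric] by (rule LIMSEQ_imp_Suc)
  qed
  then show ?thesis
    unfolding form_is_distribution_def
    using continuous_form_proj_tendsto[OF f] LIMSEQ_unique by blast
qed

lemma coef_goodset: "good L (coef f) \<Longrightarrow> coef f \<in> goodset L"
  by (simp add: goodset_def coef_def)

end

subsection \<open>Moments and tightness\<close>

lemma Lp_norm_le_moment:
  assumes p: "1 \<le> p" and le: "Lp_norm M p X \<le> ennreal c" and c: "0 \<le> c"
  shows "(\<integral>\<^sup>+ \<omega>. ennreal (\<bar>X \<omega>\<bar> powr p) \<partial>M) \<le> ennreal (c powr p)"
proof -
  define I where "I = (\<integral>\<^sup>+ \<omega>. ennreal (\<bar>X \<omega>\<bar> powr p) \<partial>M)"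
  have L: "Lp_norm M p X = (if I = \<infinity> then \<infinity> else ennreal (enn2real I powr (1 / p)))"
    by (simp add: Lp_norm_def I_def Let_def)
  \<comment> \<open>An infinite moment would make the norm infinite by the case distinction in
    \<open>Lp_norm\<close>.\<close>
  have fin: "I \<noteq> \<infinity>"
    using le unfolding L by (auto simp: top_unique)
  then have "ennreal (enn2real I powr (1 / p)) \<le> ennreal c" using le L by simp
  then have "enn2real I powr (1 / p) \<le> c" using c by (simp add: ennreal_le_iff)
  then have "(enn2real I powr (1 / p)) powr p \<le> c powr p" using p by (intro powr_mono2) auto
  then have "enn2real I \<le> c powr p" using p by (simp add: powr_powr)
  then have "ennreal (enn2real I) \<le> ennreal (c powr p)" by (rule ennreal_leI)
  moreover have "ennreal (enn2real I) = I" using fin by (simp add: less_top)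
  ultimately show ?thesis unfolding I_def by (simp only:)
qed

lemma emeasure_moment_sum_le:
  assumes K: "finite K" "real (card K) \<le> N" and X: "\<And>k. k \<in> K \<Longrightarrow> X k \<in> borel_measurable M"
    and m: "\<And>k. k \<in> K \<Longrightarrow> (\<integral>\<^sup>+ \<omega>. ennreal (\<bar>X k \<omega>\<bar> powr p) \<partial>M) \<le> ennreal m" "0 \<le> m" and s: "0 < s"
  shows "emeasure M {\<omega> \<in> space M. s \<le> (\<Sum>k\<in>K. \<bar>X k \<omega>\<bar> powr p)} \<le> ennreal (N * m / s)"
proof -
  let ?u = "\<lambda>\<omega>. \<Sum>k\<in>K. ennreal (\<bar>X k \<omega>\<bar> powr p)"
  have M: "(\<lambda>\<omega>. ennreal (\<bar>X k \<omega>\<bar> powr p)) \<in> borel_measurable M" if "k \<in> K" for k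
    using X[OF that] by measurable
  then have u: "?u \<in> borel_measurable M" by (rule borel_measurable_sum)
  have eq: "1 \<le> ennreal (1 / s) * ?u \<omega> \<longleftrightarrow> s \<le> (\<Sum>k\<in>K. \<bar>X k \<omega>\<bar> powr p)" for \<omega>
  proof -
    have "?u \<omega> = ennreal (\<Sum>k\<in>K. \<bar>X k \<omega>\<bar> powr p)" by (rule sum_ennreal) simp
    then have "ennreal (1 / s) * ?u \<omega> = ennreal (1 / s * (\<Sum>k\<in>K. \<bar>X k \<omega>\<bar> powr p))"
      using s by (simp only:) (rule ennreal_mult[symmetric], simp_all add: sum_nonneg)
    then have "1 \<le> ennreal (1 / s) * ?u \<omega> \<longleftrightarrow> ennreal 1 \<le> ennreal (1 / s * (\<Sum>k\<in>K. \<bar>X k \<omega>\<bar> powr p))" by simp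
    also have "\<dots> \<longleftrightarrow> 1 \<le> 1 / s * (\<Sum>k\<in>K. \<bar>X k \<omega>\<bar> powr p)"
      using s by (intro ennreal_le_iff) (simp add: sum_nonneg)
    also have "\<dots> \<longleftrightarrow> s \<le> (\<Sum>k\<in>K. \<bar>X k \<omega>\<bar> powr p)" using s by (simp add: field_simps)
    finally show ?thesis .
  qed
  have "emeasure M {\<omega> \<in> space M. 1 \<le> ennreal (1 / s) * ?u \<omega>} \<le> ennreal (1 / s) * (\<integral>\<^sup>+ \<omega>. ?u \<omega> * indicator (space M) \<omega> \<partial>M)"
    using u by (intro nn_integral_Markov_inequality) auto
  also have "(\<integral>\<^sup>+ \<omega>. ?u \<omega> * indicator (space M) \<omega> \<partial>M) = (\<integral>\<^sup>+ \<omega>. ?u \<omega> \<partial>M)"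
    by (intro nn_integral_cong) simp
  also have "\<dots> = (\<Sum>k\<in>K. \<integral>\<^sup>+ \<omega>. ennreal (\<bar>X k \<omega>\<bar> powr p) \<partial>M)" using M by (rule nn_integral_sum)
  also have "\<dots> \<le> (\<Sum>k\<in>K. ennreal m)" by (intro sum_mono m)
  also have "\<dots> = ennreal (real (card K) * m)" using m(2) by (simp add: ennreal_mult ennreal_of_nat_eq_real_of_nat)
  also have "\<dots> \<le> ennreal (N * m)" using K m(2) by (intro ennreal_leI mult_right_mono)
  also have "ennreal (1 / s) * ennreal (N * m) = ennreal (N * m / s)"
    using s by (simp add: ennreal_mult'[symmetric])
  finally show ?thesis unfolding eq by (simp add: mult_left_mono)
qed

context wavelets
begin

text \<open>A normalised wavelet is 2^(n d / 2) times the function in the hypothesis, which carries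
  the weight 2^(n d); the quotient is the additional decay 2^(-n d / 2). The centre is the dyadic
  point k / 2^n.\<close>

lemma coefficient_moment:
  fixes f :: "'w \<Rightarrow> (real ^ 'n \<Rightarrow> real) \<Rightarrow> real"
  assumes f: "random_linear_form r M f" and p: "1 \<le> p"
    and h\<phi>: "(SUP x. Lp_norm M p (\<lambda>\<omega>. f \<omega> (\<lambda>y. \<phi> (y - x)))) \<le> ennreal C"
    and h\<psi>: "\<And>i n. i \<in> II \<Longrightarrow> (SUP x. 2 ^ (CARD('n) * n) * Lp_norm M p (\<lambda>\<omega>. f \<omega> (\<lambda>y. \<psi> i (2 ^ n *\<^sub>R (y - x)))))
      \<le> ennreal (C * 2 powr (- real n * b))"
    and D: "C \<le> D" "0 \<le> D" and i: "i \<in> levels II n"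
  shows "(\<integral>\<^sup>+ \<omega>. ennreal (\<bar>f \<omega> (scaled (gen i) n k)\<bar> powr p) \<partial>M)
    \<le> ennreal ((D * 2 powr (- (real n * (b + real CARD('n) / 2)))) powr p)"
proof (cases "i = 0")
  case True
  then have n: "n = 0" using i by (auto simp: levels_def zero_notin_II split: if_splits)
  have s: "scaled (gen i) n k = (\<lambda>y. \<phi> (y - k))" by (simp add: n True gen_def scaled_def)
  have "Lp_norm M p (\<lambda>\<omega>. f \<omega> (\<lambda>y. \<phi> (y - k))) \<le> (SUP x. Lp_norm M p (\<lambda>\<omega>. f \<omega> (\<lambda>y. \<phi> (y - x))))"
    by (rule SUP_upper) simp
  also have "\<dots> \<le> ennreal D" using h\<phi> ennreal_leI[OF D(1)] by (rule order_trans)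
  finally show ?thesis using Lp_norm_le_moment[OF p _ D(2)] unfolding s by (simp add: n)
next
  case False
  then have i: "i \<in> II" using i levels_pos by blast
  let ?d = "real CARD('n)"
  define c where "c = 2 powr (real (CARD('n) * n) / 2)"
  define g where "g = (\<lambda>y. \<psi> i (2 ^ n *\<^sub>R (y - (1 / 2 ^ n) *\<^sub>R k)))"
  define e where "e = D * 2 powr (- real n * b) / 2 ^ (CARD('n) * n)"
  have c: "0 < c" by (simp add: c_def)
  have e0: "0 \<le> e" using D by (simp add: e_def)
  have s: "scaled (gen i) n k = (\<lambda>y. c * g y)"
    by (simp add: gen_II[OF i] scaled_def c_def g_def scaleR_diff_right)
  have "(\<lambda>y. (1 / c) * scaled (gen i) n k y) \<in> Cr_c r"
    unfolding gen_II[OF i] by (intro Cr_c_cmult scaled_Cr_c \<psi> i)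
  then have g: "g \<in> Cr_c r" unfolding s using c by simp
  let ?X = "Lp_norm M p (\<lambda>\<omega>. f \<omega> g)"
  have "2 ^ (CARD('n) * n) * ?X \<le> (SUP x. 2 ^ (CARD('n) * n) * Lp_norm M p (\<lambda>\<omega>. f \<omega> (\<lambda>y. \<psi> i (2 ^ n *\<^sub>R (y - x)))))"
    unfolding g_def by (rule SUP_upper) simp
  also have "\<dots> \<le> ennreal (D * 2 powr (- real n * b))"
    by (rule order_trans[OF h\<psi>[OF i]]) (intro ennreal_leI mult_right_mono D, simp)
  finally have X: "2 ^ (CARD('n) * n) * ?X \<le> ennreal (D * 2 powr (- real n * b))" .
  have "?X \<le> ennreal e"
  proof (cases "?X")
    case (real x)
    have "(2 :: ennreal) ^ (CARD('n) * n) * ?X = ennreal (2 ^ (CARD('n) * n) * x)"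
      using real by (simp add: ennreal_mult ennreal_power[symmetric])
    then have "2 ^ (CARD('n) * n) * x \<le> D * 2 powr (- real n * b)"
      using X D by (simp add: ennreal_le_iff)
    then have "x \<le> e" by (simp add: e_def field_simps)
    then show ?thesis using real by (simp add: ennreal_leI)
  next
    case top
    then show ?thesis using X by (simp add: ennreal_mult_top top_unique)
  qed
  then have I: "(\<integral>\<^sup>+ \<omega>. ennreal (\<bar>f \<omega> g\<bar> powr p) \<partial>M) \<le> ennreal (e powr p)"
    by (rule Lp_norm_le_moment[OF p _ e0])
  have meas: "(\<lambda>\<omega>. f \<omega> g) \<in> borel_measurable M" using f g by (simp add: random_linear_form_def)
  have lin: "f \<omega> (scaled (gen i) n k) = c * f \<omega> g" if "\<omega> \<in> space M" for \<omega>
    unfolding s using f that g by (intro linear_form_cmult) (auto simp: random_linear_form_def)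
  have "(\<integral>\<^sup>+ \<omega>. ennreal (\<bar>f \<omega> (scaled (gen i) n k)\<bar> powr p) \<partial>M) = (\<integral>\<^sup>+ \<omega>. ennreal (c powr p) * ennreal (\<bar>f \<omega> g\<bar> powr p) \<partial>M)"
    using c by (intro nn_integral_cong) (simp add: lin abs_mult powr_mult ennreal_mult)
  also have "\<dots> = ennreal (c powr p) * (\<integral>\<^sup>+ \<omega>. ennreal (\<bar>f \<omega> g\<bar> powr p) \<partial>M)"
    using meas by (intro nn_integral_cmult) measurable
  also have "\<dots> \<le> ennreal (c powr p) * ennreal (e powr p)" using I by (rule mult_left_mono) simp
  also have "\<dots> = ennreal ((c * e) powr p)" using c e0 by (simp add: ennreal_mult powr_mult)
  also have "c * e = D * 2 powr (- (real n * (b + ?d / 2)))"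
  proof -
    have 1: "(2 :: real) ^ (CARD('n) * n) = 2 powr (?d * real n)" by (simp add: powr_realpow[symmetric])
    have "c * e = D * (2 powr (?d * real n / 2) * 2 powr (- real n * b) * 2 powr (- (?d * real n)))"
      unfolding c_def e_def 1 by (simp add: powr_minus_divide)
    also have "2 powr (?d * real n / 2) * 2 powr (- real n * b) * 2 powr (- (?d * real n)) = 2 powr (?d * real n / 2 + - real n * b + - (?d * real n))"
      by (simp only: powr_add)
    also have "?d * real n / 2 + - real n * b + - (?d * real n) = - (real n * (b + ?d / 2))"
      by (simp add: algebra_simps)
    finally show ?thesis .
  qed
  finally show ?thesis .
qed

end

context wavelet_scale
begin

text \<open>The number of coefficients of level n times their p-th moment over the p-th power of the
  threshold: the dimension cancels, and the excess of \<open>b\<close> over \<beta> remains as a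
  geometric factor.\<close>

lemma bad_event_exponent:
  "(2 ^ n) ^ CARD('n) * (2 powr (- (real n * (b + real CARD('n) / 2)))) powr p / (2 powr (- (real n * wt \<beta> p))) powr p
    = (2 powr (- (p * (b - \<beta>)))) ^ n"
proof -
  let ?d = "real CARD('n)"
  have "((2::real) ^ n) ^ CARD('n) = 2 powr (real n * ?d)" by (simp add: powr_realpow[symmetric] powr_powr)
  moreover have "real n * ?d + p * (- (real n * (b + ?d / 2))) - p * (- (real n * wt \<beta> p)) = - (p * (b - \<beta>)) * real n"
    using p by (simp add: wt_def field_simps)
  moreover have "(2 powr (- (p * (b - \<beta>)))) ^ n = 2 powr (- (p * (b - \<beta>)) * real n)"
    by (simp add: powr_realpow[symmetric] powr_powr)
  ultimately show ?thesis
    by (simp only: powr_powr powr_add[symmetric] powr_diff[symmetric] mult.commute[of _ p])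
qed

text \<open>\<open>L\<close> is fixed before the probability space and the form, which is the
  uniformity that tightness demands.\<close>

lemma good_with_large_probability:
  fixes b D \<epsilon> :: real
  assumes b: "\<beta> < b" and D: "0 < D" and \<epsilon>: "0 < \<epsilon>"
  shows "\<exists>L. (\<forall>R. 0 \<le> L R) \<and>
    (\<forall>(M :: 'w measure) f. prob_space M \<longrightarrow> random_linear_form r M f \<longrightarrow>
      (\<forall>n i k. i \<in> levels II n \<longrightarrow> (\<integral>\<^sup>+ \<omega>. ennreal (\<bar>f \<omega> (scaled (gen i) n k)\<bar> powr p) \<partial>M)
        \<le> ennreal ((D * 2 powr (- (real n * (b + real CARD('n) / 2)))) powr p)) \<longrightarrow>
      (\<exists>A\<in>sets M. measure M A \<ge> 1 - \<epsilon> \<and> (\<forall>\<omega>\<in>A. good L (coef (f \<omega>)))))"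
proof -
  let ?d = "CARD('n)"
  define \<gamma> where "\<gamma> = 2 powr (- (p * (b - \<beta>)))"
  have "p * (b - \<beta>) > 0" using p b by simp
  then have \<gamma>: "0 < \<gamma>" "\<gamma> < 1" unfolding \<gamma>_def by (simp_all add: powr_less_one)
  define NI where "NI = real (card (insert 0 II))"
  have NI: "NI \<ge> 1" using finite_II zero_notin_II by (simp add: NI_def)
  have cl: "real (card (levels II n)) \<le> NI" for n
    unfolding NI_def using levels_subset finite_II by (intro of_nat_mono card_mono) auto
  define NR where "NR R = (2 * (real R + \<rho>) + 1) ^ ?d" for R
  have NR: "0 < NR R" for R unfolding NR_def using \<rho>(1) by (intro zero_less_power) simp
  \<comment> \<open>Chosen so that the Markov bound for given i, n and R is at most
    \<open>\<epsilon> / 2 ^ Suc R * ((1 - \<gamma>) * \<gamma> ^ n) / NI\<close>, which adds up to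
    at most \<epsilon> over all of them.\<close>
  define Y where "Y R = NR R * D powr p * NI powr p * (NI / (1 - \<gamma>)) * 2 ^ Suc R / \<epsilon>" for R
  have Y: "0 < Y R" for R using NR[of R] NI D \<epsilon> \<gamma> by (simp add: Y_def)
  define L where "L R = Y R powr (1 / p)" for R
  have L: "0 < L R" "L R powr p = Y R" for R using Y[of R] p by (simp_all add: L_def powr_powr)
  \<comment> \<open>Each of the at most \<open>NI\<close> functions of a level gets an equal share
    of the bound required by \<open>good\<close>.\<close>
  define s where "s n R = L R * 2 powr (- (real n * wt \<beta> p)) / NI" for n R
  have s: "0 < s n R" for n R using L NI by (simp add: s_def)
  define m where "m n = (D * 2 powr (- (real n * (b + real ?d / 2)))) powr p" for n :: nat
  have card_lat: "real (card (lat (2 ^ n * real R + \<rho>) :: (real ^ 'n) set)) \<le> (2 ^ n) ^ ?d * NR R" for n R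
  proof -
    have "real (card (lat (2 ^ n * real R + \<rho>) :: (real ^ 'n) set)) \<le> (2 * (2 ^ n * real R + \<rho>) + 1) ^ ?d"
      using \<rho>(1) by (intro near_finite_card(2)) simp
    also have "\<dots> \<le> (2 ^ n * (2 * (real R + \<rho>) + 1)) ^ ?d"
    proof (rule power_mono)
      have "1 * (2 * \<rho> + 1) \<le> 2 ^ n * (2 * \<rho> + 1)" using \<rho>(1) by (intro mult_right_mono) auto
      then show "2 * (2 ^ n * real R + \<rho>) + 1 \<le> 2 ^ n * (2 * (real R + \<rho>) + 1)" by (simp add: algebra_simps)
    qed (use \<rho>(1) in simp)
    finally show ?thesis by (simp add: NR_def power_mult_distrib)
  qed
  have ratio: "(2 ^ n) ^ ?d * NR R * m n / s n R powr p = \<epsilon> / 2 ^ Suc R * ((1 - \<gamma>) * \<gamma> ^ n) / NI" for n R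
  proof -
    have sp: "s n R powr p = Y R * (2 powr (- (real n * wt \<beta> p))) powr p / NI powr p"
      using L[of R] NI by (simp add: s_def powr_mult powr_divide)
    have mp: "m n = D powr p * (2 powr (- (real n * (b + real ?d / 2)))) powr p"
      using D by (simp add: m_def powr_mult)
    have "(2 ^ n) ^ ?d * NR R * m n / s n R powr p = NR R * D powr p * NI powr p / Y R *
      ((2 ^ n) ^ ?d * (2 powr (- (real n * (b + real ?d / 2)))) powr p / (2 powr (- (real n * wt \<beta> p))) powr p)"
      unfolding sp mp by simp
    also have "\<dots> = NR R * D powr p * NI powr p / Y R * \<gamma> ^ n" by (simp only: bad_event_exponent \<gamma>_def)
    also have "NR R * D powr p * NI powr p / Y R = \<epsilon> / 2 ^ Suc R * (1 - \<gamma>) / NI"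
      using NR[of R] D NI \<epsilon> \<gamma> by (simp add: Y_def field_simps)
    finally show ?thesis by simp
  qed
  have "\<exists>A\<in>sets M. measure M A \<ge> 1 - \<epsilon> \<and> (\<forall>\<omega>\<in>A. good L (coef (f \<omega>)))"
    if M: "prob_space M" and f: "random_linear_form r M f"
      and mom: "\<And>n i k. i \<in> levels II n \<Longrightarrow> (\<integral>\<^sup>+ \<omega>. ennreal (\<bar>f \<omega> (scaled (gen i) n k)\<bar> powr p) \<partial>M) \<le> ennreal (m n)"
    for M :: "'w measure" and f
  proof -
    interpret prob_space M by (rule M)
    let ?S = "\<lambda>n R i \<omega>. \<Sum>k\<in>lat (2 ^ n * real R + \<rho>). \<bar>f \<omega> (scaled (gen i) n k)\<bar> powr p"
    define bad where "bad n R i = {\<omega> \<in> space M. s n R powr p \<le> ?S n R i \<omega>}" for n R i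
    have meas: "(\<lambda>\<omega>. f \<omega> (scaled (gen i) n k)) \<in> borel_measurable M" if "i \<in> levels II n" for i n k
      using f scaled_Cr_c[OF gen_Cr_c[OF levels_pos[OF that]]] by (simp add: random_linear_form_def)
    have bad_sets: "bad n R i \<in> sets M" if "i \<in> levels II n" for n R i
      unfolding bad_def using meas[OF that] by measurable
    have bad: "emeasure M (bad n R i) \<le> ennreal (\<epsilon> / 2 ^ Suc R * ((1 - \<gamma>) * \<gamma> ^ n) / NI)" if i: "i \<in> levels II n" for n R i
      unfolding ratio[symmetric] bad_def using s[of n R]
      by (intro emeasure_moment_sum_le near_finite card_lat meas mom i) (auto simp: m_def)
    define B where "B R n = (\<Union>i\<in>levels II n. bad n R i)" for R n
    have B_sets: "B R n \<in> sets M" for R n unfolding B_def using bad_sets by (intro sets.finite_UN) auto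
    have B: "emeasure M (B R n) \<le> ennreal (\<epsilon> / 2 ^ Suc R * ((1 - \<gamma>) * \<gamma> ^ n))" for R n
    proof -
      define e where "e = \<epsilon> / 2 ^ Suc R * ((1 - \<gamma>) * \<gamma> ^ n)"
      have e: "0 \<le> e" using \<epsilon> \<gamma> by (simp add: e_def)
      have "emeasure M (B R n) \<le> (\<Sum>i\<in>levels II n. emeasure M (bad n R i))"
        unfolding B_def using bad_sets by (intro emeasure_subadditive_finite) auto
      also have "\<dots> \<le> (\<Sum>i\<in>levels II n. ennreal (e / NI))" by (unfold e_def, intro sum_mono bad)
      also have "\<dots> = ennreal (real (card (levels II n)) * (e / NI))"
        unfolding sum_constant ennreal_of_nat_eq_real_of_nat
        by (rule ennreal_mult[symmetric]) (use e NI in simp_all)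
      also have "\<dots> \<le> ennreal (NI * (e / NI))" using e NI by (intro ennreal_leI mult_right_mono cl) auto
      also have "NI * (e / NI) = e" using NI by simp
      finally show ?thesis by (simp only: e_def)
    qed
    have BB: "emeasure M (\<Union>n. B R n) \<le> ennreal (\<epsilon> / 2 ^ Suc R)" for R
    proof -
      have "emeasure M (\<Union>n. B R n) \<le> (\<Sum>n. emeasure M (B R n))"
        using B_sets by (intro emeasure_subadditive_countably) auto
      also have "\<dots> \<le> (\<Sum>n. ennreal (\<epsilon> / 2 ^ Suc R * ((1 - \<gamma>) * \<gamma> ^ n)))" by (intro suminf_le B) auto
      also have "\<dots> = ennreal (\<epsilon> / 2 ^ Suc R)"
      proof (rule suminf_ennreal_eq)
        show "0 \<le> \<epsilon> / 2 ^ Suc R * ((1 - \<gamma>) * \<gamma> ^ n)" for n using \<epsilon> \<gamma> by simp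
        have "(\<lambda>n. \<epsilon> / 2 ^ Suc R * ((1 - \<gamma>) * \<gamma> ^ n)) sums (\<epsilon> / 2 ^ Suc R * ((1 - \<gamma>) * (1 / (1 - \<gamma>))))"
          using \<gamma> by (intro sums_mult geometric_sums) simp
        then show "(\<lambda>n. \<epsilon> / 2 ^ Suc R * ((1 - \<gamma>) * \<gamma> ^ n)) sums (\<epsilon> / 2 ^ Suc R)" using \<gamma> by simp
      qed
      finally show ?thesis .
    qed
    define Bad where "Bad = (\<Union>R. \<Union>n. B R n)"
    have Bad_sets: "Bad \<in> sets M" unfolding Bad_def using B_sets by auto
    have "emeasure M Bad \<le> (\<Sum>R. emeasure M (\<Union>n. B R n))"
      unfolding Bad_def using B_sets by (intro emeasure_subadditive_countably) auto
    also have "\<dots> \<le> (\<Sum>R. ennreal (\<epsilon> / 2 ^ Suc R))" by (intro suminf_le BB) auto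
    also have "\<dots> = ennreal \<epsilon>"
    proof (rule suminf_ennreal_eq)
      show "0 \<le> \<epsilon> / 2 ^ Suc R" for R using \<epsilon> by simp
      show "(\<lambda>R. \<epsilon> / 2 ^ Suc R) sums \<epsilon>"
        using sums_mult[OF power_half_series, of \<epsilon>] by (simp add: power_divide)
    qed
    finally have "measure M Bad \<le> \<epsilon>" using \<epsilon> by (simp add: emeasure_eq_measure ennreal_le_iff)
    then have "1 - \<epsilon> \<le> measure M (space M - Bad)" using prob_compl[OF Bad_sets] by simp
    moreover have "good L (coef (f \<omega>))" if \<omega>: "\<omega> \<in> space M - Bad" for \<omega>
      unfolding good_def
    proof (intro allI)
      fix n R
      have "lp p (lat (2 ^ n * real R + \<rho>)) (\<lambda>k. coef (f \<omega>) (n, i, k)) \<le> s n R" if i: "i \<in> levels II n" for i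
      proof -
        have "\<omega> \<notin> bad n R i" using \<omega> i by (auto simp: Bad_def B_def)
        then have "?S n R i \<omega> \<le> s n R powr p" using \<omega> by (auto simp: bad_def)
        moreover have "(\<Sum>k\<in>lat (2 ^ n * real R + \<rho>). \<bar>coef (f \<omega>) (n, i, k)\<bar> powr p) = ?S n R i \<omega>"
          using i near_int_lattice by (intro sum.cong) (auto simp: coef_def)
        ultimately have "lp p (lat (2 ^ n * real R + \<rho>)) (\<lambda>k. coef (f \<omega>) (n, i, k)) \<le> (s n R powr p) powr (1 / p)"
          unfolding lp_def using p by (intro powr_mono2) (auto intro: sum_nonneg)
        then show ?thesis using p s[of n R] by (simp add: powr_powr)
      qed
      then have "q n (real R) (coef (f \<omega>)) \<le> (\<Sum>i\<in>levels II n. s n R)" unfolding q_def by (rule sum_mono)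
      also have "\<dots> \<le> NI * s n R" using cl[of n] s[of n R] by (simp add: mult_right_mono)
      also have "\<dots> = L R * 2 powr (- (real n * wt \<beta> p))" using NI by (simp add: s_def)
      finally show "q n (real R) (coef (f \<omega>)) \<le> L R * 2 powr (- (real n * wt \<beta> p))" .
    qed
    ultimately show ?thesis using Bad_sets by (intro bexI[of _ "space M - Bad"]) auto
  qed
  then show ?thesis unfolding m_def using less_imp_le[OF L(1)] by (intro exI[of _ L]) blast
qed

end

theorem theorem1p1:
  fixes r :: nat
    and V :: "int \<Rightarrow> (real ^ 'n \<Rightarrow> real) set"
    and \<phi> :: "real ^ 'n \<Rightarrow> real"
    and \<psi> :: "nat \<Rightarrow> real ^ 'n \<Rightarrow> real"
    and M :: "nat \<Rightarrow> 'w measure"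
    and f :: "nat \<Rightarrow> 'w \<Rightarrow> (real ^ 'n \<Rightarrow> real) \<Rightarrow> real"
    and p \<beta> C :: real
  assumes "r \<ge> 1"
    and "wavelet_family r V \<phi> \<psi>"
    and "\<And>m. prob_space (M m)"
    and "\<And>m. random_linear_form r (M m) (f m)"
    and "1 \<le> p"
    and "\<bar>\<beta>\<bar> < real r"
    and "\<And>m. (SUP x. Lp_norm (M m) p (\<lambda>\<omega>. f m \<omega> (\<lambda>y. \<phi> (y - x)))) \<le> ennreal C"
    and "\<And>m i n. i \<in> {1..<2 ^ CARD('n)} \<Longrightarrow>
           (SUP x. 2 ^ (CARD('n) * n) * Lp_norm (M m) p (\<lambda>\<omega>. f m \<omega> (\<lambda>y. \<psi> i (2 ^ n *\<^sub>R (y - x)))))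
             \<le> ennreal (C * 2 powr (- real n * \<beta>))"
  shows "\<forall>\<alpha> < \<beta> - real CARD('n) / p. tight_in_holder_loc r V \<phi> \<alpha> M f"
proof (intro allI impI)
  fix \<alpha> assume \<alpha>: "\<alpha> < \<beta> - real CARD('n) / p"
  \<comment> \<open>A positive constant above \<open>C\<close>, whose sign is not prescribed since
    \<open>ennreal\<close> truncates it.\<close>
  define D where "D = max C 0 + 1"
  have D: "0 < D" "C \<le> D" by (auto simp: D_def)
  \<comment> \<open>The new exponent is below \<beta> to make the Markov bounds summable over
    levels, and above both \<open>\<alpha> + d / p\<close> and \<open>- r\<close> to make both
    entries of \<open>order_gap\<close> positive.\<close>
  have "max (\<alpha> + real CARD('n) / p) (- real r) < \<beta>" using \<alpha> assms(6) by auto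
  then obtain b where b: "max (\<alpha> + real CARD('n) / p) (- real r) < b" "b < \<beta>" using dense by blast
  have "0 \<le> real CARD('n) / p" using assms(5) by simp
  then have "\<alpha> < real r" using \<alpha> assms(6) by linarith
  moreover have "\<alpha> < b - real CARD('n) / p" "- real r < b" using b(1) by auto
  ultimately interpret wavelet_scale r V \<phi> \<psi> "{1..<2 ^ CARD('n)}" \<alpha> b p
    using assms(1,2,5) by unfold_locales simp_all
  let ?II = "{1..<2 ^ CARD('n)} :: nat set"
  have mom: "(\<integral>\<^sup>+ \<omega>. ennreal (\<bar>f m \<omega> (scaled (gen i) n k)\<bar> powr p) \<partial>M m)
      \<le> ennreal ((D * 2 powr (- (real n * (\<beta> + real CARD('n) / 2)))) powr p)" if "i \<in> levels ?II n" for m n i k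
    by (rule coefficient_moment[OF assms(4,5,7,8) D(2) less_imp_le[OF D(1)] that])
  show "tight_in_holder_loc r V \<phi> \<alpha> M f"
    unfolding tight_in_holder_loc_def
  proof (intro allI impI)
    fix \<epsilon> :: real assume "0 < \<epsilon>"
    from good_with_large_probability[where 'w = 'w, OF b(2) D(1) this] obtain L where L: "\<forall>R. 0 \<le> L R"
      and A: "\<forall>(M :: 'w measure) f. prob_space M \<longrightarrow> random_linear_form r M f \<longrightarrow>
      (\<forall>n i k. i \<in> levels ?II n \<longrightarrow> (\<integral>\<^sup>+ \<omega>. ennreal (\<bar>f \<omega> (scaled (gen i) n k)\<bar> powr p) \<partial>M)
        \<le> ennreal ((D * 2 powr (- (real n * (\<beta> + real CARD('n) / 2)))) powr p)) \<longrightarrow>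
      (\<exists>A\<in>sets M. measure M A \<ge> 1 - \<epsilon> \<and> (\<forall>\<omega>\<in>A. good L (coef (f \<omega>))))" by blast
    show "\<exists>K. compactin (holder_loc_topology V \<alpha>) K \<and>
      (\<forall>m. \<exists>A\<in>sets (M m). measure (M m) A \<ge> 1 - \<epsilon> \<and> (\<forall>\<omega>\<in>A. \<exists>u\<in>K. form_is_distribution r \<phi> (f m \<omega>) u))"
    proof (intro exI[of _ "T ` goodset L"] conjI allI)
      show "compactin (holder_loc_topology V \<alpha>) (T ` goodset L)" using compactin_T L by blast
      fix m
      obtain A where A: "A \<in> sets (M m)" "measure (M m) A \<ge> 1 - \<epsilon>" "\<And>\<omega>. \<omega> \<in> A \<Longrightarrow> good L (coef (f m \<omega>))"
        using A[rule_format, OF assms(3,4) mom] by blast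
      have "form_is_distribution r \<phi> (f m \<omega>) (T (coef (f m \<omega>)))" if "\<omega> \<in> A" for \<omega>
      proof (rule form_is_distribution_T[OF _ A(3)[OF that]])
        have "\<omega> \<in> space (M m)" using sets.sets_into_space[OF A(1)] that by blast
        then show "linear_form r (f m \<omega>)" using assms(4)[of m] by (simp add: random_linear_form_def)
      qed
      then show "\<exists>A\<in>sets (M m). measure (M m) A \<ge> 1 - \<epsilon> \<and> (\<forall>\<omega>\<in>A. \<exists>u\<in>T ` goodset L. form_is_distribution r \<phi> (f m \<omega>) u)"
        using A coef_goodset by (intro bexI[OF _ A(1)]) blast
    qed
  qed
qed

end
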